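(* Let $\mathbb{X}$ be a $0$-dimensional weakly curvilinear scheme in $\mathbb{P}^n$ (setting and notation as in the context), let $S=\mathcal{O}_1\times\cdots\times\mathcal{O}_t$ be the decomposition of its affine coordinate ring into local rings, let $L_i$ be the residue class field of $\mathcal{O}_i$, let $\kappa_i=\dim_K(L_i)$, and let $\nu_i=\dim_K(\mathcal{O}_i)/\kappa_i$ for $i=1,\dots,t$. Then: (a) $\mathrm{HP}(\Omega^1_{R/K})=2\deg(\mathbb{X})-\sum_{\mathrm{char}(K)\nmid\nu_i}\kappa_i$. (b) $\mathrm{HP}(\Omega^2_{R/K})=\deg(\mathbb{X})-\sum_{\mathrm{char}(K)\nmid\nu_i}\kappa_i$. (c) For $m>2$, we have $\mathrm{HP}(\Omega^m_{R/K})=0$. Here the sums run over all $i\in\{1,\dots,t\}$ such that $\mathrm{char}(K)$ does not divide $\nu_i$ (in characteristic $0$, over all $i$).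
   Context: Let $K$ be a perfect field, $n\ge 1$, $P=K[X_0,\dots,X_n]$ with the standard grading, and $\mathbb{X}\subseteq\mathbb{P}^n$ a $0$-dimensional subscheme over $K$ with saturated homogeneous vanishing ideal $I_{\mathbb{X}}$. Put $R=P/I_{\mathbb{X}}$ and let $x_i$ be the image of $X_i$ in $R$. Assume no point of the support of $\mathbb{X}$ lies on the hyperplane $X_0=0$; then $x_0$ is a non-zerodivisor of $R$. Let $S=R/\langle x_0-1\rangle$ be the affine coordinate ring of $\mathbb{X}$, a finite dimensional $K$-algebra, and $\deg(\mathbb{X})=\dim_K S$. The ring $S$ is a product of $0$-dimensional local rings $\mathcal{O}_1,\dots,\mathcal{O}_t$, called the local rings of $\mathbb{X}$. A $0$-dimensional local ring is called weakly curvilinear if its maximal ideal is generated by one element; $\mathbb{X}$ is called weakly curvilinear if all its local rings $\mathcal{O}_i$ are weakly curvilinear. $\Omega^m_{R/K}=\Lambda^m_R\Omega^1_{R/K}$ is the module of Kähler differential $m$-forms, graded with $\deg(dx_i)=1$. For a finitely generated graded $R$-module $M$, $\mathrm{HP}(M)$ denotes the constant value of $\dim_K M_i$ for $i\gg0$. *)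

theory Defs
  imports
    "HOL-Library.Poly_Mapping"
    "HOL-Algebra.Chinese_Remainder"
    "Jordan_Normal_Form.VS_Connect"
begin

text \<open>
  Rings and modules are the records of HOL-Algebra, while the base field is a type
  \<open>'k\<close> of class \<open>field\<close>, viewed as the record \<^term>\<open>class_ring\<close>.
  A \<open>K\<close>-algebra is a ring \<open>A\<close> together with its structure map
  \<open>\<phi> :: 'k \<Rightarrow> 'a\<close>.
\<close>

section \<open>Perfect fields, vector spaces, local rings\<close>

definition perfect_field :: "'k::field itself \<Rightarrow> bool" where
  "perfect_field _ \<longleftrightarrow> CHAR('k) = 0 \<or> (\<forall>x::'k. \<exists>y. y ^ CHAR('k) = x)"

definition restrict_scalars ::
  "('k \<Rightarrow> 'a) \<Rightarrow> ('a, 'm) module \<Rightarrow> ('k, 'm) module"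
where
  "restrict_scalars \<phi> M =
     \<lparr>carrier = carrier M, mult = mult M, one = one M, zero = zero M, add = add M,
      smult = (\<lambda>c v. \<phi> c \<odot>\<^bsub>M\<^esub> v)\<rparr>"

definition regular_module :: "'a ring \<Rightarrow> ('a, 'a) module" where
  "regular_module A =
     \<lparr>carrier = carrier A, mult = mult A, one = one A, zero = zero A, add = add A,
      smult = mult A\<rparr>"

definition algebra_dim :: "('k::field \<Rightarrow> 'a) \<Rightarrow> 'a ring \<Rightarrow> nat" where
  "algebra_dim \<phi> A = vectorspace.dim class_ring (restrict_scalars \<phi> (regular_module A))"

definition local_ring :: "'a ring \<Rightarrow> bool" where
  "local_ring A \<longleftrightarrow> cring A \<and> (\<exists>!M. maximalideal M A)"

definition max_ideal :: "'a ring \<Rightarrow> 'a set" where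
  "max_ideal A = (THE M. maximalideal M A)"

definition zero_dim_local_ring :: "'a ring \<Rightarrow> bool" where
  "zero_dim_local_ring A \<longleftrightarrow>
     local_ring A \<and> (\<forall>P. primeideal P A \<longrightarrow> maximalideal P A)"

definition weakly_curvilinear_ring :: "'a ring \<Rightarrow> bool" where
  "weakly_curvilinear_ring A \<longleftrightarrow> zero_dim_local_ring A \<and> principalideal (max_ideal A) A"

definition residue_dim :: "('k::field \<Rightarrow> 'a) \<Rightarrow> 'a ring \<Rightarrow> nat" where
  "residue_dim \<phi> A =
     algebra_dim (\<lambda>c. max_ideal A +>\<^bsub>A\<^esub> \<phi> c) (A Quot max_ideal A)"

definition local_decomposition ::
  "'a ring \<Rightarrow> 'b ring list \<Rightarrow> ('a \<Rightarrow> 'b list) \<Rightarrow> bool"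
where
  "local_decomposition A Os h \<longleftrightarrow>
     (\<forall>B \<in> set Os. zero_dim_local_ring B) \<and> h \<in> ring_iso A (RDirProd_list Os)"

section \<open>Kaehler differentials and exterior powers\<close>

text \<open>Elements of the free module are finitely supported functions that vanish outside of
  the set of generators.\<close>

definition free_module :: "'a ring \<Rightarrow> 'x set \<Rightarrow> ('a, 'x \<Rightarrow> 'a) module" where
  "free_module A X =
     \<lparr>carrier = {f. (\<forall>x. f x \<in> carrier A) \<and> finite {x. f x \<noteq> \<zero>\<^bsub>A\<^esub>} \<and>
                    {x. f x \<noteq> \<zero>\<^bsub>A\<^esub>} \<subseteq> X},
      mult = undefined, one = undefined,
      zero = (\<lambda>_. \<zero>\<^bsub>A\<^esub>), add = (\<lambda>f g x. f x \<oplus>\<^bsub>A\<^esub> g x),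
      smult = (\<lambda>a f x. a \<otimes>\<^bsub>A\<^esub> f x)\<rparr>"

definition free_gen :: "'a ring \<Rightarrow> 'x \<Rightarrow> ('x \<Rightarrow> 'a)" where
  "free_gen A y = (\<lambda>x. if x = y then \<one>\<^bsub>A\<^esub> else \<zero>\<^bsub>A\<^esub>)"

definition quotient_module :: "('a, 'm) module \<Rightarrow> 'm set \<Rightarrow> ('a, 'm set) module" where
  "quotient_module M N =
     \<lparr>carrier = a_rcosets\<^bsub>M\<^esub> N, mult = undefined, one = undefined,
      zero = N, add = set_add M,
      smult = (\<lambda>a Y. \<Union>y\<in>Y. N +>\<^bsub>M\<^esub> (a \<odot>\<^bsub>M\<^esub> y))\<rparr>"

text \<open>The differentials of \<open>A\<close> over \<open>K\<close> are presented by
  symbols \<open>da\<close> with \<open>a \<in> A\<close>, subject to additivity, the Leibniz rule and \<open>dc = 0\<close> for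
  \<open>c \<in> K\<close>.\<close>

definition kaehler_relations :: "('k \<Rightarrow> 'a) \<Rightarrow> 'a ring \<Rightarrow> ('a \<Rightarrow> 'a) set" where
  "kaehler_relations \<phi> A =
     (let F = free_module A (carrier A); e = free_gen A in
      {e (a \<oplus>\<^bsub>A\<^esub> b) \<ominus>\<^bsub>F\<^esub> (e a \<oplus>\<^bsub>F\<^esub> e b) | a b. a \<in> carrier A \<and> b \<in> carrier A} \<union>
      {e (a \<otimes>\<^bsub>A\<^esub> b) \<ominus>\<^bsub>F\<^esub> ((a \<odot>\<^bsub>F\<^esub> e b) \<oplus>\<^bsub>F\<^esub> (b \<odot>\<^bsub>F\<^esub> e a))
         | a b. a \<in> carrier A \<and> b \<in> carrier A} \<union>
      {e (\<phi> c) | c. True})"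

definition kaehler_submodule :: "('k \<Rightarrow> 'a) \<Rightarrow> 'a ring \<Rightarrow> ('a \<Rightarrow> 'a) set" where
  "kaehler_submodule \<phi> A =
     LinearCombinations.module.span A (free_module A (carrier A)) (kaehler_relations \<phi> A)"

definition kaehler :: "('k \<Rightarrow> 'a) \<Rightarrow> 'a ring \<Rightarrow> ('a, ('a \<Rightarrow> 'a) set) module" where
  "kaehler \<phi> A = quotient_module (free_module A (carrier A)) (kaehler_submodule \<phi> A)"

definition kaehler_d :: "('k \<Rightarrow> 'a) \<Rightarrow> 'a ring \<Rightarrow> 'a \<Rightarrow> ('a \<Rightarrow> 'a) set" where
  "kaehler_d \<phi> A a =
     kaehler_submodule \<phi> A +>\<^bsub>free_module A (carrier A)\<^esub> free_gen A a"

text \<open>The \<open>m\<close>-th exterior power is presented by symbols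
  \<open>v\<^sub>1 \<and> \<dots> \<and> v\<^sub>m\<close>, one for each \<open>m\<close>-tuple of elements, which are multilinear and
  alternating.\<close>

definition tuples :: "nat \<Rightarrow> ('a, 'm) module \<Rightarrow> 'm list set" where
  "tuples m M = {vs. length vs = m \<and> set vs \<subseteq> carrier M}"

definition exterior_relations ::
  "'a ring \<Rightarrow> nat \<Rightarrow> ('a, 'm) module \<Rightarrow> ('m list \<Rightarrow> 'a) set"
where
  "exterior_relations A m M =
     (let F = free_module A (tuples m M); e = free_gen A in
      {e (vs[i := v \<oplus>\<^bsub>M\<^esub> w]) \<ominus>\<^bsub>F\<^esub> (e (vs[i := v]) \<oplus>\<^bsub>F\<^esub> e (vs[i := w])) | vs i v w.
         vs \<in> tuples m M \<and> i < m \<and> v \<in> carrier M \<and> w \<in> carrier M} \<union>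
      {e (vs[i := a \<odot>\<^bsub>M\<^esub> v]) \<ominus>\<^bsub>F\<^esub> (a \<odot>\<^bsub>F\<^esub> e (vs[i := v])) | vs i a v.
         vs \<in> tuples m M \<and> i < m \<and> a \<in> carrier A \<and> v \<in> carrier M} \<union>
      {e vs | vs. vs \<in> tuples m M \<and> (\<exists>i j. i < j \<and> j < m \<and> vs ! i = vs ! j)})"

definition exterior_submodule ::
  "'a ring \<Rightarrow> nat \<Rightarrow> ('a, 'm) module \<Rightarrow> ('m list \<Rightarrow> 'a) set"
where
  "exterior_submodule A m M =
     LinearCombinations.module.span A (free_module A (tuples m M)) (exterior_relations A m M)"

definition exterior_power ::
  "'a ring \<Rightarrow> nat \<Rightarrow> ('a, 'm) module \<Rightarrow> ('a, ('m list \<Rightarrow> 'a) set) module"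
where
  "exterior_power A m M =
     quotient_module (free_module A (tuples m M)) (exterior_submodule A m M)"

definition wedge ::
  "'a ring \<Rightarrow> nat \<Rightarrow> ('a, 'm) module \<Rightarrow> 'm list \<Rightarrow> ('m list \<Rightarrow> 'a) set"
where
  "wedge A m M vs =
     exterior_submodule A m M +>\<^bsub>free_module A (tuples m M)\<^esub> free_gen A vs"

definition kaehler_forms ::
  "('k \<Rightarrow> 'a) \<Rightarrow> 'a ring \<Rightarrow> nat \<Rightarrow> ('a, (('a \<Rightarrow> 'a) set list \<Rightarrow> 'a) set) module"
where
  "kaehler_forms \<phi> A m = exterior_power A m (kaehler \<phi> A)"

section \<open>Zero-dimensional subschemes of projective space\<close>

type_synonym 'k mpoly = "(nat \<Rightarrow>\<^sub>0 nat) \<Rightarrow>\<^sub>0 'k"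

definition mpoly_const :: "'k::field \<Rightarrow> 'k mpoly" where
  "mpoly_const c = Poly_Mapping.single 0 c"

definition mpoly_var :: "nat \<Rightarrow> 'k::field mpoly" where
  "mpoly_var i = Poly_Mapping.single (Poly_Mapping.single i 1) 1"

definition mdegree :: "(nat \<Rightarrow>\<^sub>0 nat) \<Rightarrow> nat" where
  "mdegree t = (\<Sum>i\<in>Poly_Mapping.keys t. Poly_Mapping.lookup t i)"

text \<open>The polynomial ring in the \<open>n + 1\<close> indeterminates with indices \<open>0, \<dots>, n\<close>.\<close>

definition poly_ring :: "nat \<Rightarrow> 'k::field mpoly ring" where
  "poly_ring n =
     \<lparr>carrier = {p. \<forall>t\<in>Poly_Mapping.keys p. Poly_Mapping.keys t \<subseteq> {..n}},
      mult = (*), one = 1, zero = 0, add = (+)\<rparr>"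

definition homogeneous_part :: "nat \<Rightarrow> nat \<Rightarrow> 'k::field mpoly set" where
  "homogeneous_part n d =
     {p \<in> carrier (poly_ring n). \<forall>t\<in>Poly_Mapping.keys p. mdegree t = d}"

definition homogeneous_ideal :: "nat \<Rightarrow> 'k::field mpoly set \<Rightarrow> bool" where
  "homogeneous_ideal n J \<longleftrightarrow>
     (\<exists>H \<subseteq> (\<Union>d. homogeneous_part n d). J = genideal (poly_ring n) H)"

text \<open>The \<open>k\<close>-th power of the irrelevant ideal is generated by the forms of degree \<open>k\<close>.\<close>

definition saturated :: "nat \<Rightarrow> 'k::field mpoly set \<Rightarrow> bool" where
  "saturated n J \<longleftrightarrow>
     (\<forall>f\<in>carrier (poly_ring n).
        (\<exists>k. \<forall>g\<in>homogeneous_part n k. g * f \<in> J) \<longrightarrow> f \<in> J)"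

text \<open>The underlying set of the closed subscheme of projective \<open>n\<close>-space defined by \<open>J\<close>: the
  homogeneous primes containing \<open>J\<close> but not the irrelevant ideal.\<close>

definition proj_points :: "nat \<Rightarrow> 'k::field mpoly set \<Rightarrow> 'k mpoly set set" where
  "proj_points n J =
     {p. primeideal p (poly_ring n) \<and> homogeneous_ideal n p \<and> J \<subseteq> p \<and>
         \<not> genideal (poly_ring n) (mpoly_var ` {..n}) \<subseteq> p}"

text \<open>The dimension is the supremum of the lengths of chains of points under specialization,
  so it is zero iff there is a point and no point specializes to a different one.\<close>

definition zero_dim_scheme :: "nat \<Rightarrow> 'k::field mpoly set \<Rightarrow> bool" where
  "zero_dim_scheme n J \<longleftrightarrow>
     ideal J (poly_ring n) \<and> homogeneous_ideal n J \<and> saturated n J \<and>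
     proj_points n J \<noteq> {} \<and>
     (\<forall>p\<in>proj_points n J. \<forall>q\<in>proj_points n J. p \<subseteq> q \<longrightarrow> p = q)"

definition coord_ring :: "nat \<Rightarrow> 'k::field mpoly set \<Rightarrow> 'k mpoly set ring" where
  "coord_ring n J = poly_ring n Quot J"

definition residue_class :: "nat \<Rightarrow> 'k::field mpoly set \<Rightarrow> 'k mpoly \<Rightarrow> 'k mpoly set" where
  "residue_class n J f = J +>\<^bsub>poly_ring n\<^esub> f"

definition coord_const :: "nat \<Rightarrow> 'k::field mpoly set \<Rightarrow> 'k \<Rightarrow> 'k mpoly set" where
  "coord_const n J c = residue_class n J (mpoly_const c)"

definition coord_var :: "nat \<Rightarrow> 'k::field mpoly set \<Rightarrow> nat \<Rightarrow> 'k mpoly set" where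
  "coord_var n J i = residue_class n J (mpoly_var i)"

definition coord_part :: "nat \<Rightarrow> 'k::field mpoly set \<Rightarrow> nat \<Rightarrow> 'k mpoly set set" where
  "coord_part n J d = residue_class n J ` homogeneous_part n d"

definition dehomogenization_ideal ::
  "nat \<Rightarrow> 'k::field mpoly set \<Rightarrow> 'k mpoly set set"
where
  "dehomogenization_ideal n J =
     genideal (coord_ring n J)
       {coord_var n J 0 \<ominus>\<^bsub>coord_ring n J\<^esub> \<one>\<^bsub>coord_ring n J\<^esub>}"

definition affine_ring :: "nat \<Rightarrow> 'k::field mpoly set \<Rightarrow> 'k mpoly set set ring" where
  "affine_ring n J = coord_ring n J Quot dehomogenization_ideal n J"

definition affine_const :: "nat \<Rightarrow> 'k::field mpoly set \<Rightarrow> 'k \<Rightarrow> 'k mpoly set set" where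
  "affine_const n J c = dehomogenization_ideal n J +>\<^bsub>coord_ring n J\<^esub> coord_const n J c"

definition scheme_degree :: "nat \<Rightarrow> 'k::field mpoly set \<Rightarrow> nat" where
  "scheme_degree n J = algebra_dim (affine_const n J) (affine_ring n J)"

section \<open>Hilbert functions of the modules of differential forms\<close>

abbreviation differential_forms where
  "differential_forms n J m \<equiv> kaehler_forms (coord_const n J) (coord_ring n J) m"

text \<open>The grading with \<open>deg (dx\<^sub>i) = 1\<close>: the part of degree \<open>d\<close> is spanned over \<open>K\<close> by the
  \<open>f dx\<^sub>j\<^sub>1 \<and> \<dots> \<and> dx\<^sub>j\<^sub>m\<close> with \<open>f\<close> homogeneous of degree \<open>d - m\<close>.\<close>

definition differential_forms_part where
  "differential_forms_part n J m d =
     (let R = coord_ring n J; \<phi> = coord_const n J in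
      LinearCombinations.module.span class_ring
        (restrict_scalars \<phi> (differential_forms n J m))
        {f \<odot>\<^bsub>differential_forms n J m\<^esub>
           wedge R m (kaehler \<phi> R) (map (\<lambda>j. kaehler_d \<phi> R (coord_var n J j)) js) | f js e.
           length js = m \<and> set js \<subseteq> {..n} \<and> e + m = d \<and> f \<in> coord_part n J e})"

text \<open>\<open>has_HP V h\<close>: the graded vector space with homogeneous parts \<open>V d\<close> satisfies
  \<open>dim (V d) = h\<close> for all sufficiently large \<open>d\<close>. Finite dimension is required explicitly, since
  \<open>vectorspace.dim\<close> is meaningless otherwise.\<close>

definition has_HP :: "(nat \<Rightarrow> ('k::field, 'm) module) \<Rightarrow> int \<Rightarrow> bool" where
  "has_HP V h \<longleftrightarrow>
     (\<forall>\<^sub>F d in sequentially. vectorspace.fin_dim class_ring (V d) \<and>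
        int (vectorspace.dim class_ring (V d)) = h)"

definition forms_graded_part where
  "forms_graded_part n J m d =
     restrict_scalars (coord_const n J) (differential_forms n J m)
       \<lparr>carrier := differential_forms_part n J m d\<rparr>"

end

theory Submission
  imports
    "HOL-Algebra.Ring_Divisibility"
    Defs
    "HOL-Computational_Algebra.Polynomial_Factorial"
begin

text \<open>Over a perfect field a finite-dimensional local algebra with principal maximal ideal is
  generated by one element, so \<open>\<O>\<^sub>i = K[\<theta>]/(g\<^sub>i)\<close> with \<open>g\<^sub>i\<close> the \<open>\<nu>\<^sub>i\<close>-th power of an irreducible
  polynomial of degree \<open>\<kappa>\<^sub>i\<close>. Its module of differentials is \<open>K[\<theta>]/(h\<^sub>i)\<close> with
  \<open>h\<^sub>i = gcd(g\<^sub>i, g\<^sub>i')\<close>, whose degree is \<open>deg g\<^sub>i\<close> if the characteristic divides \<open>\<nu>\<^sub>i\<close> and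
  \<open>deg g\<^sub>i - \<kappa>\<^sub>i\<close> otherwise. In large degrees a homogeneous part of \<open>R\<close> is a copy of \<open>S\<close>, and the
  one-forms are the direct sum of \<open>S dx\<^sub>0\<close> and \<open>\<Omega>\<^sup>1\<close> of \<open>S\<close>. The latter is generated by one
  element \<open>dY\<close>, so the two-forms are \<open>\<Omega>\<^sup>1 dx\<^sub>0\<close> and all higher forms vanish.

  The upper bounds come from linear functionals on a homogeneous part: one that vanishes on
  the expected basis vanishes everywhere, because idempotents have differential zero and
  \<open>g\<^sub>i'(Y) dY = 0\<close>. The basis is independent because \<open>d/d\<theta>\<close> modulo \<open>h\<^sub>i\<close> detects \<open>dY\<close> and the
  Euler derivation detects \<open>dx\<^sub>0\<close>.\<close>

text \<open>The forms over \<open>R\<close> are never identified with modules over \<open>S\<close>;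
  all dimensions are computed inside \<open>R\<close>. The obstacle is the degree: idempotents and
  \<theta> belong to \<open>S\<close>, and \<open>R\<close> contains them only as forms of some
  degree at least \<open>k0\<close>. They are lifted to forms of one common degree \<open>D\<close>,
  and surplus degree is absorbed by powers of \<open>x0\<close>, which represent 1 in every local
  ring. Once a functional kills dx0, these powers pass freely between the coefficient and the
  differentiated factor; this makes affine identities such as e^2 = e or d p(Y) = p'(Y) dY usable in
  a fixed total degree. Testing with functionals has a second benefit: if all slots of an m-form but
  one are frozen, the value becomes a function of a single \<open>f dx\<close>, so one computation
  with one-forms serves every m. The bounds k0 + 3 D + m D come from splitting off up to three
  factors of degree \<open>D\<close> from a coefficient, which must keep degree at least
  \<open>k0\<close>, while the other slots use up at most m D. Perfectness acts through separability
  of irreducible polynomials: it yields the primitive element and the inverse of f' modulo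
  f.\<close>

section \<open>Finite-dimensional linear algebra through functionals\<close>

definition linear_functional :: "('k::field, 'v) module \<Rightarrow> ('v \<Rightarrow> 'k) \<Rightarrow> bool" where
  "linear_functional V l \<longleftrightarrow>
     (\<forall>x\<in>carrier V. \<forall>y\<in>carrier V. l (x \<oplus>\<^bsub>V\<^esub> y) = l x + l y) \<and>
     (\<forall>c. \<forall>x\<in>carrier V. l (c \<odot>\<^bsub>V\<^esub> x) = c * l x)"

lemma linear_functionalD:
  assumes "linear_functional V l" "x \<in> carrier V"
  shows "y \<in> carrier V \<Longrightarrow> l (x \<oplus>\<^bsub>V\<^esub> y) = l x + l y" "l (c \<odot>\<^bsub>V\<^esub> x) = c * l x"
  using assms by (auto simp: linear_functional_def)

lemma linear_functional_finsum:
  fixes V :: "('k::field, 'v) module"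
  assumes "vectorspace class_ring V"
    and "linear_functional V l" "finite J" "v \<in> J \<rightarrow> carrier V"
  shows "l (\<Oplus>\<^bsub>V\<^esub>j\<in>J. v j) = (\<Sum>j\<in>J. l (v j))"
  using assms(3,4)
proof (induction J)
  case empty
  interpret V: vectorspace "class_ring :: 'k ring" V by fact
  have "l (0 \<odot>\<^bsub>V\<^esub> \<zero>\<^bsub>V\<^esub>) = 0 * l \<zero>\<^bsub>V\<^esub>"
    by (rule linear_functionalD(2)[OF assms(2)]) simp
  then show ?case using V.lmult_0[of "\<zero>\<^bsub>V\<^esub>"] by simp
next
  case (insert a J)
  interpret V: vectorspace "class_ring :: 'k ring" V by fact
  show ?case using insert
    by (simp add: Pi_def linear_functionalD(1)[OF assms(2)])
qed

text \<open>Bases are counted as sets, whereas the families used here are indexed. Independence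
  therefore has to yield injectivity before the cardinality of \<open>J\<close> can be transferred
  to the set of vectors.\<close>

lemma dim_basisI:
  fixes V :: "('k::field, 'v) module" and v :: "'j \<Rightarrow> 'v"
  assumes V: "vectorspace class_ring V"
    and fin: "finite J" and v: "v \<in> J \<rightarrow> carrier V"
    and span: "\<And>x. x \<in> carrier V \<Longrightarrow> \<exists>c. x = (\<Oplus>\<^bsub>V\<^esub>j\<in>J. c j \<odot>\<^bsub>V\<^esub> v j)"
    and indep: "\<And>c. (\<Oplus>\<^bsub>V\<^esub>j\<in>J. c j \<odot>\<^bsub>V\<^esub> v j) = \<zero>\<^bsub>V\<^esub> \<Longrightarrow> \<forall>j\<in>J. c j = 0"
  shows "vectorspace.fin_dim class_ring V \<and> vectorspace.dim class_ring V = card J"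
proof -
  interpret V: vectorspace "class_ring :: 'k ring" V by fact
  have inj: "inj_on v J"
  proof (rule inj_onI, rule ccontr)
    fix i j assume ij: "i \<in> J" "j \<in> J" "v i = v j" "i \<noteq> j"
    \<comment> \<open>Coefficients of the relation \<open>v i - v j = 0\<close> that a collision
      would produce.\<close>
    define c where "c = (\<lambda>k. if k = i then 1 else if k = j then - 1 else (0::'k))"
    have vi: "v i \<in> carrier V" using v ij by auto
    have "(\<Oplus>\<^bsub>V\<^esub>k\<in>J. c k \<odot>\<^bsub>V\<^esub> v k) = (\<Oplus>\<^bsub>V\<^esub>k\<in>insert i (insert j (J - {i,j})). c k \<odot>\<^bsub>V\<^esub> v k)"
      using ij by (intro arg_cong2[where f="finsum V"]) auto
    also have "\<dots> = c i \<odot>\<^bsub>V\<^esub> v i \<oplus>\<^bsub>V\<^esub> (c j \<odot>\<^bsub>V\<^esub> v j \<oplus>\<^bsub>V\<^esub> (\<Oplus>\<^bsub>V\<^esub>k\<in>J - {i,j}. c k \<odot>\<^bsub>V\<^esub> v k))"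
      using ij fin v by (subst V.finsum_insert; (subst V.finsum_insert)?) (auto simp: Pi_def)
    also have "(\<Oplus>\<^bsub>V\<^esub>k\<in>J - {i,j}. c k \<odot>\<^bsub>V\<^esub> v k) = (\<Oplus>\<^bsub>V\<^esub>k\<in>J - {i,j}. \<zero>\<^bsub>V\<^esub>)"
      using v V.lmult_0 by (intro V.finsum_cong') (auto simp: c_def Pi_def)
    also have "\<dots> = \<zero>\<^bsub>V\<^esub>" by simp
    also have "c i \<odot>\<^bsub>V\<^esub> v i \<oplus>\<^bsub>V\<^esub> (c j \<odot>\<^bsub>V\<^esub> v j \<oplus>\<^bsub>V\<^esub> \<zero>\<^bsub>V\<^esub>) = (1 + (-1)) \<odot>\<^bsub>V\<^esub> v i"
      using ij vi V.smult_l_distr[of 1 "-1" "v i"] by (simp add: c_def)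
    also have "\<dots> = \<zero>\<^bsub>V\<^esub>" using vi V.lmult_0[of "v i"] by simp
    finally have "\<forall>k\<in>J. c k = 0" by (rule indep)
    then have "c i = 0" using ij(1) by blast
    then show False by (simp add: c_def)
  qed
  define X where "X = v ` J"
  have X: "X \<subseteq> carrier V" "finite X" "card X = card J"
    using v fin inj by (auto simp: X_def card_image)
  have lin: "V.lincomb a X = (\<Oplus>\<^bsub>V\<^esub>j\<in>J. a (v j) \<odot>\<^bsub>V\<^esub> v j)" for a
    unfolding V.lincomb_def X_def
    by (rule V.finsum_reindex) (use v inj in \<open>auto simp: Pi_def\<close>)
  have "V.gen_set X"
  proof -
    have "x \<in> V.span X" if x: "x \<in> carrier V" for x
    proof -
      obtain c where c: "x = (\<Oplus>\<^bsub>V\<^esub>j\<in>J. c j \<odot>\<^bsub>V\<^esub> v j)" using span[OF x] by auto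
      have "x = V.lincomb (\<lambda>w. c (the_inv_into J v w)) X"
        unfolding lin c using v inj by (intro V.finsum_cong') (auto simp: the_inv_into_f_f Pi_def)
      then show ?thesis using V.finite_span[OF X(2) X(1)] by auto
    qed
    then show ?thesis using V.span_closed[OF X(1)] by auto
  qed
  moreover have "V.lin_indpt X"
  proof (rule V.finite_lin_indpt2[OF X(2) X(1)])
    fix a assume "V.lincomb a X = \<zero>\<^bsub>V\<^esub>"
    then have "\<forall>j\<in>J. a (v j) = 0" unfolding lin class_ring_simps by (rule indep)
    then show "\<forall>w\<in>X. a w = \<zero>\<^bsub>class_ring\<^esub>" unfolding X_def by simp
  qed
  ultimately have "V.basis X" using X by (simp add: V.basis_def)
  then show ?thesis
    using V.dim_basis[OF X(2)] X(3) V.fin_dim_def X by (auto simp: V.basis_def)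
qed

text \<open>A maximal independent subset \<open>X\<close> of \<open>W\<close> spans \<open>W\<close>
  and extends to a basis \<open>B\<close> of \<open>V\<close>. The coordinates at the vectors of
  \<open>B - X\<close> vanish on \<open>W\<close>, and a vector on which all of them vanish is a
  combination of \<open>X\<close>.\<close>

lemma subspace_coordinates:
  fixes V :: "('k::field, 'v) module"
  assumes V: "vectorspace class_ring V" and fd: "vectorspace.fin_dim class_ring V"
    and W: "submodule class_ring W V"
  shows "\<exists>(B :: 'v set) l. finite B \<and> (\<forall>b\<in>B. linear_functional V (l b) \<and> (\<forall>x\<in>W. l b x = 0)) \<and>
    (\<forall>x\<in>carrier V. (\<forall>b\<in>B. l b x = 0) \<longrightarrow> x \<in> W)"
proof -
  interpret V: vectorspace "class_ring :: 'k ring" V by fact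
  interpret W: submodule "class_ring :: 'k ring" W V by fact
  define Pr where "Pr S \<longleftrightarrow> S \<subseteq> W \<and> V.lin_indpt S" for S
  have "Pr {}" by (simp add: Pr_def V.lin_dep_def)
  moreover have "finite S \<and> card S \<le> V.dim" if "Pr S" for S
    using V.li_le_dim[OF fd, of S] that W.subset by (auto simp: Pr_def)
  ultimately obtain X where X: "finite X" "maximal X Pr"
    using maximal_exists[of Pr V.dim] by blast
  have X2: "X \<subseteq> W" "V.lin_indpt X" "X \<subseteq> carrier V"
    using X W.subset by (auto simp: maximal_def Pr_def)
  have WX: "x \<in> V.span X" if x: "x \<in> W" for x
  proof (cases "x \<in> X")
    case True then show ?thesis using V.span_mem[OF X2(3)] by auto
  next
    case False
    then have "V.lin_dep (X \<union> {x})"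
      using X x unfolding maximal_def Pr_def by blast
    then show ?thesis using V.lin_dep_iff_in_span[OF X2(3,2)] x False W.subset by auto
  qed
  have XW: "V.span X \<subseteq> W" by (rule V.span_is_subset[OF X2(1) W])
  define Q where "Q S \<longleftrightarrow> S \<subseteq> carrier V \<and> V.lin_indpt S \<and> X \<subseteq> S" for S
  have "Q X" using X2 by (auto simp: Q_def)
  moreover have "finite S \<and> card S \<le> V.dim" if "Q S" for S
    using V.li_le_dim[OF fd, of S] that by (auto simp: Q_def)
  ultimately obtain B where B: "finite B" "maximal B Q"
    using maximal_exists[of Q V.dim] by blast
  have Bm: "maximal B (\<lambda>S. S \<subseteq> carrier V \<and> V.lin_indpt S)"
    using B(2) unfolding maximal_def Q_def by blast
  have Bb: "V.basis B" by (rule V.max_li_is_basis[OF Bm])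
  have Bc: "B \<subseteq> carrier V" "X \<subseteq> B" using B by (auto simp: maximal_def Q_def)
  have uniq: "\<exists>!a. a \<in> B \<rightarrow>\<^sub>E UNIV \<and> V.lincomb a B = x" if "x \<in> carrier V" for x
    using V.basis_criterion[OF B(1) Bc(1)] Bb that by simp
  define co where "co x = (THE a. a \<in> B \<rightarrow>\<^sub>E UNIV \<and> V.lincomb a B = x)" for x
  have co: "co x \<in> B \<rightarrow>\<^sub>E UNIV" "V.lincomb (co x) B = x" if "x \<in> carrier V" for x
    using theI'[OF uniq[OF that]] by (auto simp: co_def)
  have co_eq: "co x b = a b" if "V.lincomb a B = x" "b \<in> B" for a x b
  proof -
    have x: "x \<in> carrier V" using that(1) V.lincomb_closed[OF Bc(1)] by auto
    have "V.lincomb (restrict a B) B = x"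
      using that(1) V.lincomb_restrict[OF Bc(1), of "restrict a B" a] by auto
    then have "co x = restrict a B" using uniq[OF x] co[OF x] by auto
    then show ?thesis using that by simp
  qed
  define l where "l b x = co x b" for b x
  have lf: "linear_functional V (l b)" if b: "b \<in> B" for b
    unfolding linear_functional_def
  proof (intro conjI ballI allI)
    fix x y assume x: "x \<in> carrier V" and y: "y \<in> carrier V"
    have "V.lincomb (\<lambda>b. co x b + co y b) B = V.lincomb (co x) B \<oplus>\<^bsub>V\<^esub> V.lincomb (co y) B"
      using V.lincomb_sum[OF B(1) Bc(1), of "co x" "co y"] by simp
    then show "l b (x \<oplus>\<^bsub>V\<^esub> y) = l b x + l b y"
      unfolding l_def using co[OF x] co[OF y] by (intro co_eq b) simp
  next
    fix c x assume x: "x \<in> carrier V"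
    have "V.lincomb (\<lambda>b. c * co x b) B = c \<odot>\<^bsub>V\<^esub> V.lincomb (co x) B"
      using V.lincomb_smult[OF Bc(1), of "co x" c] by simp
    then show "l b (c \<odot>\<^bsub>V\<^esub> x) = c * l b x"
      unfolding l_def using co[OF x] by (intro co_eq b) simp
  qed
  \<comment> \<open>Padding by zeros turns a combination over \<open>X\<close> into one over
    \<open>B\<close>, so that uniqueness of coordinates applies to elements of
    \<open>W\<close>.\<close>
  have sub: "V.lincomb (\<lambda>v. if v \<in> X then a v else 0) B = V.lincomb a X" for a
  proof -
    have "V.lincomb a X = (\<Oplus>\<^bsub>V\<^esub>v\<in>X. (if v \<in> X then a v else 0) \<odot>\<^bsub>V\<^esub> v)"
      unfolding V.lincomb_def using Bc by (intro V.finsum_cong') auto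
    also have "\<dots> = (\<Oplus>\<^bsub>V\<^esub>v\<in>B. (if v \<in> X then a v else 0) \<odot>\<^bsub>V\<^esub> v)"
      using Bc B V.lmult_0 by (intro V.add.finprod_mono_neutral_cong_left) auto
    finally show ?thesis by (simp add: V.lincomb_def)
  qed
  have "l b x = 0" if x: "x \<in> W" and b: "b \<in> B - X" for x b
  proof -
    obtain a where a: "x = V.lincomb a X" using V.finite_span[OF X(1) X2(3)] WX[OF x] by auto
    show ?thesis unfolding l_def using b a sub[of a] by (subst co_eq[of "\<lambda>v. if v \<in> X then a v else 0"]) auto
  qed
  moreover have "x \<in> W" if x: "x \<in> carrier V" and z: "\<forall>b\<in>B - X. l b x = 0" for x
  proof -
    have "x = V.lincomb (co x) B" using co[OF x] by simp
    also have "\<dots> = V.lincomb (\<lambda>v. if v \<in> X then co x v else 0) B"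
      unfolding V.lincomb_def using Bc z by (intro V.finsum_cong') (auto simp: l_def)
    also have "\<dots> = V.lincomb (co x) X" by (rule sub)
    also have "\<dots> \<in> W" using V.finite_span[OF X(1) X2(3)] XW by auto
    finally show ?thesis .
  qed
  ultimately show ?thesis using lf B(1)
    by (intro exI[of _ "B - X"] exI[of _ l] conjI ballI impI) auto
qed

text \<open>One of the coordinates that cut out \<open>W\<close> is nonzero at \<open>w\<close>;
  dividing by its value there normalizes it.\<close>

lemma separating_functional:
  fixes V :: "('k::field, 'v) module"
  assumes V: "vectorspace class_ring V" and fd: "vectorspace.fin_dim class_ring V"
    and W: "submodule class_ring W V" and w: "w \<in> carrier V" "w \<notin> W"
  shows "\<exists>l. linear_functional V l \<and> (\<forall>x\<in>W. l x = 0) \<and> l w = 1"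
proof -
  obtain B :: "'v set" and l where B: "\<forall>b\<in>B. linear_functional V (l b) \<and> (\<forall>x\<in>W. l b x = 0)"
    "\<forall>x\<in>carrier V. (\<forall>b\<in>B. l b x = 0) \<longrightarrow> x \<in> W"
    using subspace_coordinates[OF V fd W] by blast
  then obtain b where b: "b \<in> B" "l b w \<noteq> 0" using w by blast
  define m where "m x = l b x / l b w" for x
  have "linear_functional V m"
    using B(1) b(1) unfolding linear_functional_def m_def by (simp add: add_divide_distrib)
  moreover have "\<forall>x\<in>W. m x = 0" "m w = 1" using B(1) b by (simp_all add: m_def)
  ultimately show ?thesis by blast
qed

text \<open>Dual form of the basis criterion. A family that failed to span would leave room for a
  functional vanishing on its span but not everywhere, so no vector ever has to be written as an
  explicit combination; independence is tested by evaluating functionals as well.\<close>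

lemma dim_functionalsI:
  fixes V :: "('k::field, 'v) module" and v :: "'j \<Rightarrow> 'v"
  assumes V: "vectorspace class_ring V" and fd: "vectorspace.fin_dim class_ring V"
    and fin: "finite J" and v: "v \<in> J \<rightarrow> carrier V"
    and span: "\<And>l x. linear_functional V l \<Longrightarrow> \<forall>j\<in>J. l (v j) = 0 \<Longrightarrow> x \<in> carrier V \<Longrightarrow> l x = 0"
    and indep: "\<And>c. (\<And>l. linear_functional V l \<Longrightarrow> (\<Sum>j\<in>J. c j * l (v j)) = 0) \<Longrightarrow> \<forall>j\<in>J. c j = 0"
  shows "vectorspace.dim class_ring V = card J"
proof -
  interpret V: vectorspace "class_ring :: 'k ring" V by fact
  have fs: "l (\<Oplus>\<^bsub>V\<^esub>j\<in>J. c j \<odot>\<^bsub>V\<^esub> v j) = (\<Sum>j\<in>J. c j * l (v j))"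
    if "linear_functional V l" for l c
  proof -
    have "l (\<Oplus>\<^bsub>V\<^esub>j\<in>J. c j \<odot>\<^bsub>V\<^esub> v j) = (\<Sum>j\<in>J. l (c j \<odot>\<^bsub>V\<^esub> v j))"
      using v by (intro linear_functional_finsum[OF V] that fin) auto
    also have "\<dots> = (\<Sum>j\<in>J. c j * l (v j))"
      using v linear_functionalD(2)[OF that] by (intro sum.cong) auto
    finally show ?thesis .
  qed
  have ind: "\<forall>j\<in>J. c j = 0" if "(\<Oplus>\<^bsub>V\<^esub>j\<in>J. c j \<odot>\<^bsub>V\<^esub> v j) = \<zero>\<^bsub>V\<^esub>" for c
  proof (rule indep)
    fix l assume l: "linear_functional V l"
    show "(\<Sum>j\<in>J. c j * l (v j)) = 0"
      using fs[OF l, of c] that linear_functional_finsum[OF V l, of "{}"] by simp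
  qed
  have X: "v ` J \<subseteq> carrier V" "finite (v ` J)" using v fin by auto
  have sp: "\<exists>c. x = (\<Oplus>\<^bsub>V\<^esub>j\<in>J. c j \<odot>\<^bsub>V\<^esub> v j)" if x: "x \<in> carrier V" for x
  proof -
    have "x \<in> V.span (v ` J)"
    proof (rule ccontr)
      assume "x \<notin> V.span (v ` J)"
      then obtain l where "linear_functional V l" "\<forall>y\<in>v ` J. l y = 0" "l x = 1"
        using separating_functional[OF V fd V.span_is_submodule[OF X(1)] x] V.span_mem[OF X(1)]
        by blast
      then show False using span[of l x] x by auto
    qed
    then show ?thesis using X
    proof -
      assume "x \<in> V.span (v ` J)"
      then obtain a where a: "x = V.lincomb a (v ` J)" using V.finite_span[OF X(2,1)] by auto
      \<comment> \<open>Injectivity of \<open>v\<close> is not yet available here, so the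
        combination over the image is pulled back along a section \<open>J'\<close> and extended by
        zero coefficients.\<close>
      obtain J' where J': "J' \<subseteq> J" "inj_on v J'" "v ` J' = v ` J"
        using subset_image_inj[of "v ` J" v J] by auto
      have "x = (\<Oplus>\<^bsub>V\<^esub>j\<in>J'. a (v j) \<odot>\<^bsub>V\<^esub> v j)"
        unfolding a V.lincomb_def J'(3)[symmetric]
        by (rule V.finsum_reindex) (use v J' in \<open>auto simp: Pi_def\<close>)
      also have "\<dots> = (\<Oplus>\<^bsub>V\<^esub>j\<in>J'. (if j \<in> J' then a (v j) else 0) \<odot>\<^bsub>V\<^esub> v j)"
        using v J' by (intro V.finsum_cong') (auto simp: Pi_def)
      also have "\<dots> = (\<Oplus>\<^bsub>V\<^esub>j\<in>J. (if j \<in> J' then a (v j) else 0) \<odot>\<^bsub>V\<^esub> v j)"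
        using v J' fin V.lmult_0 by (intro V.add.finprod_mono_neutral_cong_left) (auto simp: Pi_def)
      finally show ?thesis by (intro exI[of _ "\<lambda>j. if j \<in> J' then a (v j) else 0"])
    qed
  qed
  show ?thesis using dim_basisI[OF V fin v sp ind] by auto
qed

text \<open>These are N equations in N + 1 unknowns. A zero row makes the system square with
  determinant zero, and a kernel vector is the solution.\<close>

lemma linear_dependence:
  fixes a :: "nat \<Rightarrow> nat \<Rightarrow> 'k::field"
  shows "\<exists>x. (\<exists>k\<le>N. x k \<noteq> 0) \<and> (\<forall>j<N. (\<Sum>k\<le>N. x k * a k j) = 0)"
proof -
  define A where "A = mat (Suc N) (Suc N) (\<lambda>(j, k). if j < N then a k j else 0)"
  have A: "A \<in> carrier_mat (Suc N) (Suc N)" by (simp add: A_def)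
  have "det A = 0"
  proof -
    have "A = mat\<^sub>r (Suc N) (Suc N) (\<lambda>i. if i = N then 0\<^sub>v (Suc N) else row A i)"
    proof (intro eq_matI)
      fix i j assume "i < dim_row (mat\<^sub>r (Suc N) (Suc N) (\<lambda>i. if i = N then 0\<^sub>v (Suc N) else row A i))"
        "j < dim_col (mat\<^sub>r (Suc N) (Suc N) (\<lambda>i. if i = N then 0\<^sub>v (Suc N) else row A i))"
      then show "A $$ (i, j) = mat\<^sub>r (Suc N) (Suc N) (\<lambda>i. if i = N then 0\<^sub>v (Suc N) else row A i) $$ (i, j)"
        using A by (auto simp: A_def)
    qed (use A in auto)
    then show ?thesis using det_row_0[of N "Suc N" "\<lambda>i. row A i"] A by auto
  qed
  then obtain v where v: "v \<in> carrier_vec (Suc N)" "v \<noteq> 0\<^sub>v (Suc N)" "A *\<^sub>v v = 0\<^sub>v (Suc N)"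
    using det_0_iff_vec_prod_zero_field[OF A] by auto
  have "\<exists>k\<le>N. v $ k \<noteq> 0"
  proof (rule ccontr)
    assume "\<not> ?thesis"
    then have "v = 0\<^sub>v (Suc N)" using v(1) by (intro eq_vecI) auto
    with v show False by simp
  qed
  moreover have "(\<Sum>k\<le>N. v $ k * a k j) = 0" if "j < N" for j
  proof -
    have "0 = (A *\<^sub>v v) $ j" using v that by simp
    also have "(A *\<^sub>v v) $ j = (\<Sum>k<Suc N. A $$ (j, k) * v $ k)"
      using that v(1) A by (simp add: scalar_prod_def lessThan_atLeast0)
    also have "\<dots> = (\<Sum>k\<le>N. v $ k * a k j)"
      using that by (intro sum.cong) (auto simp: A_def)
    finally show ?thesis ..
  qed
  ultimately show ?thesis by blast
qed

section \<open>Restriction of scalars\<close>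

lemma restrict_scalars_simps [simp]:
  "carrier (restrict_scalars \<phi> M) = carrier M" "zero (restrict_scalars \<phi> M) = zero M"
  "add (restrict_scalars \<phi> M) = add M" "smult (restrict_scalars \<phi> M) c v = \<phi> c \<odot>\<^bsub>M\<^esub> v"
  by (auto simp: restrict_scalars_def)

lemma regular_module_simps [simp]:
  "carrier (regular_module A) = carrier A" "zero (regular_module A) = zero A"
  "add (regular_module A) = add A" "smult (regular_module A) = mult A"
  by (auto simp: regular_module_def)

lemma module_regular:
  assumes "cring A"
  shows "Module.module A (regular_module A)"
proof -
  interpret cring A by fact
  have "abelian_group (regular_module A)"
  proof (rule abelian_groupI, goal_cases)
    case (6 x)
    then show ?case using add.l_inv_ex[of x] by simp
  qed (simp_all add: add.m_ac)
  then show ?thesis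
    by (intro Module.module.intro module_axioms.intro is_cring) (simp_all add: l_distr r_distr m_assoc)
qed

lemma vectorspace_restrict_scalars:
  fixes \<phi> :: "'k::field \<Rightarrow> 'a"
  assumes "Module.module A M" "\<phi> \<in> Ring.ring_hom class_ring A"
  shows "vectorspace class_ring (restrict_scalars \<phi> M)"
proof -
  interpret M: Module.module A M by fact
  note h = ring_hom_memE[OF assms(2), simplified]
  have "abelian_group (restrict_scalars \<phi> M)"
  proof (rule abelian_groupI, goal_cases)
    case (6 x)
    then show ?case using M.add.l_inv_ex[of x] by simp
  qed (simp_all add: M.add.m_ac)
  then show ?thesis
    by (intro vectorspace.intro Module.module.intro module_axioms.intro class_field class_cring.cring_axioms)
      (simp_all add: h M.smult_l_distr M.smult_r_distr M.smult_assoc1)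
qed

section \<open>Evaluation of polynomials in algebras\<close>

locale algebra_over = cring A for A :: "'a ring" (structure) +
  fixes \<phi> :: "'k::field \<Rightarrow> 'a"
  assumes \<phi>: "\<phi> \<in> Ring.ring_hom class_ring A"
begin

lemma \<phi>_closed [simp]: "\<phi> c \<in> carrier A"
  and \<phi>_add: "\<phi> (c + d) = \<phi> c \<oplus> \<phi> d"
  and \<phi>_mult: "\<phi> (c * d) = \<phi> c \<otimes> \<phi> d"
  and \<phi>_one [simp]: "\<phi> 1 = \<one>"
  using ring_hom_memE[OF \<phi>] by simp_all

lemma \<phi>_zero [simp]: "\<phi> 0 = \<zero>"
  using \<phi>_add[of 0 0] by (metis \<phi>_closed add.l_cancel_one' add_0)

definition ev :: "'a \<Rightarrow> 'k poly \<Rightarrow> 'a" where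
  "ev \<theta> p = fold_coeffs (\<lambda>c x. \<phi> c \<oplus> \<theta> \<otimes> x) p \<zero>"

lemma ev_0 [simp]: "ev \<theta> 0 = \<zero>"
  by (simp add: ev_def)

lemma ev_pCons [simp]: "\<theta> \<in> carrier A \<Longrightarrow> ev \<theta> (pCons c p) = \<phi> c \<oplus> \<theta> \<otimes> ev \<theta> p"
  by (cases "c = 0"; cases "p = 0") (simp_all add: ev_def)

context
  fixes \<theta> assumes \<theta> [simp]: "\<theta> \<in> carrier A"
begin

lemma ev_closed [simp]: "ev \<theta> p \<in> carrier A"
  by (induction p) simp_all

lemma ev_add: "ev \<theta> (p + q) = ev \<theta> p \<oplus> ev \<theta> q"
proof (induction p arbitrary: q)
  case (pCons a p)
  then show ?case by (cases q) (simp add: \<phi>_add r_distr a_ac)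
qed simp

lemma ev_smult: "ev \<theta> (Polynomial.smult c p) = \<phi> c \<otimes> ev \<theta> p"
  by (induction p) (simp_all add: \<phi>_mult r_distr m_ac)

lemma ev_mult: "ev \<theta> (p * q) = ev \<theta> p \<otimes> ev \<theta> q"
  by (induction p) (simp_all add: ev_add ev_smult l_distr m_assoc)

lemma ev_uminus: "ev \<theta> (- p) = \<ominus> ev \<theta> p"
  using ev_add[of "-p" p] by (intro minus_equality[symmetric]) simp_all

lemma ev_minus: "ev \<theta> (p - q) = ev \<theta> p \<ominus> ev \<theta> q"
  using ev_add[of p "-q"] by (simp add: ev_uminus minus_eq)

lemma ev_const: "ev \<theta> [:c:] = \<phi> c"
  by simp

lemma ev_one [simp]: "ev \<theta> 1 = \<one>"
  using ev_const[of 1] by (simp add: one_pCons)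

lemma ev_power: "ev \<theta> (p ^ n) = ev \<theta> p [^] n"
  by (induction n) (simp_all add: ev_mult m_comm)

lemma ev_monom: "ev \<theta> (monom c k) = \<phi> c \<otimes> \<theta> [^] k"
  by (induction k) (simp_all add: monom_0 monom_Suc m_ac)

end

text \<open>The remainder stays an unspecified multiple of the square of \<tau>, so no factorials
  are inverted and every characteristic is covered. The induction expands along Horner's
  scheme.\<close>

lemma ev_taylor:
  assumes [simp]: "\<theta> \<in> carrier A" "\<tau> \<in> carrier A"
  shows "\<exists>b\<in>carrier A. ev (\<theta> \<oplus> \<tau>) p = ev \<theta> p \<oplus> \<tau> \<otimes> ev \<theta> (pderiv p) \<oplus> \<tau> \<otimes> \<tau> \<otimes> b"
proof (induction p)
  case (pCons a q)
  then obtain b where b [simp]: "b \<in> carrier A"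
    and eq: "ev (\<theta> \<oplus> \<tau>) q = ev \<theta> q \<oplus> \<tau> \<otimes> ev \<theta> (pderiv q) \<oplus> \<tau> \<otimes> \<tau> \<otimes> b" by auto
  have "ev (\<theta> \<oplus> \<tau>) (pCons a q) =
      \<phi> a \<oplus> (\<theta> \<oplus> \<tau>) \<otimes> (ev \<theta> q \<oplus> \<tau> \<otimes> ev \<theta> (pderiv q) \<oplus> \<tau> \<otimes> \<tau> \<otimes> b)"
    by (simp add: eq)
  also have "\<dots> = ev \<theta> (pCons a q) \<oplus> \<tau> \<otimes> ev \<theta> (pderiv (pCons a q)) \<oplus>
      \<tau> \<otimes> \<tau> \<otimes> (ev \<theta> (pderiv q) \<oplus> \<theta> \<otimes> b \<oplus> \<tau> \<otimes> b)"
    by (simp add: pderiv_pCons ev_add r_distr l_distr a_ac m_ac)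
  finally show ?case by (rule bexI) simp
qed (auto intro: bexI[of _ \<zero>])

abbreviation "V \<equiv> restrict_scalars \<phi> (regular_module A)"

lemma vectorspace_V: "vectorspace class_ring V"
  by (rule vectorspace_restrict_scalars[OF module_regular[OF is_cring] \<phi>])

lemma functional_add: "linear_functional V l \<Longrightarrow> x \<in> carrier A \<Longrightarrow> y \<in> carrier A \<Longrightarrow> l (x \<oplus> y) = l x + l y"
  using linear_functionalD(1)[of V l x y] by simp

lemma functional_smult: "linear_functional V l \<Longrightarrow> x \<in> carrier A \<Longrightarrow> l (\<phi> c \<otimes> x) = c * l x"
  using linear_functionalD(2)[of V l x c] by simp

lemma functional_zero: "linear_functional V l \<Longrightarrow> l \<zero> = 0"
  using functional_smult[of l \<zero> 0] by simp

lemma functional_mult: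
  assumes "linear_functional V l" and [simp]: "a \<in> carrier A"
  shows "linear_functional V (\<lambda>x. l (a \<otimes> x))"
  using functional_add[OF assms(1)] functional_smult[OF assms(1)]
  by (simp add: linear_functional_def r_distr m_lcomm[of a])

lemma functional_ev:
  assumes l: "linear_functional V l" and [simp]: "\<theta> \<in> carrier A" and "degree p \<le> N"
  shows "l (ev \<theta> p) = (\<Sum>k\<le>N. coeff p k * l (\<theta> [^] k))"
proof -
  have "l (ev \<theta> (\<Sum>k\<in>S. monom (coeff p k) k)) = (\<Sum>k\<in>S. coeff p k * l (\<theta> [^] k))"
    if "finite S" for S
    using that by (induction S rule: finite_induct)
      (simp_all add: functional_zero[OF l] ev_add functional_add[OF l] ev_monom functional_smult[OF l])
  then show ?thesis using poly_as_sum_of_monoms'[OF assms(3)] by (metis finite_atMost)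
qed

lemma submodule_ideal:
  assumes "ideal I A" shows "submodule class_ring I V"
proof -
  interpret I: ideal I A by fact
  interpret V: vectorspace "class_ring :: 'k ring" V by (rule vectorspace_V)
  show ?thesis
    by unfold_locales (use I.a_subset I.I_l_closed in auto)
qed

text \<open>Division with remainder by \<open>g\<close> shows that the powers of \<theta> below
  \<open>degree g\<close> span; a relation between them would be a nonzero multiple of
  \<open>g\<close> of smaller degree.\<close>

lemma algebra_dim_monogenic:
  assumes \<theta> [simp]: "\<theta> \<in> carrier A" and g: "g \<noteq> 0"
    and onto: "\<And>x. x \<in> carrier A \<Longrightarrow> \<exists>p. x = ev \<theta> p"
    and ker: "\<And>p. ev \<theta> p = \<zero> \<longleftrightarrow> g dvd p"
  shows "algebra_dim \<phi> A = degree g"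
proof -
  interpret V: vectorspace "class_ring :: 'k ring" V by (rule vectorspace_V)
  have sum: "(\<Oplus>\<^bsub>V\<^esub>k\<in>{..<degree g}. c k \<odot>\<^bsub>V\<^esub> (\<theta> [^] k)) = ev \<theta> (\<Sum>k<degree g. monom (c k) k)" for c
  proof -
    have "(\<Oplus>\<^bsub>V\<^esub>k\<in>S. c k \<odot>\<^bsub>V\<^esub> (\<theta> [^] k)) = ev \<theta> (\<Sum>k\<in>S. monom (c k) k)"
      if "finite S" for S :: "nat set"
      using that
    proof (induction S rule: finite_induct)
      case (insert k S)
      have "(\<Oplus>\<^bsub>V\<^esub>k\<in>insert k S. c k \<odot>\<^bsub>V\<^esub> (\<theta> [^] k)) =
          c k \<odot>\<^bsub>V\<^esub> (\<theta> [^] k) \<oplus>\<^bsub>V\<^esub> (\<Oplus>\<^bsub>V\<^esub>k\<in>S. c k \<odot>\<^bsub>V\<^esub> (\<theta> [^] k))"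
        using insert.hyps by (intro V.finsum_insert) auto
      then show ?case using insert by (simp add: ev_add ev_monom)
    qed simp
    then show ?thesis by simp
  qed
  have deg: "(\<Sum>k<degree g. monom (c k) k) = 0 \<or> degree (\<Sum>k<degree g. monom (c k) k) < degree g"
    for c :: "nat \<Rightarrow> 'k"
  proof (cases "degree g = 0")
    case False
    then have "degree (\<Sum>k<degree g. monom (c k) k) \<le> degree g - 1"
      by (intro degree_sum_le) (auto intro: order.trans[OF degree_monom_le])
    with False show ?thesis by auto
  qed simp
  have "vectorspace.fin_dim class_ring V \<and> vectorspace.dim class_ring V = card {..<degree g}"
  proof (rule dim_basisI[OF vectorspace_V, of _ "\<lambda>k. \<theta> [^] k"], goal_cases)
    case (3 x)
    then obtain p where p: "x = ev \<theta> p" using onto by auto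
    have "x = ev \<theta> (p mod g)"
    proof -
      have "ev \<theta> (p - p mod g) = \<zero>" unfolding ker by (metis dvd_minus_mod)
      then have "ev \<theta> p = ev \<theta> (p mod g)" by (simp add: ev_minus)
      then show ?thesis using p by simp
    qed
    also have "p mod g = (\<Sum>k<degree g. monom (coeff (p mod g) k) k)"
    \<comment> \<open>A constant \<open>g\<close> is a unit, so every remainder is 0 and the sum is
      empty; this is the case of the zero algebra.\<close>
    proof (cases "degree g = 0")
      case True
      then show ?thesis using g by (metis is_unit_iff_degree lessThan_0 mod_eq_0_iff_dvd sum.empty unit_imp_dvd)
    next
      case False
      then have "degree (p mod g) \<le> degree g - 1" using degree_mod_less[OF g, of p] by auto
      from poly_as_sum_of_monoms'[OF this] False show ?thesis
        by (simp add: lessThan_Suc_atMost[symmetric])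
    qed
    finally show ?case unfolding sum[symmetric] by (intro exI[of _ "coeff (p mod g)"])
  next
    case (4 c)
    then have "g dvd (\<Sum>k<degree g. monom (c k) k)" unfolding sum ker[symmetric] by simp
    then have z: "(\<Sum>k<degree g. monom (c k) k) = 0"
      using deg[of c] dvd_imp_degree_le by (meson not_less)
    show ?case
    proof
      fix j assume j: "j \<in> {..<degree g}"
      have "coeff (\<Sum>k<degree g. monom (c k) k) j = (\<Sum>k<degree g. if k = j then c k else 0)"
        by (simp add: coeff_sum)
      then show "c j = 0" using j z by simp
    qed
  qed auto
  then show ?thesis by (simp add: algebra_dim_def)
qed

end

section \<open>Ideals of univariate polynomials\<close>

text \<open>An element of least degree, made monic, generates: a remainder modulo it would lie in
  \<open>Z\<close> with smaller degree.\<close>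

lemma poly_ideal_generator:
  fixes Z :: "'k::field poly set"
  assumes add: "\<And>p q. p \<in> Z \<Longrightarrow> q \<in> Z \<Longrightarrow> p + q \<in> Z"
    and mult: "\<And>p r. p \<in> Z \<Longrightarrow> r * p \<in> Z" and ne: "p0 \<in> Z" "p0 \<noteq> 0"
  obtains g where "lead_coeff g = 1" "\<And>p. p \<in> Z \<longleftrightarrow> g dvd p"
proof -
  obtain g0 where g0: "g0 \<in> Z" "g0 \<noteq> 0" and min: "\<And>q. q \<in> Z \<Longrightarrow> q \<noteq> 0 \<Longrightarrow> degree g0 \<le> degree q"
    using ex_has_least_nat[of "\<lambda>q. q \<in> Z \<and> q \<noteq> 0" p0 degree] ne by blast
  define g where "g = Polynomial.smult (inverse (lead_coeff g0)) g0"
  have g: "lead_coeff g = 1" "g \<in> Z" "g \<noteq> 0" "degree g = degree g0"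
    using g0 mult[OF g0(1), of "[:inverse (lead_coeff g0):]"] by (auto simp: g_def)
  have "g dvd p" if "p \<in> Z" for p
  proof -
    have "p mod g = p + (- (p div g)) * g" by (simp add: minus_div_mult_eq_mod[symmetric])
    then have "p mod g \<in> Z" using add[OF that mult[OF g(2)]] by metis
    then have "p mod g = 0" using min[of "p mod g"] degree_mod_less[OF g(3), of p] g(4) by force
    then show ?thesis by (simp add: dvd_eq_mod_eq_0)
  qed
  moreover have "p \<in> Z" if "g dvd p" for p
    using that mult[OF g(2)] by (metis dvdE mult.commute)
  ultimately show ?thesis using g that by blast
qed

text \<open>The combinations of \<open>f\<close> and \<open>q\<close> form an ideal. Its generator
  divides both polynomials and hence is a unit, as \<open>f\<close> is irreducible and does not
  divide \<open>q\<close>.\<close>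

lemma irreducible_bezout:
  fixes f q :: "'k::field poly"
  assumes f: "irreducible f" and q: "\<not> f dvd q"
  obtains a b where "a * f + b * q = 1"
proof -
  define Z where "Z = {a * f + b * q | a b. True}"
  have add: "p + r \<in> Z" if pr: "p \<in> Z" "r \<in> Z" for p r
  proof -
    obtain a b a' b' where "p = a * f + b * q" "r = a' * f + b' * q" using pr by (auto simp: Z_def)
    then have "p + r = (a + a') * f + (b + b') * q" by (simp add: algebra_simps)
    then show ?thesis by (auto simp: Z_def)
  qed
  have mult: "r * p \<in> Z" if pr: "p \<in> Z" for p r
  proof -
    obtain a b where "p = a * f + b * q" using pr by (auto simp: Z_def)
    then have "r * p = (r * a) * f + (r * b) * q" by (simp add: algebra_simps)
    then show ?thesis by (auto simp: Z_def)
  qed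
  have fq: "f \<in> Z" "q \<in> Z"
    using exI[of "\<lambda>a. \<exists>b. f = a * f + b * q" 1] exI[of "\<lambda>a. \<exists>b. q = a * f + b * q" 0]
    by (force simp: Z_def intro: exI[of _ "0 :: 'k poly"] exI[of _ "1 :: 'k poly"])+
  obtain g where g: "lead_coeff g = 1" "\<And>p. p \<in> Z \<longleftrightarrow> g dvd p"
    using poly_ideal_generator[of Z f] add mult fq f by (metis not_irreducible_zero)
  have "g dvd f" "g dvd q" using fq g(2) by auto
  then have "is_unit g" using f q by (metis dvd_trans irreducible_altdef)
  then have "1 \<in> Z" using g(2) by simp
  then show ?thesis using that by (auto simp: Z_def)
qed

lemma irreducible_power_decomp:
  fixes f p :: "'k::field poly"
  assumes f: "irreducible f" and "p \<noteq> 0"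
  obtains k q where "p = f ^ k * q" "\<not> f dvd q"
proof -
  have "\<exists>k q. p = f ^ k * q \<and> \<not> f dvd q"
    using \<open>p \<noteq> 0\<close>
  proof (induction "degree p" arbitrary: p rule: less_induct)
    case less
    show ?case
    proof (cases "f dvd p")
      case True
      then obtain q where q: "p = f * q" by auto
      have fpos: "degree f > 0" using f by (metis irreducible_def is_unit_iff_degree gr0I)
      have "degree q < degree p" using less.prems fpos unfolding q by (subst degree_mult_eq) auto
      then obtain k r where "q = f ^ k * r" "\<not> f dvd r" using less.hyps[of q] less.prems q by auto
      then show ?thesis using q by (intro exI[of _ "Suc k"] exI[of _ r]) (simp add: mult.assoc)
    qed (auto intro: exI[of _ "0::nat"])
  qed
  then show ?thesis using that by blast
qed

text \<open>If the derivative vanished, only exponents divisible by the characteristic would occur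
  in \<open>f\<close>; as all coefficients have roots of that order in a perfect field,
  \<open>f\<close> would be a proper power.\<close>

lemma irreducible_pderiv_nonzero:
  fixes f :: "'k::field poly"
  assumes perfect: "perfect_field TYPE('k)" and f: "irreducible f"
  shows "pderiv f \<noteq> 0"
proof
  assume d: "pderiv f = 0"
  have fpos: "degree f > 0" using f by (metis irreducible_def is_unit_iff_degree gr0I)
  have char_dvd: "CHAR('k) dvd k" if "coeff f k \<noteq> 0" for k
  proof (cases k)
    case (Suc j)
    have "of_nat (Suc j) * coeff f (Suc j) = coeff (pderiv f) j" by (simp add: coeff_pderiv)
    then have "of_nat k = (0 :: 'k)" using that d Suc by simp
    then show ?thesis by (simp only: of_nat_eq_0_iff_char_dvd)
  qed simp
  have "CHAR('k) dvd degree f" using char_dvd[of "degree f"] fpos by fastforce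
  then have "CHAR('k) > 0" using fpos by (intro gr0I) auto
  then have prime: "prime CHAR('k)" by (rule prime_CHAR_semidom)
  define c where "c = CHAR('k)"
  have c: "c > 1" "prime c" using prime prime_gt_1_nat by (auto simp: c_def)
  have "\<exists>y. y ^ c = x" for x :: 'k
    using perfect \<open>CHAR('k) > 0\<close> by (simp add: perfect_field_def c_def)
  then obtain s where s: "\<And>x :: 'k. s x ^ c = x" by metis
  have cP: "CHAR('k poly) = c" by (simp add: c_def)
  \<comment> \<open>The c-th root of \<open>f\<close>: exponents are divided by \<open>c\<close> and
    coefficients replaced by their c-th roots. The Frobenius map is additive, so
    \<open>h ^ c\<close> can be computed term by term.\<close>
  define h where "h = (\<Sum>j\<le>degree f div c. monom (s (coeff f (c * j))) j)"
  have "h ^ c = (\<Sum>j\<le>degree f div c. monom (s (coeff f (c * j))) j ^ c)"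
    unfolding h_def using c cP by (intro freshmans_dream_sum) auto
  also have "\<dots> = (\<Sum>j\<le>degree f div c. monom (coeff f (c * j)) (c * j))"
    by (simp add: monom_power s mult.commute)
  also have "\<dots> = (\<Sum>k\<in>(\<lambda>j. c * j) ` {..degree f div c}. monom (coeff f k) k)"
    using c by (subst sum.reindex) (auto simp: inj_on_def)
  also have "\<dots> = (\<Sum>k\<le>degree f. monom (coeff f k) k)"
  proof (rule sum.mono_neutral_left)
    show "(\<lambda>j. c * j) ` {..degree f div c} \<subseteq> {..degree f}"
      using c by (auto simp: less_eq_div_iff_mult_less_eq mult.commute)
    show "\<forall>k\<in>{..degree f} - (\<lambda>j. c * j) ` {..degree f div c}. monom (coeff f k) k = 0"
    proof
      fix k assume k: "k \<in> {..degree f} - (\<lambda>j. c * j) ` {..degree f div c}"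
      have "coeff f k = 0"
      proof (rule ccontr)
        assume "coeff f k \<noteq> 0"
        then obtain j where "k = c * j" using char_dvd[of k] by (auto simp: c_def)
        moreover have "j \<le> degree f div c" using k calculation c div_le_mono[of k "degree f" c] by auto
        ultimately show False using k by auto
      qed
      then show "monom (coeff f k) k = 0" by simp
    qed
  qed auto
  also have "\<dots> = f" by (rule poly_as_sum_of_monoms)
  finally have hf: "h ^ c = f" .
  obtain e where e: "c = Suc (Suc e)" using c(1) by (metis Suc_lessD less_imp_Suc_add add_Suc_right One_nat_def add_Suc)
  have "f = h * h ^ Suc e" using hf e by simp
  then have "is_unit h \<or> is_unit (h ^ Suc e)" using f unfolding irreducible_def by blast
  then have "is_unit h" by (metis dvd_mult_left power_Suc)
  then have "is_unit (h ^ c)" by (simp add: is_unit_power_iff)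
  then show False using f hf by (simp add: irreducible_def)
qed

section \<open>Finite-dimensional local algebras with principal maximal ideal\<close>

locale local_algebra = algebra_over A \<phi> for A :: "'a ring" (structure) and \<phi> :: "'k::field \<Rightarrow> 'a" +
  fixes M :: "'a set"
  assumes fin_dim: "vectorspace.fin_dim class_ring (restrict_scalars \<phi> (regular_module A))"
    and M: "maximalideal M A"
    and unique: "maximalideal N A \<Longrightarrow> N = M"
begin

sublocale M: maximalideal M A by (rule M)

lemma one_notin_M: "\<one> \<notin> M"
  using M.I_notcarr M.one_imp_carrier by auto

lemma M_carrier: "x \<in> M \<Longrightarrow> x \<in> carrier A"
  using M.a_subset by auto

text \<open>By Zorn's lemma a nonunit lies in an ideal that is maximal among those avoiding 1. Such
  an ideal is maximal, and \<open>M\<close> is the only maximal ideal.\<close>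

lemma unit_iff:
  assumes x [simp]: "x \<in> carrier A" and xM: "x \<notin> M"
  shows "\<exists>y\<in>carrier A. x \<otimes> y = \<one>"
proof (rule ccontr)
  assume no: "\<not> ?thesis"
  define AA where "AA = {I. ideal I A \<and> x \<in> I \<and> \<one> \<notin> I}"
  have "PIdl x \<in> AA"
    using cgenideal_ideal[OF x] cgenideal_self[OF x] no
    by (auto simp: AA_def cgenideal_def m_comm)
  moreover have "\<Union>C \<in> AA" if "C \<noteq> {}" "subset.chain AA C" for C
  proof -
    have "subset.chain {I. ideal I A} C" using that(2) by (auto simp: subset_chain_def AA_def)
    then have "ideal (\<Union>C) A" using chain_Union_is_ideal[of C] that(1) by simp
    then show ?thesis using that by (auto simp: AA_def subset_chain_def)
  qed
  ultimately obtain I where I: "I \<in> AA" "\<forall>X\<in>AA. I \<subseteq> X \<longrightarrow> X = I"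
    using subset_Zorn_nonempty[of AA] by blast
  have "maximalideal I A"
  proof (rule maximalidealI)
    show "ideal I A" "carrier A \<noteq> I" using I(1) by (auto simp: AA_def)
    fix J assume J: "ideal J A" "I \<subseteq> J" "J \<subseteq> carrier A"
    show "J = I \<or> J = carrier A"
    proof (cases "\<one> \<in> J")
      case True then show ?thesis using ideal.one_imp_carrier[OF J(1)] by auto
    next
      case False
      then have "J \<in> AA" using J I(1) by (auto simp: AA_def)
      then show ?thesis using I(2) J by auto
    qed
  qed
  then have "I = M" by (rule unique)
  then show False using I(1) xM by (auto simp: AA_def)
qed

lemma M_prime: "x \<in> carrier A \<Longrightarrow> y \<in> carrier A \<Longrightarrow> x \<otimes> y \<in> M \<Longrightarrow> x \<in> M \<or> y \<in> M"
  using primeideal.I_prime[OF maximalideal_prime[OF M]] by blast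

lemma M_cancel:
  assumes [simp]: "x \<in> carrier A" "y \<in> carrier A" and "x \<otimes> y = \<zero>" "y \<notin> M"
  shows "x = \<zero>"
proof -
  obtain z where z [simp]: "z \<in> carrier A" "y \<otimes> z = \<one>" using unit_iff[of y] assms by auto
  have "x = x \<otimes> (y \<otimes> z)" by simp
  also have "\<dots> = (x \<otimes> y) \<otimes> z" by (simp add: m_assoc del: z(2))
  finally show ?thesis using assms(3) by simp
qed

text \<open>The functionals that cut out the subspace \<open>I\<close> are numbered here so that
  they can serve as the equations of a linear system.\<close>

lemma functional_coordinates:
  assumes "ideal I A"
  shows "\<exists>(N::nat) l. (\<forall>i<N. linear_functional V (l i) \<and> (\<forall>x\<in>I. l i x = 0)) \<and>
    (\<forall>x\<in>carrier A. (\<forall>i<N. l i x = 0) \<longrightarrow> x \<in> I)"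
proof -
  obtain B :: "'a set" and l where B: "finite B"
    "\<forall>b\<in>B. linear_functional V (l b) \<and> (\<forall>x\<in>I. l b x = 0)"
    "\<forall>x\<in>carrier V. (\<forall>b\<in>B. l b x = 0) \<longrightarrow> x \<in> I"
    using subspace_coordinates[OF vectorspace_V fin_dim submodule_ideal[OF assms]] by blast
  obtain h where h: "bij_betw h {0..<card B} B" using ex_bij_betw_nat_finite[OF B(1)] by blast
  have "\<forall>i<card B. h i \<in> B" "\<forall>b\<in>B. \<exists>i<card B. h i = b"
    using h by (auto simp: bij_betw_def, metis atLeastLessThan_iff imageE)
  then show ?thesis using B(2,3)
    by (intro exI[of _ "card B"] exI[of _ "\<lambda>i. l (h i)"]) (simp, metis)
qed

text \<open>If \<open>N\<close> functionals separate the points of A/I, the first N + 1 powers of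
  \<theta> are dependent modulo \<open>I\<close>. The bound \<open>N\<close> precedes \<theta>; this
  uniformity is what lets an element of maximal degree be chosen later.\<close>

lemma annihilating_poly:
  assumes "ideal I A"
  shows "\<exists>N::nat. \<forall>\<theta>\<in>carrier A. \<exists>p. p \<noteq> 0 \<and> degree p \<le> N \<and> ev \<theta> p \<in> I"
proof -
  obtain N :: nat and l where l: "\<forall>i<N. linear_functional V (l i) \<and> (\<forall>x\<in>I. l i x = 0)"
    "\<forall>x\<in>carrier A. (\<forall>i<N. l i x = 0) \<longrightarrow> x \<in> I"
    using functional_coordinates[OF assms] by blast
  have "\<exists>p. p \<noteq> 0 \<and> degree p \<le> N \<and> ev \<theta> p \<in> I" if [simp]: "\<theta> \<in> carrier A" for \<theta>
  proof -
    obtain x :: "nat \<Rightarrow> 'k" where x: "\<exists>k\<le>N. x k \<noteq> 0" "\<forall>j<N. (\<Sum>k\<le>N. x k * l j (\<theta> [^] k)) = 0"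
      using linear_dependence[of N "\<lambda>k j. l j (\<theta> [^] k)"] by blast
    define p where "p = (\<Sum>k\<le>N. monom (x k) k)"
    have c: "coeff p k = (if k \<le> N then x k else 0)" for k
      by (simp add: p_def coeff_sum)
    have deg: "degree p \<le> N" by (rule degree_le) (simp add: c)
    have "l j (ev \<theta> p) = 0" if "j < N" for j
      using functional_ev[of "l j" \<theta> p N] l(1) x(2) that deg by (simp add: c)
    then have "ev \<theta> p \<in> I" using l(2) by simp
    moreover have "p \<noteq> 0" using x(1) c by (metis coeff_0)
    ultimately show ?thesis using deg by blast
  qed
  then show ?thesis by blast
qed

text \<open>An annihilating polynomial of \<open>t\<close> is X^k q with nonzero constant term in
  \<open>q\<close>. Since \<open>t\<close> lies in \<open>M\<close>, the value of \<open>q\<close>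
  at \<open>t\<close> is a unit, and \<open>t [^] k\<close> must vanish.\<close>

lemma M_nilpotent:
  assumes t: "t \<in> M"
  shows "\<exists>n. t [^] (n::nat) = \<zero>"
proof -
  have [simp]: "t \<in> carrier A" using t by (rule M_carrier)
  obtain p where p: "p \<noteq> 0" "ev t p \<in> {\<zero>}" using annihilating_poly[OF zeroideal] \<open>t \<in> carrier A\<close> by blast
  obtain q where q: "p = [:- 0, 1:] ^ order 0 p * q" "\<not> [:- 0, 1:] dvd q"
    using order_decomp[OF p(1), of 0] by auto
  obtain c q' where c: "q = pCons c q'" by (cases q)
  have "c \<noteq> 0"
  proof
    assume "c = 0"
    then have "q = [:- 0, 1:] * q'" by (simp add: c)
    then show False using q(2) by (metis dvd_triv_left)
  qed
  have "ev t q \<notin> M"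
  proof
    assume "ev t q \<in> M"
    moreover have "t \<otimes> ev t q' \<in> M" using t by (simp add: M.I_r_closed)
    ultimately have "ev t q \<ominus> t \<otimes> ev t q' \<in> M"
      using M.a_closed M.a_inv_closed by (simp add: minus_eq)
    also have "ev t q \<ominus> t \<otimes> ev t q' = \<phi> c" unfolding c by (simp add: minus_eq a_assoc r_neg)
    finally have "\<phi> c \<in> M" .
    then have "\<phi> (inverse c) \<otimes> \<phi> c \<in> M" by (simp add: M.I_l_closed)
    then have "\<phi> 1 \<in> M" unfolding \<phi>_mult[symmetric] using \<open>c \<noteq> 0\<close> by simp
    then show False using one_notin_M by simp
  qed
  moreover have "t [^] order 0 p \<otimes> ev t q = \<zero>"
  proof -
    have "ev t p = ev t ([:0, 1:] ^ order 0 p * q)" using q(1) by simp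
    also have "\<dots> = ev t ([:0, 1:] ^ order 0 p) \<otimes> ev t q" by (rule ev_mult) simp
    also have "ev t ([:0, 1:] ^ order 0 p) = t [^] order 0 p" by (simp add: ev_power)
    finally show ?thesis using p(2) by simp
  qed
  ultimately have "t [^] order 0 p = \<zero>" by - (rule M_cancel[of _ "ev t q"], simp_all)
  then show ?thesis by blast
qed

text \<open>This is the minimal polynomial of the residue class of \<theta>; it is irreducible
  because \<open>M\<close> is prime.\<close>

lemma residue_minpoly:
  assumes [simp]: "\<theta> \<in> carrier A"
  shows "\<exists>g. lead_coeff g = 1 \<and> irreducible g \<and> (\<forall>p. ev \<theta> p \<in> M \<longleftrightarrow> g dvd p)"
proof -
  obtain p0 where p0: "p0 \<noteq> 0" "ev \<theta> p0 \<in> M" using annihilating_poly[OF M.is_ideal] assms by blast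
  obtain g where g: "lead_coeff g = 1" "\<And>p. p \<in> {p. ev \<theta> p \<in> M} \<longleftrightarrow> g dvd p"
    using poly_ideal_generator[of "{p. ev \<theta> p \<in> M}" p0] p0
    by (auto simp: ev_add ev_mult M.I_l_closed)
  have "irreducible g"
  proof (rule irreducibleI)
    show "g \<noteq> 0" using g(1) by auto
    show "\<not> is_unit g" using g(2)[of 1] one_notin_M by simp
    fix a b assume ab: "g = a * b"
    then have "ev \<theta> a \<otimes> ev \<theta> b \<in> M" using g(2)[of g] by (simp add: ev_mult)
    then have "g dvd a \<or> g dvd b" using M_prime[of "ev \<theta> a" "ev \<theta> b"] g(2) by auto
    then show "is_unit a \<or> is_unit b" using ab \<open>g \<noteq> 0\<close>
      by (metis dvd_times_left_cancel_iff dvd_times_right_cancel_iff mult.commute mult_1 mult_eq_0_iff)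
  qed
  then show ?thesis using g by auto
qed

end

context abelian_group
begin

lemma minus_add_cancel: "x \<in> carrier G \<Longrightarrow> y \<in> carrier G \<Longrightarrow> (x \<ominus> y) \<oplus> y = x"
  by (simp add: minus_eq a_assoc l_neg)

lemma add_minus_cancel: "x \<in> carrier G \<Longrightarrow> y \<in> carrier G \<Longrightarrow> x \<oplus> \<ominus> (x \<ominus> y) = y"
  by (simp add: minus_eq minus_add r_neg2)

lemma minus_diff_cancel:
  assumes "x \<in> carrier G" "y \<in> carrier G" "z \<in> carrier G"
  shows "(x \<ominus> y) \<oplus> \<ominus> (z \<ominus> y) = x \<ominus> z"
proof -
  have "\<ominus> y \<oplus> (\<ominus> z \<oplus> y) = \<ominus> z"
    using assms by (simp add: a_lcomm[of "\<ominus> y" "\<ominus> z" y] l_neg)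
  then show ?thesis using assms by (simp add: minus_eq minus_add a_assoc)
qed

end

section \<open>Primitive elements of the residue field\<close>

context local_algebra
begin

text \<open>Along the line \<theta> + c \<beta> a functional of \<open>ev\<close> is a polynomial in
  c, and only its two lowest coefficients are needed later. The functional varies in the induction
  because a Horner step composes it with multiplication by \<theta> or by \<beta>.\<close>

lemma functional_taylor:
  assumes l: "linear_functional V l" and [simp]: "\<theta> \<in> carrier A" "\<beta> \<in> carrier A"
  shows "\<exists>Q. (\<forall>c. poly Q c = l (ev (\<theta> \<oplus> \<phi> c \<otimes> \<beta>) p)) \<and>
    coeff Q 0 = l (ev \<theta> p) \<and> coeff Q 1 = l (\<beta> \<otimes> ev \<theta> (pderiv p))"
  using l
proof (induction p arbitrary: l)
  case 0
  then show ?case by (intro exI[of _ 0]) (simp add: functional_zero)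
next
  case (pCons a q)
  note l = pCons.prems
  obtain Q1 where Q1: "\<And>c. poly Q1 c = l (\<theta> \<otimes> ev (\<theta> \<oplus> \<phi> c \<otimes> \<beta>) q)"
    "coeff Q1 0 = l (\<theta> \<otimes> ev \<theta> q)" "coeff Q1 1 = l (\<theta> \<otimes> (\<beta> \<otimes> ev \<theta> (pderiv q)))"
    using pCons.IH[OF functional_mult[OF l, of \<theta>]] by auto
  obtain Q2 where Q2: "\<And>c. poly Q2 c = l (\<beta> \<otimes> ev (\<theta> \<oplus> \<phi> c \<otimes> \<beta>) q)"
    "coeff Q2 0 = l (\<beta> \<otimes> ev \<theta> q)"
    using pCons.IH[OF functional_mult[OF l, of \<beta>]] by auto
  define Q where "Q = [:l (\<phi> a):] + Q1 + pCons 0 Q2"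
  have "poly Q c = l (ev (\<theta> \<oplus> \<phi> c \<otimes> \<beta>) (pCons a q))" for c
  proof -
    let ?u = "ev (\<theta> \<oplus> \<phi> c \<otimes> \<beta>) q"
    have "ev (\<theta> \<oplus> \<phi> c \<otimes> \<beta>) (pCons a q) = \<phi> a \<oplus> (\<theta> \<otimes> ?u \<oplus> \<phi> c \<otimes> (\<beta> \<otimes> ?u))"
      by (simp add: l_distr m_assoc)
    then show ?thesis
      by (simp add: Q_def Q1 Q2 functional_add[OF l] functional_smult[OF l])
  qed
  moreover have "coeff Q 0 = l (ev \<theta> (pCons a q))"
    by (simp add: Q_def Q1 functional_add[OF l])
  moreover have "coeff Q 1 = l (\<beta> \<otimes> ev \<theta> (pderiv (pCons a q)))"
    using Q1(3) Q2(2) by (simp add: Q_def pderiv_pCons ev_add r_distr functional_add[OF l] m_lcomm[of \<beta> \<theta>])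
  ultimately show ?case by blast
qed

text \<open>The residue field embeds into a finite power of the finite field K, so its
  multiplicative group is cyclic. Powers of a lifted generator reach every nonzero class.\<close>

lemma residue_generator_finite:
  assumes "finite (UNIV :: 'k set)"
  shows "\<exists>\<theta>\<in>carrier A. \<forall>x\<in>carrier A. \<exists>p. x \<ominus> ev \<theta> p \<in> M"
proof -
  have zero_Quot: "\<zero>\<^bsub>A Quot M\<^esub> = M" by (simp add: FactRing_def)
  interpret L: field "A Quot M" by (rule M.quotient_is_field[OF is_cring])
  interpret h: ring_hom_ring A "A Quot M" "(+>) M" by (rule M.rcos_ring_hom_ring)
  obtain N :: nat and l where l: "\<forall>i<N. linear_functional V (l i) \<and> (\<forall>x\<in>M. l i x = 0)"
    "\<forall>x\<in>carrier A. (\<forall>i<N. l i x = 0) \<longrightarrow> x \<in> M"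
    using functional_coordinates[OF M.is_ideal] by blast
  define co where "co x = restrict (\<lambda>i. l i x) {..<N}" for x
  have eqI: "M +> x = M +> y" if [simp]: "x \<in> carrier A" "y \<in> carrier A" and "co x = co y" for x y
  proof -
    have "l i (x \<ominus> y) = 0" if i: "i < N" for i
    proof -
      have "l i x = l i y" using fun_cong[OF \<open>co x = co y\<close>, of i] i by (simp add: co_def)
      moreover have "l i x = l i ((x \<ominus> y) \<oplus> y)" by (simp add: minus_eq a_assoc l_neg)
      ultimately show ?thesis using l(1) i functional_add[of "l i" "x \<ominus> y" y] by auto
    qed
    then have "x \<ominus> y \<in> M" using l(2) by simp
    then show ?thesis by (simp add: quotient_eq_iff_same_a_r_cos[OF M.is_ideal])
  qed
  have "finite (co ` carrier A)"
    by (rule finite_subset[of _ "{..<N} \<rightarrow>\<^sub>E UNIV"])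
      (simp_all add: co_def image_subset_iff PiE_iff finite_PiE assms)
  moreover
  define rep where "rep X = (SOME x. x \<in> carrier A \<and> X = M +> x)" for X
  have rep: "rep X \<in> carrier A \<and> X = M +> rep X" if "X \<in> carrier (A Quot M)" for X
  proof -
    have "\<exists>x. x \<in> carrier A \<and> X = M +> x"
      using that unfolding FactRing_def A_RCOSETS_def' partial_object.select_convs by blast
    then show ?thesis unfolding rep_def by (rule someI_ex)
  qed
  have "inj_on (\<lambda>X. co (rep X)) (carrier (A Quot M))"
  proof (rule inj_onI)
    fix X Y assume X: "X \<in> carrier (A Quot M)" and Y: "Y \<in> carrier (A Quot M)"
      and "co (rep X) = co (rep Y)"
    then have "M +> rep X = M +> rep Y" using rep[OF X] rep[OF Y] by (intro eqI) auto
    then show "X = Y" using rep[OF X] rep[OF Y] by simp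
  qed
  moreover have "(\<lambda>X. co (rep X)) ` carrier (A Quot M) \<subseteq> co ` carrier A" using rep by blast
  ultimately have fin: "finite (carrier (A Quot M))" using inj_on_finite by blast
  obtain a where a: "a \<in> carrier (Multiplicative_Group.mult_of (A Quot M))"
    "carrier (Multiplicative_Group.mult_of (A Quot M)) = {a [^]\<^bsub>A Quot M\<^esub> i | i :: nat. i \<in> UNIV}"
    by (rule bexE[OF L.finite_field_mult_group_has_gen[OF fin]])
  from a(1) have "a \<in> carrier (A Quot M)" by (simp add: carrier_mult_of)
  then obtain \<theta> where [simp]: "\<theta> \<in> carrier A" and \<theta>: "a = M +> \<theta>"
    unfolding FactRing_def A_RCOSETS_def' partial_object.select_convs by blast
  have "\<exists>p. x \<ominus> ev \<theta> p \<in> M" if [simp]: "x \<in> carrier A" for x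
  proof (cases "x \<in> M")
    case True
    then show ?thesis by (intro exI[of _ 0]) (simp add: minus_eq)
  next
    case False
    have "M +> x \<noteq> \<zero>\<^bsub>A Quot M\<^esub>"
      unfolding zero_Quot using False M.rcos_const_imp_mem[OF \<open>x \<in> carrier A\<close>] by blast
    then have "M +> x \<in> carrier (Multiplicative_Group.mult_of (A Quot M))"
      using h.hom_closed[of x] by simp
    then obtain i :: nat where "M +> x = a [^]\<^bsub>A Quot M\<^esub> i" using a(2) by blast
    then have "M +> x = M +> (\<theta> [^] i)" using h.hom_nat_pow[of \<theta> i] \<theta> by simp
    then have "x \<ominus> \<theta> [^] i \<in> M" by (simp add: quotient_eq_iff_same_a_r_cos[OF M.is_ideal])
    then show ?thesis by (intro exI[of _ "monom 1 i"]) (simp add: ev_monom)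
  qed
  then show ?thesis using \<open>\<theta> \<in> carrier A\<close> by blast
qed

text \<open>Over an infinite field, an element \<open>\<theta>\<close> of maximal degree \<open>r\<close> generates the residue field:
  otherwise some \<open>\<beta> g'(\<theta>)\<close>, where \<open>g\<close> is the minimal polynomial of \<open>\<theta>\<close>, is independent of the powers of
  \<open>\<theta>\<close>. As \<open>g(\<theta> + c \<beta>) = c \<beta> g'(\<theta>) + O(c\<^sup>2)\<close>, the powers up to \<open>r\<close> of \<open>\<theta> + c \<beta>\<close>
  are then independent for all but finitely many \<open>c\<close>.\<close>

lemma residue_generator_infinite:
  assumes perfect: "perfect_field TYPE('k)" and inf: "infinite (UNIV :: 'k set)"
  shows "\<exists>\<theta>\<in>carrier A. \<forall>x\<in>carrier A. \<exists>p. x \<ominus> ev \<theta> p \<in> M"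
proof -
  have "\<forall>\<theta>\<in>carrier A. \<exists>g. lead_coeff g = 1 \<and> irreducible g \<and> (\<forall>p. ev \<theta> p \<in> M \<longleftrightarrow> g dvd p)"
    using residue_minpoly by blast
  then obtain mp where mp: "\<And>\<theta>. \<theta> \<in> carrier A \<Longrightarrow> lead_coeff (mp \<theta>) = 1"
    "\<And>\<theta>. \<theta> \<in> carrier A \<Longrightarrow> irreducible (mp \<theta>)"
    "\<And>\<theta> p. \<theta> \<in> carrier A \<Longrightarrow> ev \<theta> p \<in> M \<longleftrightarrow> mp \<theta> dvd p" by metis
  obtain N :: nat where N: "\<forall>\<theta>\<in>carrier A. \<exists>p. p \<noteq> 0 \<and> degree p \<le> N \<and> ev \<theta> p \<in> M"
    using annihilating_poly[OF M.is_ideal] by blast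
  have "\<forall>\<theta>. \<theta> \<in> carrier A \<longrightarrow> degree (mp \<theta>) < Suc N"
  proof (intro allI impI)
    fix \<theta> assume \<theta>: "\<theta> \<in> carrier A"
    then obtain p where p: "p \<noteq> 0" "degree p \<le> N" "ev \<theta> p \<in> M" using N by blast
    then have "mp \<theta> dvd p" using mp(3)[OF \<theta>] by blast
    then show "degree (mp \<theta>) < Suc N" using p dvd_imp_degree_le[of "mp \<theta>" p] by linarith
  qed
  \<comment> \<open>The uniform bound \<open>N\<close> on degrees of minimal polynomials makes this
    maximum exist.\<close>
  from ex_has_greatest_nat[of "\<lambda>\<theta>. \<theta> \<in> carrier A" \<zero> "\<lambda>\<theta>. degree (mp \<theta>)", OF zero_closed this]
  obtain \<theta> where \<theta> [simp]: "\<theta> \<in> carrier A"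
    and max: "\<And>\<eta>. \<eta> \<in> carrier A \<Longrightarrow> degree (mp \<eta>) \<le> degree (mp \<theta>)" by blast
  define g where "g = mp \<theta>"
  define r where "r = degree g"
  have g: "lead_coeff g = 1" "irreducible g" "\<And>p. ev \<theta> p \<in> M \<longleftrightarrow> g dvd p"
    using mp by (auto simp: g_def)
  have r: "r > 0" using g(2) unfolding r_def by (metis irreducible_def is_unit_iff_degree gr0I)
  have "\<not> g dvd pderiv g"
  proof
    assume "g dvd pderiv g"
    then have "degree g \<le> degree (pderiv g)"
      using irreducible_pderiv_nonzero[OF perfect g(2)] by (intro dvd_imp_degree_le)
    moreover have "degree (pderiv g) \<le> degree g - 1"
      by (rule degree_le) (auto simp: coeff_pderiv coeff_eq_0)
    ultimately show False using r unfolding r_def by linarith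
  qed
  \<comment> \<open>Separability makes g'(\<theta>) a unit, with inverse \<open>w\<close>.\<close>
  then obtain w where w [simp]: "w \<in> carrier A" and w2: "ev \<theta> (pderiv g) \<otimes> w = \<one>"
    using unit_iff[of "ev \<theta> (pderiv g)"] g(3) by auto
  have "\<exists>p. \<beta>0 \<ominus> ev \<theta> p \<in> M" if \<beta>0 [simp]: "\<beta>0 \<in> carrier A" for \<beta>0
  proof (rule ccontr)
    assume no: "\<not> ?thesis"
    \<comment> \<open>The direction is chosen such that \<beta> g'(\<theta>) is exactly the element
      \<beta>0 outside the residue algebra of \<theta>.\<close>
    define \<beta> where "\<beta> = \<beta>0 \<otimes> w"
    have [simp]: "\<beta> \<in> carrier A" by (simp add: \<beta>_def)
    have \<beta>g: "\<beta> \<otimes> ev \<theta> (pderiv g) = \<beta>0"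
    proof -
      have "\<beta> \<otimes> ev \<theta> (pderiv g) = \<beta>0 \<otimes> (ev \<theta> (pderiv g) \<otimes> w)" by (simp add: \<beta>_def m_ac)
      then show ?thesis by (simp add: w2)
    qed
    \<comment> \<open>With \<open>v\<close> running through 1, \<theta>, ..., \<theta>^(r-1),
      \<beta>0, the subspace \<open>W i\<close> is \<open>M\<close> plus the span of all
      \<open>v j\<close> with j different from i. Functionals that separate \<open>v i\<close> from
      \<open>W i\<close> form a dual family modulo \<open>M\<close>.\<close>
    define W where "W i = {x. \<exists>m p c. x = m \<oplus> ev \<theta> p \<oplus> \<phi> c \<otimes> \<beta>0 \<and> m \<in> M \<and> degree p < r \<and>
      (if i = r then c = 0 else coeff p i = 0)}" for i
    have WI: "m \<oplus> ev \<theta> p \<oplus> \<phi> c \<otimes> \<beta>0 \<in> W i"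
      if "m \<in> M" "degree p < r" "if i = r then c = 0 else coeff p i = 0" for m p c i
      using that unfolding W_def by blast
    define v where "v j = (if j = r then \<beta>0 else \<theta> [^] j)" for j
    have v [simp]: "v j \<in> carrier A" for j by (simp add: v_def)
    have W_sub: "submodule class_ring (W i) V" for i
    proof -
      interpret V: vectorspace "class_ring :: 'k ring" V by (rule vectorspace_V)
      show ?thesis
      proof unfold_locales
        show "W i \<subseteq> carrier V" using M_carrier by (auto simp: W_def)
        show "\<zero>\<^bsub>V\<^esub> \<in> W i" using WI[of \<zero> 0 i 0] r by simp
        fix x y assume "x \<in> W i" "y \<in> W i"
        then obtain m p c m' p' c' where x: "x = m \<oplus> ev \<theta> p \<oplus> \<phi> c \<otimes> \<beta>0" "m \<in> M" "degree p < r"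
          "if i = r then c = 0 else coeff p i = 0" and y: "y = m' \<oplus> ev \<theta> p' \<oplus> \<phi> c' \<otimes> \<beta>0" "m' \<in> M" "degree p' < r"
          "if i = r then c' = 0 else coeff p' i = 0" unfolding W_def by blast
        have [simp]: "m \<in> carrier A" "m' \<in> carrier A" using x y M_carrier by auto
        have "x \<oplus> y = (m \<oplus> m') \<oplus> ev \<theta> (p + p') \<oplus> \<phi> (c + c') \<otimes> \<beta>0"
          by (simp add: x(1) y(1) ev_add \<phi>_add l_distr a_ac)
        also have "\<dots> \<in> W i"
          using x y by (intro WI M.a_closed degree_add_less) (auto split: if_splits)
        finally show "x \<oplus>\<^bsub>V\<^esub> y \<in> W i" by simp
      next
        fix d x assume "x \<in> W i"
        then obtain m p c where x: "x = m \<oplus> ev \<theta> p \<oplus> \<phi> c \<otimes> \<beta>0" "m \<in> M" "degree p < r"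
          "if i = r then c = 0 else coeff p i = 0" unfolding W_def by blast
        have [simp]: "m \<in> carrier A" using x M_carrier by auto
        have "\<phi> d \<otimes> x = \<phi> d \<otimes> m \<oplus> ev \<theta> (Polynomial.smult d p) \<oplus> \<phi> (d * c) \<otimes> \<beta>0"
          by (simp add: x(1) ev_smult \<phi>_mult r_distr m_assoc)
        also have "\<dots> \<in> W i"
          using x by (intro WI) (auto split: if_splits intro: M.I_l_closed le_less_trans[OF degree_smult_le])
        finally show "d \<odot>\<^bsub>V\<^esub> x \<in> W i" by simp
      qed
    qed
    have MW: "m \<in> W i" if "m \<in> M" for m i
      using WI[of m 0 i 0] that r M_carrier by simp
    have vW: "v j \<in> W i" if "j \<le> r" "i \<le> r" "i \<noteq> j" for i j
    proof (cases "j = r")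
      case True
      then show ?thesis using WI[of \<zero> 0 i 1] that r by (simp add: v_def)
    next
      case False
      then have "degree (monom (1::'k) j) < r" using that by (simp add: Polynomial.degree_monom_eq)
      then show ?thesis using WI[of \<zero> "monom 1 j" i 0] that False by (simp add: v_def ev_monom)
    qed
    have vnW: "v i \<notin> W i" if i: "i \<le> r" for i
    proof
      assume "v i \<in> W i"
      then obtain m p c where x: "v i = m \<oplus> ev \<theta> p \<oplus> \<phi> c \<otimes> \<beta>0" "m \<in> M" "degree p < r"
          "if i = r then c = 0 else coeff p i = 0" unfolding W_def by blast
      have [simp]: "m \<in> carrier A" using x M_carrier by auto
      show False
      proof (cases "i = r")
        case True
        then have "\<beta>0 \<ominus> ev \<theta> p = m" using x by (simp add: v_def minus_eq a_assoc r_neg)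
        then show False using no x(2) by auto
      next
        case False
        have aux: "y \<oplus> (z \<oplus> \<ominus> y) = z" if "y \<in> carrier A" "z \<in> carrier A" for y z
          using that by (simp add: a_lcomm[of y z] r_neg)
        have eq: "ev \<theta> (monom 1 i - p) = m \<oplus> \<phi> c \<otimes> \<beta>0"
          using x(1) False by (simp add: v_def ev_minus ev_monom minus_eq a_assoc aux)
        show False
        proof (cases "c = 0")
          case True
          then have "ev \<theta> (monom 1 i - p) \<in> M" using eq x(2) by simp
          then have "g dvd monom 1 i - p" using g(3) by simp
          moreover have "degree (monom 1 i - p) < r"
            using x(3) i False by (intro degree_diff_less) (auto simp: Polynomial.degree_monom_eq)
          ultimately have "monom 1 i - p = 0"
            using dvd_imp_degree_le[of g "monom 1 i - p"] unfolding r_def by fastforce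
          then have "coeff (monom 1 i - p) i = 0" by simp
          then show False using x(4) False by simp
        next
          case c: False
          define q where "q = Polynomial.smult (inverse c) (monom 1 i - p)"
          have "ev \<theta> q = \<phi> (inverse c) \<otimes> m \<oplus> (\<phi> (inverse c) \<otimes> \<phi> c) \<otimes> \<beta>0"
            by (simp add: q_def ev_smult eq r_distr m_assoc)
          also have "\<phi> (inverse c) \<otimes> \<phi> c = \<one>" unfolding \<phi>_mult[symmetric] using c by simp
          finally have "\<beta>0 \<ominus> ev \<theta> q = \<ominus> (\<phi> (inverse c) \<otimes> m)"
            by (simp add: minus_eq minus_add a_ac r_neg r_neg2)
          then have "\<beta>0 \<ominus> ev \<theta> q \<in> M" using x(2) by (simp add: M.I_l_closed M.a_inv_closed)
          then show False using no by blast
        qed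
      qed
    qed
    have "\<forall>i\<in>{..r}. \<exists>\<mu>. linear_functional V \<mu> \<and> (\<forall>x\<in>W i. \<mu> x = 0) \<and> \<mu> (v i) = 1"
      using separating_functional[OF vectorspace_V fin_dim W_sub _ vnW] by simp
    then obtain \<mu> where \<mu>: "\<And>i. i \<le> r \<Longrightarrow> linear_functional V (\<mu> i)"
      "\<And>i x. i \<le> r \<Longrightarrow> x \<in> W i \<Longrightarrow> \<mu> i x = 0" "\<And>i. i \<le> r \<Longrightarrow> \<mu> i (v i) = 1"
      using bchoice[of "{..r}"] by (metis atMost_iff)
    \<comment> \<open>The last power X^r is replaced by \<open>g\<close>: since g(\<theta>) lies in
      \<open>M\<close>, its values along the line are divisible by c.\<close>
    define pp where "pp j = (if j = r then g else monom 1 j)" for j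
    have "\<forall>i\<in>{..r}. \<forall>j. \<exists>Q. (\<forall>c. poly Q c = \<mu> i (ev (\<theta> \<oplus> \<phi> c \<otimes> \<beta>) (pp j))) \<and>
      coeff Q 0 = \<mu> i (ev \<theta> (pp j)) \<and> coeff Q 1 = \<mu> i (\<beta> \<otimes> ev \<theta> (pderiv (pp j)))"
      using functional_taylor[OF \<mu>(1)] by simp
    then obtain Q where Q: "\<And>i j c. i \<le> r \<Longrightarrow> poly (Q i j) c = \<mu> i (ev (\<theta> \<oplus> \<phi> c \<otimes> \<beta>) (pp j))"
      "\<And>i j. i \<le> r \<Longrightarrow> coeff (Q i j) 0 = \<mu> i (ev \<theta> (pp j))"
      "\<And>i j. i \<le> r \<Longrightarrow> coeff (Q i j) 1 = \<mu> i (\<beta> \<otimes> ev \<theta> (pderiv (pp j)))"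
      by (metis atMost_iff)
    have "\<exists>B. Q i r = pCons 0 B" if "i \<le> r" for i
    proof -
      obtain a B where aB: "Q i r = pCons a B" by (cases "Q i r")
      have "\<mu> i (ev \<theta> g) = 0" using \<mu>(2)[OF that] MW g(3)[of g] by simp
      then have "a = 0" using Q(2)[OF that, of r] aB by (simp add: pp_def)
      then show ?thesis using aB by blast
    qed
    then obtain B where B: "\<And>i. i \<le> r \<Longrightarrow> Q i r = pCons 0 (B i)" by metis
    \<comment> \<open>Column \<open>r\<close> is already divided by c. At c = 0 the matrix is that
      of the dual family on \<open>v\<close>, the identity, so its determinant is a nonzero
      polynomial in c.\<close>
    define D where "D = mat (Suc r) (Suc r) (\<lambda>(i, j). if j = r then B i else Q i j)"
    have D: "D \<in> carrier_mat (Suc r) (Suc r)" by (simp add: D_def)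
    define Dc where "Dc c = map_mat (\<lambda>p. poly p c) D" for c
    have Dc: "Dc c \<in> carrier_mat (Suc r) (Suc r)" for c using D by (simp add: Dc_def)
    have det: "det (Dc c) = poly (det D) c" for c
    proof -
      interpret comm_ring_hom "\<lambda>p :: 'k poly. poly p c" by unfold_locales simp_all
      show ?thesis unfolding Dc_def by (rule hom_det)
    qed
    have "Dc 0 = 1\<^sub>m (Suc r)"
    proof (rule eq_matI)
      fix i j assume "i < dim_row (1\<^sub>m (Suc r))" "j < dim_col (1\<^sub>m (Suc r))"
      then have ij: "i \<le> r" "j \<le> r" by auto
      have "Dc 0 $$ (i, j) = \<mu> i (v j)"
      proof (cases "j = r")
        case True
        have "poly (B i) 0 = coeff (Q i r) 1" using B[OF ij(1)] by (simp add: poly_0_coeff_0)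
        then show ?thesis using ij True Q(3)[OF ij(1), of r] by (simp add: Dc_def D_def pp_def \<beta>g v_def)
      next
        case False
        then show ?thesis using ij Q(2)[OF ij(1), of j]
          by (simp add: Dc_def D_def pp_def v_def ev_monom poly_0_coeff_0)
      qed
      also have "\<dots> = (if i = j then 1 else 0)" using \<mu> ij vW[of j i] by auto
      finally show "Dc 0 $$ (i, j) = 1\<^sub>m (Suc r) $$ (i, j)" using ij by simp
    qed (use Dc in auto)
    then have "poly (det D) 0 = 1" using det[of 0] by simp
    then have "det D \<noteq> 0" by auto
    then have "finite {c. poly (det D) c = 0}" by (rule poly_roots_finite)
    then have "finite (insert 0 {c. poly (det D) c = 0})" by simp
    \<comment> \<open>Infinitude of K provides a nonzero c at which the determinant
      survives.\<close>
    from ex_new_if_finite[OF inf this] obtain c where c: "c \<noteq> 0" "poly (det D) c \<noteq> 0" by blast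
    define u where "u = \<theta> \<oplus> \<phi> c \<otimes> \<beta>"
    have u [simp]: "u \<in> carrier A" by (simp add: u_def)
    \<comment> \<open>By maximality of \<theta> the minimal polynomial of \<open>u\<close> has
      degree at most \<open>r\<close>; the monomial raises it to degree exactly
      \<open>r\<close>.\<close>
    define f where "f = mp u * monom 1 (r - degree (mp u))"
    have mpu: "lead_coeff (mp u) = 1" "degree (mp u) \<le> r" "mp u \<noteq> 0"
      using mp(1)[of u] max[of u] by (auto simp: r_def g_def)
    have f: "degree f = r" "lead_coeff f = 1" "ev u f \<in> M"
    proof -
      have "degree f = degree (mp u) + degree (monom (1::'k) (r - degree (mp u)))"
        unfolding f_def using mpu by (intro degree_mult_eq) (simp_all add: monom_eq_0_iff)
      also have "degree (monom (1::'k) (r - degree (mp u))) = r - degree (mp u)"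
        by (rule Polynomial.degree_monom_eq) simp
      finally show "degree f = r" using mpu by simp
      show "lead_coeff f = 1" unfolding f_def lead_coeff_mult lead_coeff_monom using mpu by simp
      show "ev u f \<in> M" using mp(3)[of u f] by (simp add: f_def)
    qed
    have fg: "degree (f - g) < r"
    proof -
      have "coeff (f - g) k = 0" if "k > r - 1" for k
        using f g(1) that by (cases "k = r") (auto simp: r_def coeff_eq_0)
      then have "degree (f - g) \<le> r - 1" by (intro degree_le) auto
      then show ?thesis using r by linarith
    qed
    \<comment> \<open>The coefficients of f = (f - g) + g in the polynomials \<open>pp\<close>. The
      last entry is c rather than 1 because column \<open>r\<close> was divided by c, and c being
      nonzero makes \<open>y\<close> a nonzero kernel vector.\<close>
    define y where "y = vec (Suc r) (\<lambda>j. if j = r then c else coeff (f - g) j)"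
    have y: "y \<in> carrier_vec (Suc r)" by (simp add: y_def)
    have "y \<noteq> 0\<^sub>v (Suc r)"
    proof
      assume "y = 0\<^sub>v (Suc r)"
      then have "y $ r = 0" by simp
      then show False using c by (simp add: y_def)
    qed
    moreover have "Dc c *\<^sub>v y = 0\<^sub>v (Suc r)"
    proof (rule eq_vecI)
      fix i assume "i < dim_vec (0\<^sub>v (Suc r))"
      then have i: "i \<le> r" by simp
      note l = \<mu>(1)[OF i]
      have "(Dc c *\<^sub>v y) $ i = (\<Sum>j<Suc r. Dc c $$ (i, j) * y $ j)"
        using Dc[of c] y i by (simp add: scalar_prod_def lessThan_atLeast0 del: sum.op_ivl_Suc)
      also have "\<dots> = (\<Sum>j<r. coeff (f - g) j * \<mu> i (u [^] j)) + poly (B i) c * c"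
        using i Q(1)[OF i] D by (simp add: Dc_def D_def y_def pp_def u_def ev_monom mult.commute)
      also have "poly (B i) c * c = \<mu> i (ev u g)"
        using Q(1)[OF i, of r c] B[OF i] by (simp add: pp_def u_def mult.commute)
      also have "(\<Sum>j<r. coeff (f - g) j * \<mu> i (u [^] j)) = \<mu> i (ev u (f - g))"
        using functional_ev[OF l u, of "f - g" "r - 1"] fg r
        by (simp add: lessThan_Suc_atMost[symmetric])
      also have "\<mu> i (ev u (f - g)) + \<mu> i (ev u g) = \<mu> i (ev u (f - g) \<oplus> ev u g)"
        by (simp add: functional_add[OF l])
      also have "ev u (f - g) \<oplus> ev u g = ev u f" by (simp add: ev_add[symmetric])
      also have "\<mu> i (ev u f) = 0" using \<mu>(2)[OF i] MW f(3) by simp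
      finally show "(Dc c *\<^sub>v y) $ i = 0\<^sub>v (Suc r) $ i" using i by simp
    qed (use Dc[of c] in auto)
    ultimately have "det (Dc c) = 0" using det_0_iff_vec_prod_zero_field[OF Dc] y by blast
    then show False using det c by simp
  qed
  then show ?thesis using \<theta> by blast
qed

lemma residue_generator:
  assumes "perfect_field TYPE('k)"
  shows "\<exists>\<theta>\<in>carrier A. \<forall>x\<in>carrier A. \<exists>p. x \<ominus> ev \<theta> p \<in> M"
  using residue_generator_finite residue_generator_infinite[OF assms] by blast

text \<open>A generator of the residue field is adjusted within its class until its minimal
  polynomial \<open>f\<close> takes a value generating \<open>M\<close>. Successive approximation by
  powers of this value reaches all of \<open>A\<close>, as \<open>M\<close> is nilpotent, and
  \<open>e\<close> is the order of nilpotency of that value.\<close>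

lemma monogenic:
  assumes perfect: "perfect_field TYPE('k)" and t: "t \<in> carrier A" "M = PIdl t"
  obtains \<theta> f e where "\<theta> \<in> carrier A" "irreducible f" "lead_coeff f = 1" "e > 0"
    "\<And>x. x \<in> carrier A \<Longrightarrow> \<exists>p. x = ev \<theta> p" "\<And>p. ev \<theta> p = \<zero> \<longleftrightarrow> f ^ e dvd p"
    "\<And>p. ev \<theta> p \<in> M \<longleftrightarrow> f dvd p"
proof -
  obtain \<theta>0 where \<theta>0 [simp]: "\<theta>0 \<in> carrier A" and gen0: "\<And>x. x \<in> carrier A \<Longrightarrow> \<exists>p. x \<ominus> ev \<theta>0 p \<in> M"
    using residue_generator[OF perfect] by blast
  obtain f where f: "lead_coeff f = 1" "irreducible f" and f0: "\<And>p. ev \<theta>0 p \<in> M \<longleftrightarrow> f dvd p"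
    using residue_minpoly[OF \<theta>0] by blast
  have fpos: "degree f > 0" using f(2) by (metis irreducible_def is_unit_iff_degree gr0I)
  have tM: "t \<in> M" using t cgenideal_self by simp
  have Mt: "\<exists>a\<in>carrier A. x = t \<otimes> a" if "x \<in> M" for x
  proof -
    obtain a where "a \<in> carrier A" "x = a \<otimes> t" using \<open>x \<in> M\<close> unfolding t(2) cgenideal_def by blast
    then show ?thesis using t(1) m_comm[of a t] by blast
  qed
  have nd: "\<not> f dvd pderiv f"
  proof
    assume "f dvd pderiv f"
    then have "degree f \<le> degree (pderiv f)"
      using irreducible_pderiv_nonzero[OF perfect f(2)] by (intro dvd_imp_degree_le)
    moreover have "degree (pderiv f) \<le> degree f - 1"
      by (rule degree_le) (auto simp: coeff_pderiv coeff_eq_0)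
    ultimately show False using fpos by linarith
  qed
  have shift: "ev (\<theta>0 \<oplus> t) p \<ominus> ev \<theta>0 p \<in> M" for p
  proof -
    obtain b where b [simp]: "b \<in> carrier A" and
      eq: "ev (\<theta>0 \<oplus> t) p = ev \<theta>0 p \<oplus> t \<otimes> ev \<theta>0 (pderiv p) \<oplus> t \<otimes> t \<otimes> b"
      using ev_taylor[OF \<theta>0 t(1)] by blast
    have "ev (\<theta>0 \<oplus> t) p \<ominus> ev \<theta>0 p = t \<otimes> (ev \<theta>0 (pderiv p) \<oplus> t \<otimes> b)"
    proof -
      have "ev (\<theta>0 \<oplus> t) p \<ominus> ev \<theta>0 p =
          (ev \<theta>0 p \<oplus> (t \<otimes> ev \<theta>0 (pderiv p) \<oplus> t \<otimes> t \<otimes> b)) \<oplus> \<ominus> ev \<theta>0 p"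
        using t(1) by (simp add: eq minus_eq a_assoc)
      also have "\<dots> = (ev \<theta>0 p \<oplus> \<ominus> ev \<theta>0 p) \<oplus> (t \<otimes> ev \<theta>0 (pderiv p) \<oplus> t \<otimes> t \<otimes> b)"
        using t(1) by (simp add: a_ac)
      finally show ?thesis using t(1) by (simp add: r_neg r_distr m_assoc)
    qed
    then show ?thesis using tM t(1) by (simp add: M.I_r_closed)
  qed
  \<comment> \<open>Both candidates for the generator have the same residue class, hence the same
    minimal polynomial \<open>f\<close>.\<close>
  have cong_M: "ev (\<theta>0 \<oplus> t) p \<in> M \<longleftrightarrow> ev \<theta>0 p \<in> M" for p
  proof -
    have e: "ev (\<theta>0 \<oplus> t) p = (ev (\<theta>0 \<oplus> t) p \<ominus> ev \<theta>0 p) \<oplus> ev \<theta>0 p"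
      "ev \<theta>0 p = ev (\<theta>0 \<oplus> t) p \<oplus> \<ominus> (ev (\<theta>0 \<oplus> t) p \<ominus> ev \<theta>0 p)"
      using t(1) by (simp_all add: minus_add_cancel add_minus_cancel)
    show ?thesis
    proof
      assume "ev (\<theta>0 \<oplus> t) p \<in> M"
      then show "ev \<theta>0 p \<in> M" by (subst e(2)) (intro M.a_closed M.a_inv_closed shift)
    next
      assume "ev \<theta>0 p \<in> M"
      then show "ev (\<theta>0 \<oplus> t) p \<in> M" by (subst e(1)) (intro M.a_closed shift)
    qed
  qed
  text \<open>Either \<open>f(\<theta>\<^sub>0)\<close> or \<open>f(\<theta>\<^sub>0 + t)\<close> generates the maximal ideal, since they differ by
    \<open>t f'(\<theta>\<^sub>0)\<close> modulo \<open>t\<^sup>2\<close>, and \<open>f'(\<theta>\<^sub>0)\<close> is a unit.\<close>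
  have "\<exists>\<theta>. \<theta> \<in> {\<theta>0, \<theta>0 \<oplus> t} \<and> (\<exists>a\<in>carrier A. t = ev \<theta> f \<otimes> a)"
  proof -
    obtain a where a [simp]: "a \<in> carrier A" "ev \<theta>0 f = t \<otimes> a" using Mt[of "ev \<theta>0 f"] f0[of f] by auto
    show ?thesis
    proof (cases "a \<in> M")
      case False
      then obtain a' where "a' \<in> carrier A" "a \<otimes> a' = \<one>" using unit_iff[of a] a(1) by blast
      then show ?thesis using t(1) by (intro exI[of _ \<theta>0]) (auto simp: m_assoc intro!: bexI[of _ a'])
    next
      case True
      obtain b where b [simp]: "b \<in> carrier A" and
        eq: "ev (\<theta>0 \<oplus> t) f = ev \<theta>0 f \<oplus> t \<otimes> ev \<theta>0 (pderiv f) \<oplus> t \<otimes> t \<otimes> b"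
        using ev_taylor[OF \<theta>0 t(1)] by blast
      define w where "w = ev \<theta>0 (pderiv f) \<oplus> (a \<oplus> t \<otimes> b)"
      have w [simp]: "w \<in> carrier A" using t(1) by (simp add: w_def)
      have eqw: "ev (\<theta>0 \<oplus> t) f = t \<otimes> w" using t(1) by (simp add: eq w_def r_distr m_assoc a_ac)
      have "a \<oplus> t \<otimes> b \<in> M" using True tM by (simp add: M.I_r_closed)
      moreover have "ev \<theta>0 (pderiv f) = w \<oplus> \<ominus> (a \<oplus> t \<otimes> b)"
        using t(1) by (simp add: w_def a_assoc r_neg)
      ultimately have "w \<in> M \<Longrightarrow> ev \<theta>0 (pderiv f) \<in> M" by simp
      then have "w \<notin> M" using f0[of "pderiv f"] nd by blast
      then obtain w' where "w' \<in> carrier A" "w \<otimes> w' = \<one>" using unit_iff[of w] w by blast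
      then show ?thesis using t(1)
        by (intro exI[of _ "\<theta>0 \<oplus> t"]) (auto simp: eqw m_assoc intro!: bexI[of _ w'])
    qed
  qed
  then obtain \<theta> a where \<theta>: "\<theta> = \<theta>0 \<or> \<theta> = \<theta>0 \<oplus> t" and a [simp]: "a \<in> carrier A" and ta: "t = ev \<theta> f \<otimes> a"
    by blast
  have \<theta>c [simp]: "\<theta> \<in> carrier A" using \<theta> t(1) by auto
  have fM: "ev \<theta> p \<in> M \<longleftrightarrow> f dvd p" for p using \<theta> cong_M f0 by auto
  have gen: "\<exists>p y. x = ev \<theta> p \<oplus> ev \<theta> f \<otimes> y \<and> y \<in> carrier A" if x [simp]: "x \<in> carrier A" for x
  proof -
    obtain p where "x \<ominus> ev \<theta>0 p \<in> M" using gen0[OF x] by blast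
    then have "x \<ominus> ev \<theta> p \<in> M"
    proof -
      have "x \<ominus> ev (\<theta>0 \<oplus> t) p = (x \<ominus> ev \<theta>0 p) \<oplus> \<ominus> (ev (\<theta>0 \<oplus> t) p \<ominus> ev \<theta>0 p)"
        using t(1) by (simp add: minus_diff_cancel)
      then have "x \<ominus> ev (\<theta>0 \<oplus> t) p \<in> M"
        using shift[of p] \<open>x \<ominus> ev \<theta>0 p \<in> M\<close> by simp
      then show ?thesis using \<theta> \<open>x \<ominus> ev \<theta>0 p \<in> M\<close> by blast
    qed
    then obtain y where y: "y \<in> carrier A" "x \<ominus> ev \<theta> p = t \<otimes> y" using Mt by blast
    have "x = ev \<theta> p \<oplus> (x \<ominus> ev \<theta> p)" by (simp add: a_comm[of "ev \<theta> p"] minus_add_cancel)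
    also have "\<dots> = ev \<theta> p \<oplus> ev \<theta> f \<otimes> (a \<otimes> y)" 
    proof -
      have "t \<otimes> y = (ev \<theta> f \<otimes> a) \<otimes> y" by (rule arg_cong[OF ta])
      also have "\<dots> = ev \<theta> f \<otimes> (a \<otimes> y)" by (rule m_assoc) (simp_all add: y(1))
      finally show ?thesis by (simp only: y(2))
    qed
    finally show ?thesis by (intro exI conjI) (assumption, simp add: y(1))
  qed
  have fpow: "ev \<theta> f \<in> M" using fM by simp
  then obtain n :: nat where n: "ev \<theta> f [^] n = \<zero>" using M_nilpotent by blast
  \<comment> \<open>Iterating gives A = K[\<theta>] + f(\<theta>)^k A; for \<open>k = n\<close> the
    second summand is zero.\<close>
  have gen_n: "\<exists>p y. x = ev \<theta> p \<oplus> ev \<theta> f [^] k \<otimes> y \<and> y \<in> carrier A" if x: "x \<in> carrier A" for x and k :: nat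
  proof (induction k)
    case 0
    show ?case using x by (intro exI[of _ 0] exI[of _ x]) simp
  next
    case (Suc k)
    then obtain p y where p: "x = ev \<theta> p \<oplus> ev \<theta> f [^] k \<otimes> y" "y \<in> carrier A" by blast
    obtain q z where q: "y = ev \<theta> q \<oplus> ev \<theta> f \<otimes> z" "z \<in> carrier A" using gen[OF p(2)] by blast
    have "x = ev \<theta> (p + f ^ k * q) \<oplus> ev \<theta> f [^] Suc k \<otimes> z"
    proof -
      have "x = ev \<theta> p \<oplus> ev \<theta> f [^] k \<otimes> (ev \<theta> q \<oplus> ev \<theta> f \<otimes> z)" using p(1) q(1) by simp
      also have "\<dots> = ev \<theta> p \<oplus> ev \<theta> f [^] k \<otimes> ev \<theta> q \<oplus> ev \<theta> f [^] k \<otimes> (ev \<theta> f \<otimes> z)"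
        using q(2) by (simp add: r_distr a_assoc)
      also have "ev \<theta> p \<oplus> ev \<theta> f [^] k \<otimes> ev \<theta> q = ev \<theta> (p + f ^ k * q)"
        by (simp add: ev_add ev_mult ev_power)
      also have "ev \<theta> f [^] k \<otimes> (ev \<theta> f \<otimes> z) = ev \<theta> f [^] Suc k \<otimes> z"
        using q(2) by (simp add: m_assoc)
      finally show ?thesis .
    qed
    then show ?case using q(2) by (intro exI conjI)
  qed
  have onto: "\<exists>p. x = ev \<theta> p" if x: "x \<in> carrier A" for x
  proof -
    obtain p y where "x = ev \<theta> p \<oplus> ev \<theta> f [^] n \<otimes> y" "y \<in> carrier A" using gen_n[OF x, of n] by blast
    then have "x = ev \<theta> p" using n by simp
    then show ?thesis by (rule exI)
  qed
  define e where "e = (LEAST k. ev \<theta> (f ^ k) = \<zero>)"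
  have e0: "ev \<theta> (f ^ e) = \<zero>" unfolding e_def by (rule LeastI[of _ n]) (simp add: ev_power n)
  have emin: "e \<le> k" if "ev \<theta> (f ^ k) = \<zero>" for k unfolding e_def by (rule Least_le) (rule that)
  have "e > 0"
  proof (rule gr0I)
    assume "e = 0"
    then show False using e0 one_notin_M by simp
  qed
  moreover have "ev \<theta> p = \<zero> \<longleftrightarrow> f ^ e dvd p" for p
  proof
    assume "f ^ e dvd p"
    then show "ev \<theta> p = \<zero>" using e0 by (auto simp: ev_mult elim!: dvdE)
  next
    assume z: "ev \<theta> p = \<zero>"
    show "f ^ e dvd p"
    proof (cases "p = 0")
      case False
      \<comment> \<open>The factor \<open>q\<close> has a unit as its value, so the vanishing of
        p(\<theta>) is decided by \<open>f ^ k\<close> alone, and \<open>e\<close> is at most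
        \<open>k\<close>.\<close>
      then obtain k q where kq: "p = f ^ k * q" "\<not> f dvd q" using irreducible_power_decomp[OF f(2)] by blast
      have "ev \<theta> (f ^ k) \<otimes> ev \<theta> q = \<zero>" using z kq by (simp add: ev_mult)
      then have "ev \<theta> (f ^ k) = \<zero>" using fM[of q] kq(2) by - (rule M_cancel[of _ "ev \<theta> q"], simp_all)
      then show ?thesis using emin kq(1) by (simp add: le_imp_power_dvd dvd_mult2)
    qed simp
  qed
  ultimately show ?thesis using that[OF \<theta>c f(2,1)] onto fM by blast
qed

end

section \<open>Graded polynomial rings\<close>

lemma mdegree_superset:
  "finite S \<Longrightarrow> Poly_Mapping.keys t \<subseteq> S \<Longrightarrow> mdegree t = (\<Sum>i\<in>S. Poly_Mapping.lookup t i)"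
  unfolding mdegree_def by (rule sum.mono_neutral_left) (auto simp: in_keys_iff)

lemma mdegree_add: "mdegree (s + t) = mdegree s + mdegree t"
proof -
  let ?S = "Poly_Mapping.keys s \<union> Poly_Mapping.keys t"
  have "mdegree (s + t) = (\<Sum>i\<in>?S. Poly_Mapping.lookup (s + t) i)"
    by (rule mdegree_superset) (auto dest: Poly_Mapping.keys_add[THEN subsetD])
  then show ?thesis
    by (simp add: lookup_add sum.distrib mdegree_superset[of ?S])
qed

lemma mdegree_0 [simp]: "mdegree 0 = 0"
  by (simp add: mdegree_def)

lemma mdegree_single [simp]: "mdegree (Poly_Mapping.single i k) = k"
  by (simp add: mdegree_def)

definition homog :: "nat \<Rightarrow> 'k::field mpoly \<Rightarrow> bool" where
  "homog d p \<longleftrightarrow> (\<forall>t\<in>Poly_Mapping.keys p. mdegree t = d)"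

definition hcomp :: "nat \<Rightarrow> 'k::field mpoly \<Rightarrow> 'k mpoly" where
  "hcomp d p = (\<Sum>t\<in>{t \<in> Poly_Mapping.keys p. mdegree t = d}. Poly_Mapping.single t (Poly_Mapping.lookup p t))"

lemma lookup_hcomp: "Poly_Mapping.lookup (hcomp d p) t = (if mdegree t = d then Poly_Mapping.lookup p t else 0)"
  by (simp add: hcomp_def lookup_sum lookup_single when_def in_keys_iff)

lemma hcomp_add: "hcomp d (p + q) = hcomp d p + hcomp d q"
  by (rule poly_mapping_eqI) (simp add: lookup_hcomp lookup_add)

lemma hcomp_0 [simp]: "hcomp d 0 = 0"
  by (rule poly_mapping_eqI) (simp add: lookup_hcomp)

lemma hcomp_sum: "hcomp d (\<Sum>i\<in>S. p i) = (\<Sum>i\<in>S. hcomp d (p i))"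
  by (induction S rule: infinite_finite_induct) (simp_all add: hcomp_add)

lemma keys_hcomp: "Poly_Mapping.keys (hcomp d p) = {t \<in> Poly_Mapping.keys p. mdegree t = d}"
  by (auto simp: in_keys_iff lookup_hcomp split: if_splits)

lemma homog_hcomp: "homog d (hcomp d p)"
  by (auto simp: homog_def keys_hcomp)

lemma hcomp_homog: "homog d p \<Longrightarrow> hcomp e p = (if e = d then p else 0)"
  by (rule poly_mapping_eqI) (auto simp: lookup_hcomp homog_def in_keys_iff)

lemma homog_mult: "homog a p \<Longrightarrow> homog b q \<Longrightarrow> homog (a + b) (p * q)"
  using keys_mult[of p q] by (fastforce simp: homog_def mdegree_add)

lemma homog_add: "homog d p \<Longrightarrow> homog d q \<Longrightarrow> homog d (p + q)"
  using Poly_Mapping.keys_add[of p q] by (auto simp: homog_def)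

lemma homog_zero: "homog d 0"
  by (simp add: homog_def)

lemma homog_sum: "(\<And>i. i \<in> S \<Longrightarrow> homog d (p i)) \<Longrightarrow> homog d (\<Sum>i\<in>S. p i)"
  by (induction S rule: infinite_finite_induct) (simp_all add: homog_add homog_zero)

text \<open>Only an upper bound for the degree. Summing over the monomials instead of maximizing
  gives 0 for the zero polynomial without a case distinction.\<close>

definition max_mdegree :: "'k::field mpoly \<Rightarrow> nat" where
  "max_mdegree p = (\<Sum>t\<in>Poly_Mapping.keys p. mdegree t)"

lemma mdegree_le_max: "t \<in> Poly_Mapping.keys p \<Longrightarrow> mdegree t \<le> max_mdegree p"
  unfolding max_mdegree_def by (rule member_le_sum) auto

lemma hcomp_above: "max_mdegree p < d \<Longrightarrow> hcomp d p = 0"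
  by (rule poly_mapping_eqI) (use mdegree_le_max[of _ p] in \<open>force simp: lookup_hcomp in_keys_iff\<close>)

lemma sum_hcomp: "max_mdegree p \<le> D \<Longrightarrow> p = (\<Sum>d\<le>D. hcomp d p)"
  by (rule poly_mapping_eqI)
    (use mdegree_le_max[of _ p] in \<open>force simp: lookup_sum lookup_hcomp in_keys_iff\<close>)

lemma hcomp_mult: "hcomp d (p * q) = (\<Sum>i\<le>d. hcomp i p * hcomp (d - i) q)"
proof -
  \<comment> \<open>Large enough to decompose both factors, and at least \<open>d\<close> so that
    the index d - i stays within the range.\<close>
  define D where "D = max d (max (max_mdegree p) (max_mdegree q))"
  have p: "p = (\<Sum>i\<le>D. hcomp i p)" and q: "q = (\<Sum>i\<le>D. hcomp i q)"
    by (rule sum_hcomp, simp add: D_def)+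
  have "p * q = (\<Sum>i\<le>D. \<Sum>j\<le>D. hcomp i p * hcomp j q)"
    by (subst p, subst q) (rule sum_product)
  then have "hcomp d (p * q) = (\<Sum>i\<le>D. \<Sum>j\<le>D. hcomp d (hcomp i p * hcomp j q))"
    by (simp add: hcomp_sum)
  also have "\<dots> = (\<Sum>i\<le>D. \<Sum>j\<le>D. if d = i + j then hcomp i p * hcomp j q else 0)"
    by (intro sum.cong refl hcomp_homog homog_mult homog_hcomp)
  also have "\<dots> = (\<Sum>i\<le>D. if i \<le> d then hcomp i p * hcomp (d - i) q else 0)"
  proof (rule sum.cong)
    fix i assume "i \<in> {..D}"
    show "(\<Sum>j\<le>D. if d = i + j then hcomp i p * hcomp j q else 0) =
        (if i \<le> d then hcomp i p * hcomp (d - i) q else 0)"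
    proof (cases "i \<le> d")
      case True
      have "(\<Sum>j\<le>D. if d = i + j then hcomp i p * hcomp j q else 0) =
        (\<Sum>j\<le>D. if d - i = j then hcomp i p * hcomp j q else 0)"
        using True by (intro sum.cong) auto
      also have "\<dots> = hcomp i p * hcomp (d - i) q" by (simp add: D_def)
      finally show ?thesis using True by simp
    qed auto
  qed simp
  also have "\<dots> = (\<Sum>i\<in>{..D} \<inter> {i. i \<le> d}. hcomp i p * hcomp (d - i) q)"
    using sum.inter_restrict[of "{..D}" "\<lambda>i. hcomp i p * hcomp (d - i) q" "{i. i \<le> d}"] by simp
  also have "{..D} \<inter> {i. i \<le> d} = {..d}" by (auto simp: D_def)
  finally show ?thesis .
qed

lemma hcomp_mult_homog:
  assumes "homog e p"
  shows "hcomp d (p * q) = (if e \<le> d then p * hcomp (d - e) q else 0)"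
proof -
  have "hcomp d (p * q) = (\<Sum>i\<le>d. if i = e then p * hcomp (d - e) q else 0)"
    unfolding hcomp_mult by (intro sum.cong) (auto simp: hcomp_homog[OF assms])
  then show ?thesis by simp
qed

lemma poly_ring_simps [simp]:
  "mult (poly_ring n) = (*)" "one (poly_ring n) = 1" "zero (poly_ring n) = 0" "add (poly_ring n) = (+)"
  by (auto simp: poly_ring_def)

lemma poly_ring_carrier:
  "p \<in> carrier (poly_ring n) \<longleftrightarrow> (\<forall>t\<in>Poly_Mapping.keys p. Poly_Mapping.keys t \<subseteq> {..n})"
  by (simp add: poly_ring_def)

lemma
  shows P_zero [simp]: "0 \<in> carrier (poly_ring n)"
    and P_one [simp]: "1 \<in> carrier (poly_ring n)"
    and P_add [simp]: "p \<in> carrier (poly_ring n) \<Longrightarrow> q \<in> carrier (poly_ring n) \<Longrightarrow> p + q \<in> carrier (poly_ring n)"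
    and P_mult [simp]: "p \<in> carrier (poly_ring n) \<Longrightarrow> q \<in> carrier (poly_ring n) \<Longrightarrow> p * q \<in> carrier (poly_ring n)"
    and P_uminus [simp]: "p \<in> carrier (poly_ring n) \<Longrightarrow> - p \<in> carrier (poly_ring n)"
    and P_const [simp]: "mpoly_const c \<in> carrier (poly_ring n)"
    and P_var [simp]: "i \<le> n \<Longrightarrow> mpoly_var i \<in> carrier (poly_ring n)"
    and P_hcomp [simp]: "p \<in> carrier (poly_ring n) \<Longrightarrow> hcomp d p \<in> carrier (poly_ring n)"
proof -
  show "p + q \<in> carrier (poly_ring n)" if "p \<in> carrier (poly_ring n)" "q \<in> carrier (poly_ring n)"
    using that Poly_Mapping.keys_add[of p q] unfolding poly_ring_carrier by blast
  show "p * q \<in> carrier (poly_ring n)" if pq: "p \<in> carrier (poly_ring n)" "q \<in> carrier (poly_ring n)"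
    unfolding poly_ring_carrier
  proof
    fix t assume "t \<in> Poly_Mapping.keys (p * q)"
    then obtain a b where "t = a + b" "a \<in> Poly_Mapping.keys p" "b \<in> Poly_Mapping.keys q"
      using keys_mult[of p q] by blast
    then show "Poly_Mapping.keys t \<subseteq> {..n}"
      using pq Poly_Mapping.keys_add[of a b] unfolding poly_ring_carrier by blast
  qed
qed (auto simp: poly_ring_carrier mpoly_const_def mpoly_var_def keys_hcomp)

lemma P_diff [simp]: "p \<in> carrier (poly_ring n) \<Longrightarrow> q \<in> carrier (poly_ring n) \<Longrightarrow> p - q \<in> carrier (poly_ring n)"
  using P_add[of p n "- q"] by simp

lemma P_power [simp]: "p \<in> carrier (poly_ring n) \<Longrightarrow> p ^ k \<in> carrier (poly_ring n)"
  by (induction k) simp_all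

lemma P_sum [simp]: "(\<And>i. i \<in> S \<Longrightarrow> p i \<in> carrier (poly_ring n)) \<Longrightarrow> (\<Sum>i\<in>S. p i) \<in> carrier (poly_ring n)"
  by (induction S rule: infinite_finite_induct) simp_all

lemma cring_poly_ring: "cring (poly_ring n)"
proof (rule cringI)
  show "abelian_group (poly_ring n)"
  proof (rule abelian_groupI, goal_cases)
    case (6 x)
    then show ?case by (intro bexI[of _ "- x"]) simp_all
  qed (simp_all add: ac_simps)
  show "comm_monoid (poly_ring n)"
    by (rule comm_monoidI) (simp_all add: ac_simps)
qed (simp add: algebra_simps)

lemma poly_ring_a_inv: "p \<in> carrier (poly_ring n) \<Longrightarrow> \<ominus>\<^bsub>poly_ring n\<^esub> p = - p"
proof -
  interpret cring "poly_ring n" by (rule cring_poly_ring)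
  assume "p \<in> carrier (poly_ring n)"
  then show ?thesis by (intro minus_equality) simp_all
qed

lemma poly_ring_a_minus:
  "p \<in> carrier (poly_ring n) \<Longrightarrow> q \<in> carrier (poly_ring n) \<Longrightarrow> p \<ominus>\<^bsub>poly_ring n\<^esub> q = p - q"
  by (simp add: a_minus_def poly_ring_a_inv)

lemma poly_idealI:
  assumes "J \<subseteq> carrier (poly_ring n)" "0 \<in> J" "\<And>a b. a \<in> J \<Longrightarrow> b \<in> J \<Longrightarrow> a + b \<in> J"
    "\<And>a x. a \<in> J \<Longrightarrow> x \<in> carrier (poly_ring n) \<Longrightarrow> x * a \<in> J"
  shows "ideal J (poly_ring n)"
proof -
  interpret cring "poly_ring n" by (rule cring_poly_ring)
  show ?thesis
  proof (rule idealI)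
    show "ring (poly_ring n)" by (rule ring_axioms)
    show "subgroup J (add_monoid (poly_ring n))"
    proof (rule subgroup.intro)
      fix x assume x: "x \<in> J"
      then have "- x = (- 1) * x" "- 1 \<in> carrier (poly_ring n)" by simp_all
      then have "- x \<in> J" using assms(4)[OF x, of "- 1"] by simp
      moreover have "inv\<^bsub>add_monoid (poly_ring n)\<^esub> x = - x"
        using poly_ring_a_inv[of x n] x assms(1) by (auto simp: a_inv_def)
      ultimately show "inv\<^bsub>add_monoid (poly_ring n)\<^esub> x \<in> J" by simp
    qed (use assms(1,2) in \<open>auto intro: assms(3)\<close>)
  qed (use assms(4) in \<open>auto simp: mult.commute\<close>)
qed

lemma
  assumes "ideal J (poly_ring n)"
  shows poly_ideal_subset: "a \<in> J \<Longrightarrow> a \<in> carrier (poly_ring n)"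
    and poly_ideal_add: "a \<in> J \<Longrightarrow> b \<in> J \<Longrightarrow> a + b \<in> J"
    and poly_ideal_zero: "0 \<in> J"
    and poly_ideal_mult: "a \<in> J \<Longrightarrow> x \<in> carrier (poly_ring n) \<Longrightarrow> x * a \<in> J"
    and poly_ideal_uminus: "a \<in> J \<Longrightarrow> - a \<in> J"
    and poly_ideal_diff: "a \<in> J \<Longrightarrow> b \<in> J \<Longrightarrow> a - b \<in> J"
proof -
  interpret ideal J "poly_ring n" by fact
  show s: "a \<in> J \<Longrightarrow> a \<in> carrier (poly_ring n)" for a using a_subset by auto
  show ad: "a \<in> J \<Longrightarrow> b \<in> J \<Longrightarrow> a + b \<in> J" for a b using additive_subgroup.a_closed[OF is_additive_subgroup, of a b] by simp
  show "0 \<in> J" using additive_subgroup.zero_closed[OF is_additive_subgroup] by simp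
  show "a \<in> J \<Longrightarrow> x \<in> carrier (poly_ring n) \<Longrightarrow> x * a \<in> J" using I_l_closed[of a x] by simp
  show um: "a \<in> J \<Longrightarrow> - a \<in> J" for a using additive_subgroup.a_inv_closed[OF is_additive_subgroup, of a] s by (simp add: poly_ring_a_inv)
  show "a \<in> J \<Longrightarrow> b \<in> J \<Longrightarrow> a - b \<in> J" using ad[of a "- b"] um by simp
qed

lemma poly_ideal_sum:
  assumes "ideal J (poly_ring n)" "\<And>i. i \<in> S \<Longrightarrow> f i \<in> J"
  shows "(\<Sum>i\<in>S. f i) \<in> J"
  using assms(2) by (induction S rule: infinite_finite_induct)
    (simp_all add: poly_ideal_zero[OF assms(1)] poly_ideal_add[OF assms(1)])

lemma homogeneous_part_iff: "p \<in> homogeneous_part n d \<longleftrightarrow> p \<in> carrier (poly_ring n) \<and> homog d p"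
  by (simp add: homogeneous_part_def homog_def)

section \<open>Homogeneous ideals and homogeneous primes\<close>

text \<open>Working form of homogeneity, by closure under components instead of generation by forms;
  the next two lemmas show the equivalence.\<close>

definition graded_ideal :: "nat \<Rightarrow> 'k::field mpoly set \<Rightarrow> bool" where
  "graded_ideal n J \<longleftrightarrow> ideal J (poly_ring n) \<and> (\<forall>f\<in>J. \<forall>d. hcomp d f \<in> J)"

lemma homogeneous_imp_graded:
  fixes J :: "'k::field mpoly set"
  assumes "homogeneous_ideal n J"
  shows "graded_ideal n J"
proof -
  interpret cring "poly_ring n" by (rule cring_poly_ring)
  obtain H where H: "H \<subseteq> (\<Union>d. homogeneous_part n d)" "J = genideal (poly_ring n) H"
    using assms by (auto simp: homogeneous_ideal_def)
  have Hc: "H \<subseteq> carrier (poly_ring n)" using H(1) by (auto simp: homogeneous_part_iff)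
  have J: "ideal J (poly_ring n)" unfolding H(2) by (rule genideal_ideal[OF Hc])
  have HJ: "H \<subseteq> J" unfolding H(2) by (rule genideal_self[OF Hc])
  \<comment> \<open>The polynomials with all components in \<open>J\<close> form an ideal that
    contains the generators.\<close>
  define Z where "Z = {f \<in> carrier (poly_ring n). \<forall>d. hcomp d f \<in> J}"
  have "ideal Z (poly_ring n)"
  proof (rule poly_idealI)
    fix a x :: "'k mpoly" assume a: "a \<in> Z" and x: "x \<in> carrier (poly_ring n)"
    have "hcomp d (x * a) \<in> J" for d
      unfolding hcomp_mult using a x
      by (intro poly_ideal_sum[OF J] poly_ideal_mult[OF J]) (auto simp: Z_def)
    then show "x * a \<in> Z" using a x by (simp add: Z_def)
  qed (auto simp: Z_def hcomp_add poly_ideal_zero[OF J] poly_ideal_add[OF J])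
  moreover have "H \<subseteq> Z"
  proof
    fix h assume h: "h \<in> H"
    then obtain d where "h \<in> homogeneous_part n d" using H(1) by auto
    then show "h \<in> Z" using h HJ
      by (auto simp: Z_def homogeneous_part_iff hcomp_homog poly_ideal_zero[OF J])
  qed
  ultimately have "J \<subseteq> Z" unfolding H(2) by (rule genideal_minimal)
  then show ?thesis using J by (auto simp: graded_ideal_def Z_def)
qed

lemma graded_imp_homogeneous:
  assumes "graded_ideal n J"
  shows "homogeneous_ideal n J"
proof -
  interpret cring "poly_ring n" by (rule cring_poly_ring)
  have J: "ideal J (poly_ring n)" "\<And>f d. f \<in> J \<Longrightarrow> hcomp d f \<in> J"
    using assms by (auto simp: graded_ideal_def)
  define H where "H = {h \<in> J. \<exists>d. homog d h}"
  have Hs: "H \<subseteq> carrier (poly_ring n)" using poly_ideal_subset[OF J(1)] by (auto simp: H_def)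
  have gen: "ideal (genideal (poly_ring n) H) (poly_ring n)" by (rule genideal_ideal[OF Hs])
  have "J \<subseteq> genideal (poly_ring n) H"
  proof
    fix f assume f: "f \<in> J"
    have "(\<Sum>d\<le>max_mdegree f. hcomp d f) \<in> genideal (poly_ring n) H"
    proof (rule poly_ideal_sum[OF gen])
      fix d show "hcomp d f \<in> genideal (poly_ring n) H"
        by (rule subsetD[OF genideal_self[OF Hs]]) (use J(2)[OF f] homog_hcomp in \<open>auto simp: H_def\<close>)
    qed
    then show "f \<in> genideal (poly_ring n) H" using sum_hcomp[of f, OF order_refl] by simp
  qed
  moreover have "genideal (poly_ring n) H \<subseteq> J" by (rule genideal_minimal[OF J(1)]) (auto simp: H_def)
  moreover have "H \<subseteq> (\<Union>d. homogeneous_part n d)"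
  proof
    fix h assume h: "h \<in> H"
    then obtain d where "homog d h" by (auto simp: H_def)
    then show "h \<in> (\<Union>d. homogeneous_part n d)" using h Hs by (auto simp: homogeneous_part_iff)
  qed
  ultimately show ?thesis unfolding homogeneous_ideal_def by blast
qed

lemma graded_idealD:
  assumes "graded_ideal n J"
  shows "ideal J (poly_ring n)" "f \<in> J \<Longrightarrow> hcomp d f \<in> J"
  using assms by (auto simp: graded_ideal_def)

lemma graded_ideal_extend:
  fixes Q :: "'k::field mpoly set"
  assumes Q: "graded_ideal n Q" and a: "a \<in> carrier (poly_ring n)" "homog e a"
  shows "graded_ideal n {q + a * c | q c. q \<in> Q \<and> c \<in> carrier (poly_ring n)}" (is "graded_ideal n ?E")
proof -
  note QI = graded_idealD[OF Q]
  have EI: "q + a * c \<in> ?E" if "q \<in> Q" "c \<in> carrier (poly_ring n)" for q c using that by blast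
  have "ideal ?E (poly_ring n)"
  proof (rule poly_idealI)
    show "?E \<subseteq> carrier (poly_ring n)" using poly_ideal_subset[OF QI(1)] a by auto
    show "0 \<in> ?E" using EI[of 0 0] poly_ideal_zero[OF QI(1)] by simp
    fix x y :: "'k mpoly" assume x: "x \<in> ?E"
    then obtain q c where qc: "x = q + a * c" "q \<in> Q" "c \<in> carrier (poly_ring n)" by blast
    { assume "y \<in> ?E"
      then obtain q' c' where qc': "y = q' + a * c'" "q' \<in> Q" "c' \<in> carrier (poly_ring n)" by blast
      have "x + y = (q + q') + a * (c + c')" by (simp add: qc qc' algebra_simps)
      moreover have "(q + q') + a * (c + c') \<in> ?E"
        using qc(2,3) qc'(2,3) by (intro EI poly_ideal_add[OF QI(1)] P_add)
      ultimately show "x + y \<in> ?E" by (simp only:) }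
    { assume y: "y \<in> carrier (poly_ring n)"
      have "y * x = y * q + a * (y * c)" by (simp add: qc algebra_simps)
      moreover have "y * q + a * (y * c) \<in> ?E"
        using qc(2,3) y by (intro EI poly_ideal_mult[OF QI(1)] P_mult)
      ultimately show "y * x \<in> ?E" by (simp only:) }
  qed
  moreover have "hcomp d x \<in> ?E" if x: "x \<in> ?E" for x d
  proof -
    obtain q c where qc: "x = q + a * c" "q \<in> Q" "c \<in> carrier (poly_ring n)" using x by blast
    have "hcomp d x = hcomp d q + a * (if e \<le> d then hcomp (d - e) c else 0)"
      by (simp add: qc hcomp_add hcomp_mult_homog[OF a(2)])
    then show ?thesis using EI[of "hcomp d q" "if e \<le> d then hcomp (d - e) c else 0"] qc QI(2) by simp
  qed
  ultimately show ?thesis by (simp add: graded_ideal_def)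
qed

text \<open>Singles out the lowest component outside \<open>Q\<close>, the analogue of a leading
  term when primality is checked.\<close>

lemma ex_hcomp_notin:
  assumes "graded_ideal n Q" "f \<notin> Q"
  obtains s where "hcomp s f \<notin> Q" "\<And>i. i < s \<Longrightarrow> hcomp i f \<in> Q"
proof -
  have "\<exists>s. hcomp s f \<notin> Q"
    using sum_hcomp[of f, OF order_refl] assms(2) poly_ideal_sum[OF graded_idealD(1)[OF assms(1)]]
    by metis
  then have "hcomp (LEAST s. hcomp s f \<notin> Q) f \<notin> Q" by (rule LeastI_ex)
  moreover have "hcomp i f \<in> Q" if "i < (LEAST s. hcomp s f \<notin> Q)" for i
    using not_less_Least[OF that] by simp
  ultimately show ?thesis using that by blast
qed

text \<open>Krull's argument within graded ideals: one that is maximal among those avoiding the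
  powers of \<open>x\<close> is prime. Maximality yields primality for forms, and lowest components
  outside the ideal extend it to all polynomials.\<close>

lemma graded_prime:
  assumes J: "graded_ideal n J" and x: "x \<in> carrier (poly_ring n)" and avoid: "\<And>k. x ^ k \<notin> J"
  obtains Q where "primeideal Q (poly_ring n)" "homogeneous_ideal n Q" "J \<subseteq> Q" "x \<notin> Q"
proof -
  interpret cring "poly_ring n" by (rule cring_poly_ring)
  define AA where "AA = {Q. graded_ideal n Q \<and> J \<subseteq> Q \<and> (\<forall>k. x ^ k \<notin> Q)}"
  have "J \<in> AA" using J avoid by (auto simp: AA_def)
  moreover have "\<Union>C \<in> AA" if "C \<noteq> {}" "subset.chain AA C" for C
  proof -
    have "subset.chain {I. ideal I (poly_ring n)} C"
      using that(2) by (auto simp: subset_chain_def AA_def graded_ideal_def)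
    then have "ideal (\<Union>C) (poly_ring n)" using chain_Union_is_ideal[of C] that(1) by simp
    moreover have C: "Q \<in> AA" if "Q \<in> C" for Q
      using \<open>subset.chain AA C\<close> that by (auto simp: subset_chain_def)
    have "hcomp d f \<in> \<Union>C" if "f \<in> \<Union>C" for f d
      using that C unfolding AA_def graded_ideal_def by blast
    ultimately have "graded_ideal n (\<Union>C)" by (simp add: graded_ideal_def)
    moreover have "J \<subseteq> \<Union>C" using \<open>C \<noteq> {}\<close> C unfolding AA_def by blast
    moreover have "x ^ k \<notin> \<Union>C" for k using C unfolding AA_def by blast
    ultimately show ?thesis by (simp add: AA_def)
  qed
  ultimately obtain Q where Q: "Q \<in> AA" "\<forall>X\<in>AA. Q \<subseteq> X \<longrightarrow> X = Q"
    using subset_Zorn_nonempty[of AA] by blast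
  have Qg: "graded_ideal n Q" "J \<subseteq> Q" "\<And>k. x ^ k \<notin> Q" using Q(1) by (auto simp: AA_def)
  note QI = graded_idealD[OF Qg(1)]
  \<comment> \<open>A form \<open>a\<close> outside \<open>Q\<close> enlarges \<open>Q\<close> to a
    graded ideal, which must then contain a power of \<open>x\<close>.\<close>
  have pow: "\<exists>k q c. x ^ k = q + a * c \<and> q \<in> Q \<and> c \<in> carrier (poly_ring n)"
    if a: "a \<in> carrier (poly_ring n)" "homog e a" "a \<notin> Q" for a e
  proof (rule ccontr)
    assume no: "\<not> ?thesis"
    define E where "E = {q + a * c | q c. q \<in> Q \<and> c \<in> carrier (poly_ring n)}"
    have QE: "Q \<subseteq> E"
    proof
      fix q assume "q \<in> Q"
      then have "q + a * 0 \<in> E" unfolding E_def using P_zero by blast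
      then show "q \<in> E" by simp
    qed
    have "0 + a * 1 \<in> E" unfolding E_def using P_one poly_ideal_zero[OF QI(1)] by blast
    then have "a \<in> E" by simp
    moreover have "E \<in> AA" unfolding AA_def
      using graded_ideal_extend[OF Qg(1) a(1,2)] QE Qg(2) no by (auto simp: E_def)
    ultimately show False using Q(2) QE a(3) by blast
  qed
  have hprime: "a * b \<notin> Q" if a: "a \<in> carrier (poly_ring n)" "homog d a" "a \<notin> Q"
    and b: "b \<in> carrier (poly_ring n)" "homog e b" "b \<notin> Q" for a b d e
  proof
    assume ab: "a * b \<in> Q"
    obtain k q c where k: "x ^ k = q + a * c" "q \<in> Q" "c \<in> carrier (poly_ring n)" using pow[OF a] by blast
    obtain l q' c' where l: "x ^ l = q' + b * c'" "q' \<in> Q" "c' \<in> carrier (poly_ring n)" using pow[OF b] by blast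
    have "x ^ (k + l) = (q' + b * c') * q + ((a * c) * q' + (c * c') * (a * b))"
      by (simp add: power_add k l algebra_simps)
    also have "\<dots> \<in> Q"
    proof (intro poly_ideal_add[OF QI(1)])
      have "q' + b * c' \<in> carrier (poly_ring n)" using poly_ideal_subset[OF QI(1) l(2)] b(1) l(3) by simp
      then show "(q' + b * c') * q \<in> Q" by (rule poly_ideal_mult[OF QI(1) k(2)])
      show "(a * c) * q' \<in> Q" by (rule poly_ideal_mult[OF QI(1) l(2)]) (simp add: a(1) k(3))
      show "(c * c') * (a * b) \<in> Q" by (rule poly_ideal_mult[OF QI(1) ab]) (simp add: k(3) l(3))
    qed
    finally show False using Qg(3) by blast
  qed
  have "primeideal Q (poly_ring n)"
  proof (rule primeidealI)
    show "ideal Q (poly_ring n)" "cring (poly_ring n)" by (rule QI, rule cring_poly_ring)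
    show "carrier (poly_ring n) \<noteq> Q" using Qg(3)[of 0] P_one by auto
    fix a b assume a: "a \<in> carrier (poly_ring n)" and b: "b \<in> carrier (poly_ring n)"
      and ab: "a \<otimes>\<^bsub>poly_ring n\<^esub> b \<in> Q"
    show "a \<in> Q \<or> b \<in> Q"
    proof (rule ccontr)
      assume "\<not> ?thesis"
      then have no: "a \<notin> Q" "b \<notin> Q" by auto
      obtain s where s: "hcomp s a \<notin> Q" "\<And>i. i < s \<Longrightarrow> hcomp i a \<in> Q" using ex_hcomp_notin[OF Qg(1) no(1)] by blast
      obtain r where r: "hcomp r b \<notin> Q" "\<And>i. i < r \<Longrightarrow> hcomp i b \<in> Q" using ex_hcomp_notin[OF Qg(1) no(2)] by blast
      \<comment> \<open>In every other summand one factor lies below the chosen lowest component,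
        hence in \<open>Q\<close>; so the product of the two lowest components would lie in
        \<open>Q\<close>.\<close>
      have "hcomp (s + r) (a * b) = hcomp s a * hcomp r b +
          (\<Sum>i\<in>{..s + r} - {s}. hcomp i a * hcomp (s + r - i) b)"
        unfolding hcomp_mult by (subst sum.remove[of _ s]) auto
      then have "hcomp s a * hcomp r b = hcomp (s + r) (a * b) -
          (\<Sum>i\<in>{..s + r} - {s}. hcomp i a * hcomp (s + r - i) b)" by simp
      also have "\<dots> \<in> Q"
      proof (intro poly_ideal_diff[OF QI(1)] QI(2) poly_ideal_sum[OF QI(1)])
        show "a * b \<in> Q" using ab by simp
        fix i assume i: "i \<in> {..s + r} - {s}"
        show "hcomp i a * hcomp (s + r - i) b \<in> Q"
        proof (cases "i < s")
          case True
          then show ?thesis using poly_ideal_mult[OF QI(1) s(2), of i "hcomp (s + r - i) b"] b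
            by (simp add: mult.commute)
        next
          case False
          then have "s + r - i < r" using i by auto
          then show ?thesis using poly_ideal_mult[OF QI(1) r(2)] a by simp
        qed
      qed
      finally show False
        using hprime[OF P_hcomp[OF a] homog_hcomp s(1) P_hcomp[OF b] homog_hcomp r(1)] by blast
    qed
  qed
  moreover have "x \<notin> Q" using Qg(3)[of 1] by simp
  ultimately show ?thesis using that graded_imp_homogeneous[OF Qg(1)] Qg(2) by blast
qed

lemma monomial_power: "mpoly_var i ^ k = (Poly_Mapping.single (Poly_Mapping.single i k) 1 :: 'k::field mpoly)"
  by (induction k) (simp_all add: mpoly_var_def mult_single single_add[symmetric])

lemma mpoly_sum_monomials:
  "f = (\<Sum>t\<in>Poly_Mapping.keys f. mpoly_const (Poly_Mapping.lookup f t) * Poly_Mapping.single t 1)"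
  by (rule poly_mapping_eqI)
    (simp add: lookup_sum mpoly_const_def mult_single lookup_single when_def in_keys_iff)

lemma mpoly_const_add: "mpoly_const (a + b) = mpoly_const a + mpoly_const b"
  by (simp add: mpoly_const_def single_add)

lemma mpoly_const_mult: "mpoly_const (a * b) = mpoly_const a * mpoly_const b"
  by (simp add: mpoly_const_def mult_single)

lemma mpoly_const_one [simp]: "mpoly_const 1 = 1"
  by (simp add: mpoly_const_def)

lemma homog_var: "homog 1 (mpoly_var i)"
  by (simp add: homog_def mpoly_var_def)

lemma homog_const: "homog 0 (mpoly_const c)"
  by (simp add: homog_def mpoly_const_def)

lemma homog_power: "homog d p \<Longrightarrow> homog (k * d) (p ^ k)"
  by (induction k) (simp_all add: homog_mult homog_const[of 1, simplified])

lemma homog_var_power: "homog k (mpoly_var i ^ k)"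
  using homog_power[OF homog_var, of k i] by simp

lemma homog_var_power_mult: "homog d p \<Longrightarrow> e = k + d \<Longrightarrow> homog e (mpoly_var i ^ k * p)"
  using homog_mult[OF homog_var_power] by blast

section \<open>Zero-dimensional schemes missing a hyperplane\<close>

locale proj_scheme =
  fixes n :: nat and I :: "'k::field mpoly set"
  assumes zd: "zero_dim_scheme n I" and off: "\<forall>p\<in>proj_points n I. mpoly_var 0 \<notin> p"
begin

abbreviation P :: "'k mpoly ring" where "P \<equiv> poly_ring n"
abbreviation "x0 \<equiv> (mpoly_var 0 :: 'k mpoly)"

lemma gI: "graded_ideal n I"
  using zd homogeneous_imp_graded by (auto simp: zero_dim_scheme_def)

lemma II: "ideal I P"
  by (rule graded_idealD(1)[OF gI])

lemmas I_simps = poly_ideal_subset[OF II] poly_ideal_add[OF II] poly_ideal_zero[OF II]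
  poly_ideal_mult[OF II] poly_ideal_uminus[OF II] poly_ideal_diff[OF II]

lemma I_mult_right: "a \<in> I \<Longrightarrow> x \<in> carrier P \<Longrightarrow> a * x \<in> I"
  using poly_ideal_mult[OF II, of a x] by (simp add: mult.commute)

text \<open>Defines the intersection of the scheme with the hyperplane x0 = 0, which has no
  points.\<close>

definition J :: "'k mpoly set" where
  "J = {q + x0 * c | q c. q \<in> I \<and> c \<in> carrier P}"

lemma gJ: "graded_ideal n J"
  unfolding J_def by (rule graded_ideal_extend[OF gI _ homog_var]) simp

text \<open>Otherwise a homogeneous prime over \<open>J\<close> would omit this variable. It would
  be a point of the scheme containing \<open>x0\<close>, contrary to the choice of the
  hyperplane.\<close>

lemma var_power_mem_J:
  assumes i: "i \<le> n"
  shows "\<exists>k. mpoly_var i ^ k \<in> J"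
proof (rule ccontr)
  interpret cring P by (rule cring_poly_ring)
  assume "\<not> ?thesis"
  then obtain Q where Q: "primeideal Q P" "homogeneous_ideal n Q" "J \<subseteq> Q" "mpoly_var i \<notin> Q"
    using graded_prime[OF gJ P_var[OF i]] by blast
  have IJ: "q \<in> J" if "q \<in> I" for q
  proof -
    have "q + x0 * 0 \<in> J" unfolding J_def using that P_zero by blast
    then show ?thesis by simp
  qed
  have "0 + x0 * 1 \<in> J" unfolding J_def using I_simps(3) P_one by blast
  then have "x0 \<in> Q" using Q(3) by auto
  moreover have "\<not> genideal P (mpoly_var ` {..n}) \<subseteq> Q"
  proof -
    have "mpoly_var i \<in> genideal P (mpoly_var ` {..n})"
      by (rule subsetD[OF genideal_self]) (use i in auto)
    then show ?thesis using Q(4) by blast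
  qed
  ultimately show False using off Q IJ unfolding proj_points_def by blast
qed

lemma monomials_mem_J: "\<exists>k. \<forall>t. Poly_Mapping.keys t \<subseteq> {..n} \<longrightarrow> k \<le> mdegree t \<longrightarrow> Poly_Mapping.single t 1 \<in> J"
proof -
  have "\<forall>i\<in>{..n}. \<exists>k. mpoly_var i ^ k \<in> J" using var_power_mem_J by simp
  then obtain k where k: "\<And>i. i \<le> n \<Longrightarrow> mpoly_var i ^ k i \<in> J" by (metis atMost_iff)
  \<comment> \<open>Pigeonhole: a degree above the sum of the \<open>k i\<close> forces some
    exponent to reach its \<open>k i\<close>.\<close>
  have "Poly_Mapping.single t 1 \<in> J" if t: "Poly_Mapping.keys t \<subseteq> {..n}" "Suc (\<Sum>i\<le>n. k i) \<le> mdegree t" for t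
  proof -
    have "mdegree t = (\<Sum>i\<le>n. Poly_Mapping.lookup t i)" by (rule mdegree_superset[OF _ t(1)]) simp
    then obtain i where i: "i \<le> n" "k i \<le> Poly_Mapping.lookup t i"
      using t(2) sum_mono[of "{..n}" "Poly_Mapping.lookup t" k] by (metis atMost_iff nat_le_linear not_less_eq_eq)
    define s where "s = t - Poly_Mapping.single i (k i)"
    have ts: "t = Poly_Mapping.single i (k i) + s"
      using i by (intro poly_mapping_eqI) (auto simp: s_def lookup_add lookup_minus lookup_single when_def)
    have "Poly_Mapping.keys s \<subseteq> {..n}"
      using t(1) by (auto simp: s_def in_keys_iff lookup_minus subset_iff)
    then have "Poly_Mapping.single s 1 \<in> carrier P" by (simp add: poly_ring_carrier)
    moreover have "Poly_Mapping.single t 1 = Poly_Mapping.single s 1 * (mpoly_var i ^ k i :: 'k mpoly)"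
      by (simp add: monomial_power mult_single ts add.commute)
    ultimately show ?thesis using poly_ideal_mult[OF graded_idealD(1)[OF gJ] k[OF i(1)]] by simp
  qed
  then show ?thesis by blast
qed

text \<open>A form of large degree lies in \<open>J\<close>, hence equals a + x0 c with
  \<open>a\<close> in \<open>I\<close>; taking components of the right degree makes the cofactor a
  form.\<close>

lemma ex_k0: "\<exists>k0. \<forall>e\<ge>k0. \<forall>f\<in>carrier P. homog (Suc e) f \<longrightarrow> (\<exists>c\<in>carrier P. homog e c \<and> f - x0 * c \<in> I)"
proof -
  obtain k where k: "\<And>t. Poly_Mapping.keys t \<subseteq> {..n} \<Longrightarrow> k \<le> mdegree t \<Longrightarrow> Poly_Mapping.single t 1 \<in> J"
    using monomials_mem_J by blast
  have "\<exists>c\<in>carrier P. homog e c \<and> f - x0 * c \<in> I"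
    if e: "k \<le> e" and f: "f \<in> carrier P" "homog (Suc e) f" for e f
  proof -
    have "(\<Sum>t\<in>Poly_Mapping.keys f. mpoly_const (Poly_Mapping.lookup f t) * Poly_Mapping.single t 1) \<in> J"
    proof (intro poly_ideal_sum[OF graded_idealD(1)[OF gJ]] poly_ideal_mult[OF graded_idealD(1)[OF gJ]])
      fix t assume t: "t \<in> Poly_Mapping.keys f"
      show "Poly_Mapping.single t 1 \<in> J"
        using t f e by (intro k) (auto simp: poly_ring_carrier homog_def)
    qed simp
    then have "f \<in> J" using mpoly_sum_monomials[of f] by simp
    then obtain a c where ac: "f = a + x0 * c" "a \<in> I" "c \<in> carrier P" by (auto simp: J_def)
    have "f = hcomp (Suc e) f" using f(2) by (simp add: hcomp_homog)
    also have "\<dots> = hcomp (Suc e) a + x0 * hcomp e c"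
      by (simp add: ac(1) hcomp_add hcomp_mult_homog[OF homog_var])
    finally have "f - x0 * hcomp e c = hcomp (Suc e) a" by (simp add: algebra_simps)
    then show ?thesis using graded_idealD(2)[OF gI ac(2)] ac(3) homog_hcomp[of e c]
      by (intro bexI[of _ "hcomp e c"]) simp_all
  qed
  then show ?thesis by blast
qed

text \<open>From this degree on, multiplication by \<open>x0\<close> maps each homogeneous part of
  \<open>R\<close> onto the next one; it is also injective, as shown in
  \<open>x0_cancel\<close>.\<close>

definition k0 :: nat where
  "k0 = (SOME k0. \<forall>e\<ge>k0. \<forall>f\<in>carrier P. homog (Suc e) f \<longrightarrow> (\<exists>c\<in>carrier P. homog e c \<and> f - x0 * c \<in> I))"

lemma k0: "k0 \<le> e \<Longrightarrow> f \<in> carrier P \<Longrightarrow> homog (Suc e) f \<Longrightarrow> \<exists>c\<in>carrier P. homog e c \<and> f - x0 * c \<in> I"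
  using someI_ex[OF ex_k0] unfolding k0_def by blast

lemma divide_x0_power:
  assumes "k0 \<le> e" "f \<in> carrier P" "homog (N + e) f"
  shows "\<exists>c\<in>carrier P. homog e c \<and> f - x0 ^ N * c \<in> I"
  using assms(2,3)
proof (induction N arbitrary: f)
  case 0
  then show ?case by (intro bexI[of _ f]) (simp_all add: I_simps)
next
  case (Suc N)
  then obtain d where d: "d \<in> carrier P" "homog (N + e) d" "f - x0 * d \<in> I"
    using k0[of "N + e" f] assms(1) by auto
  obtain c where c: "c \<in> carrier P" "homog e c" "d - x0 ^ N * c \<in> I" using Suc.IH[OF d(1,2)] by blast
  have "f - x0 ^ Suc N * c = (f - x0 * d) + x0 * (d - x0 ^ N * c)" by (simp add: algebra_simps)
  also have "\<dots> \<in> I" using c d by (intro poly_ideal_add[OF II] poly_ideal_mult[OF II]) auto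
  finally show ?case using c by blast
qed

text \<open>Saturation enters here: forms \<open>g\<close> of degree k0 + 1 are multiples of
  \<open>x0\<close> modulo \<open>I\<close>, so x0 f in \<open>I\<close> gives g f in
  \<open>I\<close> for all of them.\<close>

lemma x0_cancel:
  assumes f: "f \<in> carrier P" "x0 * f \<in> I"
  shows "f \<in> I"
proof -
  have "g * f \<in> I" if g: "g \<in> homogeneous_part n (Suc k0)" for g
  proof -
    obtain c where c: "c \<in> carrier P" "g - x0 * c \<in> I"
      using k0[of k0 g] g by (auto simp: homogeneous_part_iff)
    have "g * f = (g - x0 * c) * f + c * (x0 * f)" by (simp add: algebra_simps)
    also have "\<dots> \<in> I"
      by (rule poly_ideal_add[OF II I_mult_right[OF c(2) f(1)] poly_ideal_mult[OF II f(2) c(1)]])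
    finally show ?thesis .
  qed
  then show ?thesis using zd f(1) unfolding zero_dim_scheme_def saturated_def by blast
qed

lemma x0_power_cancel: "f \<in> carrier P \<Longrightarrow> x0 ^ N * f \<in> I \<Longrightarrow> f \<in> I"
proof (induction N)
  case (Suc N)
  then show ?case using x0_cancel[of "x0 ^ N * f"] by (simp add: mult.assoc)
qed simp

section \<open>Homogenization with respect to x0\<close>

text \<open>Components of degree above \<open>N\<close> are dropped, which makes the map additive
  for fixed \<open>N\<close>; it retains all of \<open>f\<close> only when \<open>N\<close> is at
  least the degree.\<close>

definition homogenize :: "nat \<Rightarrow> 'k mpoly \<Rightarrow> 'k mpoly" where
  "homogenize N f = (\<Sum>e\<le>N. x0 ^ (N - e) * hcomp e f)"

lemma homogenize_add: "homogenize N (f + g) = homogenize N f + homogenize N g"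
  by (simp add: homogenize_def hcomp_add distrib_left sum.distrib)

lemma homogenize_closed: "f \<in> carrier P \<Longrightarrow> homogenize N f \<in> carrier P"
  by (simp add: homogenize_def)

lemma homog_homogenize: "homog N (homogenize N f)"
  unfolding homogenize_def by (intro homog_sum homog_var_power_mult[OF homog_hcomp]) auto

lemma homogenize_ideal: "f \<in> I \<Longrightarrow> homogenize N f \<in> I"
  unfolding homogenize_def
  by (intro poly_ideal_sum[OF II] poly_ideal_mult[OF II] graded_idealD(2)[OF gI]) simp_all

lemma homogenize_homog: "homog d f \<Longrightarrow> d \<le> N \<Longrightarrow> homogenize N f = x0 ^ (N - d) * f"
proof -
  assume "homog d f" "d \<le> N"
  then have "homogenize N f = (\<Sum>e\<le>N. if e = d then x0 ^ (N - d) * f else 0)"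
    unfolding homogenize_def by (intro sum.cong) (auto simp: hcomp_homog)
  then show ?thesis using \<open>d \<le> N\<close> by simp
qed

text \<open>Raising \<open>b\<close> or x0 b to degree \<open>N\<close> gives the same form. The
  strict bound on \<open>N\<close> leaves room for the extra factor.\<close>

lemma homogenize_x0_diff:
  assumes "max_mdegree b < N"
  shows "homogenize N ((x0 - 1) * b) = 0"
proof -
  obtain M where M: "N = Suc M" using assms by (cases N) auto
  have "homogenize N (x0 * b) = (\<Sum>e\<le>Suc M. x0 ^ (N - e) * (if 1 \<le> e then x0 * hcomp (e - 1) b else 0))"
    unfolding homogenize_def M by (simp only: hcomp_mult_homog[OF homog_var])
  also have "\<dots> = (\<Sum>e\<le>M. x0 ^ (M - e) * (x0 * hcomp e b))"
    by (subst sum.atMost_Suc_shift) (simp add: M)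
  also have "\<dots> = (\<Sum>e\<le>M. x0 ^ (N - e) * hcomp e b)"
    by (intro sum.cong) (auto simp: M Suc_diff_le)
  also have "\<dots> = homogenize N b"
    using hcomp_above[OF assms] by (simp add: homogenize_def M)
  finally have "homogenize N (x0 * b) = homogenize N b" .
  moreover have "homogenize N (x0 * b) = homogenize N ((x0 - 1) * b) + homogenize N b"
    by (simp add: homogenize_add[symmetric] algebra_simps)
  ultimately show ?thesis by simp
qed

section \<open>The homogeneous coordinate ring\<close>

abbreviation "R \<equiv> coord_ring n I"
abbreviation "cls \<equiv> residue_class n I"

lemma cring_R: "cring R"
  unfolding coord_ring_def by (rule ideal.quotient_is_cring[OF II cring_poly_ring])

lemma cls_hom: "cls \<in> Ring.ring_hom P R"
proof -
  have "(\<lambda>f. I +>\<^bsub>P\<^esub> f) \<in> Ring.ring_hom P R"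
    unfolding coord_ring_def by (rule ideal.rcos_ring_hom[OF II])
  moreover have "cls = (\<lambda>f. I +>\<^bsub>P\<^esub> f)" by (rule ext) (simp add: residue_class_def)
  ultimately show ?thesis by simp
qed

lemma
  shows cls_closed [simp]: "f \<in> carrier P \<Longrightarrow> cls f \<in> carrier R"
    and cls_add: "f \<in> carrier P \<Longrightarrow> g \<in> carrier P \<Longrightarrow> cls (f + g) = cls f \<oplus>\<^bsub>R\<^esub> cls g"
    and cls_mult: "f \<in> carrier P \<Longrightarrow> g \<in> carrier P \<Longrightarrow> cls (f * g) = cls f \<otimes>\<^bsub>R\<^esub> cls g"
    and cls_one: "cls 1 = \<one>\<^bsub>R\<^esub>"
  using ring_hom_memE[OF cls_hom] by simp_all

lemma cls_eq_iff: "f \<in> carrier P \<Longrightarrow> g \<in> carrier P \<Longrightarrow> cls f = cls g \<longleftrightarrow> f - g \<in> I"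
proof -
  interpret cring P by (rule cring_poly_ring)
  assume "f \<in> carrier P" "g \<in> carrier P"
  then show ?thesis
    using quotient_eq_iff_same_a_r_cos[OF II, of f g] by (simp add: poly_ring_a_minus residue_class_def)
qed

lemma cls_surj: "x \<in> carrier R \<Longrightarrow> \<exists>f\<in>carrier P. x = cls f"
  unfolding coord_ring_def FactRing_def A_RCOSETS_def' residue_class_def by simp

lemma cls_zero: "cls 0 = \<zero>\<^bsub>R\<^esub>"
proof -
  interpret R: cring R by (rule cring_R)
  have "cls 0 \<oplus>\<^bsub>R\<^esub> cls 0 = cls 0" using cls_add[of 0 0] by simp
  then show ?thesis using R.add.r_cancel_one[of "cls 0" "cls 0"] by simp
qed

lemma coord_const_hom: "coord_const n I \<in> Ring.ring_hom class_ring R"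
  by (rule ring_hom_memI)
    (simp_all add: coord_const_def mpoly_const_add mpoly_const_mult cls_add cls_mult cls_one)

section \<open>The affine coordinate ring and its comparison with large degrees\<close>

abbreviation "S \<equiv> affine_ring n I"

definition dehom :: "'k mpoly \<Rightarrow> 'k mpoly set set" where
  "dehom f = dehomogenization_ideal n I +>\<^bsub>R\<^esub> cls f"

lemma x0_minus_one: "coord_var n I 0 \<ominus>\<^bsub>R\<^esub> \<one>\<^bsub>R\<^esub> = cls (x0 - 1)"
proof -
  interpret R: cring R by (rule cring_R)
  have "cls (x0 - 1) \<oplus>\<^bsub>R\<^esub> cls 1 = cls x0" using cls_add[of "x0 - 1" 1] by simp
  then have "cls x0 \<ominus>\<^bsub>R\<^esub> cls 1 = cls (x0 - 1)"
    using R.add.inv_solve_right'[of "cls (x0 - 1)" "cls x0" "cls 1"] by (simp add: a_minus_def a_inv_def)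
  then show ?thesis by (simp add: coord_var_def cls_one)
qed

lemma dehom_ideal: "ideal (dehomogenization_ideal n I) R"
proof -
  interpret R: cring R by (rule cring_R)
  show ?thesis unfolding dehomogenization_ideal_def x0_minus_one by (rule R.genideal_ideal) simp
qed

lemma dehom_hom: "dehom \<in> Ring.ring_hom P S"
proof -
  have "(\<lambda>x. dehomogenization_ideal n I +>\<^bsub>R\<^esub> x) \<in> Ring.ring_hom R S"
    unfolding affine_ring_def by (rule ideal.rcos_ring_hom[OF dehom_ideal])
  from ring_hom_trans[OF cls_hom this] show ?thesis by (simp add: dehom_def[abs_def] comp_def)
qed

lemma cring_S: "cring S"
  unfolding affine_ring_def by (rule ideal.quotient_is_cring[OF dehom_ideal cring_R])

lemma
  shows dehom_closed [simp]: "f \<in> carrier P \<Longrightarrow> dehom f \<in> carrier S"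
    and dehom_add: "f \<in> carrier P \<Longrightarrow> g \<in> carrier P \<Longrightarrow> dehom (f + g) = dehom f \<oplus>\<^bsub>S\<^esub> dehom g"
    and dehom_mult: "f \<in> carrier P \<Longrightarrow> g \<in> carrier P \<Longrightarrow> dehom (f * g) = dehom f \<otimes>\<^bsub>S\<^esub> dehom g"
    and dehom_one: "dehom 1 = \<one>\<^bsub>S\<^esub>"
  using ring_hom_memE[OF dehom_hom] by simp_all

lemma affine_const_eq: "affine_const n I c = dehom (mpoly_const c)"
  by (simp add: affine_const_def dehom_def coord_const_def)

lemma dehom_surj: "s \<in> carrier S \<Longrightarrow> \<exists>f\<in>carrier P. s = dehom f"
proof -
  assume "s \<in> carrier S"
  then obtain x where "x \<in> carrier R" "s = dehomogenization_ideal n I +>\<^bsub>R\<^esub> x"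
    unfolding affine_ring_def FactRing_def A_RCOSETS_def' by auto
  then show ?thesis using cls_surj[of x] by (auto simp: dehom_def)
qed

lemma dehom_kernel:
  assumes f: "f \<in> carrier P" and z: "dehom f = \<zero>\<^bsub>S\<^esub>"
  shows "\<exists>b\<in>carrier P. f - (x0 - 1) * b \<in> I"
proof -
  interpret R: cring R by (rule cring_R)
  have "\<zero>\<^bsub>S\<^esub> = dehomogenization_ideal n I" by (simp add: affine_ring_def FactRing_def)
  then have "cls f \<in> dehomogenization_ideal n I"
    using ideal.rcos_const_imp_mem[OF dehom_ideal cls_closed[OF f]] z by (simp add: dehom_def)
  then have "cls f \<in> cgenideal R (cls (x0 - 1))"
    using R.cgenideal_eq_genideal[of "cls (x0 - 1)"]
    by (simp add: dehomogenization_ideal_def x0_minus_one)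
  then obtain r where r: "r \<in> carrier R" "cls f = r \<otimes>\<^bsub>R\<^esub> cls (x0 - 1)"
    unfolding cgenideal_def by blast
  then obtain b where b: "b \<in> carrier P" "r = cls b" using cls_surj by blast
  have "cls f = cls (b * (x0 - 1))" using r b by (simp add: cls_mult)
  then have "f - b * (x0 - 1) \<in> I" using f b by (simp add: cls_eq_iff)
  then show ?thesis using b by (auto simp: mult.commute)
qed

lemma dehom_ideal_zero: "f \<in> I \<Longrightarrow> dehom f = \<zero>\<^bsub>S\<^esub>"
proof -
  interpret S: cring S by (rule cring_S)
  assume "f \<in> I"
  then have "cls f = cls 0" using cls_eq_iff[of f 0] I_simps(1) by simp
  then have "dehom f = dehom 0" by (simp add: dehom_def)
  also have "dehom 0 = \<zero>\<^bsub>S\<^esub>"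
  proof -
    have "dehom 0 \<oplus>\<^bsub>S\<^esub> dehom 0 = dehom 0" using dehom_add[of 0 0] by simp
    then show ?thesis using S.add.r_cancel_one[of "dehom 0" "dehom 0"] by simp
  qed
  finally show ?thesis .
qed

lemma dehom_x0: "dehom x0 = \<one>\<^bsub>S\<^esub>"
proof -
  interpret S: cring S by (rule cring_S)
  interpret R: cring R by (rule cring_R)
  have "cls (x0 - 1) \<in> dehomogenization_ideal n I"
    unfolding dehomogenization_ideal_def x0_minus_one
    by (rule subsetD[OF R.genideal_self]) simp_all
  then have "dehom (x0 - 1) = \<zero>\<^bsub>S\<^esub>"
    using abelian_group.a_coset_join2[OF R.abelian_group_axioms, of "cls (x0 - 1)" "dehomogenization_ideal n I"]
      additive_subgroup.a_subgroup[OF ideal.axioms(1)[OF dehom_ideal]]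
    by (simp add: dehom_def affine_ring_def FactRing_def)
  then show ?thesis using dehom_add[of "x0 - 1" 1] by (simp add: dehom_one)
qed

lemma dehom_x0_power: "f \<in> carrier P \<Longrightarrow> dehom (x0 ^ k * f) = dehom f"
proof (induction k)
  case (Suc k)
  interpret S: cring S by (rule cring_S)
  have "dehom (x0 ^ Suc k * f) = dehom (x0 * (x0 ^ k * f))" by (simp add: mult.assoc)
  also have "\<dots> = dehom f" using Suc by (simp add: dehom_mult dehom_x0)
  finally show ?case .
qed simp

text \<open>Each homogeneous part of \<open>R\<close> embeds into \<open>S\<close>: homogenizing f =
  a + (x0 - 1) b removes the second term, and the power of \<open>x0\<close> acquired by
  \<open>f\<close> cancels.\<close>

lemma dehom_homog_zero_iff:
  assumes f: "f \<in> carrier P" "homog d f"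
  shows "dehom f = \<zero>\<^bsub>S\<^esub> \<longleftrightarrow> f \<in> I"
proof
  assume "dehom f = \<zero>\<^bsub>S\<^esub>"
  then obtain b where b: "b \<in> carrier P" "f - (x0 - 1) * b \<in> I" using dehom_kernel[OF f(1)] by blast
  \<comment> \<open>Above the degree of \<open>b\<close>, so that (x0 - 1) b is killed, and above
    \<open>d\<close>, so that \<open>f\<close> is only multiplied by a power of
    \<open>x0\<close>.\<close>
  define N where "N = Suc (max_mdegree b + d)"
  have "homogenize N (f - (x0 - 1) * b) \<in> I" by (rule homogenize_ideal[OF b(2)])
  moreover have "homogenize N f = homogenize N (f - (x0 - 1) * b) + homogenize N ((x0 - 1) * b)"
    by (simp add: homogenize_add[symmetric])
  ultimately have "x0 ^ (N - d) * f \<in> I"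
    using homogenize_x0_diff[of b N] homogenize_homog[OF f(2), of N] by (simp add: N_def)
  then show "f \<in> I" by (rule x0_power_cancel[OF f(1)])
qed (rule dehom_ideal_zero)

lemma dehom_homogenize:
  assumes f: "f \<in> carrier P" and N: "max_mdegree f \<le> N"
  shows "dehom (homogenize N f) = dehom f"
proof -
  interpret S: cring S by (rule cring_S)
  have "dehom (\<Sum>e\<in>E. x0 ^ (N - e) * hcomp e f) = dehom (\<Sum>e\<in>E. hcomp e f)" if "finite E" for E
    using that
  proof (induction E rule: finite_induct)
    case (insert e E)
    then show ?case using f by (simp add: dehom_add dehom_x0_power)
  qed simp
  then show ?thesis using sum_hcomp[OF N] by (simp add: homogenize_def)
qed

text \<open>Homogenizing a preimage overshoots to degree N + d; the factor x0^N is then divided out,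
  which is possible down to degree \<open>k0\<close>.\<close>

lemma dehom_homog_surj:
  assumes s: "s \<in> carrier S" and d: "k0 \<le> d"
  shows "\<exists>f\<in>carrier P. homog d f \<and> dehom f = s"
proof -
  obtain f where f: "f \<in> carrier P" "s = dehom f" using dehom_surj[OF s] by blast
  define N where "N = max_mdegree f"
  have "homog (N + d) (homogenize (N + d) f)" by (rule homog_homogenize)
  then obtain c where c: "c \<in> carrier P" "homog d c" "homogenize (N + d) f - x0 ^ N * c \<in> I"
    using divide_x0_power[OF d homogenize_closed[OF f(1)]] by blast
  interpret S: cring S by (rule cring_S)
  have "dehom (homogenize (N + d) f) = dehom (homogenize (N + d) f - x0 ^ N * c) \<oplus>\<^bsub>S\<^esub> dehom (x0 ^ N * c)"
    using c(1) homogenize_closed[OF f(1)] by (simp add: dehom_add[symmetric])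
  then have "dehom f = dehom c"
    using dehom_homogenize[OF f(1), of "N + d"] dehom_ideal_zero[OF c(3)] c(1)
    by (simp add: N_def dehom_x0_power)
  then show ?thesis using c f by auto
qed

end

section \<open>Free modules, quotients and universal properties\<close>

lemma free_module_simps [simp]:
  "zero (free_module A X) = (\<lambda>_. \<zero>\<^bsub>A\<^esub>)"
  "f \<oplus>\<^bsub>free_module A X\<^esub> g = (\<lambda>x. f x \<oplus>\<^bsub>A\<^esub> g x)"
  "a \<odot>\<^bsub>free_module A X\<^esub> f = (\<lambda>x. a \<otimes>\<^bsub>A\<^esub> f x)"
  by (auto simp: free_module_def)

lemma free_module_carrier:
  "f \<in> carrier (free_module A X) \<longleftrightarrow>
     (\<forall>x. f x \<in> carrier A) \<and> finite {x. f x \<noteq> \<zero>\<^bsub>A\<^esub>} \<and> {x. f x \<noteq> \<zero>\<^bsub>A\<^esub>} \<subseteq> X"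
  by (auto simp: free_module_def)

lemma free_module_module:
  assumes "cring A"
  shows "Module.module A (free_module A X)"
proof -
  interpret cring A by fact
  have add: "(\<lambda>x. f x \<oplus>\<^bsub>A\<^esub> g x) \<in> carrier (free_module A X)"
    if "f \<in> carrier (free_module A X)" "g \<in> carrier (free_module A X)" for f g
  proof -
    have "{x. f x \<oplus>\<^bsub>A\<^esub> g x \<noteq> \<zero>\<^bsub>A\<^esub>} \<subseteq> {x. f x \<noteq> \<zero>\<^bsub>A\<^esub>} \<union> {x. g x \<noteq> \<zero>\<^bsub>A\<^esub>}"
      using that by (auto simp: free_module_carrier)
    then show ?thesis
      using that finite_subset[of _ "{x. f x \<noteq> \<zero>\<^bsub>A\<^esub>} \<union> {x. g x \<noteq> \<zero>\<^bsub>A\<^esub>}"]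
      unfolding free_module_carrier by (metis (no_types, lifting) a_closed finite_UnI le_sup_iff subset_trans)
  qed
  have smult: "(\<lambda>x. a \<otimes>\<^bsub>A\<^esub> f x) \<in> carrier (free_module A X)"
    if "f \<in> carrier (free_module A X)" "a \<in> carrier A" for f a
  proof -
    have "{x. a \<otimes>\<^bsub>A\<^esub> f x \<noteq> \<zero>\<^bsub>A\<^esub>} \<subseteq> {x. f x \<noteq> \<zero>\<^bsub>A\<^esub>}"
      using that by (auto simp: free_module_carrier)
    then show ?thesis
      using that finite_subset[of _ "{x. f x \<noteq> \<zero>\<^bsub>A\<^esub>}"]
      unfolding free_module_carrier by (metis (no_types, lifting) m_closed subset_trans)
  qed
  have "abelian_group (free_module A X)"
  proof (rule abelian_groupI, goal_cases)
    case 2 then show ?case by (simp add: free_module_carrier)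
  next
    case (6 f)
    have "(\<lambda>x. (\<ominus>\<^bsub>A\<^esub> \<one>\<^bsub>A\<^esub>) \<otimes>\<^bsub>A\<^esub> f x) \<in> carrier (free_module A X)"
      by (rule smult) (use 6 in auto)
    moreover have "(\<ominus>\<^bsub>A\<^esub> \<one>\<^bsub>A\<^esub>) \<otimes>\<^bsub>A\<^esub> f x \<oplus>\<^bsub>A\<^esub> f x = \<zero>\<^bsub>A\<^esub>" for x
      using 6 by (simp add: free_module_carrier l_minus l_neg)
    ultimately show ?case
      by (intro bexI[of _ "\<lambda>x. (\<ominus>\<^bsub>A\<^esub> \<one>\<^bsub>A\<^esub>) \<otimes>\<^bsub>A\<^esub> f x"]) (simp_all add: fun_eq_iff)
  qed (use add in \<open>auto simp: free_module_carrier add.m_ac fun_eq_iff\<close>)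
  then show ?thesis
    by (intro Module.module.intro module_axioms.intro is_cring)
      (use smult in \<open>auto simp: free_module_carrier l_distr r_distr m_assoc fun_eq_iff\<close>)
qed

lemma free_gen_closed:
  assumes "cring A" "x \<in> X"
  shows "free_gen A x \<in> carrier (free_module A X)"
proof -
  interpret cring A by fact
  have "{y. free_gen A x y \<noteq> \<zero>\<^bsub>A\<^esub>} \<subseteq> {x}" by (auto simp: free_gen_def)
  then have "finite {y. free_gen A x y \<noteq> \<zero>\<^bsub>A\<^esub>}" by (rule finite_subset) simp
  then show ?thesis using assms(2) by (auto simp: free_module_carrier free_gen_def)
qed

locale quotient_mod =
  M?: Module.module A M + submodule A N M for A :: "'a ring" and M :: "('a, 'm) module" and N
begin

abbreviation "Q \<equiv> quotient_module M N"

lemma additive_subgroup: "additive_subgroup N M"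
proof (intro additive_subgroupI subgroup.intro)
  fix x assume x: "x \<in> N"
  have "(\<ominus>\<^bsub>A\<^esub> \<one>\<^bsub>A\<^esub>) \<odot>\<^bsub>M\<^esub> x \<in> N" by (rule smult_closed) (use x in auto)
  moreover have "(\<ominus>\<^bsub>A\<^esub> \<one>\<^bsub>A\<^esub>) \<odot>\<^bsub>M\<^esub> x = \<ominus>\<^bsub>M\<^esub> x"
    using x subset by (intro M.smult_minus_1) auto
  ultimately show "inv\<^bsub>add_monoid M\<^esub> x \<in> N" by (simp add: a_inv_def)
qed (use subset m_closed zero_closed in auto)

sublocale abelian_subgroup N M
  by (rule abelian_subgroupI3[OF additive_subgroup M.abelian_group_axioms])

abbreviation "pr x \<equiv> N +>\<^bsub>M\<^esub> x"

lemma pr_closed: "x \<in> carrier M \<Longrightarrow> pr x \<in> carrier Q"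
  by (auto simp: quotient_module_def A_RCOSETS_def')

lemma carrier_ex: "X \<in> carrier Q \<Longrightarrow> \<exists>x\<in>carrier M. X = pr x"
  by (auto simp: quotient_module_def A_RCOSETS_def')

lemma pr_add: "x \<in> carrier M \<Longrightarrow> y \<in> carrier M \<Longrightarrow> pr x \<oplus>\<^bsub>Q\<^esub> pr y = pr (x \<oplus>\<^bsub>M\<^esub> y)"
  by (simp add: quotient_module_def a_rcos_sum)

lemma pr_zero: "pr \<zero>\<^bsub>M\<^esub> = \<zero>\<^bsub>Q\<^esub>"
  by (simp add: quotient_module_def subset)

lemma pr_eqI_mem: "y \<in> pr x \<Longrightarrow> x \<in> carrier M \<Longrightarrow> pr y = pr x"
  using M.a_repr_independence[OF _ _ a_subgroup, of y x] by simp

lemma mem_prE: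
  assumes "y \<in> pr x" obtains z where "z \<in> N" "y = z \<oplus>\<^bsub>M\<^esub> x"
  using assms by (auto simp: a_r_coset_def')

lemma pr_eqI:
  assumes "x \<in> carrier M" "y \<in> carrier M" "x \<ominus>\<^bsub>M\<^esub> y \<in> N"
  shows "pr x = pr y"
proof (rule pr_eqI_mem)
  have "x = (x \<ominus>\<^bsub>M\<^esub> y) \<oplus>\<^bsub>M\<^esub> y"
    using assms by (simp add: M.minus_eq M.add.m_assoc M.l_neg)
  then show "x \<in> pr y" using M.a_rcosI[OF assms(3) subset assms(2)] by simp
qed fact

lemma pr_eq_zero: "x \<in> N \<Longrightarrow> pr x = \<zero>\<^bsub>Q\<^esub>"
  using M.a_coset_join2[OF _ a_subgroup] subset by (auto simp: quotient_module_def)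

lemma pr_smult:
  assumes a: "a \<in> carrier A" and x: "x \<in> carrier M"
  shows "a \<odot>\<^bsub>Q\<^esub> pr x = pr (a \<odot>\<^bsub>M\<^esub> x)"
proof -
  have "pr (a \<odot>\<^bsub>M\<^esub> y) = pr (a \<odot>\<^bsub>M\<^esub> x)" if y: "y \<in> pr x" for y
  proof (rule pr_eqI_mem)
    obtain z where z: "z \<in> N" "y = z \<oplus>\<^bsub>M\<^esub> x" using y by (rule mem_prE)
    have zc: "z \<in> carrier M" using z subset by auto
    have "a \<odot>\<^bsub>M\<^esub> y = a \<odot>\<^bsub>M\<^esub> z \<oplus>\<^bsub>M\<^esub> a \<odot>\<^bsub>M\<^esub> x"
      unfolding z(2) by (rule M.smult_r_distr[OF a zc x])
    then show "a \<odot>\<^bsub>M\<^esub> y \<in> pr (a \<odot>\<^bsub>M\<^esub> x)"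
      using M.a_rcosI[OF smult_closed[OF a z(1)] subset, of "a \<odot>\<^bsub>M\<^esub> x"] a x by simp
  qed (use a x in simp)
  then have "(\<Union>y\<in>pr x. pr (a \<odot>\<^bsub>M\<^esub> y)) = pr (a \<odot>\<^bsub>M\<^esub> x)"
    by (intro UN_constant_eq[OF a_rcos_self[OF x]]) blast
  then show ?thesis by (simp add: quotient_module_def)
qed

lemma module_quotient: "Module.module A Q"
proof -
  have "abelian_group Q"
  proof (rule abelian_groupI, goal_cases)
    case (1 X Y)
    then obtain x y where "x \<in> carrier M" "X = pr x" "y \<in> carrier M" "Y = pr y"
      using carrier_ex[of X] carrier_ex[of Y] by blast
    then show ?case by (simp add: pr_add pr_closed)
  next
    case 2
    then show ?case using pr_closed[of "\<zero>\<^bsub>M\<^esub>"] pr_zero by simp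
  next
    case (3 X Y Z)
    then obtain x y z where "x \<in> carrier M" "X = pr x" "y \<in> carrier M" "Y = pr y"
      "z \<in> carrier M" "Z = pr z"
      using carrier_ex[of X] carrier_ex[of Y] carrier_ex[of Z] by blast
    then show ?case by (simp add: pr_add M.add.m_assoc)
  next
    case (4 X Y)
    then obtain x y where "x \<in> carrier M" "X = pr x" "y \<in> carrier M" "Y = pr y"
      using carrier_ex[of X] carrier_ex[of Y] by blast
    then show ?case by (simp add: pr_add M.add.m_comm)
  next
    case (5 X)
    then obtain x where "x \<in> carrier M" "X = pr x" using carrier_ex[of X] by blast
    then show ?case using pr_add[of "\<zero>\<^bsub>M\<^esub>" x] pr_zero by simp
  next
    case (6 X)
    then obtain x where x: "x \<in> carrier M" "X = pr x" using carrier_ex[of X] by blast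
    then have "pr (\<ominus>\<^bsub>M\<^esub> x) \<oplus>\<^bsub>Q\<^esub> X = \<zero>\<^bsub>Q\<^esub>"
      using pr_add[of "\<ominus>\<^bsub>M\<^esub> x" x] pr_zero by (simp add: M.l_neg)
    then show ?case using pr_closed[of "\<ominus>\<^bsub>M\<^esub> x"] x by auto
  qed
  moreover have "module_axioms A Q"
  proof (rule module_axioms.intro, goal_cases)
    case (1 a X)
    then obtain x where "x \<in> carrier M" "X = pr x" using carrier_ex[of X] by blast
    with 1 show ?case by (simp add: pr_smult pr_closed)
  next
    case (2 a b X)
    then obtain x where "x \<in> carrier M" "X = pr x" using carrier_ex[of X] by blast
    with 2 show ?case by (simp add: pr_smult pr_add M.smult_l_distr)
  next
    case (3 a X Y)
    then obtain x y where "x \<in> carrier M" "X = pr x" "y \<in> carrier M" "Y = pr y"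
      using carrier_ex[of X] carrier_ex[of Y] by blast
    with 3 show ?case by (simp add: pr_smult pr_add M.smult_r_distr)
  next
    case (4 a b X)
    then obtain x where "x \<in> carrier M" "X = pr x" using carrier_ex[of X] by blast
    with 4 show ?case by (simp add: pr_smult M.smult_assoc1)
  next
    case (5 X)
    then obtain x where "x \<in> carrier M" "X = pr x" using carrier_ex[of X] by blast
    then show ?case by (simp add: pr_smult)
  qed
  ultimately show ?thesis by (intro Module.module.intro M.R.is_cring)
qed

end

text \<open>The targets of the universal properties are abelian groups of type \<open>'c\<close> with an action of
  \<open>A\<close>; the action need not be unital, which allows for multiplication of residues followed by
  reduction.\<close>

locale ring_action = cring A for A :: "'a ring" (structure) +
  fixes act :: "'a \<Rightarrow> 'c::ab_group_add \<Rightarrow> 'c"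
  assumes act_add_left: "a \<in> carrier A \<Longrightarrow> b \<in> carrier A \<Longrightarrow> act (a \<oplus> b) v = act a v + act b v"
    and act_add_right: "a \<in> carrier A \<Longrightarrow> act a (v + w) = act a v + act a w"
    and act_mult: "a \<in> carrier A \<Longrightarrow> b \<in> carrier A \<Longrightarrow> act (a \<otimes> b) v = act a (act b v)"
begin

definition act_linear :: "('a, 'm) module \<Rightarrow> ('m \<Rightarrow> 'c) \<Rightarrow> bool" where
  "act_linear M L \<longleftrightarrow>
     (\<forall>x\<in>carrier M. \<forall>y\<in>carrier M. L (x \<oplus>\<^bsub>M\<^esub> y) = L x + L y) \<and>
     (\<forall>a\<in>carrier A. \<forall>x\<in>carrier M. L (a \<odot>\<^bsub>M\<^esub> x) = act a (L x))"

lemma act_zero_left: "act \<zero> v = 0"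
  using act_add_left[of \<zero> \<zero> v] by simp

lemma act_zero_right: "a \<in> carrier A \<Longrightarrow> act a 0 = 0"
  using act_add_right[of a 0 0] by simp

lemma act_linearD:
  assumes "act_linear M L" "x \<in> carrier M"
  shows "y \<in> carrier M \<Longrightarrow> L (x \<oplus>\<^bsub>M\<^esub> y) = L x + L y"
    and "a \<in> carrier A \<Longrightarrow> L (a \<odot>\<^bsub>M\<^esub> x) = act a (L x)"
  using assms by (auto simp: act_linear_def)

lemma act_linear_zero:
  assumes "Module.module A M" "act_linear M L"
  shows "L \<zero>\<^bsub>M\<^esub> = 0"
proof -
  interpret M: Module.module A M by fact
  show ?thesis using act_linearD(1)[OF assms(2), of "\<zero>\<^bsub>M\<^esub>" "\<zero>\<^bsub>M\<^esub>"] by simp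
qed

lemma act_linear_minus:
  assumes "Module.module A M" "act_linear M L" "x \<in> carrier M" "y \<in> carrier M"
  shows "L (x \<ominus>\<^bsub>M\<^esub> y) = L x - L y"
proof -
  interpret M: Module.module A M by fact
  have "L ((x \<ominus>\<^bsub>M\<^esub> y) \<oplus>\<^bsub>M\<^esub> y) = L (x \<ominus>\<^bsub>M\<^esub> y) + L y"
    using assms(3,4) by (intro act_linearD(1)[OF assms(2)]) auto
  moreover have "(x \<ominus>\<^bsub>M\<^esub> y) \<oplus>\<^bsub>M\<^esub> y = x"
    using assms(3,4) by (simp add: M.minus_eq M.add.m_assoc M.l_neg)
  ultimately show ?thesis by (simp add: algebra_simps)
qed

lemma act_linear_span:
  assumes M: "Module.module A M" and L: "act_linear M L" and S: "S \<subseteq> carrier M"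
    and vanish: "\<And>s. s \<in> S \<Longrightarrow> L s = 0" and x: "x \<in> LinearCombinations.module.span A M S"
  shows "L x = 0"
proof -
  interpret M: Module.module A M by fact
  obtain a B where B: "finite B" "B \<subseteq> S" "a \<in> B \<rightarrow> carrier A" "x = M.lincomb a B"
    using x unfolding M.span_def by auto
  have "L (\<Oplus>\<^bsub>M\<^esub>v\<in>B. a v \<odot>\<^bsub>M\<^esub> v) = 0" using B(1,2,3)
  proof (induction B)
    case empty
    then show ?case using act_linear_zero[OF M L] by simp
  next
    case (insert b B)
    have bc: "b \<in> carrier M" "a b \<in> carrier A" "(\<lambda>v. a v \<odot>\<^bsub>M\<^esub> v) \<in> B \<rightarrow> carrier M"
      using insert.prems S by auto
    then have "(\<Oplus>\<^bsub>M\<^esub>v\<in>insert b B. a v \<odot>\<^bsub>M\<^esub> v) = a b \<odot>\<^bsub>M\<^esub> b \<oplus>\<^bsub>M\<^esub> (\<Oplus>\<^bsub>M\<^esub>v\<in>B. a v \<odot>\<^bsub>M\<^esub> v)"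
      using insert.hyps by (intro M.finsum_insert) auto
    then show ?case
      using bc insert act_linearD[OF L] vanish act_zero_right M.finsum_closed[of _ B] by auto
  qed
  then show ?thesis using B(4) by (simp add: M.lincomb_def)
qed

lemma quotient_lift:
  assumes "quotient_mod A M N" and L: "act_linear M L" and vanish: "\<And>x. x \<in> N \<Longrightarrow> L x = 0"
  shows "\<exists>L'. act_linear (quotient_module M N) L' \<and> (\<forall>x\<in>carrier M. L' (N +>\<^bsub>M\<^esub> x) = L x)"
proof -
  interpret quotient_mod A M N by fact
  define L' where "L' Y = L (SOME y. y \<in> Y)" for Y
  have L': "L' (pr x) = L x" if x: "x \<in> carrier M" for x
  proof -
    have "(SOME y. y \<in> pr x) \<in> pr x" using a_rcos_self[OF x] by (rule someI)
    then obtain z where z: "z \<in> N" "(SOME y. y \<in> pr x) = z \<oplus>\<^bsub>M\<^esub> x" by (rule mem_prE)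
    then show ?thesis using act_linearD(1)[OF L, of z x] x vanish subset by (auto simp: L'_def)
  qed
  have "act_linear Q L'"
    unfolding act_linear_def
  proof (intro conjI ballI)
    fix X Y assume "X \<in> carrier Q" "Y \<in> carrier Q"
    then obtain x y where "x \<in> carrier M" "X = pr x" "y \<in> carrier M" "Y = pr y"
      using carrier_ex[of X] carrier_ex[of Y] by blast
    then show "L' (X \<oplus>\<^bsub>Q\<^esub> Y) = L' X + L' Y"
      by (simp add: pr_add L' act_linearD(1)[OF L])
  next
    fix a X assume a: "a \<in> carrier A" and "X \<in> carrier Q"
    then obtain x where "x \<in> carrier M" "X = pr x" using carrier_ex[of X] by blast
    with a show "L' (a \<odot>\<^bsub>Q\<^esub> X) = act a (L' X)"
      by (simp add: pr_smult L' act_linearD(2)[OF L])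
  qed
  with L' show ?thesis by auto
qed

definition free_lift :: "('x \<Rightarrow> 'c) \<Rightarrow> ('x \<Rightarrow> 'a) \<Rightarrow> 'c" where
  "free_lift u f = (\<Sum>x | f x \<noteq> \<zero>. act (f x) (u x))"

lemma free_lift_superset:
  assumes "finite S" "{x. f x \<noteq> \<zero>} \<subseteq> S"
  shows "free_lift u f = (\<Sum>x\<in>S. act (f x) (u x))"
  unfolding free_lift_def
  by (rule sum.mono_neutral_left) (use assms act_zero_left in auto)

lemma act_linear_free_lift: "act_linear (free_module A X) (free_lift u)"
  unfolding act_linear_def
proof (intro conjI ballI)
  fix f g assume f: "f \<in> carrier (free_module A X)" and g: "g \<in> carrier (free_module A X)"
  define S where "S = {x. f x \<noteq> \<zero>} \<union> {x. g x \<noteq> \<zero>}"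
  have S: "finite S" "{x. f x \<noteq> \<zero>} \<subseteq> S" "{x. g x \<noteq> \<zero>} \<subseteq> S" "{x. f x \<oplus> g x \<noteq> \<zero>} \<subseteq> S"
    using f g by (auto simp: S_def free_module_carrier)
  have "free_lift u (\<lambda>x. f x \<oplus> g x) = (\<Sum>x\<in>S. act (f x) (u x) + act (g x) (u x))"
    unfolding free_lift_superset[OF S(1,4)]
    using f g by (intro sum.cong) (auto simp: act_add_left free_module_carrier)
  then show "free_lift u (f \<oplus>\<^bsub>free_module A X\<^esub> g) = free_lift u f + free_lift u g"
    by (simp add: free_lift_superset[OF S(1,2)] free_lift_superset[OF S(1,3)] sum.distrib)
next
  fix a f assume a: "a \<in> carrier A" and f: "f \<in> carrier (free_module A X)"
  define S where "S = {x. f x \<noteq> \<zero>}"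
  have S: "finite S" "{x. f x \<noteq> \<zero>} \<subseteq> S" "{x. a \<otimes> f x \<noteq> \<zero>} \<subseteq> S"
    using a f by (auto simp: S_def free_module_carrier)
  have "free_lift u (\<lambda>x. a \<otimes> f x) = (\<Sum>x\<in>S. act a (act (f x) (u x)))"
    unfolding free_lift_superset[OF S(1,3)]
    using a f by (intro sum.cong) (auto simp: act_mult free_module_carrier)
  also have "\<dots> = act a (\<Sum>x\<in>S. act (f x) (u x))"
    using S(1) by (induction S) (auto simp: act_zero_right act_add_right a)
  finally show "free_lift u (a \<odot>\<^bsub>free_module A X\<^esub> f) = act a (free_lift u f)"
    by (simp add: free_lift_superset[OF S(1,2)])
qed

lemma free_lift_gen: "free_lift u (free_gen A x) = act \<one> (u x)"
  by (subst free_lift_superset[of "{x}"]) (auto simp: free_gen_def)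

end

section \<open>Kaehler differentials and exterior powers\<close>

lemma quotient_mod_span:
  assumes "Module.module R M"
  shows "S \<subseteq> carrier M \<Longrightarrow> quotient_mod R M (LinearCombinations.module.span R M S)"
  by (intro quotient_mod.intro assms module.span_is_submodule)

lemma (in Module.module) minus_closed': "x \<in> carrier M \<Longrightarrow> y \<in> carrier M \<Longrightarrow> x \<ominus>\<^bsub>M\<^esub> y \<in> carrier M"
  by simp

lemma kaehler_relations_closed:
  assumes "cring A" "\<phi> \<in> Ring.ring_hom class_ring A"
  shows "kaehler_relations \<phi> A \<subseteq> carrier (free_module A (carrier A))"
proof -
  interpret cring A by fact
  interpret F: Module.module A "free_module A (carrier A)" by (rule free_module_module[OF assms(1)])
  note [simp] = free_gen_closed[OF assms(1)] and h = ring_hom_memE[OF assms(2), simplified]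
  show ?thesis
    unfolding kaehler_relations_def Let_def
    by (auto simp del: free_module_simps simp: h intro!: F.minus_closed' F.add.m_closed F.smult_closed)
qed

lemma kaehler_quotient_mod:
  assumes "cring A" "\<phi> \<in> Ring.ring_hom class_ring A"
  shows "quotient_mod A (free_module A (carrier A)) (kaehler_submodule \<phi> A)"
  unfolding kaehler_submodule_def
  by (intro quotient_mod_span free_module_module kaehler_relations_closed assms)

lemma module_kaehler:
  assumes "cring A" "\<phi> \<in> Ring.ring_hom class_ring A"
  shows "Module.module A (kaehler \<phi> A)"
  unfolding kaehler_def by (rule quotient_mod.module_quotient[OF kaehler_quotient_mod[OF assms]])

lemma
  assumes "cring A" "\<phi> \<in> Ring.ring_hom class_ring A"
  shows kaehler_d_closed: "a \<in> carrier A \<Longrightarrow> kaehler_d \<phi> A a \<in> carrier (kaehler \<phi> A)"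
    and kaehler_d_add: "a \<in> carrier A \<Longrightarrow> b \<in> carrier A \<Longrightarrow>
      kaehler_d \<phi> A (a \<oplus>\<^bsub>A\<^esub> b) = kaehler_d \<phi> A a \<oplus>\<^bsub>kaehler \<phi> A\<^esub> kaehler_d \<phi> A b"
    and kaehler_d_mult: "a \<in> carrier A \<Longrightarrow> b \<in> carrier A \<Longrightarrow>
      kaehler_d \<phi> A (a \<otimes>\<^bsub>A\<^esub> b) =
        a \<odot>\<^bsub>kaehler \<phi> A\<^esub> kaehler_d \<phi> A b \<oplus>\<^bsub>kaehler \<phi> A\<^esub> b \<odot>\<^bsub>kaehler \<phi> A\<^esub> kaehler_d \<phi> A a"
    and kaehler_d_const: "kaehler_d \<phi> A (\<phi> c) = \<zero>\<^bsub>kaehler \<phi> A\<^esub>"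
proof -
  interpret cring A by fact
  let ?F = "free_module A (carrier A)"
  interpret F: Module.module A ?F by (rule free_module_module[OF assms(1)])
  interpret Q: quotient_mod A ?F "kaehler_submodule \<phi> A" by (rule kaehler_quotient_mod[OF assms])
  note gen = free_gen_closed[OF assms(1)]
  note h = ring_hom_memE[OF assms(2), simplified]
  note [simp del] = free_module_simps
  have rel: "x \<in> kaehler_submodule \<phi> A" if "x \<in> kaehler_relations \<phi> A" for x
    unfolding kaehler_submodule_def
    using F.in_own_span[OF kaehler_relations_closed[OF assms]] that by auto
  show "kaehler_d \<phi> A a \<in> carrier (kaehler \<phi> A)" if "a \<in> carrier A"
    unfolding kaehler_def kaehler_d_def by (intro Q.pr_closed gen that)
  show "kaehler_d \<phi> A (a \<oplus>\<^bsub>A\<^esub> b) = kaehler_d \<phi> A a \<oplus>\<^bsub>kaehler \<phi> A\<^esub> kaehler_d \<phi> A b"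
    if ab: "a \<in> carrier A" "b \<in> carrier A"
  proof -
    have "free_gen A (a \<oplus>\<^bsub>A\<^esub> b) \<ominus>\<^bsub>?F\<^esub> (free_gen A a \<oplus>\<^bsub>?F\<^esub> free_gen A b) \<in> kaehler_submodule \<phi> A"
      by (rule rel) (use ab in \<open>auto simp: kaehler_relations_def Let_def\<close>)
    then show ?thesis unfolding kaehler_def kaehler_d_def
      using ab by (simp add: Q.pr_add gen Q.pr_eqI)
  qed
  show "kaehler_d \<phi> A (a \<otimes>\<^bsub>A\<^esub> b) =
        a \<odot>\<^bsub>kaehler \<phi> A\<^esub> kaehler_d \<phi> A b \<oplus>\<^bsub>kaehler \<phi> A\<^esub> b \<odot>\<^bsub>kaehler \<phi> A\<^esub> kaehler_d \<phi> A a"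
    if ab: "a \<in> carrier A" "b \<in> carrier A"
  proof -
    have "free_gen A (a \<otimes>\<^bsub>A\<^esub> b) \<ominus>\<^bsub>?F\<^esub> (a \<odot>\<^bsub>?F\<^esub> free_gen A b \<oplus>\<^bsub>?F\<^esub> b \<odot>\<^bsub>?F\<^esub> free_gen A a)
      \<in> kaehler_submodule \<phi> A"
      by (rule rel) (use ab in \<open>auto simp: kaehler_relations_def Let_def\<close>)
    then show ?thesis unfolding kaehler_def kaehler_d_def
      using ab by (simp add: Q.pr_add Q.pr_smult gen Q.pr_eqI)
  qed
  show "kaehler_d \<phi> A (\<phi> c) = \<zero>\<^bsub>kaehler \<phi> A\<^esub>"
    unfolding kaehler_def kaehler_d_def
    by (intro Q.pr_eq_zero rel) (auto simp: kaehler_relations_def Let_def)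
qed

text \<open>Universal property for K-derivations: the free lift kills the defining relations. As the
  action may be non-unital, the values of \<delta> are required to be fixed by the unit; otherwise
  the lift would reach only their images under it.\<close>

lemma (in ring_action) kaehler_lift:
  assumes \<phi>: "\<phi> \<in> Ring.ring_hom class_ring A"
    and add: "\<And>a b. a \<in> carrier A \<Longrightarrow> b \<in> carrier A \<Longrightarrow> \<delta> (a \<oplus> b) = \<delta> a + \<delta> b"
    and mult: "\<And>a b. a \<in> carrier A \<Longrightarrow> b \<in> carrier A \<Longrightarrow> \<delta> (a \<otimes> b) = act a (\<delta> b) + act b (\<delta> a)"
    and const: "\<And>c. \<delta> (\<phi> c) = 0"
    and one: "\<And>a. a \<in> carrier A \<Longrightarrow> act \<one> (\<delta> a) = \<delta> a"
  shows "\<exists>D. act_linear (kaehler \<phi> A) D \<and> (\<forall>a\<in>carrier A. D (kaehler_d \<phi> A a) = \<delta> a)"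
proof -
  let ?F = "free_module A (carrier A)"
  interpret F: Module.module A ?F by (rule free_module_module[OF is_cring])
  note gen = free_gen_closed[OF is_cring]
  note h = ring_hom_memE[OF \<phi>, simplified]
  note rc = kaehler_relations_closed[OF is_cring \<phi>]
  note [simp del] = free_module_simps
  let ?L = "free_lift \<delta>"
  note lin = act_linear_free_lift[of "carrier A" \<delta>]
  note L = act_linear_minus[OF F.module_axioms lin] act_linearD[OF lin]
  have g: "?L (free_gen A a) = \<delta> a" if "a \<in> carrier A" for a
    using that by (simp add: free_lift_gen one)
  have "?L x = 0" if "x \<in> kaehler_relations \<phi> A" for x
    using that unfolding kaehler_relations_def Let_def
    by (elim UnE CollectE exE conjE) (auto simp: L gen g add mult const h)
  then have "?L x = 0" if "x \<in> kaehler_submodule \<phi> A" for x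
    using act_linear_span[OF F.module_axioms lin rc] that by (auto simp: kaehler_submodule_def)
  from quotient_lift[OF kaehler_quotient_mod[OF is_cring \<phi>] lin this]
  obtain D where D: "act_linear (kaehler \<phi> A) D"
    "\<And>x. x \<in> carrier ?F \<Longrightarrow> D (kaehler_submodule \<phi> A +>\<^bsub>?F\<^esub> x) = ?L x"
    by (auto simp: kaehler_def)
  then show ?thesis by (intro exI[of _ D]) (simp add: kaehler_d_def D gen g)
qed

locale ext_module = Module.module R M for R :: "'a ring" and M :: "('a, 'm) module"
begin

lemma tuples_update: "vs \<in> tuples m M \<Longrightarrow> v \<in> carrier M \<Longrightarrow> vs[i := v] \<in> tuples m M"
  using set_update_subset_insert[of vs i v] by (auto simp: tuples_def)

lemma exterior_relations_closed:
  "exterior_relations R m M \<subseteq> carrier (free_module R (tuples m M))"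
proof -
  interpret F: Module.module R "free_module R (tuples m M)" by (rule free_module_module[OF R.is_cring])
  note [simp] = free_gen_closed[OF R.is_cring] tuples_update
  show ?thesis
    unfolding exterior_relations_def Let_def
    by (auto simp del: free_module_simps intro!: F.minus_closed' F.add.m_closed F.smult_closed)
qed

lemma exterior_quotient_mod:
  "quotient_mod R (free_module R (tuples m M)) (exterior_submodule R m M)"
  unfolding exterior_submodule_def
  by (intro quotient_mod_span free_module_module exterior_relations_closed R.is_cring)

lemma module_exterior_power: "Module.module R (exterior_power R m M)"
  unfolding exterior_power_def by (rule quotient_mod.module_quotient[OF exterior_quotient_mod])

lemma
  assumes vs: "vs \<in> tuples m M"
  shows wedge_closed: "wedge R m M vs \<in> carrier (exterior_power R m M)"
    and wedge_add: "i < m \<Longrightarrow> v \<in> carrier M \<Longrightarrow> w \<in> carrier M \<Longrightarrow>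
      wedge R m M (vs[i := v \<oplus>\<^bsub>M\<^esub> w]) =
        wedge R m M (vs[i := v]) \<oplus>\<^bsub>exterior_power R m M\<^esub> wedge R m M (vs[i := w])"
    and wedge_smult: "i < m \<Longrightarrow> a \<in> carrier R \<Longrightarrow> v \<in> carrier M \<Longrightarrow>
      wedge R m M (vs[i := a \<odot>\<^bsub>M\<^esub> v]) = a \<odot>\<^bsub>exterior_power R m M\<^esub> wedge R m M (vs[i := v])"
    and wedge_alternating: "i < j \<Longrightarrow> j < m \<Longrightarrow> vs ! i = vs ! j \<Longrightarrow>
      wedge R m M vs = \<zero>\<^bsub>exterior_power R m M\<^esub>"
proof -
  let ?F = "free_module R (tuples m M)"
  interpret F: Module.module R ?F by (rule free_module_module[OF R.is_cring])
  interpret Q: quotient_mod R ?F "exterior_submodule R m M" by (rule exterior_quotient_mod)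
  note gen = free_gen_closed[OF R.is_cring] tuples_update
  note [simp del] = free_module_simps
  have rel: "x \<in> exterior_submodule R m M" if "x \<in> exterior_relations R m M" for x
    unfolding exterior_submodule_def
    using F.in_own_span[OF exterior_relations_closed] that by auto
  show "wedge R m M vs \<in> carrier (exterior_power R m M)"
    unfolding exterior_power_def wedge_def by (intro Q.pr_closed gen vs)
  show "wedge R m M (vs[i := v \<oplus>\<^bsub>M\<^esub> w]) =
        wedge R m M (vs[i := v]) \<oplus>\<^bsub>exterior_power R m M\<^esub> wedge R m M (vs[i := w])"
    if i: "i < m" "v \<in> carrier M" "w \<in> carrier M"
  proof -
    have "free_gen R (vs[i := v \<oplus>\<^bsub>M\<^esub> w]) \<ominus>\<^bsub>?F\<^esub> (free_gen R (vs[i := v]) \<oplus>\<^bsub>?F\<^esub> free_gen R (vs[i := w]))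
      \<in> exterior_submodule R m M"
      by (rule rel, unfold exterior_relations_def Let_def) (use vs i in blast)
    then show ?thesis unfolding exterior_power_def wedge_def
      using vs i by (simp add: Q.pr_add gen Q.pr_eqI)
  qed
  show "wedge R m M (vs[i := a \<odot>\<^bsub>M\<^esub> v]) = a \<odot>\<^bsub>exterior_power R m M\<^esub> wedge R m M (vs[i := v])"
    if i: "i < m" "a \<in> carrier R" "v \<in> carrier M"
  proof -
    have "free_gen R (vs[i := a \<odot>\<^bsub>M\<^esub> v]) \<ominus>\<^bsub>?F\<^esub> (a \<odot>\<^bsub>?F\<^esub> free_gen R (vs[i := v]))
      \<in> exterior_submodule R m M"
      by (rule rel, unfold exterior_relations_def Let_def) (use vs i in blast)
    then show ?thesis unfolding exterior_power_def wedge_def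
      using vs i by (simp add: Q.pr_smult gen Q.pr_eqI)
  qed
  show "wedge R m M vs = \<zero>\<^bsub>exterior_power R m M\<^esub>" if "i < j" "j < m" "vs ! i = vs ! j"
    unfolding exterior_power_def wedge_def
    by (intro Q.pr_eq_zero rel, unfold exterior_relations_def Let_def) (use vs that in blast)
qed

end

text \<open>Universal property for alternating multilinear maps, with the same proviso about the
  unit as for derivations.\<close>

lemma (in ring_action) exterior_lift:
  assumes M: "Module.module A M"
    and add: "\<And>vs i v w. vs \<in> tuples m M \<Longrightarrow> i < m \<Longrightarrow> v \<in> carrier M \<Longrightarrow> w \<in> carrier M \<Longrightarrow>
      u (vs[i := v \<oplus>\<^bsub>M\<^esub> w]) = u (vs[i := v]) + u (vs[i := w])"
    and smult: "\<And>vs i a v. vs \<in> tuples m M \<Longrightarrow> i < m \<Longrightarrow> a \<in> carrier A \<Longrightarrow> v \<in> carrier M \<Longrightarrow>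
      u (vs[i := a \<odot>\<^bsub>M\<^esub> v]) = act a (u (vs[i := v]))"
    and alternating: "\<And>vs i j. vs \<in> tuples m M \<Longrightarrow> i < j \<Longrightarrow> j < m \<Longrightarrow> vs ! i = vs ! j \<Longrightarrow> u vs = 0"
    and one: "\<And>vs. vs \<in> tuples m M \<Longrightarrow> act \<one> (u vs) = u vs"
  shows "\<exists>D. act_linear (exterior_power A m M) D \<and> (\<forall>vs\<in>tuples m M. D (wedge A m M vs) = u vs)"
proof -
  interpret M: ext_module A M using M by (rule ext_module.intro)
  let ?F = "free_module A (tuples m M)"
  interpret F: Module.module A ?F by (rule free_module_module[OF is_cring])
  note gen = free_gen_closed[OF is_cring] M.tuples_update
  note rc = M.exterior_relations_closed[of m]
  note [simp del] = free_module_simps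
  let ?L = "free_lift u"
  note lin = act_linear_free_lift[of "tuples m M" u]
  note L = act_linear_minus[OF F.module_axioms lin] act_linearD[OF lin]
  have g: "?L (free_gen A vs) = u vs" if "vs \<in> tuples m M" for vs
    using that by (simp add: free_lift_gen one)
  have "?L x = 0" if "x \<in> exterior_relations A m M" for x
    using that unfolding exterior_relations_def Let_def
    by (elim UnE CollectE exE conjE) (auto simp: L gen g add smult alternating)
  then have "?L x = 0" if "x \<in> exterior_submodule A m M" for x
    using act_linear_span[OF F.module_axioms lin rc] that by (auto simp: exterior_submodule_def)
  from quotient_lift[OF M.exterior_quotient_mod lin this]
  obtain D where D: "act_linear (exterior_power A m M) D"
    "\<And>x. x \<in> carrier ?F \<Longrightarrow> D (exterior_submodule A m M +>\<^bsub>?F\<^esub> x) = ?L x"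
    by (auto simp: exterior_power_def)
  then show ?thesis by (intro exI[of _ D]) (simp add: wedge_def D gen g)
qed

section \<open>Weakly curvilinear algebras\<close>

context local_algebra
begin

lemma residue_dim_monogenic:
  assumes \<theta> [simp]: "\<theta> \<in> carrier A" and onto: "\<And>x. x \<in> carrier A \<Longrightarrow> \<exists>p. x = ev \<theta> p"
    and f: "f \<noteq> 0" "\<And>p. ev \<theta> p \<in> M \<longleftrightarrow> f dvd p"
  shows "algebra_dim (\<lambda>c. M +> \<phi> c) (A Quot M) = degree f"
proof -
  have zero_Quot: "\<zero>\<^bsub>A Quot M\<^esub> = M" by (simp add: FactRing_def)
  have hom: "(+>) M \<in> Ring.ring_hom A (A Quot M)" by (rule M.rcos_ring_hom)
  have "(\<lambda>c. M +> \<phi> c) \<in> Ring.ring_hom class_ring (A Quot M)"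
    using ring_hom_trans[OF \<phi> hom] by (simp add: comp_def)
  moreover have "cring (A Quot M)" by (rule M.quotient_is_cring[OF is_cring])
  ultimately interpret Q: algebra_over "A Quot M" "\<lambda>c. M +> \<phi> c"
    by (intro algebra_over.intro algebra_over_axioms.intro)
  have \<theta>Q: "M +> \<theta> \<in> carrier (A Quot M)" by (rule ring_hom_closed[OF hom \<theta>])
  have ev_Q: "Q.ev (M +> \<theta>) p = M +> ev \<theta> p" for p
  proof (induction p)
    case 0
    show ?case using a_rcos_zero[OF M.is_ideal, of \<zero>] by (simp add: zero_Quot)
  next
    case (pCons a p)
    then show ?case using ring_hom_add[OF hom] ring_hom_mult[OF hom] by (simp add: Q.ev_pCons[OF \<theta>Q])
  qed
  show ?thesis
  proof (rule Q.algebra_dim_monogenic[OF \<theta>Q f(1)])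
    fix X assume "X \<in> carrier (A Quot M)"
    then obtain x where "x \<in> carrier A" "X = M +> x"
      unfolding FactRing_def A_RCOSETS_def' partial_object.select_convs by blast
    then show "\<exists>p. X = Q.ev (M +> \<theta>) p" using onto[of x] ev_Q by metis
  next
    fix p
    have "M +> ev \<theta> p = M \<longleftrightarrow> ev \<theta> p \<in> M"
      using M.rcos_const_imp_mem[of "ev \<theta> p"] a_rcos_zero[OF M.is_ideal, of "ev \<theta> p"] by (auto simp: zero_Quot)
    then show "Q.ev (M +> \<theta>) p = \<zero>\<^bsub>A Quot M\<^esub> \<longleftrightarrow> f dvd p" by (simp add: ev_Q zero_Quot f(2))
  qed
qed

end

text \<open>An algebra \<open>K[\<theta>]/(g)\<close> together with \<open>h = gcd(g, g')\<close>, so that its module of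
  differentials is \<open>K[\<theta>]/(h)\<close>.\<close>

definition monogenic_presentation ::
  "('k::field \<Rightarrow> 'a) \<Rightarrow> 'a ring \<Rightarrow> 'a \<Rightarrow> 'k poly \<Rightarrow> 'k poly \<Rightarrow> 'k poly \<Rightarrow> bool"
where
  "monogenic_presentation \<phi> A \<theta> g h u \<longleftrightarrow> \<theta> \<in> carrier A \<and> g \<noteq> 0 \<and> h \<noteq> 0 \<and>
     (\<forall>x\<in>carrier A. \<exists>p. x = algebra_over.ev A \<phi> \<theta> p) \<and>
     (\<forall>p. algebra_over.ev A \<phi> \<theta> p = \<zero>\<^bsub>A\<^esub> \<longleftrightarrow> g dvd p) \<and>
     h dvd g \<and> h dvd pderiv g \<and> g dvd pderiv g * u - h"

text \<open>With g = f^e the derivative is e f^(e-1) f', and f' is invertible modulo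
  \<open>f\<close>. The exponent \<open>e\<close> equals the quotient of the two dimensions, because
  they are e deg f and deg f.\<close>

lemma weakly_curvilinear_presentation:
  fixes \<phi> :: "'k::field \<Rightarrow> 'a" and A :: "'a ring"
  assumes perfect: "perfect_field TYPE('k)" and wc: "weakly_curvilinear_ring A"
    and \<phi>: "\<phi> \<in> Ring.ring_hom class_ring A"
    and fd: "vectorspace.fin_dim class_ring (restrict_scalars \<phi> (regular_module A))"
  shows "\<exists>\<theta> g h u. monogenic_presentation \<phi> A \<theta> g h u \<and> algebra_dim \<phi> A = degree g \<and>
    int (degree h) = int (algebra_dim \<phi> A) -
      (if CHAR('k) dvd algebra_dim \<phi> A div residue_dim \<phi> A then 0 else int (residue_dim \<phi> A))"
proof -
  have loc: "local_ring A" and prin: "principalideal (max_ideal A) A"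
    using wc by (auto simp: weakly_curvilinear_ring_def zero_dim_local_ring_def)
  have ex1: "\<exists>!M. maximalideal M A" and cr: "cring A" using loc by (auto simp: local_ring_def)
  have M: "maximalideal (max_ideal A) A" unfolding max_ideal_def by (rule theI'[OF ex1])
  interpret local_algebra A \<phi> "max_ideal A"
    by (intro local_algebra.intro algebra_over.intro algebra_over_axioms.intro
      local_algebra_axioms.intro cr \<phi> fd M) (use ex1 M in blast)
  obtain t where t: "t \<in> carrier A" "max_ideal A = PIdl\<^bsub>A\<^esub> t"
    using principalideal.generate[OF prin] cgenideal_eq_genideal by blast
  obtain \<theta> f e where \<theta>: "\<theta> \<in> carrier A" and f: "Factorial_Ring.irreducible f" "lead_coeff f = 1" and e: "e > 0"
    and onto: "\<And>x. x \<in> carrier A \<Longrightarrow> \<exists>p. x = ev \<theta> p" and ker: "\<And>p. ev \<theta> p = \<zero>\<^bsub>A\<^esub> \<longleftrightarrow> f ^ e dvd p"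
    and kerM: "\<And>p. ev \<theta> p \<in> max_ideal A \<longleftrightarrow> f dvd p"
    using monogenic[OF perfect t] by metis
  have f0: "f \<noteq> 0" using f(1) by auto
  have fpos: "degree f > 0" using f(1) by (metis Factorial_Ring.irreducible_def is_unit_iff_degree gr0I)
  have dimA: "algebra_dim \<phi> A = degree (f ^ e)"
    by (rule algebra_dim_monogenic[OF \<theta> _ onto ker]) (use f0 in auto)
  have dimL: "residue_dim \<phi> A = degree f"
    unfolding residue_dim_def by (rule residue_dim_monogenic[OF \<theta> onto f0 kerM])
  have deg: "degree (f ^ k) = k * degree f" for k using f0 by (simp add: degree_power_eq)
  have \<nu>: "algebra_dim \<phi> A div residue_dim \<phi> A = e" using fpos by (simp add: dimA dimL deg)
  obtain m where m: "e = Suc m" using e by (cases e) auto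
  have dg: "pderiv (f ^ e) = Polynomial.smult (of_nat e) (f ^ m) * pderiv f"
    unfolding m by (rule pderiv_power_Suc)
  show ?thesis
  proof (cases "CHAR('k) dvd e")
    case True
    then have "of_nat e = (0 :: 'k)" by (simp only: of_nat_eq_0_iff_char_dvd)
    then have "pderiv (f ^ e) = 0" using dg by simp
    \<comment> \<open>As g' = 0, the choice h = g works with cofactor 0, since \<open>g\<close>
      divides -h.\<close>
    then have "monogenic_presentation \<phi> A \<theta> (f ^ e) (f ^ e) 0"
      using \<theta> onto ker f0 by (auto simp: monogenic_presentation_def)
    then show ?thesis using dimA \<nu> True by auto
  next
    case False
    then have e0: "of_nat e \<noteq> (0 :: 'k)" by (simp only: of_nat_eq_0_iff_char_dvd not_False_eq_True)
    have "\<not> f dvd pderiv f"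
    proof
      assume "f dvd pderiv f"
      then have "degree f \<le> degree (pderiv f)"
        using irreducible_pderiv_nonzero[OF perfect f(1)] by (intro dvd_imp_degree_le)
      moreover have "degree (pderiv f) \<le> degree f - 1"
        by (rule degree_le) (auto simp: coeff_pderiv coeff_eq_0)
      ultimately show False using fpos by linarith
    qed
    then obtain a b where ab: "a * f + b * pderiv f = 1" using irreducible_bezout[OF f(1)] by blast
    \<comment> \<open>The Bezout coefficient inverts f' modulo \<open>f\<close>, and the scalar
      removes the factor e; thus g' u is f^(e-1) modulo f^e.\<close>
    define u where "u = Polynomial.smult (inverse (of_nat e)) b"
    have "pderiv (f ^ e) * u = f ^ m * (b * pderiv f)"
      using e0 by (simp add: dg u_def mult_ac)
    then have "pderiv (f ^ e) * u - f ^ m = f ^ m * (b * pderiv f - 1)" by (simp add: algebra_simps)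
    also have "b * pderiv f - 1 = - (a * f)" unfolding ab[symmetric] by simp
    also have "f ^ m * - (a * f) = f ^ e * (- a)" by (simp add: m mult_ac)
    finally have u: "f ^ e dvd pderiv (f ^ e) * u - f ^ m" by simp
    have "monogenic_presentation \<phi> A \<theta> (f ^ e) (f ^ m) u"
    proof -
      have "f ^ m dvd pderiv (f ^ e)" by (simp add: dg dvd_smult)
      then show ?thesis unfolding monogenic_presentation_def
        using \<theta> onto ker f0 u le_imp_power_dvd[of m e f] by (simp add: m del: power_Suc)
    qed
    moreover have "int (degree (f ^ m)) = int (algebra_dim \<phi> A) - int (residue_dim \<phi> A)"
      unfolding dimA dimL deg by (simp add: m distrib_right)
    ultimately show ?thesis using dimA \<nu> False by auto
  qed
qed

section \<open>Projections of products of rings\<close>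

lemma RDirProd_list_Cons_ops:
  assumes "a \<in> carrier R" "b \<in> carrier R" "as \<in> carrier (RDirProd_list Rs)" "bs \<in> carrier (RDirProd_list Rs)"
  shows "(a # as) \<otimes>\<^bsub>RDirProd_list (R # Rs)\<^esub> (b # bs) = (a \<otimes>\<^bsub>R\<^esub> b) # (as \<otimes>\<^bsub>RDirProd_list Rs\<^esub> bs)"
    and "(a # as) \<oplus>\<^bsub>RDirProd_list (R # Rs)\<^esub> (b # bs) = (a \<oplus>\<^bsub>R\<^esub> b) # (as \<oplus>\<^bsub>RDirProd_list Rs\<^esub> bs)"
proof -
  have c: "(a, as) \<in> carrier (RDirProd R (RDirProd_list Rs))" "(b, bs) \<in> carrier (RDirProd R (RDirProd_list Rs))"
    using assms by (auto simp: RDirProd_carrier)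
  note hom = ring_hom_memE[OF RDirProd_list_hom1[of R Rs]]
  show "(a # as) \<otimes>\<^bsub>RDirProd_list (R # Rs)\<^esub> (b # bs) = (a \<otimes>\<^bsub>R\<^esub> b) # (as \<otimes>\<^bsub>RDirProd_list Rs\<^esub> bs)"
    using hom(2)[OF c] by (simp add: RDirProd_def DirProd_def monoid.defs)
  show "(a # as) \<oplus>\<^bsub>RDirProd_list (R # Rs)\<^esub> (b # bs) = (a \<oplus>\<^bsub>R\<^esub> b) # (as \<oplus>\<^bsub>RDirProd_list Rs\<^esub> bs)"
    using hom(3)[OF c] by (simp add: RDirProd_def DirProd_def monoid.defs)
qed

lemma RDirProd_list_nth_hom:
  "i < length Rs \<Longrightarrow> (\<lambda>as. as ! i) \<in> Ring.ring_hom (RDirProd_list Rs) (Rs ! i)"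
proof (induction Rs arbitrary: i)
  case (Cons R Rs)
  have carr: "\<exists>a as'. as = a # as' \<and> a \<in> carrier R \<and> as' \<in> carrier (RDirProd_list Rs)"
    if "as \<in> carrier (RDirProd_list (R # Rs))" for as
    using that unfolding RDirProd_list_carrier by auto
  show ?case
  proof (rule ring_hom_memI)
    fix as assume as: "as \<in> carrier (RDirProd_list (R # Rs))"
    show "as ! i \<in> carrier ((R # Rs) ! i)"
      by (rule RDirProd_list_carrier_mem(2)[OF as Cons.prems])
    fix bs assume "bs \<in> carrier (RDirProd_list (R # Rs))"
    then obtain b bs' where b: "bs = b # bs'" "b \<in> carrier R" "bs' \<in> carrier (RDirProd_list Rs)"
      using carr by blast
    obtain a as' where a: "as = a # as'" "a \<in> carrier R" "as' \<in> carrier (RDirProd_list Rs)"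
      using carr[OF as] by blast
    note ops = RDirProd_list_Cons_ops[OF a(2) b(2) a(3) b(3)]
    show "(as \<otimes>\<^bsub>RDirProd_list (R # Rs)\<^esub> bs) ! i = as ! i \<otimes>\<^bsub>(R # Rs) ! i\<^esub> bs ! i"
      unfolding a(1) b(1) ops using ring_hom_memE(2)[OF Cons.IH, of "i - 1"] Cons.prems a b
      by (cases i) simp_all
    show "(as \<oplus>\<^bsub>RDirProd_list (R # Rs)\<^esub> bs) ! i = as ! i \<oplus>\<^bsub>(R # Rs) ! i\<^esub> bs ! i"
      unfolding a(1) b(1) ops using ring_hom_memE(3)[OF Cons.IH, of "i - 1"] Cons.prems a b
      by (cases i) simp_all
  next
    show "\<one>\<^bsub>RDirProd_list (R # Rs)\<^esub> ! i = \<one>\<^bsub>(R # Rs) ! i\<^esub>"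
      using ring_hom_memE(4)[OF Cons.IH, of "i - 1"] Cons.prems
      by (cases i) (simp_all add: RDirProd_list_one)
  qed
qed simp

section \<open>Finite generation by monomials\<close>

text \<open>Generation is phrased through subspaces containing \<open>X\<close>, the form in which
  linearity arguments on monomials deliver it.\<close>

lemma fin_dimI:
  fixes V :: "('k::field, 'v) module"
  assumes V: "vectorspace class_ring V" and X: "finite X" "X \<subseteq> carrier V"
    and gen: "\<And>x W. submodule class_ring W V \<Longrightarrow> X \<subseteq> W \<Longrightarrow> x \<in> carrier V \<Longrightarrow> x \<in> W"
  shows "vectorspace.fin_dim class_ring V"
proof -
  interpret V: vectorspace "class_ring :: 'k ring" V by fact
  have "V.span X = carrier V"
    using gen[OF V.span_is_submodule[OF X(2)]] V.span_mem[OF X(2)] V.span_closed[OF X(2)] by blast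
  then show ?thesis using X unfolding V.fin_dim_def by blast
qed

lemma finite_monomials: "finite {t. Poly_Mapping.keys t \<subseteq> {..n} \<and> mdegree t = d}"
proof (rule inj_on_finite)
  let ?T = "{t. Poly_Mapping.keys t \<subseteq> {..n} \<and> mdegree t = d}"
  show "inj_on (\<lambda>t. restrict (Poly_Mapping.lookup t) {..n}) ?T"
  proof (rule inj_onI, rule poly_mapping_eqI)
    fix s t i assume "s \<in> ?T" "t \<in> ?T"
      and eq: "restrict (Poly_Mapping.lookup s) {..n} = restrict (Poly_Mapping.lookup t) {..n}"
    then have "i \<notin> Poly_Mapping.keys s" "i \<notin> Poly_Mapping.keys t" if "\<not> i \<le> n" using that by auto
    then show "Poly_Mapping.lookup s i = Poly_Mapping.lookup t i"
      using fun_cong[OF eq, of i] by (cases "i \<le> n") (simp_all add: in_keys_iff)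
  qed
  show "(\<lambda>t. restrict (Poly_Mapping.lookup t) {..n}) ` ?T \<subseteq> {..n} \<rightarrow>\<^sub>E {..d}"
  proof
    fix f assume "f \<in> (\<lambda>t. restrict (Poly_Mapping.lookup t) {..n}) ` ?T"
    then obtain t where t: "f = restrict (Poly_Mapping.lookup t) {..n}" "Poly_Mapping.keys t \<subseteq> {..n}" "mdegree t = d"
      by blast
    have "Poly_Mapping.lookup t i \<le> d" if "i \<le> n" for i
      using t(3) mdegree_superset[of "{..n}" t] t(2) that
        member_le_sum[of i "{..n}" "Poly_Mapping.lookup t"] by simp
    then show "f \<in> {..n} \<rightarrow>\<^sub>E {..d}" by (simp add: t(1) PiE_iff)
  qed
qed (simp add: finite_PiE)

section \<open>Representing functions of a curvilinear scheme\<close>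

text \<open>\<open>r i f\<close> is the reduced polynomial that represents the image of \<open>f\<close> in the \<open>i\<close>-th local ring
  \<open>K[\<theta>]/(g i)\<close>.\<close>

locale curvilinear_data = proj_scheme n I for n and I :: "'k::field mpoly set" +
  fixes t :: nat and g h u :: "nat \<Rightarrow> 'k poly" and r :: "nat \<Rightarrow> 'k mpoly \<Rightarrow> 'k poly"
  assumes g_nonzero: "i < t \<Longrightarrow> g i \<noteq> 0" and h_nonzero: "i < t \<Longrightarrow> h i \<noteq> 0"
    and h_dvd_g: "i < t \<Longrightarrow> h i dvd g i" and h_dvd_g': "i < t \<Longrightarrow> h i dvd pderiv (g i)"
    and g_dvd_h: "i < t \<Longrightarrow> g i dvd pderiv (g i) * u i - h i"
    and r_add: "i < t \<Longrightarrow> f \<in> carrier P \<Longrightarrow> f' \<in> carrier P \<Longrightarrow> r i (f + f') = r i f + r i f'"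
    and r_mult: "i < t \<Longrightarrow> f \<in> carrier P \<Longrightarrow> f' \<in> carrier P \<Longrightarrow> r i (f * f') = (r i f * r i f') mod g i"
    and r_const: "i < t \<Longrightarrow> r i (mpoly_const c) = [:c:] mod g i"
    and r_x0: "i < t \<Longrightarrow> r i x0 = 1 mod g i"
    and r_ideal: "i < t \<Longrightarrow> f \<in> I \<Longrightarrow> r i f = 0"
    and r_eq_zero: "f \<in> carrier P \<Longrightarrow> homog d f \<Longrightarrow> (\<And>i. i < t \<Longrightarrow> r i f = 0) \<Longrightarrow> f \<in> I"
    and r_mod: "i < t \<Longrightarrow> f \<in> carrier P \<Longrightarrow> r i f mod g i = r i f"
    and r_surj: "k0 \<le> d \<Longrightarrow> \<exists>f\<in>carrier P. homog d f \<and> (\<forall>i<t. r i f = p i mod g i)"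

text \<open>A K-linear map sends all forms of degree \<open>d\<close> into a subspace as soon as it
  does so for monomials. It serves both for images in local rings and for the slots of a
  differential form.\<close>

lemma (in proj_scheme) homog_combination_mem:
  assumes W: "submodule class_ring W V"
    and closed: "\<And>f. f \<in> carrier P \<Longrightarrow> \<rho> f \<in> carrier V"
    and add: "\<And>f f'. f \<in> carrier P \<Longrightarrow> f' \<in> carrier P \<Longrightarrow> \<rho> (f + f') = \<rho> f \<oplus>\<^bsub>V\<^esub> \<rho> f'"
    and smult: "\<And>c f. f \<in> carrier P \<Longrightarrow> \<rho> (mpoly_const c * f) = c \<odot>\<^bsub>V\<^esub> \<rho> f"
    and mono: "\<And>s. Poly_Mapping.keys s \<subseteq> {..n} \<Longrightarrow> mdegree s = d \<Longrightarrow> \<rho> (Poly_Mapping.single s 1) \<in> W"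
    and f: "f \<in> carrier P" "homog d f"
  shows "\<rho> f \<in> W"
proof -
  interpret W: submodule class_ring W V by fact
  interpret V: Module.module class_ring V by (rule W.module)
  have "\<rho> (\<Sum>s\<in>T. mpoly_const (Poly_Mapping.lookup f s) * Poly_Mapping.single s 1) \<in> W"
    if "finite T" "T \<subseteq> Poly_Mapping.keys f" for T
    using that
  proof (induction T rule: finite_induct)
    case empty
    have "\<rho> (mpoly_const 0 * 0) = 0 \<odot>\<^bsub>V\<^esub> \<rho> 0" by (rule smult) simp
    moreover have "0 \<odot>\<^bsub>V\<^esub> \<rho> 0 \<in> W"
      using V.lmult_0[OF closed[of 0]] W.zero_closed by simp
    ultimately show ?case by simp
  next
    case (insert s T)
    then have s: "Poly_Mapping.keys s \<subseteq> {..n}" "mdegree s = d"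
      using f by (auto simp: poly_ring_carrier homog_def)
    have sP: "Poly_Mapping.single s 1 \<in> carrier P" using s by (simp add: poly_ring_carrier)
    have TP: "(\<Sum>s\<in>T. mpoly_const (Poly_Mapping.lookup f s) * Poly_Mapping.single s 1) \<in> carrier P"
      using insert.prems f by (intro P_sum P_mult P_const) (auto simp: poly_ring_carrier)
    show ?case using insert sP TP s
      by (simp add: add smult W.m_closed W.smult_closed mono)
  qed
  from this[of "Poly_Mapping.keys f"] show ?thesis using mpoly_sum_monomials[of f] by simp
qed

section \<open>From the local decomposition to polynomial representatives\<close>

locale curvilinear_scheme = proj_scheme n I for n and I :: "'k::field mpoly set" +
  fixes Os :: "'b ring list" and \<h> :: "'k mpoly set set \<Rightarrow> 'b list" and \<psi> :: "nat \<Rightarrow> 'k \<Rightarrow> 'b"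
  assumes perfect: "perfect_field TYPE('k)"
    and decomp: "local_decomposition (affine_ring n I) Os \<h>"
    and wc: "\<forall>B\<in>set Os. weakly_curvilinear_ring B"
    and \<psi>: "\<And>i c. i < length Os \<Longrightarrow> \<psi> i c = \<h> (affine_const n I c) ! i"
begin

abbreviation "t \<equiv> length Os"

definition \<rho> :: "nat \<Rightarrow> 'k mpoly \<Rightarrow> 'b" where
  "\<rho> i f = \<h> (dehom f) ! i"

lemma \<h>_iso: "\<h> \<in> ring_iso S (RDirProd_list Os)"
  using decomp by (simp add: local_decomposition_def)

lemma \<h>_hom: "\<h> \<in> Ring.ring_hom S (RDirProd_list Os)"
  and \<h>_bij: "bij_betw \<h> (carrier S) (carrier (RDirProd_list Os))"
  using \<h>_iso by (auto simp: ring_iso_def)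

lemma cring_Os: "i < t \<Longrightarrow> cring (Os ! i)"
  using wc nth_mem[of i Os]
  by (auto simp: weakly_curvilinear_ring_def zero_dim_local_ring_def local_ring_def)

lemma \<rho>_hom: "i < t \<Longrightarrow> \<rho> i \<in> Ring.ring_hom P (Os ! i)"
  using ring_hom_trans[OF ring_hom_trans[OF dehom_hom \<h>_hom] RDirProd_list_nth_hom[of i Os]]
  by (simp add: comp_def \<rho>_def[abs_def])

lemma
  assumes "i < t"
  shows \<rho>_closed: "f \<in> carrier P \<Longrightarrow> \<rho> i f \<in> carrier (Os ! i)"
    and \<rho>_add: "f \<in> carrier P \<Longrightarrow> f' \<in> carrier P \<Longrightarrow> \<rho> i (f + f') = \<rho> i f \<oplus>\<^bsub>Os ! i\<^esub> \<rho> i f'"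
    and \<rho>_mult: "f \<in> carrier P \<Longrightarrow> f' \<in> carrier P \<Longrightarrow> \<rho> i (f * f') = \<rho> i f \<otimes>\<^bsub>Os ! i\<^esub> \<rho> i f'"
    and \<rho>_one: "\<rho> i 1 = \<one>\<^bsub>Os ! i\<^esub>"
    and \<rho>_const: "\<rho> i (mpoly_const c) = \<psi> i c"
    and \<rho>_x0: "\<rho> i x0 = \<one>\<^bsub>Os ! i\<^esub>"
  using ring_hom_memE[OF \<rho>_hom[OF assms]] \<psi>[OF assms, of c]
  by (simp_all add: \<rho>_def affine_const_eq dehom_x0 dehom_one)

lemma \<psi>_hom: "i < t \<Longrightarrow> \<psi> i \<in> Ring.ring_hom class_ring (Os ! i)"
  by (rule ring_hom_memI)
    (simp_all add: \<rho>_const[symmetric] mpoly_const_add mpoly_const_mult \<rho>_add \<rho>_mult \<rho>_one \<rho>_closed)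

lemma \<rho>_zero_iff:
  assumes f: "f \<in> carrier P"
  shows "(\<forall>i<t. \<rho> i f = \<zero>\<^bsub>Os ! i\<^esub>) \<longleftrightarrow> dehom f = \<zero>\<^bsub>S\<^esub>"
proof -
  interpret S: cring S by (rule cring_S)
  have z: "\<rho> i 0 = \<zero>\<^bsub>Os ! i\<^esub>" if "i < t" for i
  proof -
    interpret O: cring "Os ! i" by (rule cring_Os[OF that])
    show ?thesis using \<rho>_add[OF that, of 0 0] \<rho>_closed[OF that, of 0] O.add.r_cancel_one[of "\<rho> i 0" "\<rho> i 0"] by simp
  qed
  have d0: "dehom 0 = \<zero>\<^bsub>S\<^esub>" by (rule dehom_ideal_zero[OF I_simps(3)])
  have "dehom f = dehom 0" if "\<forall>i<t. \<rho> i f = \<rho> i 0"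
  proof (rule inj_onD[OF bij_betw_imp_inj_on[OF \<h>_bij]])
    have c: "\<h> (dehom f) \<in> carrier (RDirProd_list Os)" "\<h> (dehom 0) \<in> carrier (RDirProd_list Os)"
      using ring_hom_closed[OF \<h>_hom] f by simp_all
    show "\<h> (dehom f) = \<h> (dehom 0)"
      by (rule nth_equalityI) (use that RDirProd_list_carrier_mem(1)[OF c(1)] RDirProd_list_carrier_mem(1)[OF c(2)] in \<open>simp_all add: \<rho>_def\<close>)
  qed (use f in simp_all)
  moreover have "\<rho> i f = \<rho> i 0" if "dehom f = dehom 0" for i using that by (simp add: \<rho>_def)
  ultimately show ?thesis using z d0 by (intro iffI allI impI) simp_all
qed

text \<open>Elements of the local rings may be prescribed independently because \<open>S\<close> is
  their product, and any element of \<open>S\<close> is the image of a form of degree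
  \<open>d\<close>.\<close>

lemma \<rho>_surj:
  assumes x: "\<And>i. i < t \<Longrightarrow> x i \<in> carrier (Os ! i)" and d: "k0 \<le> d"
  shows "\<exists>f\<in>carrier P. homog d f \<and> (\<forall>i<t. \<rho> i f = x i)"
proof -
  have "map x [0..<t] \<in> carrier (RDirProd_list Os)"
    by (rule RDirProd_list_carrier_memI) (simp_all add: x)
  then have "map x [0..<t] \<in> \<h> ` carrier S" by (simp only: bij_betw_imp_surj_on[OF \<h>_bij])
  then obtain s where s: "map x [0..<t] = \<h> s" "s \<in> carrier S" by (rule imageE)
  obtain f where f: "f \<in> carrier P" "homog d f" "dehom f = s" using dehom_homog_surj[OF s(2) d] by blast
  have "\<rho> i f = x i" if "i < t" for i using that by (simp add: \<rho>_def f(3) s(1)[symmetric])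
  then show ?thesis using f(1,2) by blast
qed

text \<open>The monomials of degree \<open>k0\<close> are finitely many, and their images span each
  local ring because forms of that degree map onto \<open>S\<close>.\<close>

lemma fin_dim_Os:
  assumes i: "i < t"
  shows "vectorspace.fin_dim class_ring (restrict_scalars (\<psi> i) (regular_module (Os ! i)))" (is "vectorspace.fin_dim _ ?V")
proof (rule fin_dimI)
  interpret O: cring "Os ! i" by (rule cring_Os[OF i])
  show "vectorspace class_ring ?V"
    by (rule vectorspace_restrict_scalars[OF module_regular[OF O.is_cring] \<psi>_hom[OF i]])
  let ?T = "{s. Poly_Mapping.keys s \<subseteq> {..n} \<and> mdegree s = k0}"
  let ?X = "(\<lambda>s. \<rho> i (Poly_Mapping.single s 1)) ` ?T"
  show "finite ?X" using finite_monomials by simp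
  show "?X \<subseteq> carrier ?V" by (auto simp: poly_ring_carrier intro!: \<rho>_closed[OF i])
  fix x W assume W: "submodule class_ring W ?V" "?X \<subseteq> W" and x: "x \<in> carrier ?V"
  \<comment> \<open>Prescribing zero in the other local rings allows surjectivity onto the whole
    product to be applied.\<close>
  define y where "y j = (if j = i then x else \<zero>\<^bsub>Os ! j\<^esub>)" for j
  have "y j \<in> carrier (Os ! j)" if "j < t" for j
  proof -
    interpret Oj: cring "Os ! j" by (rule cring_Os[OF that])
    show ?thesis using x by (simp add: y_def)
  qed
  then obtain f where f: "f \<in> carrier P" "homog k0 f" "\<rho> i f = x"
    using \<rho>_surj[of y k0] i by (auto simp: y_def)
  have "\<rho> i f \<in> W"
    by (rule homog_combination_mem[OF W(1) _ _ _ _ f(1,2)])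
      (use W(2) in \<open>auto simp: \<rho>_closed[OF i] \<rho>_add[OF i] \<rho>_mult[OF i] \<rho>_const[OF i]\<close>)
  then show "x \<in> W" using f by simp
qed

text \<open>Evaluation at the chosen generator identifies the i-th local ring with polynomials
  modulo \<open>g i\<close>; computations pass from abstract rings to remainders by this
  identification.\<close>

lemma obtain_data:
  obtains g h u r where "curvilinear_data n I t g h u r"
    "\<And>i. i < t \<Longrightarrow> degree (g i) = algebra_dim (\<psi> i) (Os ! i)"
    "\<And>i. i < t \<Longrightarrow> int (degree (h i)) = int (algebra_dim (\<psi> i) (Os ! i)) -
       (if CHAR('k) dvd algebra_dim (\<psi> i) (Os ! i) div residue_dim (\<psi> i) (Os ! i) then 0
        else int (residue_dim (\<psi> i) (Os ! i)))"
proof -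
  have "\<forall>i. \<exists>\<theta> g h u. i < t \<longrightarrow> monogenic_presentation (\<psi> i) (Os ! i) \<theta> g h u \<and>
      algebra_dim (\<psi> i) (Os ! i) = degree g \<and>
      int (degree h) = int (algebra_dim (\<psi> i) (Os ! i)) -
       (if CHAR('k) dvd algebra_dim (\<psi> i) (Os ! i) div residue_dim (\<psi> i) (Os ! i) then 0
        else int (residue_dim (\<psi> i) (Os ! i)))" (is "\<forall>i. \<exists>\<theta> g h u. i < t \<longrightarrow> ?Pr i \<theta> g h u")
  proof
    fix i
    show "\<exists>\<theta> g h u. i < t \<longrightarrow> ?Pr i \<theta> g h u"
    proof (cases "i < t")
      case True
      then have "weakly_curvilinear_ring (Os ! i)" using wc by simp
      from weakly_curvilinear_presentation[OF perfect this \<psi>_hom[OF True] fin_dim_Os[OF True]]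
      show ?thesis by blast
    qed simp
  qed
  then obtain \<theta> g h u where pr: "\<And>i. i < t \<Longrightarrow> ?Pr i (\<theta> i) (g i) (h i) (u i)" by metis
  define ev where "ev i = algebra_over.ev (Os ! i) (\<psi> i) (\<theta> i)" for i
  have pr': "\<theta> i \<in> carrier (Os ! i)" "g i \<noteq> 0" "h i \<noteq> 0"
    "\<And>x. x \<in> carrier (Os ! i) \<Longrightarrow> \<exists>p. x = ev i p" "\<And>p. ev i p = \<zero>\<^bsub>Os ! i\<^esub> \<longleftrightarrow> g i dvd p"
    "h i dvd g i" "h i dvd pderiv (g i)" "g i dvd pderiv (g i) * u i - h i" if "i < t" for i
    using pr[OF that] by (auto simp: monogenic_presentation_def ev_def)
  have alg: "algebra_over (Os ! i) (\<psi> i)" if "i < t" for i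
    by (intro algebra_over.intro algebra_over_axioms.intro cring_Os \<psi>_hom that)
  \<comment> \<open>The choice of a preimage is made canonical by reduction modulo
    \<open>g i\<close>.\<close>
  define r where "r i f = (SOME p. ev i p = \<rho> i f) mod g i" for i f
  have ev_mod: "ev i (p mod g i) = ev i p" if i: "i < t" for i p
  proof -
    interpret A: algebra_over "Os ! i" "\<psi> i" by (rule alg[OF i])
    have "ev i (p - p mod g i) = \<zero>\<^bsub>Os ! i\<^esub>" unfolding pr'(5)[OF i] by (metis dvd_minus_mod)
    then show ?thesis using pr'(1)[OF i] by (simp add: ev_def A.ev_minus)
  qed
  have ev_eq: "ev i p = ev i q \<longleftrightarrow> p mod g i = q mod g i" if i: "i < t" for i p q
  proof -
    interpret A: algebra_over "Os ! i" "\<psi> i" by (rule alg[OF i])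
    have "ev i p = ev i q \<longleftrightarrow> ev i (p - q) = \<zero>\<^bsub>Os ! i\<^esub>"
      using pr'(1)[OF i] by (simp add: ev_def A.ev_minus)
    also have "\<dots> \<longleftrightarrow> p mod g i = q mod g i"
      unfolding pr'(5)[OF i] by (simp add: mod_eq_dvd_iff)
    finally show ?thesis .
  qed
  have ev_r: "ev i (r i f) = \<rho> i f" if i: "i < t" and f: "f \<in> carrier P" for i f
  proof -
    obtain p where "\<rho> i f = ev i p" using pr'(4)[OF i \<rho>_closed[OF i f]] by blast
    then have "ev i (SOME p. ev i p = \<rho> i f) = \<rho> i f" by (intro someI[of "\<lambda>p. ev i p = \<rho> i f" p]) simp
    then show ?thesis by (simp add: r_def ev_mod[OF i])
  qed
  have r_mod: "r i f mod g i = r i f" for i f by (simp add: r_def)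
  have r_eqI: "r i f = p mod g i" if "i < t" "f \<in> carrier P" "ev i p = \<rho> i f" for i f p
    using ev_eq[OF that(1), of "r i f" p] ev_r[OF that(1,2)] that(3) r_mod[of i f] by simp
  have r_zero: "r i f = 0 \<longleftrightarrow> \<rho> i f = \<zero>\<^bsub>Os ! i\<^esub>" if i: "i < t" and f: "f \<in> carrier P" for i f
    using pr'(5)[OF i, of "r i f"] ev_r[OF i f] r_mod[of i f] by (auto simp: dvd_eq_mod_eq_0)
  have "curvilinear_data n I t g h u r"
  proof unfold_locales
    fix i assume i: "i < t"
    interpret A: algebra_over "Os ! i" "\<psi> i" by (rule alg[OF i])
    note \<theta> = pr'(1)[OF i]
    show "g i \<noteq> 0" "h i \<noteq> 0" "h i dvd g i" "h i dvd pderiv (g i)" "g i dvd pderiv (g i) * u i - h i"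
      using pr'[OF i] by blast+
    show "r i f mod g i = r i f" for f by (rule r_mod)
    show "r i (mpoly_const c) = [:c:] mod g i" for c
      using \<theta> by (intro r_eqI[OF i]) (simp_all add: \<rho>_const[OF i] ev_def A.ev_const)
    show "r i x0 = 1 mod g i"
      using \<theta> by (intro r_eqI[OF i]) (simp_all add: \<rho>_x0[OF i] ev_def)
    fix f f' assume f: "f \<in> carrier P" and f': "f' \<in> carrier P"
    show "r i (f * f') = (r i f * r i f') mod g i"
      using \<theta> f f' ev_r[OF i] by (intro r_eqI[OF i]) (simp_all add: \<rho>_mult[OF i] ev_def A.ev_mult)
    have "r i (f + f') = (r i f + r i f') mod g i"
      using \<theta> f f' ev_r[OF i] by (intro r_eqI[OF i]) (simp_all add: \<rho>_add[OF i] ev_def A.ev_add)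
    then show "r i (f + f') = r i f + r i f'" by (simp add: poly_mod_add_left r_mod)
  next
    fix i f assume i: "i < t" and f: "f \<in> I"
    have "dehom f = \<zero>\<^bsub>S\<^esub>" by (rule dehom_ideal_zero[OF f])
    then show "r i f = 0" using r_zero[OF i I_simps(1)[OF f]] \<rho>_zero_iff[OF I_simps(1)[OF f]] i by simp
  next
    fix f d assume f: "f \<in> carrier P" "homog d f" and z: "\<And>i. i < t \<Longrightarrow> r i f = 0"
    then have "\<forall>i<t. \<rho> i f = \<zero>\<^bsub>Os ! i\<^esub>" using r_zero[OF _ f(1)] by simp
    then show "f \<in> I" using \<rho>_zero_iff[OF f(1)] dehom_homog_zero_iff[OF f] by simp
  next
    fix d and p :: "nat \<Rightarrow> 'k poly" assume d: "k0 \<le> d"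
    have "ev i (p i) \<in> carrier (Os ! i)" if i: "i < t" for i
    proof -
      interpret A: algebra_over "Os ! i" "\<psi> i" by (rule alg[OF i])
      show ?thesis using pr'(1)[OF i] by (simp add: ev_def)
    qed
    then obtain f where f: "f \<in> carrier P" "homog d f" "\<forall>i<t. \<rho> i f = ev i (p i)"
      using \<rho>_surj[of "\<lambda>i. ev i (p i)" d] d by blast
    then show "\<exists>f\<in>carrier P. homog d f \<and> (\<forall>i<t. r i f = p i mod g i)"
      using r_eqI by (intro bexI[of _ f]) auto
  qed
  then show ?thesis using that[of g h u r] pr by simp
qed

end

section \<open>Derivation-like functionals on a curvilinear scheme\<close>

lemma poly_sum_monoms_mod:
  fixes p q :: "'k::field poly"
  assumes "q \<noteq> 0" "p mod q = p"
  shows "p = (\<Sum>k<degree q. Polynomial.monom (poly.coeff p k) k)"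
proof (cases "degree q = 0")
  case True
  then have "p = 0" using assms by (metis is_unit_iff_degree mod_eq_0_iff_dvd unit_imp_dvd)
  then show ?thesis by simp
next
  case False
  then have "degree p \<le> degree q - 1"
    using degree_mod_less[OF assms(1), of p] assms(2) by auto
  from poly_as_sum_of_monoms'[OF this] False show ?thesis
    by (simp add: lessThan_Suc_atMost[symmetric])
qed

context curvilinear_data
begin

definition PH :: "nat \<Rightarrow> 'k mpoly set" where
  "PH d = {f \<in> carrier P. homog d f}"

lemma PH_carrier: "f \<in> PH d \<Longrightarrow> f \<in> carrier P"
  by (simp add: PH_def)

lemma PH_zero [simp]: "0 \<in> PH d"
  by (simp add: PH_def homog_zero)

lemma PH_add: "f \<in> PH d \<Longrightarrow> f' \<in> PH d \<Longrightarrow> f + f' \<in> PH d"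
  by (simp add: PH_def homog_add)

lemma PH_mult: "f \<in> PH a \<Longrightarrow> f' \<in> PH b \<Longrightarrow> d = a + b \<Longrightarrow> f * f' \<in> PH d"
  by (simp add: PH_def homog_mult)

lemma PH_const [simp]: "mpoly_const c \<in> PH 0"
  by (simp add: PH_def homog_const)

lemma PH_const_mult: "f \<in> PH d \<Longrightarrow> mpoly_const c * f \<in> PH d"
  by (rule PH_mult[OF PH_const]) simp_all

lemma PH_var: "j \<le> n \<Longrightarrow> mpoly_var j \<in> PH 1"
  using homog_var[of j] by (simp add: PH_def)

lemma PH_x0_power [simp]: "x0 ^ k \<in> PH k"
  by (simp add: PH_def homog_var_power)

lemma PH_sum: "(\<And>i. i \<in> A \<Longrightarrow> f i \<in> PH d) \<Longrightarrow> (\<Sum>i\<in>A. f i) \<in> PH d"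
  by (simp add: PH_def homog_sum)

lemma r_zero: "i < t \<Longrightarrow> r i 0 = 0"
  by (rule r_ideal[OF _ I_simps(3)])

lemma r_diff: "i < t \<Longrightarrow> f \<in> carrier P \<Longrightarrow> f' \<in> carrier P \<Longrightarrow> r i (f - f') = r i f - r i f'"
  using r_add[of i "f - f'" f'] by simp

lemma r_sum: "i < t \<Longrightarrow> (\<And>j. j \<in> A \<Longrightarrow> f j \<in> carrier P) \<Longrightarrow> r i (\<Sum>j\<in>A. f j) = (\<Sum>j\<in>A. r i (f j))"
  by (induction A rule: infinite_finite_induct) (simp_all add: r_zero r_add)

lemma r_const_mult: "i < t \<Longrightarrow> f \<in> carrier P \<Longrightarrow> r i (mpoly_const c * f) = Polynomial.smult c (r i f)"
  by (simp add: r_mult r_const mod_mult_left_eq mod_smult_left r_mod)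

text \<open>As \<open>x0\<close> becomes 1 in \<open>S\<close>, its powers change the degree of a
  form but none of its representatives.\<close>

lemma r_x0_power: "i < t \<Longrightarrow> f \<in> carrier P \<Longrightarrow> r i (x0 ^ k * f) = r i f"
proof (induction k)
  case (Suc k)
  have "r i (x0 ^ Suc k * f) = r i (x0 * (x0 ^ k * f))" by (simp add: mult.assoc)
  also have "\<dots> = r i f" using Suc by (simp add: r_mult r_x0 mod_mult_left_eq r_mod)
  finally show ?case .
qed simp

text \<open>The difference is again a form of degree \<open>d\<close>, and on such forms the
  representatives detect membership in \<open>I\<close>.\<close>

lemma r_eq_imp: "f \<in> PH d \<Longrightarrow> f' \<in> PH d \<Longrightarrow> (\<And>i. i < t \<Longrightarrow> r i f = r i f') \<Longrightarrow> f - f' \<in> I"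
proof -
  assume f: "f \<in> PH d" "f' \<in> PH d" and eq: "\<And>i. i < t \<Longrightarrow> r i f = r i f'"
  have "f + mpoly_const (-1) * f' \<in> PH d" by (intro PH_add PH_const_mult f)
  moreover have "f + mpoly_const (-1) * f' = f - f'"
  proof -
    have "mpoly_const (-1) = - (1 :: 'k mpoly)" by (simp add: mpoly_const_def single_uminus flip: single_one)
    then show ?thesis by simp
  qed
  ultimately have "f - f' \<in> PH d" by simp
  then show "f - f' \<in> I" using r_eq_zero[of "f - f'" d] f eq by (simp add: PH_def r_diff)
qed

text \<open>Lowers the degree of a coefficient while keeping its representatives, to make room for
  further factors. The quotient must still have degree at least \<open>k0\<close>.\<close>

lemma divide_PH:
  assumes "f \<in> PH a" "k0 + N \<le> a"
  shows "\<exists>c\<in>PH (a - N). f - x0 ^ N * c \<in> I \<and> (\<forall>i<t. r i c = r i f)"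
proof -
  have "k0 \<le> a - N" "N + (a - N) = a" using assms(2) by simp_all
  then obtain c where c: "c \<in> carrier P" "homog (a - N) c" "f - x0 ^ N * c \<in> I"
    using divide_x0_power[of "a - N" f N] assms(1) by (auto simp: PH_def)
  have "r i c = r i f" if i: "i < t" for i
  proof -
    have fP: "f \<in> carrier P" using assms(1) by (rule PH_carrier)
    have "0 = r i (f - x0 ^ N * c)" using r_ideal[OF i c(3)] by simp
    also have "\<dots> = r i f - r i (x0 ^ N * c)" using fP c(1) by (intro r_diff i) simp_all
    finally show ?thesis using r_x0_power[OF i c(1)] by simp
  qed
  then show ?thesis using c by (intro bexI[of _ c]) (simp_all add: PH_def)
qed

text \<open>Common degree of the lifted idempotents and of \<open>Y\<close>. At least
  \<open>k0\<close>, so that representatives can be prescribed; at least 1, so that a variable can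
  be raised to degree \<open>D\<close> by a power of \<open>x0\<close>.\<close>

definition D :: nat where "D = max k0 1"

lemma D: "k0 \<le> D" "1 \<le> D"
  by (simp_all add: D_def)

text \<open>Chinese remainder theorem in degree \<open>a\<close>: a form with prescribed
  representatives. The choice is meaningful only for \<open>a\<close> at least \<open>k0\<close>,
  and then unique modulo \<open>I\<close>.\<close>

definition el :: "nat \<Rightarrow> (nat \<Rightarrow> 'k poly) \<Rightarrow> 'k mpoly" where
  "el a p = (SOME f. f \<in> PH a \<and> (\<forall>i<t. r i f = p i mod g i))"

lemma el: "k0 \<le> a \<Longrightarrow> el a p \<in> PH a \<and> (\<forall>i<t. r i (el a p) = p i mod g i)"
proof -
  assume "k0 \<le> a"
  then have "\<exists>f. f \<in> PH a \<and> (\<forall>i<t. r i f = p i mod g i)"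
    using r_surj[of a p] by (auto simp: PH_def)
  then show ?thesis unfolding el_def by (rule someI_ex)
qed

lemma el_PH: "k0 \<le> a \<Longrightarrow> el a p \<in> PH a"
  and r_el: "k0 \<le> a \<Longrightarrow> i < t \<Longrightarrow> r i (el a p) = p i mod g i"
  using el by blast+

lemma el_P: "k0 \<le> a \<Longrightarrow> el a p \<in> carrier P"
  using el_PH PH_carrier by blast

lemma el_zero: "k0 \<le> a \<Longrightarrow> (\<And>i. i < t \<Longrightarrow> g i dvd p i) \<Longrightarrow> el a p \<in> I"
  using r_eq_zero[of "el a p" a] el_PH[of a p] by (auto simp: PH_def r_el dvd_eq_mod_eq_0)

definition only :: "nat \<Rightarrow> 'k poly \<Rightarrow> nat \<Rightarrow> 'k poly" where
  "only i p = (\<lambda>j. if j = i then p else 0)"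

text \<open>One form of degree \<open>D\<close> that represents \<theta> in all local rings at
  once.\<close>

definition Y :: "'k mpoly" where
  "Y = el D (\<lambda>_. [:0, 1:])"

lemma Y: "Y \<in> PH D" "i < t \<Longrightarrow> r i Y = [:0, 1:] mod g i"
  unfolding Y_def using el_PH[OF D(1)] r_el[OF D(1)] by simp_all

end

text \<open>\<open>\<Delta> f x\<close> stands for the value of a functional on \<open>f dx \<and> \<omega>\<close>, where \<open>\<omega>\<close> is a fixed form
  and \<open>f dx\<close> has degree \<open>d\<close>.\<close>

locale one_form = curvilinear_data n I t g h u r
  for n and I :: "'k::field mpoly set" and t g h u r +
  fixes d :: nat and \<Delta> :: "'k mpoly \<Rightarrow> 'k mpoly \<Rightarrow> 'k"
  assumes add_left: "a + b = d \<Longrightarrow> f \<in> PH a \<Longrightarrow> f' \<in> PH a \<Longrightarrow> x \<in> PH b \<Longrightarrow> \<Delta> (f + f') x = \<Delta> f x + \<Delta> f' x"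
    and add_right: "a + b = d \<Longrightarrow> f \<in> PH a \<Longrightarrow> x \<in> PH b \<Longrightarrow> y \<in> PH b \<Longrightarrow> \<Delta> f (x + y) = \<Delta> f x + \<Delta> f y"
    and const_left: "a + b = d \<Longrightarrow> f \<in> PH a \<Longrightarrow> x \<in> PH b \<Longrightarrow> \<Delta> (mpoly_const c * f) x = c * \<Delta> f x"
    and zero_left: "a + b = d \<Longrightarrow> f \<in> PH a \<Longrightarrow> x \<in> PH b \<Longrightarrow> f \<in> I \<Longrightarrow> \<Delta> f x = 0"
    and zero_right: "a + b = d \<Longrightarrow> f \<in> PH a \<Longrightarrow> x \<in> PH b \<Longrightarrow> x \<in> I \<Longrightarrow> \<Delta> f x = 0"
    and leibniz: "a + b + b' = d \<Longrightarrow> f \<in> PH a \<Longrightarrow> x \<in> PH b \<Longrightarrow> y \<in> PH b' \<Longrightarrow>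
      \<Delta> f (x * y) = \<Delta> (f * x) y + \<Delta> (f * y) x"
    and const_zero: "f \<in> PH d \<Longrightarrow> \<Delta> f (mpoly_const c) = 0"
    and x0_zero: "a + 1 = d \<Longrightarrow> f \<in> PH a \<Longrightarrow> \<Delta> f x0 = 0"
    and large: "k0 + 3 * D \<le> d"
begin

lemma cong_left:
  assumes "a + b = d" "f \<in> PH a" "f' \<in> PH a" "x \<in> PH b" "\<And>i. i < t \<Longrightarrow> r i f = r i f'"
  shows "\<Delta> f x = \<Delta> f' x"
proof -
  have I: "f - f' \<in> I" using r_eq_imp[OF assms(2,3,5)] by blast
  have e: "f - f' = f + mpoly_const (-1) * f'" by (simp add: mpoly_const_def single_uminus flip: single_one)
  have m: "f - f' \<in> PH a" unfolding e by (intro PH_add PH_const_mult assms)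
  have "\<Delta> (f' + (f - f')) x = \<Delta> f' x + \<Delta> (f - f') x" by (rule add_left[OF assms(1,3) m assms(4)])
  then show ?thesis using zero_left[OF assms(1) m assms(4) I] by simp
qed

lemma cong_right:
  assumes "a + b = d" "f \<in> PH a" "x \<in> PH b" "y \<in> PH b" "\<And>i. i < t \<Longrightarrow> r i x = r i y"
  shows "\<Delta> f x = \<Delta> f y"
proof -
  have I: "x - y \<in> I" using r_eq_imp[OF assms(3,4,5)] by blast
  have e: "x - y = x + mpoly_const (-1) * y" by (simp add: mpoly_const_def single_uminus flip: single_one)
  have m: "x - y \<in> PH b" unfolding e by (intro PH_add PH_const_mult assms)
  have "\<Delta> f (y + (x - y)) = \<Delta> f y + \<Delta> f (x - y)" by (rule add_right[OF assms(1,2,4) m])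
  then show ?thesis using zero_right[OF assms(1,2) m I] by simp
qed

lemma const_right:
  assumes "a + b = d" "f \<in> PH a" "x \<in> PH b"
  shows "\<Delta> f (mpoly_const c * x) = c * \<Delta> f x"
proof -
  have "\<Delta> f (mpoly_const c * x) = \<Delta> (f * mpoly_const c) x + \<Delta> (f * x) (mpoly_const c)"
    using leibniz[OF _ assms(2) PH_const assms(3), of c] assms(1) by simp
  also have "\<Delta> (f * x) (mpoly_const c) = 0"
    using PH_mult[OF assms(2,3) assms(1)[symmetric]] by (rule const_zero)
  finally show ?thesis using const_left[OF assms] by (simp add: mult.commute)
qed

lemma sum_left:
  assumes "a + b = d" "\<And>i. i \<in> A \<Longrightarrow> f i \<in> PH a" "x \<in> PH b"
  shows "\<Delta> (\<Sum>i\<in>A. f i) x = (\<Sum>i\<in>A. \<Delta> (f i) x)"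
  using assms(2)
proof (induction A rule: infinite_finite_induct)
  case (insert i A)
  then show ?case using add_left[OF assms(1) _ _ assms(3), of "f i" "\<Sum>i\<in>A. f i"] PH_sum[of A f a] by simp
qed (use zero_left[OF assms(1) PH_zero assms(3) I_simps(3)] in simp_all)

lemma sum_right:
  assumes "a + b = d" "f \<in> PH a" "\<And>i. i \<in> A \<Longrightarrow> x i \<in> PH b"
  shows "\<Delta> f (\<Sum>i\<in>A. x i) = (\<Sum>i\<in>A. \<Delta> f (x i))"
  using assms(3)
proof (induction A rule: infinite_finite_induct)
  case (insert i A)
  then show ?case using add_right[OF assms(1,2), of "x i" "\<Sum>i\<in>A. x i"] PH_sum[of A x b] by simp
qed (use zero_right[OF assms(1,2) PH_zero I_simps(3)] in simp_all)

lemma x0_power_zero: "a + k = d \<Longrightarrow> f \<in> PH a \<Longrightarrow> \<Delta> f (x0 ^ k) = 0"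
proof (induction k arbitrary: a f)
  case 0
  then show ?case using const_zero[of f 1] by simp
next
  case (Suc k)
  have "\<Delta> f (x0 ^ 1 * x0 ^ k) = \<Delta> (f * x0 ^ 1) (x0 ^ k) + \<Delta> (f * x0 ^ k) (x0 ^ 1)"
    by (rule leibniz[of a 1 k]) (use Suc.prems in \<open>simp_all add: PH_x0_power[of 1, simplified]\<close>)
  moreover have "\<Delta> (f * x0 ^ 1) (x0 ^ k) = 0"
    using Suc.prems PH_x0_power[of 1] by (intro Suc.IH[of "a + 1"] PH_mult[of f a]) simp_all
  moreover have "\<Delta> (f * x0 ^ k) x0 = 0"
    using Suc.prems by (intro x0_zero[of "a + k"] PH_mult[of f a]) simp_all
  ultimately show ?case by simp
qed

text \<open>The Leibniz term with the differential of a power of \<open>x0\<close> vanishes, so such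
  powers act as padding that can be placed on either side.\<close>

lemma x0_power_right:
  assumes "a + k + b = d" "f \<in> PH a" "x \<in> PH b"
  shows "\<Delta> f (x0 ^ k * x) = \<Delta> (f * x0 ^ k) x"
proof -
  have "\<Delta> (f * x) (x0 ^ k) = 0"
    using assms by (intro x0_power_zero[of "a + b"] PH_mult) simp_all
  then show ?thesis using leibniz[OF assms(1,2) PH_x0_power assms(3)] by simp
qed

abbreviation "b \<equiv> el D"

lemmas b_PH = el_PH[OF D(1)] and r_b = r_el[OF D(1)] and b_P = el_P[OF D(1)]

lemma PH_mult_x0: "f \<in> PH a \<Longrightarrow> d' = a + k \<Longrightarrow> f * x0 ^ k \<in> PH d'"
  by (rule PH_mult[OF _ PH_x0_power])

lemma PH_mult_b: "f \<in> PH a \<Longrightarrow> d' = a + D \<Longrightarrow> f * b p \<in> PH d'"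
  by (rule PH_mult[OF _ b_PH])

lemma PH_mult_Y: "f \<in> PH a \<Longrightarrow> d' = a + D \<Longrightarrow> f * Y \<in> PH d'"
  by (rule PH_mult[OF _ Y(1)])

text \<open>For an idempotent \<open>e\<close>, the identity \<open>(1 - 2 e) de = 0\<close> forces \<open>de = 0\<close>, as
  \<open>(1 - 2 e)\<^sup>2 = 1\<close>.\<close>

lemma idempotent_zero:
  assumes i: "i < t" and f: "f \<in> PH (d - D)"
  shows "\<Delta> f (b (only i 1)) = 0"
proof -
  let ?e = "b (only i 1)"
  \<comment> \<open>Homogeneous version of 1 - 2 e, in degree \<open>D\<close>.\<close>
  define q where "q = x0 ^ D + mpoly_const (- 2) * ?e"
  have q: "q \<in> PH D" unfolding q_def by (intro PH_add PH_const_mult PH_x0_power b_PH)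
  have step: "\<Delta> (f2 * q) ?e = 0" if f2: "f2 \<in> PH (d - 2 * D)" for f2
  proof -
    have dd: "d - 2 * D + D + D = d" "d - D + D = d" using large by simp_all
    have m: "f2 * x0 ^ D \<in> PH (d - D)" "f2 * ?e \<in> PH (d - D)"
      using f2 large by (auto intro!: PH_mult_x0[OF f2] PH_mult_b[OF f2] PH_mult_Y[OF f2] b_PH)
    \<comment> \<open>The identity e^2 = e only balances in degree 2 D, where it reads e e = x0^D e
      modulo \<open>I\<close>.\<close>
    have "\<Delta> f2 (?e * ?e) = \<Delta> f2 (x0 ^ D * ?e)"
    proof (rule cong_right[of "d - 2 * D" "D + D"])
      fix j assume j: "j < t"
      have "r j (?e * ?e) = (only i 1 j * only i 1 j) mod g j"
        using j by (simp add: r_mult b_P r_b mod_mult_eq)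
      also have "\<dots> = r j (x0 ^ D * ?e)" using j by (simp add: r_x0_power b_P r_b only_def)
      finally show "r j (?e * ?e) = r j (x0 ^ D * ?e)" .
    qed (use f2 dd in \<open>auto intro!: PH_mult[OF b_PH b_PH] PH_mult[OF PH_x0_power b_PH]\<close>)
    then have eq: "\<Delta> (f2 * ?e) ?e + \<Delta> (f2 * ?e) ?e = \<Delta> (f2 * x0 ^ D) ?e"
      using leibniz[OF dd(1) f2 b_PH b_PH, of "only i 1" "only i 1"] x0_power_right[OF dd(1) f2 b_PH] by simp
    have e: "f2 * q = f2 * x0 ^ D + mpoly_const (- 2) * (f2 * ?e)" by (simp add: q_def algebra_simps)
    have "\<Delta> (f2 * q) ?e = \<Delta> (f2 * x0 ^ D) ?e + - 2 * \<Delta> (f2 * ?e) ?e"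
      unfolding e by (simp add: add_left[OF dd(2) m(1) PH_const_mult[OF m(2)] b_PH] const_left[OF dd(2) m(2) b_PH])
    then show ?thesis using eq by (simp add: algebra_simps)
  qed
  \<comment> \<open>The differentiated idempotent already takes degree \<open>D\<close>. Removing 2
    D more from \<open>f\<close> leaves room for two factors \<open>q\<close>, whose product
    represents 1.\<close>
  have "k0 + 2 * D \<le> d - D" using large by linarith
  then obtain f1 where f1: "f1 \<in> PH (d - D - 2 * D)" "\<And>j. j < t \<Longrightarrow> r j f1 = r j f"
    using divide_PH[OF f] by blast
  have f1q: "f1 * q \<in> PH (d - 2 * D)" by (rule PH_mult[OF f1(1) q]) (use large in simp)
  have "\<Delta> f ?e = \<Delta> (f1 * q * q) ?e"
  proof (rule cong_left[of "d - D" D])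
    fix j assume j: "j < t"
    define s :: "'k poly" where "s = (if j = i then - 1 else 1)"
    have "r j q = r j (x0 ^ D * 1) + r j (mpoly_const (- 2) * ?e)"
      using j b_P by (simp add: q_def r_add)
    also have "r j (x0 ^ D * 1) = 1 mod g j"
      using r_const[OF j, of 1] by (subst r_x0_power[OF j]) (simp_all add: one_pCons)
    also have "r j (mpoly_const (- 2) * ?e) = Polynomial.smult (- 2) (only i 1 j) mod g j"
      using j b_P by (simp add: r_const_mult r_b mod_smult_left)
    also have "1 mod g j + Polynomial.smult (- 2) (only i 1 j) mod g j = s mod g j"
    proof -
      have "1 + Polynomial.smult (- 2) (only i 1 j) = s" by (auto simp: s_def only_def one_pCons)
      then show ?thesis by (simp only: poly_mod_add_left[symmetric])
    qed
    finally have rq: "r j q = s mod g j" .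
    have "r j (f1 * q * q) = (r j f1 * s * s) mod g j"
      using j f1(1) q PH_carrier by (simp add: r_mult rq mod_mult_left_eq mod_mult_right_eq)
    also have "r j f1 * s * s = r j f1" by (simp add: s_def)
    also have "r j f1 mod g j = r j f" using f1 j r_mod PH_carrier by metis
    finally show "r j f = r j (f1 * q * q)" by simp
  qed (use f f1q b_PH large in \<open>auto intro!: PH_mult[OF f1q q]\<close>)
  then show ?thesis using step[OF f1q] by simp
qed

text \<open>Chain rule d(p(Y) e) = p'(Y) e dY for the idempotent e of the i-th factor. The power of
  \<open>x0\<close> on the left balances the degree of the lift of p' on the right.\<close>

lemma derivative:
  assumes i: "i < t" and f: "f \<in> PH (d - 2 * D)"
  shows "\<Delta> (f * x0 ^ D) (b (only i p)) = \<Delta> (f * b (only i (pderiv p))) Y"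
  using f
proof (induction p arbitrary: f)
  case 0
  have m: "f * x0 ^ D \<in> PH (d - D)" "f * b (only i 0) \<in> PH (d - D)"
    using large by (auto intro!: PH_mult_x0[OF 0(1)] PH_mult_b[OF 0(1)] b_PH)
  have z: "b (only i 0) \<in> I" by (rule el_zero[OF D(1)]) (simp add: only_def)
  then have "\<Delta> (f * x0 ^ D) (b (only i 0)) = 0"
    using large by (intro zero_right[OF _ m(1) b_PH]) simp_all
  moreover have "\<Delta> (f * b (only i 0)) Y = 0"
    using large z PH_carrier[OF 0(1)] by (intro zero_left[OF _ m(2) Y(1)] I_simps(4)) simp_all
  ultimately show ?case by simp
next
  case (pCons c p)
  note f = pCons.prems
  have dd: "d - D + D = d" "d - 2 * D + D + D = d" using large by simp_all
  \<comment> \<open>The Horner step produces one more factor \<open>Y\<close> in the coefficient;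
    lowering \<open>f\<close> by \<open>D\<close> makes room for it.\<close>
  have "k0 + D \<le> d - 2 * D" using large by linarith
  then obtain f1 where f1: "f1 \<in> PH (d - 2 * D - D)" "\<And>j. j < t \<Longrightarrow> r j f1 = r j f"
    using divide_PH[OF f] by blast
  note f1P = PH_carrier[OF f1(1)] and fP = PH_carrier[OF f]
  let ?e = "b (only i 1)" and ?yp = "b (only i (pCons 0 p))" and ?p = "b (only i p)" and ?p' = "b (only i (pderiv p))"
  have m: "f * x0 ^ D \<in> PH (d - D)" "f1 * x0 ^ D \<in> PH (d - 2 * D)" "f1 * Y \<in> PH (d - 2 * D)"
    using large by (auto intro!: PH_mult_x0[OF f] PH_mult_b[OF f] PH_mult_Y[OF f] PH_mult_x0[OF f1(1)] PH_mult_b[OF f1(1)] PH_mult_Y[OF f1(1)] Y)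
  have m2: "f1 * x0 ^ D * x0 ^ D \<in> PH (d - D)" "f1 * x0 ^ D * ?p \<in> PH (d - D)" "f1 * Y * ?p' \<in> PH (d - D)"
    using large by (auto intro!: PH_mult_x0[OF m(2)] PH_mult_b[OF m(2)] PH_mult_Y[OF m(2)] PH_mult_x0[OF m(3)] PH_mult_b[OF m(3)] PH_mult_Y[OF m(3)] b_PH)
  have "\<Delta> (f * x0 ^ D) (b (only i (pCons c p))) = \<Delta> (f * x0 ^ D) (mpoly_const c * ?e + ?yp)"
  proof (rule cong_right[OF dd(1) m(1) b_PH])
    show "mpoly_const c * ?e + ?yp \<in> PH D" by (intro PH_add PH_const_mult b_PH)
    fix j assume j: "j < t"
    have "r j (mpoly_const c * ?e + ?yp) = (Polynomial.smult c (only i 1 j) + only i (pCons 0 p) j) mod g j"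
      using j b_P by (simp add: r_add r_const_mult r_b mod_smult_left poly_mod_add_left)
    then show "r j (b (only i (pCons c p))) = r j (mpoly_const c * ?e + ?yp)"
      using j by (simp add: r_b only_def one_pCons)
  qed
  \<comment> \<open>The constant term of the polynomial contributes a multiple of the differential
    of the idempotent, which is zero.\<close>
  also have "\<dots> = \<Delta> (f * x0 ^ D) ?yp"
    using idempotent_zero[OF i m(1)]
    by (simp add: add_right[OF dd(1) m(1) PH_const_mult[OF b_PH] b_PH] const_right[OF dd(1) m(1) b_PH])
  also have "\<dots> = \<Delta> (f1 * x0 ^ D * x0 ^ D) ?yp"
  proof (rule cong_left[OF dd(1) m(1) m2(1) b_PH])
    fix j assume j: "j < t"
    have "r j (f * x0 ^ D) = r j f" using r_x0_power[OF j fP, of D] by (simp add: mult.commute)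
    moreover have "r j (f1 * x0 ^ D * x0 ^ D) = r j f1"
      using r_x0_power[OF j f1P, of "D + D"] by (simp add: mult.commute mult.left_commute power_add)
    ultimately show "r j (f * x0 ^ D) = r j (f1 * x0 ^ D * x0 ^ D)" using f1(2)[OF j] by simp
  qed
  also have "\<dots> = \<Delta> (f1 * x0 ^ D) (x0 ^ D * ?yp)"
    by (rule x0_power_right[OF dd(2) m(2) b_PH, symmetric])
  also have "\<dots> = \<Delta> (f1 * x0 ^ D) (?p * Y)"
  proof (rule cong_right[of "d - 2 * D" "D + D"])
    fix j assume j: "j < t"
    have "r j (?p * Y) = (only i p j * [:0, 1:]) mod g j"
      using j PH_carrier[OF Y(1)] b_P by (simp add: r_mult r_b Y mod_mult_eq)
    also have "\<dots> = r j (x0 ^ D * ?yp)" using j b_P by (simp add: r_x0_power r_b only_def)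
    finally show "r j (x0 ^ D * ?yp) = r j (?p * Y)" by simp
  qed (use m dd in \<open>auto intro!: PH_mult[OF b_PH Y(1)] PH_mult[OF PH_x0_power b_PH]\<close>)
  also have "\<dots> = \<Delta> (f1 * x0 ^ D * ?p) Y + \<Delta> (f1 * x0 ^ D * Y) ?p"
    by (rule leibniz[OF dd(2) m(2) b_PH Y(1)])
  also have "f1 * x0 ^ D * Y = f1 * Y * x0 ^ D" by (simp add: mult_ac)
  also have "\<Delta> (f1 * Y * x0 ^ D) ?p = \<Delta> (f1 * Y * ?p') Y" by (rule pCons.IH[OF m(3)])
  also have "\<Delta> (f1 * x0 ^ D * ?p) Y + \<Delta> (f1 * Y * ?p') Y = \<Delta> (f1 * x0 ^ D * ?p + f1 * Y * ?p') Y"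
    by (rule add_left[OF dd(1) m2(2,3) Y(1), symmetric])
  also have "\<dots> = \<Delta> (f * b (only i (pderiv (pCons c p)))) Y"
  proof (rule cong_left[OF dd(1) PH_add[OF m2(2,3)] _ Y(1)])
    show "f * b (only i (pderiv (pCons c p))) \<in> PH (d - D)" using large by (auto intro!: PH_mult_x0[OF f] PH_mult_b[OF f] PH_mult_Y[OF f] b_PH)
    fix j assume j: "j < t"
    have 1: "r j (f1 * x0 ^ D * ?p) = (r j f * only i p j) mod g j"
    proof -
      have "r j (f1 * x0 ^ D * ?p) = r j (x0 ^ D * (f1 * ?p))" by (simp add: mult_ac)
      also have "\<dots> = r j (f1 * ?p)" using f1P b_P by (intro r_x0_power j P_mult)
      also have "\<dots> = (r j f * only i p j) mod g j"
        using j f1P b_P f1(2) by (simp add: r_mult r_b mod_mult_right_eq)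
      finally show ?thesis .
    qed
    have 2: "r j (f1 * Y * ?p') = (r j f * ([:0, 1:] * only i (pderiv p) j)) mod g j"
    proof -
      have YP: "Y \<in> carrier P" by (rule PH_carrier[OF Y(1)])
      have yp: "r j (Y * ?p') = ([:0, 1:] * only i (pderiv p) j) mod g j"
        unfolding r_mult[OF j YP b_P] r_b[OF j] Y(2)[OF j] by (rule mod_mult_eq)
      have "r j (f1 * Y * ?p') = r j (f1 * (Y * ?p'))" by (simp add: mult_ac)
      also have "\<dots> = (r j f1 * r j (Y * ?p')) mod g j" by (intro r_mult j f1P P_mult YP b_P)
      also have "\<dots> = (r j f * ([:0, 1:] * only i (pderiv p) j)) mod g j"
        unfolding yp f1(2)[OF j] by (rule mod_mult_right_eq)
      finally show ?thesis .
    qed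
    have "r j (f1 * x0 ^ D * ?p + f1 * Y * ?p') =
        (r j f * only i p j + r j f * ([:0, 1:] * only i (pderiv p) j)) mod g j"
      using j m2 PH_carrier by (simp add: r_add 1 2 poly_mod_add_left)
    also have "r j f * only i p j + r j f * ([:0, 1:] * only i (pderiv p) j) =
        r j f * only i (pderiv (pCons c p)) j"
      by (simp add: only_def pderiv_pCons distrib_left)
    finally show "r j (f1 * x0 ^ D * ?p + f1 * Y * ?p') = r j (f * b (only i (pderiv (pCons c p))))"
      using j fP b_P by (simp add: r_mult r_b mod_mult_right_eq)
  qed
  finally show ?case .
qed

text \<open>The lift of \<open>g i\<close> lies in \<open>I\<close>, so the chain rule gives g'(Y)
  dY = 0 in the i-th factor; multiplication by \<open>u i\<close> turns g' into
  \<open>h i\<close>.\<close>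

lemma vanish_h:
  assumes i: "i < t" and F: "F \<in> PH (d - 2 * D)"
  shows "\<Delta> (F * b (only i (h i))) Y = 0"
proof -
  have dd: "d - D + D = d" using large by simp
  have "k0 + D \<le> d - 2 * D" using large by linarith
  then obtain F1 where F1: "F1 \<in> PH (d - 2 * D - D)" "\<And>j. j < t \<Longrightarrow> r j F1 = r j F"
    using divide_PH[OF F] by blast
  let ?u = "b (only i (u i))" and ?g' = "b (only i (pderiv (g i)))"
  have m: "F1 * ?u \<in> PH (d - 2 * D)" using large by (auto intro!: PH_mult_x0[OF F1(1)] PH_mult_b[OF F1(1)] PH_mult_Y[OF F1(1)] b_PH)
  have m2: "F1 * ?u * x0 ^ D \<in> PH (d - D)" "F1 * ?u * ?g' \<in> PH (d - D)" "F * b (only i (h i)) \<in> PH (d - D)"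
    using large by (auto intro!: PH_mult_x0[OF m] PH_mult_b[OF m] PH_mult_Y[OF m] PH_mult_x0[OF F] PH_mult_b[OF F] PH_mult_Y[OF F] b_PH)
  have "b (only i (g i)) \<in> I" by (rule el_zero[OF D(1)]) (simp add: only_def)
  then have "0 = \<Delta> (F1 * ?u * x0 ^ D) (b (only i (g i)))" using zero_right[OF dd m2(1) b_PH] by simp
  also have "\<dots> = \<Delta> (F1 * ?u * ?g') Y" by (rule derivative[OF i m])
  also have "\<dots> = \<Delta> (F * b (only i (h i))) Y"
  proof (rule cong_left[OF dd m2(2,3) Y(1)])
    fix j assume j: "j < t"
    have ug: "r j (?u * ?g') = (only i (u i) j * only i (pderiv (g i)) j) mod g j"
      using j b_P by (simp add: r_mult r_b mod_mult_eq)
    have "r j (F1 * ?u * ?g') = r j (F1 * (?u * ?g'))" by (simp add: mult_ac)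
    also have "\<dots> = (r j F1 * r j (?u * ?g')) mod g j"
      using j PH_carrier[OF F1(1)] b_P by (intro r_mult P_mult)
    also have "\<dots> = (r j F * (only i (u i) j * only i (pderiv (g i)) j)) mod g j"
      unfolding ug F1(2)[OF j] by (rule mod_mult_right_eq)
    also have "\<dots> = (r j F * ((only i (u i) j * only i (pderiv (g i)) j) mod g j)) mod g j"
      by (simp add: mod_mult_right_eq)
    also have "(only i (u i) j * only i (pderiv (g i)) j) mod g j = only i (h i) j mod g j"
      using g_dvd_h[OF i] by (simp add: only_def mod_eq_dvd_iff mult.commute)
    also have "(r j F * (only i (h i) j mod g j)) mod g j = r j (F * b (only i (h i)))"
      using j PH_carrier[OF F] b_P by (simp add: r_mult r_b)
    finally show "r j (F1 * ?u * ?g') = r j (F * b (only i (h i)))" .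
  qed
  finally show ?thesis by simp
qed

text \<open>In each factor the coefficient is divided by \<open>h i\<close>: the multiple of
  \<open>h i\<close> gives zero, and the remainder is a combination of the powers covered by
  \<open>basis\<close>.\<close>

lemma vanish_Y:
  assumes basis: "\<And>i k. i < t \<Longrightarrow> k < degree (h i) \<Longrightarrow> \<Delta> (el (d - D) (only i (Polynomial.monom 1 k))) Y = 0"
    and F: "F \<in> PH (d - D)"
  shows "\<Delta> F Y = 0"
proof -
  have dd: "d - D + D = d" and ka: "k0 \<le> d - D" "k0 \<le> d - 2 * D" using large by simp_all
  let ?E = "el (d - D)"
  define q where "q i = r i F div h i" for i
  define s where "s i = r i F mod h i" for i
  define G where "G i = el (d - 2 * D) (only i (q i)) * b (only i (h i)) +
    (\<Sum>k<degree (h i). mpoly_const (poly.coeff (s i) k) * ?E (only i (Polynomial.monom 1 k)))" for i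
  have m: "el (d - 2 * D) (only i (q i)) * b (only i (h i)) \<in> PH (d - D)"
    "mpoly_const (poly.coeff (s i) k) * ?E (only i (Polynomial.monom 1 k)) \<in> PH (d - D)"
    "(\<Sum>k<degree (h i). mpoly_const (poly.coeff (s i) k) * ?E (only i (Polynomial.monom 1 k))) \<in> PH (d - D)" for i k
    using large by (auto intro!: PH_mult[OF el_PH[OF ka(2)] b_PH] PH_sum PH_const_mult el_PH[OF ka(1)])
  have G: "G i \<in> PH (d - D)" for i unfolding G_def by (intro PH_add m)
  have "\<Delta> F Y = \<Delta> (\<Sum>i<t. G i) Y"
  proof (rule cong_left[OF dd F PH_sum[OF G] Y(1)])
    fix j assume j: "j < t"
    have rG: "r j (G i) = (if j = i then r i F else 0)" if i: "i < t" for i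
    proof -
      have "r j (G i) = (only i (q i) j * only i (h i) j) mod g j +
          (\<Sum>k<degree (h i). Polynomial.smult (poly.coeff (s i) k) (only i (Polynomial.monom 1 k) j) mod g j)"
      proof -
        have "r j (el (d - 2 * D) (only i (q i)) * b (only i (h i))) = (only i (q i) j * only i (h i) j) mod g j"
          using j el_P[OF ka(2)] b_P by (simp add: r_mult r_el[OF ka(2)] r_b mod_mult_eq)
        moreover have "r j (\<Sum>k<degree (h i). mpoly_const (poly.coeff (s i) k) * ?E (only i (Polynomial.monom 1 k))) =
            (\<Sum>k<degree (h i). Polynomial.smult (poly.coeff (s i) k) (only i (Polynomial.monom 1 k) j) mod g j)"
          using j el_P[OF ka(1)]
          by (simp add: r_sum r_const_mult r_el[OF ka(1)] mod_smult_left)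
        ultimately show ?thesis unfolding G_def r_add[OF j PH_carrier[OF m(1)] PH_carrier[OF m(3)]] by simp
      qed
      also have "\<dots> = (only i (q i) j * only i (h i) j +
          (\<Sum>k<degree (h i). Polynomial.smult (poly.coeff (s i) k) (only i (Polynomial.monom 1 k) j))) mod g j"
      proof -
        have "(\<Sum>k\<in>A. p k mod g j) = (\<Sum>k\<in>A. p k) mod g j" for A :: "nat set" and p
          by (induction A rule: infinite_finite_induct) (simp_all add: poly_mod_add_left)
        then show ?thesis by (simp add: poly_mod_add_left)
      qed
      also have "\<dots> = (if j = i then r i F else 0)"
      proof (cases "j = i")
        case True
        have "s i = (\<Sum>k<degree (h i). Polynomial.monom (poly.coeff (s i) k) k)"
          by (rule poly_sum_monoms_mod[OF h_nonzero[OF i]]) (simp add: s_def)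
        then have "only i (q i) j * only i (h i) j +
          (\<Sum>k<degree (h i). Polynomial.smult (poly.coeff (s i) k) (only i (Polynomial.monom 1 k) j)) = q i * h i + s i"
          using True by (simp add: only_def smult_monom)
        also have "\<dots> = r i F" by (simp add: q_def s_def)
        finally show ?thesis using True r_mod[OF i PH_carrier[OF F]] by simp
      qed (simp add: only_def)
      finally show ?thesis .
    qed
    have "r j (\<Sum>i<t. G i) = (\<Sum>i<t. r j (G i))" by (rule r_sum[OF j PH_carrier[OF G]])
    also have "\<dots> = (\<Sum>i<t. if j = i then r i F else 0)" by (intro sum.cong refl rG) simp
    finally have "r j (\<Sum>i<t. G i) = (\<Sum>i<t. if j = i then r i F else 0)" .
    then show "r j F = r j (\<Sum>i<t. G i)" using j by simp
  qed
  also have "\<dots> = (\<Sum>i<t. \<Delta> (G i) Y)" by (rule sum_left[OF dd G Y(1)])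
  also have "\<dots> = 0"
  proof (rule sum.neutral, rule ballI)
    fix i assume "i \<in> {..<t}"
    then have i: "i < t" by simp
    show "\<Delta> (G i) Y = 0"
      unfolding G_def add_left[OF dd m(1) m(3) Y(1)] vanish_h[OF i el_PH[OF ka(2)]]
      by (simp add: sum_left[OF dd m(2) Y(1)] const_left[OF dd el_PH[OF ka(1)] Y(1)] basis[OF i])
  qed
  finally show ?thesis .
qed

text \<open>After multiplication by x0^(D-1) the variable is the sum of lifts of its
  representatives, so its differential is a multiple of dY by the chain rule.\<close>

lemma vanish_var:
  assumes Y0: "\<And>F. F \<in> PH (d - D) \<Longrightarrow> \<Delta> F Y = 0" and j: "j \<le> n" and f: "f \<in> PH (d - 1)"
  shows "\<Delta> f (mpoly_var j) = 0"
proof -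
  have dd: "d - D + D = d" "d - 1 + 1 = d" "d - D + (D - 1) + 1 = d" using large D by simp_all
  note jP = PH_carrier[OF PH_var[OF j]]
  \<comment> \<open>Of the 2 D - 1 factors \<open>x0\<close> split off from \<open>f\<close>, D - 1
    raise the variable to degree \<open>D\<close>, and the other \<open>D\<close> accompany the
    coefficient as the chain rule requires.\<close>
  have "k0 + (2 * D - 1) \<le> d - 1" using large D by linarith
  then obtain f1 where f1: "f1 \<in> PH (d - 1 - (2 * D - 1))" "\<And>j. j < t \<Longrightarrow> r j f1 = r j f"
    using divide_PH[OF f] by blast
  have e1: "d - 1 - (2 * D - 1) = d - 2 * D" using D by simp
  note f1P = PH_carrier[OF f1(1)] and fP = PH_carrier[OF f]
  have m: "f1 * x0 ^ D \<in> PH (d - D)" using large e1 by (auto intro!: PH_mult_x0[OF f1(1)] PH_mult_b[OF f1(1)] PH_mult_Y[OF f1(1)])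
  have m2: "f1 * x0 ^ D * x0 ^ (D - 1) \<in> PH (d - 1)" using large D by (auto intro!: PH_mult_x0[OF m] PH_mult_b[OF m] PH_mult_Y[OF m])
  have m3: "x0 ^ (D - 1) * mpoly_var j \<in> PH D" using D by (auto intro!: PH_mult[OF PH_x0_power PH_var[OF j]])
  have "\<Delta> f (mpoly_var j) = \<Delta> (f1 * x0 ^ D * x0 ^ (D - 1)) (mpoly_var j)"
  proof (rule cong_left[OF dd(2) f m2 PH_var[OF j]])
    fix i assume i: "i < t"
    have "r i (f1 * x0 ^ D * x0 ^ (D - 1)) = r i (x0 ^ D * (x0 ^ (D - 1) * f1))"
      by (rule arg_cong[of _ _ "r i"]) (simp add: mult_ac)
    also have "\<dots> = r i f" using i f1P f1(2) by (simp add: r_x0_power)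
    finally show "r i f = r i (f1 * x0 ^ D * x0 ^ (D - 1))" ..
  qed
  also have "\<dots> = \<Delta> (f1 * x0 ^ D) (x0 ^ (D - 1) * mpoly_var j)"
    by (rule x0_power_right[OF dd(3) m PH_var[OF j], symmetric])
  also have "\<dots> = \<Delta> (f1 * x0 ^ D) (\<Sum>i<t. b (only i (r i (mpoly_var j))))"
  proof (rule cong_right[OF dd(1) m m3 PH_sum[OF b_PH]])
    fix i assume i: "i < t"
    have "r i (\<Sum>i<t. b (only i (r i (mpoly_var j)))) = (\<Sum>k<t. if k = i then r i (mpoly_var j) else 0)"
    proof -
      have "r i (\<Sum>k<t. b (only k (r k (mpoly_var j)))) = (\<Sum>k<t. r i (b (only k (r k (mpoly_var j)))))"
        by (rule r_sum[OF i b_P])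
      also have "\<dots> = (\<Sum>k<t. if k = i then r i (mpoly_var j) else 0)"
        using r_mod[OF i jP] by (intro sum.cong refl) (simp add: r_b[OF i] only_def)
      finally show ?thesis .
    qed
    also have "\<dots> = r i (mpoly_var j)" using i by simp
    finally show "r i (x0 ^ (D - 1) * mpoly_var j) = r i (\<Sum>i<t. b (only i (r i (mpoly_var j))))"
      using i jP by (simp add: r_x0_power)
  qed
  also have "\<dots> = (\<Sum>i<t. \<Delta> (f1 * x0 ^ D) (b (only i (r i (mpoly_var j)))))"
    by (rule sum_right[OF dd(1) m b_PH])
  also have "\<dots> = 0"
  proof (rule sum.neutral, rule ballI)
    fix i assume "i \<in> {..<t}"
    then have i: "i < t" by simp
    have "\<Delta> (f1 * x0 ^ D) (b (only i (r i (mpoly_var j)))) =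
        \<Delta> (f1 * b (only i (pderiv (r i (mpoly_var j))))) Y"
      by (rule derivative[OF i]) (use f1 e1 in simp)
    also have "\<dots> = 0"
      by (rule Y0) (use large e1 in \<open>auto intro!: PH_mult[OF f1(1) b_PH]\<close>)
    finally show "\<Delta> (f1 * x0 ^ D) (b (only i (r i (mpoly_var j)))) = 0" .
  qed
  finally show ?thesis .
qed

end

section \<open>Differential forms on the projective coordinate ring\<close>

context curvilinear_data
begin

abbreviation "\<Omega> \<equiv> kaehler (coord_const n I) R"
abbreviation "E m \<equiv> differential_forms n I m"
abbreviation "EK m \<equiv> restrict_scalars (coord_const n I) (E m)"

definition dd :: "'k mpoly \<Rightarrow> ('k mpoly set \<Rightarrow> 'k mpoly set) set" where
  "dd f = kaehler_d (coord_const n I) R (cls f)"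

text \<open>The form f dg_1 \<and> ... \<and> dg_m, for polynomials instead of classes, so that the
  results about representatives apply to all arguments directly.\<close>

definition W :: "nat \<Rightarrow> 'k mpoly \<Rightarrow> 'k mpoly list \<Rightarrow>
    (('k mpoly set \<Rightarrow> 'k mpoly set) set list \<Rightarrow> 'k mpoly set) set" where
  "W m f gs = cls f \<odot>\<^bsub>E m\<^esub> wedge R m \<Omega> (map dd gs)"

lemma E_eq: "E m = exterior_power R m \<Omega>"
  by (simp add: kaehler_forms_def)

lemma module_\<Omega>: "Module.module R \<Omega>"
  by (rule module_kaehler[OF cring_R coord_const_hom])

lemma ext_\<Omega>: "ext_module R \<Omega>"
  by (rule ext_module.intro[OF module_\<Omega>])

lemma module_E: "Module.module R (E m)"
  unfolding E_eq by (rule ext_module.module_exterior_power[OF ext_\<Omega>])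

lemma vectorspace_EK: "vectorspace class_ring (EK m)"
  by (rule vectorspace_restrict_scalars[OF module_E coord_const_hom])

lemma coord_const_eq: "coord_const n I c = cls (mpoly_const c)"
  by (simp add: coord_const_def)

lemma
  shows dd_closed: "f \<in> carrier P \<Longrightarrow> dd f \<in> carrier \<Omega>"
    and dd_add: "f \<in> carrier P \<Longrightarrow> f' \<in> carrier P \<Longrightarrow> dd (f + f') = dd f \<oplus>\<^bsub>\<Omega>\<^esub> dd f'"
    and dd_mult: "f \<in> carrier P \<Longrightarrow> f' \<in> carrier P \<Longrightarrow>
      dd (f * f') = cls f \<odot>\<^bsub>\<Omega>\<^esub> dd f' \<oplus>\<^bsub>\<Omega>\<^esub> cls f' \<odot>\<^bsub>\<Omega>\<^esub> dd f"
    and dd_const: "dd (mpoly_const c) = \<zero>\<^bsub>\<Omega>\<^esub>"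
  using kaehler_d_const[OF cring_R coord_const_hom, of c]
  by (simp_all add: dd_def cls_add cls_mult kaehler_d_closed[OF cring_R coord_const_hom]
    kaehler_d_add[OF cring_R coord_const_hom] kaehler_d_mult[OF cring_R coord_const_hom] coord_const_eq)

lemma dd_ideal: "f \<in> I \<Longrightarrow> dd f = \<zero>\<^bsub>\<Omega>\<^esub>"
proof -
  assume "f \<in> I"
  then have "cls f = cls (mpoly_const 0)"
    using cls_eq_iff[of f "mpoly_const 0"] I_simps(1) by (simp add: mpoly_const_def)
  then show ?thesis using dd_const[of 0] by (simp add: dd_def)
qed

definition tup :: "nat \<Rightarrow> 'k mpoly list \<Rightarrow> bool" where
  "tup m gs \<longleftrightarrow> length gs = m \<and> set gs \<subseteq> carrier P"

lemma tup_update: "tup m gs \<Longrightarrow> x \<in> carrier P \<Longrightarrow> tup m (gs[i := x])"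
  using set_update_subset_insert[of gs i x] by (auto simp: tup_def)

lemma tuples_dd: "tup m gs \<Longrightarrow> map dd gs \<in> tuples m \<Omega>"
  using dd_closed by (auto simp: tup_def tuples_def)

lemma W_closed:
  assumes "f \<in> carrier P" "tup m gs" shows "W m f gs \<in> carrier (E m)"
proof -
  interpret E: Module.module R "E m" by (rule module_E)
  have "wedge R m \<Omega> (map dd gs) \<in> carrier (E m)"
    unfolding E_eq by (rule ext_module.wedge_closed[OF ext_\<Omega> tuples_dd[OF assms(2)]])
  then show ?thesis using assms(1) by (simp add: W_def)
qed

lemma W_add:
  assumes "f \<in> carrier P" "f' \<in> carrier P" "tup m gs"
  shows "W m (f + f') gs = W m f gs \<oplus>\<^bsub>E m\<^esub> W m f' gs"
proof -
  interpret E: Module.module R "E m" by (rule module_E)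
  have "wedge R m \<Omega> (map dd gs) \<in> carrier (E m)"
    unfolding E_eq by (rule ext_module.wedge_closed[OF ext_\<Omega> tuples_dd[OF assms(3)]])
  then show ?thesis using assms(1,2) by (simp add: W_def cls_add E.smult_l_distr)
qed

lemma W_mult:
  assumes "a \<in> carrier P" "f \<in> carrier P" "tup m gs"
  shows "W m (a * f) gs = cls a \<odot>\<^bsub>E m\<^esub> W m f gs"
proof -
  interpret E: Module.module R "E m" by (rule module_E)
  have "wedge R m \<Omega> (map dd gs) \<in> carrier (E m)"
    unfolding E_eq by (rule ext_module.wedge_closed[OF ext_\<Omega> tuples_dd[OF assms(3)]])
  then show ?thesis using assms(1,2) by (simp add: W_def cls_mult E.smult_assoc1)
qed

lemma W_ideal:
  assumes "f \<in> I" "tup m gs" shows "W m f gs = \<zero>\<^bsub>E m\<^esub>"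
proof -
  interpret E: Module.module R "E m" by (rule module_E)
  have "wedge R m \<Omega> (map dd gs) \<in> carrier (E m)"
    unfolding E_eq by (rule ext_module.wedge_closed[OF ext_\<Omega> tuples_dd[OF assms(2)]])
  moreover have "cls f = \<zero>\<^bsub>R\<^esub>"
    using cls_eq_iff[of f 0] I_simps(1)[OF assms(1)] assms(1) by (simp add: cls_zero)
  ultimately show ?thesis by (simp add: W_def E.lmult_0)
qed

lemma W_slot_add:
  assumes f: "f \<in> carrier P" and gs: "tup m gs" and i: "i < m" and xy: "x \<in> carrier P" "y \<in> carrier P"
  shows "W m f (gs[i := x + y]) = W m f (gs[i := x]) \<oplus>\<^bsub>E m\<^esub> W m f (gs[i := y])"
proof -
  interpret E: Module.module R "E m" by (rule module_E)
  have c: "wedge R m \<Omega> ((map dd gs)[i := dd z]) \<in> carrier (E m)" if "z \<in> carrier P" for z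
    unfolding E_eq map_update[symmetric]
    by (rule ext_module.wedge_closed[OF ext_\<Omega> tuples_dd[OF tup_update[OF gs that]]])
  have "wedge R m \<Omega> ((map dd gs)[i := dd x \<oplus>\<^bsub>\<Omega>\<^esub> dd y]) =
      wedge R m \<Omega> ((map dd gs)[i := dd x]) \<oplus>\<^bsub>E m\<^esub> wedge R m \<Omega> ((map dd gs)[i := dd y])"
    unfolding E_eq by (rule ext_module.wedge_add[OF ext_\<Omega> tuples_dd[OF gs] i]) (use xy dd_closed in simp_all)
  then show ?thesis using f xy c by (simp add: W_def map_update dd_add E.smult_r_distr)
qed

lemma W_slot_zero:
  assumes f: "f \<in> carrier P" and gs: "tup m gs" and i: "i < m" and x: "x \<in> carrier P" "dd x = \<zero>\<^bsub>\<Omega>\<^esub>"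
  shows "W m f (gs[i := x]) = \<zero>\<^bsub>E m\<^esub>"
proof -
  interpret E: Module.module R "E m" by (rule module_E)
  interpret O: Module.module R \<Omega> by (rule module_\<Omega>)
  \<comment> \<open>Additivity in the slot then makes the form equal to twice itself.\<close>
  have "dd (x + x) = dd x" unfolding dd_add[OF x(1) x(1)] x(2) by simp
  then have "W m f (gs[i := x + x]) = W m f (gs[i := x])"
    by (simp only: W_def map_update)
  then have "W m f (gs[i := x]) \<oplus>\<^bsub>E m\<^esub> W m f (gs[i := x]) = W m f (gs[i := x])"
    using W_slot_add[OF f gs i x(1) x(1)] by simp
  then show ?thesis
    using E.add.r_cancel_one[of "W m f (gs[i := x])" "W m f (gs[i := x])"] W_closed[OF f tup_update[OF gs x(1)]] by simp
qed

lemma W_slot_mult: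
  assumes f: "f \<in> carrier P" and gs: "tup m gs" and i: "i < m" and xy: "x \<in> carrier P" "y \<in> carrier P"
  shows "W m f (gs[i := x * y]) = W m (f * x) (gs[i := y]) \<oplus>\<^bsub>E m\<^esub> W m (f * y) (gs[i := x])"
proof -
  interpret E: Module.module R "E m" by (rule module_E)
  interpret O: Module.module R \<Omega> by (rule module_\<Omega>)
  have c: "wedge R m \<Omega> ((map dd gs)[i := dd z]) \<in> carrier (E m)" if "z \<in> carrier P" for z
    unfolding E_eq map_update[symmetric]
    by (rule ext_module.wedge_closed[OF ext_\<Omega> tuples_dd[OF tup_update[OF gs that]]])
  have s: "wedge R m \<Omega> ((map dd gs)[i := cls a \<odot>\<^bsub>\<Omega>\<^esub> dd z]) =
      cls a \<odot>\<^bsub>E m\<^esub> wedge R m \<Omega> ((map dd gs)[i := dd z])" if "a \<in> carrier P" "z \<in> carrier P" for a z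
    unfolding E_eq by (rule ext_module.wedge_smult[OF ext_\<Omega> tuples_dd[OF gs] i]) (use that dd_closed in simp_all)
  have "wedge R m \<Omega> ((map dd gs)[i := cls x \<odot>\<^bsub>\<Omega>\<^esub> dd y \<oplus>\<^bsub>\<Omega>\<^esub> cls y \<odot>\<^bsub>\<Omega>\<^esub> dd x]) =
      wedge R m \<Omega> ((map dd gs)[i := cls x \<odot>\<^bsub>\<Omega>\<^esub> dd y]) \<oplus>\<^bsub>E m\<^esub>
      wedge R m \<Omega> ((map dd gs)[i := cls y \<odot>\<^bsub>\<Omega>\<^esub> dd x])"
    unfolding E_eq by (rule ext_module.wedge_add[OF ext_\<Omega> tuples_dd[OF gs] i]) (use xy dd_closed in simp_all)
  then show ?thesis
    using f xy c s by (simp add: W_def map_update dd_mult E.smult_r_distr cls_mult E.smult_assoc1)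
qed

lemma W_alternating:
  assumes f: "f \<in> carrier P" and gs: "tup m gs" and ij: "i < m" "j < m" "i \<noteq> j" "gs ! i = gs ! j"
  shows "W m f gs = \<zero>\<^bsub>E m\<^esub>"
proof -
  interpret E: Module.module R "E m" by (rule module_E)
  have *: "wedge R m \<Omega> (map dd gs) = \<zero>\<^bsub>E m\<^esub>" if "i < j" "j < m" "gs ! i = gs ! j" for i j
    unfolding E_eq by (rule ext_module.wedge_alternating[OF ext_\<Omega> tuples_dd[OF gs], of i j])
      (use that gs in \<open>simp_all add: tup_def\<close>)
  have "wedge R m \<Omega> (map dd gs) = \<zero>\<^bsub>E m\<^esub>"
    using *[of i j] *[of j i] ij by (cases "i < j") simp_all
  then show ?thesis using f by (simp add: W_def)
qed

text \<open>Alternation gives antisymmetry by polarization: expand the vanishing form with x + y in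
  both slots.\<close>

lemma W_swap:
  assumes f: "f \<in> carrier P" and xy: "x \<in> carrier P" "y \<in> carrier P"
  shows "W 2 f [x, y] \<oplus>\<^bsub>E 2\<^esub> W 2 f [y, x] = \<zero>\<^bsub>E 2\<^esub>"
proof -
  interpret E: Module.module R "E 2" by (rule module_E)
  have tp: "tup 2 [a, b]" if "a \<in> carrier P" "b \<in> carrier P" for a b using that by (simp add: tup_def)
  have z: "W 2 f [a, a] = \<zero>\<^bsub>E 2\<^esub>" if "a \<in> carrier P" for a
    by (rule W_alternating[OF f tp[OF that that], of 0 1]) simp_all
  have 0: "W 2 f [a + a', b] = W 2 f [a, b] \<oplus>\<^bsub>E 2\<^esub> W 2 f [a', b]"
    if "a \<in> carrier P" "a' \<in> carrier P" "b \<in> carrier P" for a a' b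
    using W_slot_add[OF f tp[OF that(1,3)], of 0 a a'] that by simp
  have 1: "W 2 f [a, b + b'] = W 2 f [a, b] \<oplus>\<^bsub>E 2\<^esub> W 2 f [a, b']"
    if "a \<in> carrier P" "b \<in> carrier P" "b' \<in> carrier P" for a b b'
    using W_slot_add[OF f tp[OF that(1,2)], of 1 b b'] that by simp
  have c: "W 2 f [a, b] \<in> carrier (E 2)" if "a \<in> carrier P" "b \<in> carrier P" for a b
    by (rule W_closed[OF f tp[OF that]])
  have "\<zero>\<^bsub>E 2\<^esub> = W 2 f [x + y, x + y]" using z[of "x + y"] xy by simp
  also have "\<dots> = (W 2 f [x, x] \<oplus>\<^bsub>E 2\<^esub> W 2 f [y, x]) \<oplus>\<^bsub>E 2\<^esub> (W 2 f [x, y] \<oplus>\<^bsub>E 2\<^esub> W 2 f [y, y])"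
    using xy by (simp add: 0 1)
  also have "\<dots> = W 2 f [y, x] \<oplus>\<^bsub>E 2\<^esub> W 2 f [x, y]" using xy c by (simp add: z)
  also have "\<dots> = W 2 f [x, y] \<oplus>\<^bsub>E 2\<^esub> W 2 f [y, x]" using xy c by (intro E.a_comm) simp_all
  finally show ?thesis by simp
qed

section \<open>Homogeneous parts of the modules of forms\<close>

definition gens :: "nat \<Rightarrow> nat \<Rightarrow> (('k mpoly set \<Rightarrow> 'k mpoly set) set list \<Rightarrow> 'k mpoly set) set set" where
  "gens m d = {W m f (map mpoly_var js) | f js e.
     length js = m \<and> set js \<subseteq> {..n} \<and> e + m = d \<and> f \<in> PH e}"

abbreviation "V m d \<equiv> forms_graded_part n I m d"

lemma tup_vars: "length js = m \<Longrightarrow> set js \<subseteq> {..n} \<Longrightarrow> tup m (map mpoly_var js)"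
  by (auto simp: tup_def)

lemma gens_closed: "gens m d \<subseteq> carrier (EK m)"
proof
  fix w assume "w \<in> gens m d"
  then obtain f js e where w: "w = W m f (map mpoly_var js)" "length js = m" "set js \<subseteq> {..n}" "f \<in> PH e"
    unfolding gens_def by blast
  then show "w \<in> carrier (EK m)" using W_closed[OF PH_carrier[OF w(4)] tup_vars[OF w(2,3)]] by simp
qed

lemma part_eq: "differential_forms_part n I m d = LinearCombinations.module.span class_ring (EK m) (gens m d)"
proof -
  have coord: "coord_part n I e = cls ` PH e" for e
    unfolding coord_part_def by (rule arg_cong[of _ _ "image cls"]) (auto simp: PH_def homogeneous_part_iff)
  have vars: "map (\<lambda>j. kaehler_d (coord_const n I) R (coord_var n I j)) js = map dd (map mpoly_var js)" for js
    by (simp add: dd_def coord_var_def)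
  have "{f \<odot>\<^bsub>E m\<^esub> wedge R m \<Omega> (map (\<lambda>j. kaehler_d (coord_const n I) R (coord_var n I j)) js) | f js e.
      length js = m \<and> set js \<subseteq> {..n} \<and> e + m = d \<and> f \<in> coord_part n I e} = gens m d" (is "?G = _")
  proof (intro equalityI subsetI)
    fix w assume "w \<in> ?G"
    then obtain f js e where w: "w = f \<odot>\<^bsub>E m\<^esub> wedge R m \<Omega> (map dd (map mpoly_var js))"
      "length js = m" "set js \<subseteq> {..n}" "e + m = d" "f \<in> cls ` PH e" unfolding coord vars by blast
    from w(5) obtain f' where f': "f = cls f'" "f' \<in> PH e" by (rule imageE)
    have "w = W m f' (map mpoly_var js)" unfolding W_def w(1) f'(1) ..
    then show "w \<in> gens m d" unfolding gens_def using w(2,3,4) f'(2) by blast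
  next
    fix w assume "w \<in> gens m d"
    then obtain f js e where w: "w = W m f (map mpoly_var js)"
      "length js = m" "set js \<subseteq> {..n}" "e + m = d" "f \<in> PH e" unfolding gens_def by blast
    have "cls f \<in> cls ` PH e" by (rule imageI[OF w(5)])
    then show "w \<in> ?G" unfolding coord vars using w(1)[unfolded W_def] w(2,3,4) by blast
  qed
  then show ?thesis by (simp add: differential_forms_part_def Let_def)
qed

lemma V_simps [simp]:
  "carrier (V m d) = differential_forms_part n I m d" "zero (V m d) = zero (E m)"
  "add (V m d) = add (E m)" "smult (V m d) = smult (EK m)"
  by (simp_all add: forms_graded_part_def)

lemma V_eq: "V m d = (EK m)\<lparr>carrier := differential_forms_part n I m d\<rparr>"
  by (simp add: forms_graded_part_def)

lemma part_submodule: "submodule class_ring (differential_forms_part n I m d) (EK m)"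
proof -
  interpret EK: vectorspace "class_ring :: 'k ring" "EK m" by (rule vectorspace_EK)
  show ?thesis unfolding part_eq by (rule EK.span_is_submodule[OF gens_closed])
qed

lemma vectorspace_V: "vectorspace class_ring (V m d)"
proof -
  interpret EK: vectorspace "class_ring :: 'k ring" "EK m" by (rule vectorspace_EK)
  show ?thesis unfolding V_eq
    by (rule EK.subspace_is_vs) (rule subspace.intro[OF vectorspace_EK part_submodule])
qed

lemma part_minimal:
  assumes "submodule class_ring X (EK m)" "gens m d \<subseteq> X"
  shows "differential_forms_part n I m d \<subseteq> X"
proof -
  interpret EK: vectorspace "class_ring :: 'k ring" "EK m" by (rule vectorspace_EK)
  show ?thesis unfolding part_eq by (rule EK.span_is_subset[OF assms(2,1)])
qed

lemma gens_part: "gens m d \<subseteq> differential_forms_part n I m d"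
proof -
  interpret EK: vectorspace "class_ring :: 'k ring" "EK m" by (rule vectorspace_EK)
  show ?thesis unfolding part_eq by (rule EK.in_own_span[OF gens_closed])
qed

lemma W_smult:
  "f \<in> carrier P \<Longrightarrow> tup m gs \<Longrightarrow> W m (mpoly_const c * f) gs = c \<odot>\<^bsub>EK m\<^esub> W m f gs"
  by (simp add: W_mult coord_const_eq)

lemma W_slot_smult:
  assumes f: "f \<in> carrier P" and gs: "tup m gs" and i: "i < m" and x: "x \<in> carrier P"
  shows "W m f (gs[i := mpoly_const c * x]) = c \<odot>\<^bsub>EK m\<^esub> W m f (gs[i := x])"
proof -
  interpret E: Module.module R "E m" by (rule module_E)
  have "W m f (gs[i := mpoly_const c * x]) =
      W m (f * mpoly_const c) (gs[i := x]) \<oplus>\<^bsub>E m\<^esub> W m (f * x) (gs[i := mpoly_const c])"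
    using W_slot_mult[OF f gs i P_const x] .
  also have "W m (f * x) (gs[i := mpoly_const c]) = \<zero>\<^bsub>E m\<^esub>"
    using f x by (intro W_slot_zero gs i dd_const) simp_all
  also have "f * mpoly_const c = mpoly_const c * f" by (rule mult.commute)
  finally show ?thesis
    using W_smult[OF f tup_update[OF gs x], of c i] W_closed[OF _ tup_update[OF gs x], of "mpoly_const c * f" i] f by simp
qed

text \<open>Degrees are carried along with the entries because the zero polynomial is a form of
  every degree.\<close>

definition graded_tup :: "nat \<Rightarrow> ('k mpoly \<times> nat) list \<Rightarrow> bool" where
  "graded_tup m ps \<longleftrightarrow> length ps = m \<and> (\<forall>p\<in>set ps. fst p \<in> PH (snd p))"

abbreviation deg_sum :: "('k mpoly \<times> nat) list \<Rightarrow> nat" where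
  "deg_sum ps \<equiv> sum_list (map snd ps)"

lemma graded_tup_tup: "graded_tup m ps \<Longrightarrow> tup m (map fst ps)"
  using PH_carrier by (auto simp: graded_tup_def tup_def)

lemma graded_tup_update: "graded_tup m ps \<Longrightarrow> x \<in> PH e \<Longrightarrow> graded_tup m (ps[i := (x, e)])"
  using set_update_subset_insert[of ps i "(x, e)"] by (auto simp: graded_tup_def)

lemma deg_sum_update: "i < length ps \<Longrightarrow> deg_sum (ps[i := (x, e)]) = e + deg_sum (ps[i := (0, 0)])"
proof (induction ps arbitrary: i)
  case (Cons p ps)
  then show ?case by (cases i) simp_all
qed simp

text \<open>The grading is defined through differentials of variables only. The slots from
  \<open>i\<close> on already contain variables, and the induction clears the remaining slots one at
  a time.\<close>

lemma W_mem_part_aux: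
  assumes "graded_tup m ps" "\<And>k. i \<le> k \<Longrightarrow> k < m \<Longrightarrow> \<exists>j\<le>n. ps ! k = (mpoly_var j, 1)"
    and "f \<in> PH e" "e + deg_sum ps = d"
  shows "W m f (map fst ps) \<in> differential_forms_part n I m d"
  using assms
proof (induction i arbitrary: ps f e)
  case 0
  have len: "length ps = m" using 0(1) by (simp add: graded_tup_def)
  have "\<forall>k\<in>{..<m}. \<exists>j. j \<le> n \<and> ps ! k = (mpoly_var j, 1)" using 0(2) by simp
  then obtain j where j: "\<And>k. k < m \<Longrightarrow> j k \<le> n \<and> ps ! k = (mpoly_var (j k), 1)" by (metis lessThan_iff)
  define js where "js = map j [0..<m]"
  have ps: "ps = map (\<lambda>k. (mpoly_var (j k), 1)) [0..<m]"
    by (rule nth_equalityI) (use j len in simp_all)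
  have "map fst ps = map mpoly_var js" by (simp add: ps js_def comp_def)
  moreover have "deg_sum ps = m" by (simp add: ps comp_def sum_list_triv)
  moreover have "set js \<subseteq> {..n}" using j by (auto simp: js_def)
  moreover have "length js = m" by (simp add: js_def)
  ultimately have "W m f (map fst ps) \<in> gens m d" using 0(3,4) unfolding gens_def by auto
  then show ?case using gens_part by blast
next
  case (Suc i)
  interpret X: submodule "class_ring :: 'k ring" "differential_forms_part n I m d" "EK m" by (rule part_submodule)
  have len: "length ps = m" using Suc.prems(1) by (simp add: graded_tup_def)
  show ?case
  proof (cases "i < m")
    case False
    then show ?thesis using Suc.IH[OF Suc.prems(1) _ Suc.prems(3,4)] by simp
  next
    case i: True
    let ?gs = "map fst ps" and ?r = "deg_sum (ps[i := (0, 0)])"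
    have gs: "tup m ?gs" by (rule graded_tup_tup[OF Suc.prems(1)])
    have slot: "W m f' (?gs[i := mpoly_var j]) \<in> differential_forms_part n I m d"
      if "j \<le> n" "f' \<in> PH e'" "e' + 1 + ?r = d" for j f' e'
    proof -
      have "W m f' (map fst (ps[i := (mpoly_var j, 1)])) \<in> differential_forms_part n I m d"
      proof (rule Suc.IH[OF graded_tup_update[OF Suc.prems(1) PH_var[OF that(1)]] _ that(2)])
        show "\<exists>j'\<le>n. ps[i := (mpoly_var j, 1)] ! k = (mpoly_var j', 1)" if "i \<le> k" "k < m" for k
          using that Suc.prems(2)[of k] \<open>j \<le> n\<close> len by (cases "k = i") auto
        show "e' + deg_sum (ps[i := (mpoly_var j, 1)]) = d"
          using that(3) i len by (subst deg_sum_update) simp_all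
      qed
      then show ?thesis by (simp add: map_update)
    qed
    \<comment> \<open>Induction on the degree of the monomial: Leibniz splits off a variable, which
      either remains in the slot and is settled by \<open>slot\<close>, or moves into the
      coefficient.\<close>
    have mono: "W m f' (?gs[i := Poly_Mapping.single s 1]) \<in> differential_forms_part n I m d"
      if "Poly_Mapping.keys s \<subseteq> {..n}" "mdegree s = b" "f' \<in> PH e'" "e' + b + ?r = d" for s b f' e'
      using that
    proof (induction b arbitrary: s f' e')
      case 0
      have "s = 0"
        using 0(2) by (intro poly_mapping_eqI) (auto simp: mdegree_def in_keys_iff)
      then have "Poly_Mapping.single s 1 = (mpoly_const 1 :: 'k mpoly)" by (simp add: mpoly_const_def)
      then have "W m f' (?gs[i := Poly_Mapping.single s 1]) = \<zero>\<^bsub>E m\<^esub>"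
        using W_slot_zero[OF PH_carrier[OF 0(3)] gs i P_const dd_const, of 1] by simp
      then show ?case using X.zero_closed by simp
    next
      case (Suc b)
      have "mdegree s \<noteq> 0" using Suc.prems(2) by simp
      then obtain j where j: "j \<in> Poly_Mapping.keys s" by (auto simp: mdegree_def)
      define s' where "s' = s - Poly_Mapping.single j 1"
      have s: "s = Poly_Mapping.single j 1 + s'"
        using j by (intro poly_mapping_eqI)
          (auto simp: s'_def lookup_add lookup_minus lookup_single when_def in_keys_iff)
      have s': "Poly_Mapping.keys s' \<subseteq> {..n}" "mdegree s' = b"
        using Suc.prems(1,2) by (auto simp: s'_def in_keys_iff lookup_minus subset_iff)
          (metis One_nat_def Suc.prems(2) add_left_cancel mdegree_add mdegree_single plus_1_eq_Suc s s'_def)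
      have jn: "j \<le> n" using j Suc.prems(1) by auto
      have single: "Poly_Mapping.single s 1 = mpoly_var j * (Poly_Mapping.single s' 1 :: 'k mpoly)"
        by (simp add: s mpoly_var_def mult_single)
      have sP: "Poly_Mapping.single s' (1::'k) \<in> PH b"
        using s' by (simp add: PH_def poly_ring_carrier homog_def)
      have "W m (f' * mpoly_var j) (?gs[i := Poly_Mapping.single s' 1]) \<in> differential_forms_part n I m d"
        using Suc.prems by (intro Suc.IH[OF s' PH_mult[OF Suc.prems(3) PH_var[OF jn] refl]]) simp
      moreover have "W m (f' * Poly_Mapping.single s' 1) (?gs[i := mpoly_var j]) \<in> differential_forms_part n I m d"
        using Suc.prems by (intro slot[OF jn PH_mult[OF Suc.prems(3) sP refl]]) simp
      ultimately show ?case
        unfolding single W_slot_mult[OF PH_carrier[OF Suc.prems(3)] gs i PH_carrier[OF PH_var[OF jn]] PH_carrier[OF sP]]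
        using X.m_closed by simp
    qed
    define x where "x = fst (ps ! i)"
    define b where "b = snd (ps ! i)"
    have x: "x \<in> PH b" using Suc.prems(1) i by (simp add: graded_tup_def x_def b_def)
    have bd: "e + b + ?r = d"
      using Suc.prems(4) deg_sum_update[of i ps x b] i len by (simp add: x_def b_def)
    have "W m f (?gs[i := x]) \<in> differential_forms_part n I m d"
    proof (rule homog_combination_mem[where \<rho> = "\<lambda>x. W m f (?gs[i := x])" and d = b, OF part_submodule])
      show "x \<in> carrier P" "homog b x" using x by (simp_all add: PH_def)
    next
      fix s assume "Poly_Mapping.keys s \<subseteq> {..n}" "mdegree s = b"
      then show "W m f (?gs[i := Poly_Mapping.single s 1]) \<in> differential_forms_part n I m d"
        by (rule mono[OF _ _ Suc.prems(3) bd])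
    qed (use PH_carrier[OF Suc.prems(3)] gs i in
        \<open>simp_all add: W_closed tup_update W_slot_add W_slot_smult del: restrict_scalars_simps(4)\<close>)
    moreover have "?gs[i := x] = ?gs" using i len by (simp add: x_def list_update_same_conv)
    ultimately show ?thesis by simp
  qed
qed

lemma W_mem_part:
  "graded_tup m ps \<Longrightarrow> f \<in> PH e \<Longrightarrow> e + deg_sum ps = d \<Longrightarrow> W m f (map fst ps) \<in> differential_forms_part n I m d"
  by (rule W_mem_part_aux[of m ps m]) simp_all

text \<open>Spanned by monomials of degree d - m times wedges of the dx_j, which are finitely many.
  For d < m there are no generators at all, and truncated subtraction would mislead; hence the case
  distinction.\<close>

lemma fin_dim_V: "vectorspace.fin_dim class_ring (V m d)"
proof (cases "m \<le> d")
  case True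
  let ?T = "{s. Poly_Mapping.keys s \<subseteq> {..n} \<and> mdegree s = d - m}"
  let ?L = "{js. set js \<subseteq> {..n} \<and> length js = m}"
  let ?X = "(\<lambda>(s, js). W m (Poly_Mapping.single s 1) (map mpoly_var js)) ` (?T \<times> ?L)"
  show ?thesis
  proof (rule fin_dimI[OF vectorspace_V, of ?X])
    show "finite ?X" using finite_monomials finite_lists_length_eq[of "{..n}" m] by simp
    have sP: "Poly_Mapping.single s (1::'k) \<in> PH (d - m)" if "s \<in> ?T" for s
      using that by (simp add: PH_def poly_ring_carrier homog_def)
    show "?X \<subseteq> carrier (V m d)"
    proof
      fix w assume "w \<in> ?X"
      then obtain s js where "s \<in> ?T" "js \<in> ?L" "w = W m (Poly_Mapping.single s 1) (map mpoly_var js)" by auto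
      then have "w \<in> gens m d" using sP[of s] True unfolding gens_def by force
      then show "w \<in> carrier (V m d)" using gens_part by auto
    qed
    fix w X assume X: "submodule class_ring X (V m d)" "?X \<subseteq> X" and w: "w \<in> carrier (V m d)"
    interpret X: submodule "class_ring :: 'k ring" X "V m d" by (rule X(1))
    interpret Pt: submodule "class_ring :: 'k ring" "differential_forms_part n I m d" "EK m" by (rule part_submodule)
    have sub: "submodule class_ring X (EK m)"
    proof (rule submodule.intro)
      show "Module.module class_ring (EK m)" by (rule Pt.module)
      show "X \<subseteq> carrier (EK m)" using X.subset Pt.subset by auto
    qed (use X.m_closed X.zero_closed X.smult_closed in simp_all)
    have "gens m d \<subseteq> X"
    proof
      fix y assume "y \<in> gens m d"
      then obtain f js where y: "y = W m f (map mpoly_var js)" "length js = m" "set js \<subseteq> {..n}" "f \<in> PH (d - m)"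
        unfolding gens_def by force
      note tp = tup_vars[OF y(2,3)]
      have "W m f (map mpoly_var js) \<in> X"
      proof (rule homog_combination_mem[OF sub, of "\<lambda>f. W m f (map mpoly_var js)" "d - m"])
        fix s assume "Poly_Mapping.keys s \<subseteq> {..n}" "mdegree s = d - m"
        then show "W m (Poly_Mapping.single s 1) (map mpoly_var js) \<in> X" using X(2) y(2,3) by auto
      qed (use y(4) tp in \<open>simp_all add: PH_def W_closed W_add W_smult del: restrict_scalars_simps(4)\<close>)
      then show "y \<in> X" using y(1) by simp
    qed
    then show "w \<in> X" using part_minimal[OF sub] w by auto
  qed
next
  case False
  have "gens m d = {}" using False by (auto simp: gens_def)
  show ?thesis
  proof (rule fin_dimI[OF vectorspace_V, of "{}"])
    fix w X assume X: "submodule class_ring X (V m d)" and w: "w \<in> carrier (V m d)"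
    interpret X: submodule "class_ring :: 'k ring" X "V m d" by (rule X)
    interpret Pt: submodule "class_ring :: 'k ring" "differential_forms_part n I m d" "EK m" by (rule part_submodule)
    have sub: "submodule class_ring X (EK m)"
    proof (rule submodule.intro)
      show "Module.module class_ring (EK m)" by (rule Pt.module)
      show "X \<subseteq> carrier (EK m)" using X.subset Pt.subset by auto
    qed (use X.m_closed X.zero_closed X.smult_closed in simp_all)
    show "w \<in> X" using part_minimal[OF sub] w \<open>gens m d = {}\<close> by auto
  qed simp_all
qed

end

section \<open>Spanning sets for the forms of large degree\<close>

context curvilinear_data
begin

text \<open>For the pair (i, k) this is a lift of \<theta>^k in the i-th local ring, zero in the
  others.\<close>

definition mono_el :: "nat \<Rightarrow> nat \<times> nat \<Rightarrow> 'k mpoly" where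
  "mono_el a j = el a (only (fst j) (Polynomial.monom 1 (snd j)))"

text \<open>Indexes a K-basis of \<open>S\<close>; the set \<open>Bh\<close> after it does the same
  for the differentials of \<open>S\<close>, the product of the K[\<theta>]/(h i).\<close>

definition Bg :: "(nat \<times> nat) set" where "Bg = (SIGMA i:{..<t}. {..<degree (g i)})"
definition Bh :: "(nat \<times> nat) set" where "Bh = (SIGMA i:{..<t}. {..<degree (h i)})"

lemma finite_B: "finite Bg" "finite Bh"
  by (simp_all add: Bg_def Bh_def)

lemma card_B: "card Bg = (\<Sum>i<t. degree (g i))" "card Bh = (\<Sum>i<t. degree (h i))"
  by (simp_all add: Bg_def Bh_def)

lemma mono_el_PH: "k0 \<le> a \<Longrightarrow> mono_el a j \<in> PH a"
  unfolding mono_el_def by (rule el_PH)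

lemma r_mono_el:
  "k0 \<le> a \<Longrightarrow> i < t \<Longrightarrow> r i (mono_el a j) = (if i = fst j then Polynomial.monom 1 (snd j) mod g i else 0)"
  by (simp add: mono_el_def r_el only_def)

lemma r_mono_el_sum:
  assumes "k0 \<le> a" "i < t"
  shows "r i (\<Sum>j\<in>Bg. mpoly_const (c j) * mono_el a j) = (\<Sum>k<degree (g i). Polynomial.monom (c (i, k)) k)"
proof -
  have "r i (\<Sum>j\<in>Bg. mpoly_const (c j) * mono_el a j) =
      (\<Sum>j\<in>Bg. r i (mpoly_const (c j) * mono_el a j))"
    using PH_carrier[OF mono_el_PH[OF assms(1)]] by (intro r_sum[OF assms(2)]) simp
  also have "\<dots> = (\<Sum>j\<in>Bg. if i = fst j then Polynomial.smult (c j) (Polynomial.monom 1 (snd j) mod g i) else 0)"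
    using PH_carrier[OF mono_el_PH[OF assms(1)]] assms
    by (intro sum.cong refl) (simp add: r_const_mult r_mono_el)
  also have "\<dots> = (\<Sum>i'<t. \<Sum>k<degree (g i'). if i = i' then Polynomial.smult (c (i', k)) (Polynomial.monom 1 k mod g i) else 0)"
    unfolding Bg_def by (subst sum.Sigma) (auto intro!: sum.cong)
  also have "\<dots> = (\<Sum>i'<t. if i = i' then (\<Sum>k<degree (g i'). Polynomial.smult (c (i', k)) (Polynomial.monom 1 k mod g i)) else 0)"
    by (intro sum.cong refl) simp
  also have "\<dots> = (\<Sum>k<degree (g i). Polynomial.smult (c (i, k)) (Polynomial.monom 1 k mod g i))"
    using assms(2) by simp
  also have "\<dots> = (\<Sum>k<degree (g i). Polynomial.monom (c (i, k)) k)"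
  proof (intro sum.cong refl)
    fix k assume "k \<in> {..<degree (g i)}"
    then have "Polynomial.monom (1 :: 'k) k mod g i = Polynomial.monom 1 k"
      by (intro mod_poly_less) (simp add: degree_monom_eq)
    then show "Polynomial.smult (c (i, k)) (Polynomial.monom 1 k mod g i) = Polynomial.monom (c (i, k)) k"
      by (simp add: smult_monom)
  qed
  finally show ?thesis .
qed

text \<open>In degree \<open>a\<close> the sum has the same reduced representatives as
  \<open>F\<close>, namely those with the coefficients of \<open>r i F\<close>.\<close>

lemma expansion:
  assumes "F \<in> PH a" "k0 \<le> a"
  shows "F - (\<Sum>j\<in>Bg. mpoly_const (poly.coeff (r (fst j) F) (snd j)) * mono_el a j) \<in> I"
proof (rule r_eq_imp[OF assms(1)])
  show "(\<Sum>j\<in>Bg. mpoly_const (poly.coeff (r (fst j) F) (snd j)) * mono_el a j) \<in> PH a"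
    by (intro PH_sum PH_const_mult mono_el_PH assms(2))
  fix i assume i: "i < t"
  show "r i F = r i (\<Sum>j\<in>Bg. mpoly_const (poly.coeff (r (fst j) F) (snd j)) * mono_el a j)"
    unfolding r_mono_el_sum[OF assms(2) i] fst_conv snd_conv
    by (rule poly_sum_monoms_mod[OF g_nonzero[OF i] r_mod[OF i PH_carrier[OF assms(1)]]])
qed

lemma functional_zero:
  assumes "linear_functional (V m d) l" shows "l \<zero>\<^bsub>E m\<^esub> = 0"
proof -
  interpret V: vectorspace "class_ring :: 'k ring" "V m d" by (rule vectorspace_V)
  have "\<zero>\<^bsub>V m d\<^esub> \<in> carrier (V m d)" by (rule V.zero_closed)
  then have "l (\<zero>\<^bsub>V m d\<^esub> \<oplus>\<^bsub>V m d\<^esub> \<zero>\<^bsub>V m d\<^esub>) = l \<zero>\<^bsub>V m d\<^esub> + l \<zero>\<^bsub>V m d\<^esub>"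
    using linear_functionalD(1)[OF assms] by blast
  moreover have "\<zero>\<^bsub>V m d\<^esub> \<oplus>\<^bsub>V m d\<^esub> \<zero>\<^bsub>V m d\<^esub> = \<zero>\<^bsub>V m d\<^esub>" by (rule V.add.l_one[OF V.zero_closed])
  ultimately have "l \<zero>\<^bsub>E m\<^esub> = l \<zero>\<^bsub>E m\<^esub> + l \<zero>\<^bsub>E m\<^esub>" by (simp only: V_simps)
  then show ?thesis by (simp only: add_cancel_right_right)
qed

section \<open>Elimination slot by slot\<close>

definition kills :: "nat \<Rightarrow> nat \<Rightarrow> ((('k mpoly set \<Rightarrow> 'k mpoly set) set list \<Rightarrow> 'k mpoly set) set \<Rightarrow> 'k) \<Rightarrow>
    ('k mpoly \<times> nat) list \<Rightarrow> bool" where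
  "kills m d l ps \<longleftrightarrow> (\<forall>e f. e + deg_sum ps = d \<longrightarrow> f \<in> PH e \<longrightarrow> l (W m f (map fst ps)) = 0)"

text \<open>The bound \<open>D\<close> on each entry keeps the total degree below m D, so enough
  degree is left for the slot under treatment.\<close>

definition small_tup :: "nat \<Rightarrow> ('k mpoly \<times> nat) list \<Rightarrow> bool" where
  "small_tup m ps \<longleftrightarrow> graded_tup m ps \<and> (\<forall>p\<in>set ps. snd p \<le> D)"

lemma small_tup_update: "small_tup m ps \<Longrightarrow> x \<in> PH e \<Longrightarrow> e \<le> D \<Longrightarrow> small_tup m (ps[i := (x, e)])"
  using set_update_subset_insert[of ps i "(x, e)"] graded_tup_update[of m ps x e i]
  by (auto simp: small_tup_def)

lemma deg_sum_le: "small_tup m ps \<Longrightarrow> deg_sum ps \<le> m * D"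
proof -
  have "\<forall>p\<in>set ps. snd p \<le> D \<Longrightarrow> deg_sum ps \<le> length ps * D" for ps :: "('k mpoly \<times> nat) list"
    by (induction ps) auto
  then show "small_tup m ps \<Longrightarrow> deg_sum ps \<le> m * D" by (auto simp: small_tup_def graded_tup_def)
qed

lemma kills_alternating:
  assumes l: "linear_functional (V m d) l" and ps: "graded_tup m ps"
    and ij: "i < m" "j < m" "i \<noteq> j" "fst (ps ! i) = fst (ps ! j)"
  shows "kills m d l ps"
  unfolding kills_def
proof (intro allI impI)
  fix e f assume f: "f \<in> PH e"
  have "length ps = m" using ps by (simp add: graded_tup_def)
  then have "W m f (map fst ps) = \<zero>\<^bsub>E m\<^esub>"
    using ij by (intro W_alternating[OF PH_carrier[OF f] graded_tup_tup[OF ps] ij(1,2,3)]) simp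
  then show "l (W m f (map fst ps)) = 0" using functional_zero[OF l] by simp
qed

text \<open>With the other slots frozen, l becomes a function of one coefficient and one
  differentiated form, of total degree d - s. The results on such one-forms apply, since dx0 in this
  slot is already killed.\<close>

lemma slot_reduction_aux:
  assumes l: "linear_functional (V m d) l" and ps: "small_tup m ps" and i: "i < m"
    and large: "k0 + 3 * D + m * D \<le> d" and x0: "kills m d l (ps[i := (x0, 1)])"
    and s: "s = deg_sum (ps[i := (0, 0)])"
    and basis: "\<And>j. j \<in> Bh \<Longrightarrow> l (W m (mono_el (d - s - D) j) (map fst (ps[i := (Y, D)]))) = 0"
  shows "kills m d l (ps[i := (Y, D)]) \<and> (\<forall>j\<le>n. kills m d l (ps[i := (mpoly_var j, 1)]))"
proof -
  have gt: "graded_tup m ps" using ps by (simp add: small_tup_def)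
  have len: "length ps = m" using gt by (simp add: graded_tup_def)
  have sle: "s \<le> m * D" unfolding s by (rule deg_sum_le[OF small_tup_update[OF ps PH_zero]]) simp
  have lens: "k0 + 3 * D \<le> d - s" "s \<le> d" using large sle by linarith+
  have ds: "deg_sum (ps[i := (x, e)]) = e + s" for x e
    unfolding s by (rule deg_sum_update) (use i len in simp)
  define gs where "gs = map fst ps"
  have upd: "map fst (ps[i := (x, e)]) = gs[i := x]" for x e by (simp add: gs_def map_update)
  have gs: "tup m gs" unfolding gs_def by (rule graded_tup_tup[OF gt])
  define \<Delta> where "\<Delta> f x = l (W m f (gs[i := x]))" for f x
  have mem: "W m f (gs[i := x]) \<in> carrier (V m d)" if "a + b = d - s" "f \<in> PH a" "x \<in> PH b" for a b f x
  proof -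
    have "W m f (map fst (ps[i := (x, b)])) \<in> differential_forms_part n I m d"
      by (rule W_mem_part[OF graded_tup_update[OF gt that(3)] that(2)]) (use that(1) lens in \<open>simp add: ds\<close>)
    then show ?thesis by (simp add: upd)
  qed
  note lD = linear_functionalD[OF l]
  note l0 = functional_zero[OF l]
  note PC = PH_carrier
  \<comment> \<open>The sum \<open>s\<close> counts only the other slots, because the placeholder in
    slot \<open>i\<close> has degree 0.\<close>
  interpret one_form n I t g h u r "d - s" \<Delta>
  proof unfold_locales
    fix a b f f' x assume H: "a + b = d - s" "f \<in> PH a" "f' \<in> PH a" "x \<in> PH b"
    show "\<Delta> (f + f') x = \<Delta> f x + \<Delta> f' x"
      unfolding \<Delta>_def W_add[OF PC[OF H(2)] PC[OF H(3)] tup_update[OF gs PC[OF H(4)]]]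
      using lD(1)[OF mem[OF H(1,2,4)] mem[OF H(1,3,4)]] by simp
  next
    fix a b f x y assume H: "a + b = d - s" "f \<in> PH a" "x \<in> PH b" "y \<in> PH b"
    show "\<Delta> f (x + y) = \<Delta> f x + \<Delta> f y"
      unfolding \<Delta>_def W_slot_add[OF PC[OF H(2)] gs i PC[OF H(3)] PC[OF H(4)]]
      using lD(1)[OF mem[OF H(1,2,3)] mem[OF H(1,2,4)]] by simp
  next
    fix a b f x c assume H: "a + b = d - s" "f \<in> PH a" "x \<in> PH b"
    show "\<Delta> (mpoly_const c * f) x = c * \<Delta> f x"
      unfolding \<Delta>_def W_smult[OF PC[OF H(2)] tup_update[OF gs PC[OF H(3)]]]
      using lD(2)[OF mem[OF H]] by simp
  next
    fix a b f x assume H: "a + b = d - s" "f \<in> PH a" "x \<in> PH b" "f \<in> I"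
    show "\<Delta> f x = 0" unfolding \<Delta>_def W_ideal[OF H(4) tup_update[OF gs PC[OF H(3)]]] by (rule l0)
  next
    fix a b f x assume H: "a + b = d - s" "f \<in> PH a" "x \<in> PH b" "x \<in> I"
    show "\<Delta> f x = 0" unfolding \<Delta>_def W_slot_zero[OF PC[OF H(2)] gs i PC[OF H(3)] dd_ideal[OF H(4)]] by (rule l0)
  next
    fix a b b' f x y assume H: "a + b + b' = d - s" "f \<in> PH a" "x \<in> PH b" "y \<in> PH b'"
    have "W m (f * x) (gs[i := y]) \<in> carrier (V m d)" "W m (f * y) (gs[i := x]) \<in> carrier (V m d)"
      by (rule mem[OF H(1) PH_mult[OF H(2,3) refl] H(4)],
          rule mem[OF _ PH_mult[OF H(2,4) refl] H(3)]) (use H(1) in simp)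
    then show "\<Delta> f (x * y) = \<Delta> (f * x) y + \<Delta> (f * y) x"
      unfolding \<Delta>_def W_slot_mult[OF PC[OF H(2)] gs i PC[OF H(3)] PC[OF H(4)]]
      using lD(1) by simp
  next
    fix f c assume H: "f \<in> PH (d - s)"
    show "\<Delta> f (mpoly_const c) = 0"
      unfolding \<Delta>_def W_slot_zero[OF PC[OF H] gs i P_const dd_const] by (rule l0)
  next
    fix a f assume H: "a + 1 = d - s" "f \<in> PH a"
    have "a + deg_sum (ps[i := (x0, 1)]) = d" using H(1) lens by (simp add: ds)
    then have "l (W m f (map fst (ps[i := (x0, 1)]))) = 0"
      using x0[unfolded kills_def, rule_format, OF _ H(2)] by blast
    then show "\<Delta> f x0 = 0" unfolding \<Delta>_def upd .
  next
    show "k0 + 3 * D \<le> d - s" by (rule lens)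
  qed
  have Y0: "\<Delta> F Y = 0" if "F \<in> PH (d - s - D)" for F
  proof (rule vanish_Y[OF _ that])
    fix i' k assume "i' < t" "k < degree (h i')"
    then have "(i', k) \<in> Bh" by (simp add: Bh_def)
    from basis[OF this] show "\<Delta> (el (d - s - D) (only i' (Polynomial.monom 1 k))) Y = 0"
      by (simp add: \<Delta>_def upd mono_el_def)
  qed
  show ?thesis unfolding kills_def upd ds
  proof (intro conjI allI impI)
    fix e f assume e: "e + (D + s) = d" and f: "f \<in> PH e"
    have "e = d - s - D" using e by simp
    then show "l (W m f (gs[i := Y])) = 0" using Y0[of f] f by (simp add: \<Delta>_def)
  next
    fix j e f assume j: "j \<le> n" and e: "e + (1 + s) = d" and f: "f \<in> PH e"
    have "e = d - s - 1" using e by simp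
    then show "l (W m f (gs[i := mpoly_var j])) = 0" using vanish_var[OF Y0 j, of f] f by (simp add: \<Delta>_def)
  qed
qed

text \<open>The same step when \<open>Y\<close> in the slot is known to be harmless with every
  coefficient, so that no basis values have to be supplied.\<close>

lemma slot_reduction:
  assumes l: "linear_functional (V m d) l" and ps: "small_tup m ps" and i: "i < m"
    and large: "k0 + 3 * D + m * D \<le> d" and x0: "kills m d l (ps[i := (x0, 1)])"
    and Y: "kills m d l (ps[i := (Y, D)])" and j: "j \<le> n"
  shows "kills m d l (ps[i := (mpoly_var j, 1)])"
proof -
  define s where "s = deg_sum (ps[i := (0, 0)])"
  have len: "length ps = m" using ps by (simp add: graded_tup_def small_tup_def)
  have "s \<le> m * D" unfolding s_def by (rule deg_sum_le[OF small_tup_update[OF ps PH_zero]]) simp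
  then have a: "k0 \<le> d - s - D" "d - s - D + (D + s) = d" using large by linarith+
  have "l (W m (mono_el (d - s - D) j) (map fst (ps[i := (Y, D)]))) = 0" for j
    using Y[unfolded kills_def, rule_format, OF _ mono_el_PH[OF a(1)]] a(2) deg_sum_update[of i ps Y D] i len
    by (simp add: s_def)
  then show ?thesis using slot_reduction_aux[OF l ps i large x0 s_def] j by blast
qed

lemma functional_vanish:
  assumes l: "linear_functional (V m d) l"
    and k: "\<And>js. length js = m \<Longrightarrow> set js \<subseteq> {..n} \<Longrightarrow> kills m d l (map (\<lambda>j. (mpoly_var j, 1)) js)"
    and x: "x \<in> carrier (V m d)"
  shows "l x = 0"
proof -
  let ?X = "{x \<in> differential_forms_part n I m d. l x = 0}"
  interpret Pt: submodule "class_ring :: 'k ring" "differential_forms_part n I m d" "EK m" by (rule part_submodule)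
  have "submodule class_ring ?X (EK m)"
  proof (rule submodule.intro)
    show "Module.module class_ring (EK m)" by (rule Pt.module)
    show "?X \<subseteq> carrier (EK m)" using Pt.subset by auto
    show "\<zero>\<^bsub>EK m\<^esub> \<in> ?X" using Pt.zero_closed functional_zero[OF l] by simp
    fix a b assume "a \<in> ?X" "b \<in> ?X"
    then show "a \<oplus>\<^bsub>EK m\<^esub> b \<in> ?X" using Pt.m_closed linear_functionalD(1)[OF l, of a b] by simp
  next
    fix c a assume "a \<in> ?X"
    then show "c \<odot>\<^bsub>EK m\<^esub> a \<in> ?X"
      using Pt.smult_closed[of c a] linear_functionalD(2)[OF l, of a c] by simp
  qed
  moreover have "gens m d \<subseteq> ?X"
  proof
    fix w assume w: "w \<in> gens m d"
    then obtain f js e where *: "w = W m f (map mpoly_var js)" "length js = m" "set js \<subseteq> {..n}" "e + m = d" "f \<in> PH e"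
      unfolding gens_def by blast
    have "deg_sum (map (\<lambda>j. (mpoly_var j :: 'k mpoly, 1)) js) = m"
      using *(2) by (simp add: comp_def sum_list_triv)
    then have "l w = 0"
      using k[OF *(2,3), unfolded kills_def, rule_format, OF _ *(5)] *(1,4) by (simp add: comp_def)
    then show "w \<in> ?X" using w gens_part by auto
  qed
  ultimately show ?thesis using part_minimal[of ?X m d] x by auto
qed

lemma kills_expand:
  assumes l: "linear_functional (V m d) l" and ps: "graded_tup m ps" and e: "e + deg_sum ps = d" "k0 \<le> e"
    and basis: "\<And>j. j \<in> Bg \<Longrightarrow> l (W m (mono_el e j) (map fst ps)) = 0"
  shows "kills m d l ps"
  unfolding kills_def
proof (intro allI impI)
  fix e' f assume "e' + deg_sum ps = d" and f': "f \<in> PH e'"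
  then have "e' = e" using e by linarith
  then have f: "f \<in> PH e" using f' by simp
  let ?gs = "map fst ps"
  note gs = graded_tup_tup[OF ps]
  have mem: "W m x ?gs \<in> carrier (V m d)" if "x \<in> PH e" for x
    using W_mem_part[OF ps that e(1)] by simp
  define c where "c j = poly.coeff (r (fst j) f) (snd j)" for j
  have G: "(\<Sum>j\<in>A. mpoly_const (c j) * mono_el e j) \<in> PH e" for A
    by (intro PH_sum PH_const_mult mono_el_PH e(2))
  have "l (W m (\<Sum>j\<in>A. mpoly_const (c j) * mono_el e j) ?gs) = 0" if "finite A" "A \<subseteq> Bg" for A
    using that
  proof (induction A rule: finite_induct)
    case empty
    show ?case using functional_zero[OF l] W_ideal[OF I_simps(3) gs] by simp
  next
    case (insert j A)
    have c: "mpoly_const (c j) * mono_el e j \<in> PH e" by (intro PH_const_mult mono_el_PH e(2))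
    have "l (W m (mpoly_const (c j) * mono_el e j) ?gs) = c j * l (W m (mono_el e j) ?gs)"
      unfolding W_smult[OF PH_carrier[OF mono_el_PH[OF e(2)]] gs]
      using linear_functionalD(2)[OF l mem[OF mono_el_PH[OF e(2)]]] by simp
    then show ?case
      using insert linear_functionalD(1)[OF l mem[OF c] mem[OF G[of A]]] basis
      by (simp add: W_add[OF PH_carrier[OF c] PH_carrier[OF G] gs])
  qed
  then have z: "l (W m (\<Sum>j\<in>Bg. mpoly_const (c j) * mono_el e j) ?gs) = 0" using finite_B by blast
  define q where "q = f - (\<Sum>j\<in>Bg. mpoly_const (c j) * mono_el e j)"
  have q: "q \<in> I" unfolding q_def c_def by (rule expansion[OF f e(2)])
  have "W m f ?gs = W m (q + (\<Sum>j\<in>Bg. mpoly_const (c j) * mono_el e j)) ?gs" by (simp add: q_def)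
  also have "\<dots> = W m q ?gs \<oplus>\<^bsub>E m\<^esub> W m (\<Sum>j\<in>Bg. mpoly_const (c j) * mono_el e j) ?gs"
    by (rule W_add[OF I_simps(1)[OF q] PH_carrier[OF G] gs])
  finally have *: "W m f ?gs = W m q ?gs \<oplus>\<^bsub>E m\<^esub> W m (\<Sum>j\<in>Bg. mpoly_const (c j) * mono_el e j) ?gs" .
  have "W m q ?gs = \<zero>\<^bsub>E m\<^esub>" by (rule W_ideal[OF q gs])
  moreover have "\<zero>\<^bsub>E m\<^esub> \<in> carrier (V m d)"
  proof -
    interpret Pt: submodule "class_ring :: 'k ring" "differential_forms_part n I m d" "EK m" by (rule part_submodule)
    show ?thesis using Pt.zero_closed by simp
  qed
  ultimately show "l (W m f ?gs) = 0"
    unfolding * using linear_functionalD(1)[OF l _ mem[OF G[of Bg]], of "\<zero>\<^bsub>E m\<^esub>"] functional_zero[OF l] z by simp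
qed

lemma x0_PH: "x0 \<in> PH 1"
  using PH_var[of 0] by simp

text \<open>Killing the multiples of dx0 by the lifts indexed by \<open>Bg\<close> kills all of R
  dx0 in this degree; after that, \<open>Bh\<close> suffices for dY, and the variables
  follow.\<close>

lemma span_1:
  assumes l: "linear_functional (V 1 d) l" and large: "k0 + 4 * D \<le> d"
    and g: "\<And>j. j \<in> Bg \<Longrightarrow> l (W 1 (mono_el (d - 1) j) [x0]) = 0"
    and h: "\<And>j. j \<in> Bh \<Longrightarrow> l (W 1 (mono_el (d - D) j) [Y]) = 0"
    and x: "x \<in> carrier (V 1 d)"
  shows "l x = 0"
proof (rule functional_vanish[OF l _ x])
  fix js :: "nat list" assume js: "length js = 1" "set js \<subseteq> {..n}"
  then obtain j where j: "js = [j]" "j \<le> n" by (auto simp: length_Suc_conv)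
  have tp: "small_tup 1 [(x0, 1)]" using x0_PH D by (simp add: small_tup_def graded_tup_def)
  have "kills 1 d l [(x0, 1)]"
    by (rule kills_expand[OF l, of _ "d - 1"]) (use tp g large D in \<open>simp_all add: small_tup_def\<close>)
  then show "kills 1 d l (map (\<lambda>j. (mpoly_var j, 1)) js)"
    using slot_reduction_aux[OF l tp, of 0 0] large h j by simp
qed

text \<open>Slot 1 is reduced with slot 0 held at dx0 or dY; then slot 0 is reduced with a variable
  in slot 1.\<close>

lemma two_slots:
  assumes l: "linear_functional (V m d) l" and m: "2 \<le> m" and large: "k0 + 3 * D + m * D \<le> d"
    and js: "length js = m" "set js \<subseteq> {..n}"
    and ab: "\<And>a b. a \<in> {(x0, 1), (Y, D)} \<Longrightarrow> b \<in> {(x0, 1), (Y, D)} \<Longrightarrow>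
      kills m d l ((map (\<lambda>j. (mpoly_var j, 1)) js)[0 := a, 1 := b])"
  shows "kills m d l (map (\<lambda>j. (mpoly_var j, 1)) js)"
proof -
  define ps :: "('k mpoly \<times> nat) list" where "ps = map (\<lambda>j. (mpoly_var j, 1)) js"
  have len: "length ps = m" using js by (simp add: ps_def)
  have ps: "small_tup m ps"
    using js D PH_var by (auto simp: ps_def small_tup_def graded_tup_def)
  have nth: "ps[k := (mpoly_var (js ! k), 1)] = ps" "js ! k \<le> n" if "k < m" for k
    using that js subsetD[OF js(2) nth_mem[of k js]] by (simp_all add: ps_def list_update_same_conv)
  have a: "kills m d l (ps[0 := a])" if "a \<in> {(x0, 1), (Y, D)}" for a
  proof -
    have st: "small_tup m (ps[0 := a])" using that small_tup_update[OF ps] x0_PH Y(1) D by auto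
    have "kills m d l (ps[0 := a, 1 := (mpoly_var (js ! 1), 1)])"
      by (rule slot_reduction[OF l st _ large]) (use ab[folded ps_def, OF that] m nth(2) in simp_all)
    moreover have "ps[0 := a, 1 := (mpoly_var (js ! 1), 1)] = ps[0 := a]"
      using m js by (simp add: ps_def list_update_same_conv)
    ultimately show ?thesis by simp
  qed
  have "kills m d l (ps[0 := (mpoly_var (js ! 0), 1)])"
    by (rule slot_reduction[OF l ps _ large]) (use a m nth(2) in simp_all)
  then show ?thesis using nth(1)[of 0] m by (simp add: ps_def)
qed

lemma span_2:
  assumes l: "linear_functional (V 2 d) l" and large: "k0 + 5 * D \<le> d"
    and h: "\<And>j. j \<in> Bh \<Longrightarrow> l (W 2 (mono_el (d - 1 - D) j) [x0, Y]) = 0"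
    and x: "x \<in> carrier (V 2 d)"
  shows "l x = 0"
proof (rule functional_vanish[OF l _ x])
  fix js :: "nat list" assume js: "length js = 2" "set js \<subseteq> {..n}"
  have tp: "small_tup 2 [(a, i), (b, j)]" if "a \<in> PH i" "b \<in> PH j" "i \<le> D" "j \<le> D" for a i b j
    using that by (simp add: small_tup_def graded_tup_def)
  have gt: "graded_tup 2 [(a, i), (b, j)]" if "a \<in> PH i" "b \<in> PH j" for a i b j
    using that by (simp add: graded_tup_def)
  have alt: "kills 2 d l [(a, i), (a, i)]" if "a \<in> PH i" for a i
    by (rule kills_alternating[OF l gt[OF that that], of 0 1]) simp_all
  \<comment> \<open>The slot reduction is applied to the second slot of dx0 \<and> dx0, where the
    required vanishing for dx0 holds by alternation.\<close>
  have xY: "kills 2 d l [(x0, 1), (Y, D)]"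
    using slot_reduction_aux[OF l tp[OF x0_PH x0_PH D(2,2)], of 1 1] large h alt[OF x0_PH] by simp
  have Yx: "kills 2 d l [(Y, D), (x0, 1)]"
    unfolding kills_def
  proof (intro allI impI)
    fix e f assume e: "e + deg_sum [(Y, D), (x0, 1)] = d" and f: "f \<in> PH e"
    have "l (W 2 f [x0, Y]) = 0" using xY[unfolded kills_def, rule_format, OF _ f] e by simp
    moreover have "W 2 f [x0, Y] \<oplus>\<^bsub>E 2\<^esub> W 2 f [Y, x0] = \<zero>\<^bsub>E 2\<^esub>"
      by (rule W_swap[OF PH_carrier[OF f] PH_carrier[OF x0_PH] PH_carrier[OF Y(1)]])
    moreover have "W 2 f [x0, Y] \<in> carrier (V 2 d)" "W 2 f [Y, x0] \<in> carrier (V 2 d)"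
      using W_mem_part[OF gt[OF x0_PH Y(1)] f] W_mem_part[OF gt[OF Y(1) x0_PH] f] e by simp_all
    ultimately show "l (W 2 f (map fst [(Y, D), (x0, 1)])) = 0"
      using linear_functionalD(1)[OF l, of "W 2 f [x0, Y]" "W 2 f [Y, x0]"] functional_zero[OF l] by simp
  qed
  obtain i j where ij: "js = [i, j]" using js(1) by (auto simp: numeral_2_eq_2 length_Suc_conv)
  show "kills 2 d l (map (\<lambda>j. (mpoly_var j, 1)) js)"
    by (rule two_slots[OF l _ _ js]) (use large xY Yx alt[OF x0_PH] alt[OF Y(1)] in \<open>auto simp: ij\<close>)
qed

text \<open>Three slots filled from the two differentials dx0 and dY must repeat one of them, so
  alternation kills everything.\<close>

lemma span_ge_3:
  assumes l: "linear_functional (V m d) l" and m: "2 < m" and large: "k0 + 3 * D + m * D \<le> d"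
    and x: "x \<in> carrier (V m d)"
  shows "l x = 0"
proof (rule functional_vanish[OF l _ x])
  fix js :: "nat list" assume js: "length js = m" "set js \<subseteq> {..n}"
  define ps :: "('k mpoly \<times> nat) list" where "ps = map (\<lambda>j. (mpoly_var j, 1)) js"
  have len: "length ps = m" using js by (simp add: ps_def)
  have ps: "small_tup m ps"
    using js D PH_var by (auto simp: ps_def small_tup_def graded_tup_def)
  have n2: "js ! 2 \<le> n" using m js subsetD[OF js(2) nth_mem[of 2 js]] by simp
  have "kills m d l (ps[0 := a, 1 := b])" if ab: "a \<in> {(x0, 1), (Y, D)}" "b \<in> {(x0, 1), (Y, D)}" for a b
  proof -
    have up: "small_tup m (qs[k := c])" if "small_tup m qs" "c \<in> {(x0, 1), (Y, D)}" for qs k c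
      using that(2) small_tup_update[OF that(1)] x0_PH Y(1) D by auto
    have st: "small_tup m (ps[0 := a, 1 := b])" by (intro up ps ab)
    have gt: "graded_tup m (ps[0 := a, 1 := b, 2 := c])" if "c \<in> {(x0, 1), (Y, D)}" for c
      using up[OF st that] by (simp add: small_tup_def)
    show ?thesis
    proof (cases "a = b")
      case True
      have "graded_tup m (ps[0 := a, 1 := b])" using st by (simp add: small_tup_def)
      then show ?thesis by (rule kills_alternating[OF l, of _ 0 1]) (use True len m in simp_all)
    next
      case False
      have c: "kills m d l (ps[0 := a, 1 := b, 2 := c])" if c: "c \<in> {(x0, 1), (Y, D)}" for c
      proof (cases "c = a")
        case True
        show ?thesis by (rule kills_alternating[OF l gt[OF c], of 0 2]) (use True len m in simp_all)
      next
        case False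
        then have "c = b" using ab c \<open>a \<noteq> b\<close> by auto
        then show ?thesis by (intro kills_alternating[OF l gt[OF c], of 1 2]) (use len m in simp_all)
      qed
      have "kills m d l (ps[0 := a, 1 := b, 2 := (mpoly_var (js ! 2), 1)])"
        by (rule slot_reduction[OF l st m large c c n2]) simp_all
      moreover have "ps[0 := a, 1 := b, 2 := (mpoly_var (js ! 2), 1)] = ps[0 := a, 1 := b]"
        using m js by (simp add: ps_def list_update_same_conv)
      ultimately show ?thesis by simp
    qed
  qed
  then show "kills m d l (map (\<lambda>j. (mpoly_var j, 1)) js)"
    by (intro two_slots[OF l _ large js]) (use m in \<open>simp_all add: ps_def\<close>)
qed

end

section \<open>The Euler derivation\<close>

text \<open>Multiplies each component by its degree. It is a derivation that preserves homogeneous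
  ideals and fixes \<open>x0\<close>, hence induces a derivation of \<open>R\<close> under which dx0
  goes to 1 in each local ring.\<close>

definition euler :: "'k::field mpoly \<Rightarrow> 'k mpoly" where
  "euler f = (\<Sum>d\<le>max_mdegree f. of_nat d * hcomp d f)"

lemma lookup_of_nat_mult: "Poly_Mapping.lookup (of_nat d * (f :: 'k::field mpoly)) s = of_nat d * Poly_Mapping.lookup f s"
  by (induction d) (simp_all add: distrib_right lookup_add)

lemma lookup_euler: "Poly_Mapping.lookup (euler f) s = of_nat (mdegree s) * Poly_Mapping.lookup f s"
  using mdegree_le_max[of s f]
  by (auto simp: euler_def lookup_sum lookup_of_nat_mult lookup_hcomp in_keys_iff if_distrib cong: if_cong)

lemma euler_add: "euler (p + q) = euler p + euler q"
  by (rule poly_mapping_eqI) (simp add: lookup_euler lookup_add distrib_left)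

lemma euler_diff: "euler (p - q) = euler p - euler q"
  by (rule poly_mapping_eqI) (simp add: lookup_euler lookup_minus right_diff_distrib)

lemma euler_zero: "euler 0 = 0"
  by (rule poly_mapping_eqI) (simp add: lookup_euler)

lemma euler_sum: "euler (\<Sum>i\<in>A. p i) = (\<Sum>i\<in>A. euler (p i))"
  by (induction A rule: infinite_finite_induct) (simp_all add: euler_zero euler_add)

lemma euler_homog: "homog d p \<Longrightarrow> euler p = of_nat d * p"
  by (rule poly_mapping_eqI) (auto simp: lookup_euler lookup_of_nat_mult homog_def in_keys_iff)

lemma euler_mult: "euler (p * q) = euler p * q + p * euler q"
proof -
  let ?p = "\<lambda>i. hcomp i p" and ?q = "\<lambda>j. hcomp j q"
  let ?A = "{..max_mdegree p}" and ?B = "{..max_mdegree q}"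
  have p: "p = sum ?p ?A" and q: "q = sum ?q ?B" by (rule sum_hcomp[OF order_refl])+
  have e: "euler (hcomp i f) = of_nat i * hcomp i f" for i and f :: "'a mpoly"
    by (rule euler_homog[OF homog_hcomp])
  have "p * q = (\<Sum>i\<in>?A. \<Sum>j\<in>?B. ?p i * ?q j)" by (subst p, subst q) (rule sum_product)
  then have "euler (p * q) = (\<Sum>i\<in>?A. \<Sum>j\<in>?B. euler (?p i * ?q j))" by (simp add: euler_sum)
  also have "\<dots> = (\<Sum>i\<in>?A. \<Sum>j\<in>?B. euler (?p i) * ?q j + ?p i * euler (?q j))"
  proof (intro sum.cong refl)
    fix i j
    have "euler (?p i * ?q j) = of_nat (i + j) * (?p i * ?q j)"
      by (rule euler_homog[OF homog_mult[OF homog_hcomp homog_hcomp]])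
    then show "euler (?p i * ?q j) = euler (?p i) * ?q j + ?p i * euler (?q j)"
      by (simp add: e algebra_simps)
  qed
  also have "\<dots> = (\<Sum>i\<in>?A. euler (?p i)) * sum ?q ?B + sum ?p ?A * (\<Sum>j\<in>?B. euler (?q j))"
    by (simp add: sum.distrib sum_product)
  also have "\<dots> = euler p * q + p * euler q" by (simp only: euler_sum[symmetric] p[symmetric] q[symmetric])
  finally show ?thesis .
qed

lemma P_of_nat: "of_nat d \<in> carrier (poly_ring n)"
  by (induction d) simp_all

lemma P_euler: "f \<in> carrier (poly_ring n) \<Longrightarrow> euler f \<in> carrier (poly_ring n)"
  unfolding euler_def by (intro P_sum P_mult P_of_nat P_hcomp)

section \<open>Forms detected by local derivations\<close>

context curvilinear_data
begin

lemma euler_ideal: "f \<in> I \<Longrightarrow> euler f \<in> I"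
  unfolding euler_def by (intro poly_ideal_sum[OF II] I_simps(4) graded_idealD(2)[OF gI] P_of_nat)

text \<open>Functions on residue classes, such as \<open>rep (r i)\<close>, are only used for functions that
  are constant on the classes.\<close>

definition rep :: "('k mpoly \<Rightarrow> 'k poly) \<Rightarrow> 'k mpoly set \<Rightarrow> 'k poly" where
  "rep F x = F (SOME f. f \<in> carrier P \<and> cls f = x)"

lemma rep_cls:
  assumes f: "f \<in> carrier P" and F: "\<And>f'. f' \<in> carrier P \<Longrightarrow> f - f' \<in> I \<Longrightarrow> F f' = F f"
  shows "rep F (cls f) = F f"
proof -
  have "\<exists>f'. f' \<in> carrier P \<and> cls f' = cls f" using f by blast
  from someI_ex[OF this] have *: "(SOME f'. f' \<in> carrier P \<and> cls f' = cls f) \<in> carrier P"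
    "cls f = cls (SOME f'. f' \<in> carrier P \<and> cls f' = cls f)" by simp_all
  then show ?thesis unfolding rep_def using cls_eq_iff[OF f *(1)] by (intro F) simp_all
qed

lemma r_congI: "i < t \<Longrightarrow> f \<in> carrier P \<Longrightarrow> f' \<in> carrier P \<Longrightarrow> f - f' \<in> I \<Longrightarrow> r i f' = r i f"
  using r_ideal[of i "f - f'"] r_diff[of i f f'] by simp

lemma rep_r: "i < t \<Longrightarrow> f \<in> carrier P \<Longrightarrow> rep (r i) (cls f) = r i f"
  by (rule rep_cls) (simp_all add: r_congI)

lemma rep_euler: "i < t \<Longrightarrow> f \<in> carrier P \<Longrightarrow> rep (\<lambda>f. r i (euler f)) (cls f) = r i (euler f)"
  using euler_ideal by (intro rep_cls) (simp_all add: r_congI P_euler euler_diff[symmetric])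

text \<open>The structure of K[\<theta>]/(q) as an \<open>R\<close>-module through the i-th local
  ring, realized on remainders; \<open>q\<close> is either \<open>g i\<close> or \<open>h i\<close>
  in what follows.\<close>

definition act :: "nat \<Rightarrow> 'k poly \<Rightarrow> 'k mpoly set \<Rightarrow> 'k poly \<Rightarrow> 'k poly" where
  "act i q x v = (rep (r i) x * v) mod q"

lemma act_cls: "i < t \<Longrightarrow> f \<in> carrier P \<Longrightarrow> act i q (cls f) v = (r i f * v) mod q"
  by (simp add: act_def rep_r)

lemma ring_action_act:
  assumes i: "i < t" and q: "q dvd g i"
  shows "ring_action R (act i q)"
proof (intro ring_action.intro ring_action_axioms.intro cring_R)
  fix x y v w assume "x \<in> carrier R"
  then obtain f where f: "f \<in> carrier P" "x = cls f" using cls_surj by blast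
  then show "act i q x (v + w) = act i q x v + act i q x w"
    using i by (simp add: act_cls distrib_left poly_mod_add_left)
  assume "y \<in> carrier R"
  then obtain f' where f': "f' \<in> carrier P" "y = cls f'" using cls_surj by blast
  show "act i q (x \<oplus>\<^bsub>R\<^esub> y) v = act i q x v + act i q y v"
    using i f f' by (simp add: cls_add[symmetric] act_cls r_add distrib_right poly_mod_add_left)
  have "(r i (f * f') * v) mod q = ((r i f * r i f') mod g i mod q * v) mod q"
    using i f f' by (simp add: r_mult mod_mult_left_eq)
  also have "\<dots> = (r i f * (r i f' * v mod q)) mod q"
    by (simp add: mod_mod_cancel[OF q] mod_mult_left_eq mod_mult_right_eq mult.assoc)
  finally show "act i q (x \<otimes>\<^bsub>R\<^esub> y) v = act i q x (act i q y v)"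
    using i f f' by (simp add: cls_mult[symmetric] act_cls)
qed

lemma act_one: "i < t \<Longrightarrow> q dvd g i \<Longrightarrow> act i q \<one>\<^bsub>R\<^esub> v = v mod q"
proof -
  assume i: "i < t" and q: "q dvd g i"
  have "act i q \<one>\<^bsub>R\<^esub> v = (r i (mpoly_const 1) * v) mod q"
    using i by (simp add: cls_one[symmetric] act_cls)
  also have "\<dots> = (1 mod g i mod q * v) mod q"
    unfolding r_const[OF i] by (simp only: mod_mult_left_eq one_pCons)
  finally show ?thesis by (simp add: mod_mod_cancel[OF q] mod_mult_left_eq)
qed

text \<open>The unit of \<open>R\<close> acts as reduction modulo \<open>q\<close> and fixes
  \<open>x\<close>, so the value at \<open>x\<close> is already reduced.\<close>

lemma act_linear_mod:
  assumes i: "i < t" and q: "q dvd g i" and M: "Module.module R M"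
    and L: "ring_action.act_linear R (act i q) M L" and x: "x \<in> carrier M"
  shows "L x mod q = L x"
proof -
  interpret M: Module.module R M by fact
  interpret act: ring_action R "act i q" by (rule ring_action_act[OF i q])
  have "L (\<one>\<^bsub>R\<^esub> \<odot>\<^bsub>M\<^esub> x) = act i q \<one>\<^bsub>R\<^esub> (L x)" by (rule act.act_linearD(2)[OF L x M.R.one_closed])
  then show ?thesis using x by (simp add: act_one[OF i q])
qed

text \<open>Differentiation is well defined from K[\<theta>]/(g i) to K[\<theta>]/(h i), because
  \<open>h i\<close> divides both \<open>g i\<close> and its derivative.\<close>

lemma pderiv_mod_h:
  assumes i: "i < t"
  shows "pderiv (p mod g i) mod h i = pderiv p mod h i"
proof -
  have "pderiv p = pderiv (p div g i * g i + p mod g i)" by simp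
  also have "\<dots> = p div g i * pderiv (g i) + pderiv (p div g i) * g i + pderiv (p mod g i)"
    by (simp only: pderiv_add pderiv_mult) (simp add: algebra_simps)
  finally have e: "pderiv p - pderiv (p mod g i) = p div g i * pderiv (g i) + pderiv (p div g i) * g i" by simp
  have "h i dvd pderiv p - pderiv (p mod g i)"
    unfolding e using h_dvd_g[OF i] h_dvd_g'[OF i] by (intro dvd_add dvd_mult)
  then show ?thesis by (simp add: mod_eq_dvd_iff[symmetric])
qed

lemma affine_derivation:
  assumes i: "i < t"
  shows "\<exists>D. ring_action.act_linear R (act i (h i)) \<Omega> D \<and> (\<forall>f\<in>carrier P. D (dd f) = pderiv (r i f) mod h i)"
proof -
  interpret act: ring_action R "act i (h i)" by (rule ring_action_act[OF i h_dvd_g[OF i]])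
  let ?\<delta> = "\<lambda>x. pderiv (rep (r i) x) mod h i"
  have "\<exists>D. act.act_linear \<Omega> D \<and> (\<forall>x\<in>carrier R. D (kaehler_d (coord_const n I) R x) = ?\<delta> x)"
  proof (rule act.kaehler_lift[OF coord_const_hom])
    fix x assume "x \<in> carrier R"
    show "act i (h i) \<one>\<^bsub>R\<^esub> (?\<delta> x) = ?\<delta> x" by (simp add: act_one[OF i h_dvd_g[OF i]])
  next
    fix c
    have "pderiv ([:c:] mod g i) mod h i = pderiv [:c:] mod h i" by (rule pderiv_mod_h[OF i])
    then show "?\<delta> (coord_const n I c) = 0"
      using i by (simp add: coord_const_eq rep_r r_const pderiv_pCons)
  next
    fix x y assume "x \<in> carrier R" "y \<in> carrier R"
    then obtain f f' where f: "f \<in> carrier P" "x = cls f" "f' \<in> carrier P" "y = cls f'"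
      using cls_surj by metis
    show "?\<delta> (x \<oplus>\<^bsub>R\<^esub> y) = ?\<delta> x + ?\<delta> y"
      using i f by (simp add: cls_add[symmetric] rep_r r_add pderiv_add poly_mod_add_left)
    have "?\<delta> (x \<otimes>\<^bsub>R\<^esub> y) = pderiv (r i f * r i f') mod h i"
      using i f by (simp add: cls_mult[symmetric] rep_r r_mult pderiv_mod_h)
    also have "\<dots> = act i (h i) x (?\<delta> y) + act i (h i) y (?\<delta> x)"
      using i f by (simp add: rep_r act_cls pderiv_mult poly_mod_add_left mod_mult_right_eq)
    finally show "?\<delta> (x \<otimes>\<^bsub>R\<^esub> y) = act i (h i) x (?\<delta> y) + act i (h i) y (?\<delta> x)" .
  qed
  then show ?thesis using i by (auto simp: dd_def rep_r)
qed

lemma euler_derivation: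
  assumes i: "i < t" and q: "q dvd g i"
  shows "\<exists>D. ring_action.act_linear R (act i q) \<Omega> D \<and> (\<forall>f\<in>carrier P. D (dd f) = r i (euler f) mod q)"
proof -
  interpret act: ring_action R "act i q" by (rule ring_action_act[OF i q])
  let ?\<delta> = "\<lambda>x. rep (\<lambda>f. r i (euler f)) x mod q"
  have "\<exists>D. act.act_linear \<Omega> D \<and> (\<forall>x\<in>carrier R. D (kaehler_d (coord_const n I) R x) = ?\<delta> x)"
  proof (rule act.kaehler_lift[OF coord_const_hom])
    fix x assume "x \<in> carrier R"
    show "act i q \<one>\<^bsub>R\<^esub> (?\<delta> x) = ?\<delta> x" by (simp add: act_one[OF i q])
  next
    fix c
    have "euler (mpoly_const c :: 'k mpoly) = of_nat 0 * mpoly_const c" by (rule euler_homog[OF homog_const])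
    then show "?\<delta> (coord_const n I c) = 0"
      using i by (simp add: coord_const_eq rep_euler r_zero)
  next
    fix x y assume "x \<in> carrier R" "y \<in> carrier R"
    then obtain f f' where f: "f \<in> carrier P" "x = cls f" "f' \<in> carrier P" "y = cls f'"
      using cls_surj by metis
    show "?\<delta> (x \<oplus>\<^bsub>R\<^esub> y) = ?\<delta> x + ?\<delta> y"
      using i f by (simp add: cls_add[symmetric] rep_euler euler_add r_add P_euler poly_mod_add_left)
    have "?\<delta> (x \<otimes>\<^bsub>R\<^esub> y) = (r i (euler f) * r i f' + r i f * r i (euler f')) mod q"
      using i f by (simp add: cls_mult[symmetric] rep_euler euler_mult r_add r_mult P_euler
        poly_mod_add_left[symmetric] mod_mod_cancel[OF q])
    also have "\<dots> = act i q x (?\<delta> y) + act i q y (?\<delta> x)"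
      using i f by (simp add: rep_euler act_cls poly_mod_add_left mod_mult_right_eq mult.commute add.commute)
    finally show "?\<delta> (x \<otimes>\<^bsub>R\<^esub> y) = act i q x (?\<delta> y) + act i q y (?\<delta> x)" .
  qed
  then show ?thesis using i by (auto simp: dd_def rep_euler)
qed

text \<open>A constant acts on remainders by scalar multiplication, so each coefficient of an
  \<open>R\<close>-linear map into K[\<theta>]/(q) is a K-linear functional. This supplies the test
  functionals for independence.\<close>

lemma coeff_functional:
  assumes i: "i < t" and q: "q dvd g i" and T: "ring_action.act_linear R (act i q) (E m) T"
  shows "linear_functional (V m d) (\<lambda>w. poly.coeff (T w) k)"
proof -
  interpret act: ring_action R "act i q" by (rule ring_action_act[OF i q])
  interpret Pt: submodule "class_ring :: 'k ring" "differential_forms_part n I m d" "EK m" by (rule part_submodule)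
  have mem: "w \<in> carrier (E m)" if "w \<in> differential_forms_part n I m d" for w
    using that Pt.subset by auto
  show ?thesis unfolding linear_functional_def
  proof (intro conjI ballI allI)
    fix x y assume "x \<in> carrier (V m d)" "y \<in> carrier (V m d)"
    then show "poly.coeff (T (x \<oplus>\<^bsub>V m d\<^esub> y)) k = poly.coeff (T x) k + poly.coeff (T y) k"
      using act.act_linearD(1)[OF T mem mem] by simp
  next
    fix c x assume "x \<in> carrier (V m d)"
    then have x: "x \<in> carrier (E m)" using mem by simp
    have "T (cls (mpoly_const c) \<odot>\<^bsub>E m\<^esub> x) = act i q (cls (mpoly_const c)) (T x)"
      by (rule act.act_linearD(2)[OF T x]) simp
    also have "\<dots> = ([:c:] mod g i * T x) mod q" using i by (simp add: act_cls r_const)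
    also have "\<dots> = ([:c:] mod g i mod q * T x) mod q" by (simp only: mod_mult_left_eq)
    also have "\<dots> = Polynomial.smult c (T x mod q)"
      by (simp add: mod_mod_cancel[OF q] mod_mult_left_eq mod_smult_left)
    finally show "poly.coeff (T (c \<odot>\<^bsub>V m d\<^esub> x)) k = c * poly.coeff (T x) k"
      by (simp add: coord_const_eq act_linear_mod[OF i q module_E T x])
  qed
qed

lemma form_lift_1:
  assumes i: "i < t" and q: "q dvd g i" and D': "ring_action.act_linear R (act i q) \<Omega> D'"
  shows "\<exists>T. ring_action.act_linear R (act i q) (E 1) T \<and>
    (\<forall>f\<in>carrier P. \<forall>x\<in>carrier P. T (W 1 f [x]) = (r i f * D' (dd x)) mod q)"
proof -
  interpret act: ring_action R "act i q" by (rule ring_action_act[OF i q])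
  have "\<exists>T. act.act_linear (exterior_power R 1 \<Omega>) T \<and> (\<forall>vs\<in>tuples 1 \<Omega>. T (wedge R 1 \<Omega> vs) = D' (vs ! 0))"
  proof (rule act.exterior_lift[OF module_\<Omega>])
    show "D' (vs[i := v \<oplus>\<^bsub>\<Omega>\<^esub> w] ! 0) = D' (vs[i := v] ! 0) + D' (vs[i := w] ! 0)"
      if "vs \<in> tuples 1 \<Omega>" "i < 1" "v \<in> carrier \<Omega>" "w \<in> carrier \<Omega>" for vs i v w
      using that act.act_linearD(1)[OF D'] by (simp add: tuples_def)
    show "D' (vs[j := a \<odot>\<^bsub>\<Omega>\<^esub> v] ! 0) = act i q a (D' (vs[j := v] ! 0))"
      if "vs \<in> tuples 1 \<Omega>" "j < 1" "a \<in> carrier R" "v \<in> carrier \<Omega>" for vs j a v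
      using that act.act_linearD(2)[OF D'] by (simp add: tuples_def)
    show "act i q \<one>\<^bsub>R\<^esub> (D' (vs ! 0)) = D' (vs ! 0)" if "vs \<in> tuples 1 \<Omega>" for vs
    proof -
      have "vs ! 0 \<in> carrier \<Omega>" using that by (auto simp: tuples_def)
      then show ?thesis by (simp add: act_one[OF i q] act_linear_mod[OF i q module_\<Omega> D'])
    qed
  qed simp
  then obtain T where T: "act.act_linear (E 1) T" "\<And>vs. vs \<in> tuples 1 \<Omega> \<Longrightarrow> T (wedge R 1 \<Omega> vs) = D' (vs ! 0)"
    unfolding E_eq by blast
  have "T (W 1 f [x]) = (r i f * D' (dd x)) mod q" if f: "f \<in> carrier P" "x \<in> carrier P" for f x
  proof -
    have tp: "map dd [x] \<in> tuples 1 \<Omega>" using f by (intro tuples_dd) (simp add: tup_def)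
    have "wedge R 1 \<Omega> (map dd [x]) \<in> carrier (E 1)"
      unfolding E_eq by (rule ext_module.wedge_closed[OF ext_\<Omega> tp])
    from act.act_linearD(2)[OF T(1) this cls_closed[OF f(1)]] show ?thesis
      using i f T(2)[OF tp] by (simp add: W_def act_cls)
  qed
  then show ?thesis using T(1) by blast
qed

text \<open>The 2 x 2 determinant of two derivations is alternating and bilinear, hence a map on
  two-forms.\<close>

lemma form_lift_2:
  assumes i: "i < t" and q: "q dvd g i" and D1: "ring_action.act_linear R (act i q) \<Omega> D1"
    and D2: "ring_action.act_linear R (act i q) \<Omega> D2"
  shows "\<exists>T. ring_action.act_linear R (act i q) (E 2) T \<and> (\<forall>f\<in>carrier P. \<forall>x\<in>carrier P. \<forall>y\<in>carrier P.
    T (W 2 f [x, y]) = (r i f * (D1 (dd x) * D2 (dd y) - D1 (dd y) * D2 (dd x))) mod q)"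
proof -
  interpret act: ring_action R "act i q" by (rule ring_action_act[OF i q])
  define u where "u vs = (D1 (vs ! 0) * D2 (vs ! 1) - D1 (vs ! 1) * D2 (vs ! 0)) mod q" for vs
  have two: "\<exists>v w. vs = [v, w] \<and> v \<in> carrier \<Omega> \<and> w \<in> carrier \<Omega>" if "vs \<in> tuples 2 \<Omega>" for vs
    using that by (auto simp: tuples_def numeral_2_eq_2 length_Suc_conv)
  have slot: "j = 0 \<or> j = 1" if "j < 2" for j :: nat using that by auto
  have ac: "act i q a (x mod q) = (rep (r i) a * x) mod q" for a x by (simp add: act_def mod_mult_right_eq)
  have cross: "((a * x) mod q * y - z * ((a * w) mod q)) mod q = (a * (x * y - z * w)) mod q" for a x y z w :: "'k poly"
  proof -
    have "((a * x) mod q * y - z * ((a * w) mod q)) mod q = ((a * x) * y - z * (a * w)) mod q"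
      by (intro mod_diff_cong mod_mult_cong) simp_all
    then show ?thesis by (simp add: algebra_simps)
  qed
  have "\<exists>T. act.act_linear (exterior_power R 2 \<Omega>) T \<and> (\<forall>vs\<in>tuples 2 \<Omega>. T (wedge R 2 \<Omega> vs) = u vs)"
  proof (rule act.exterior_lift[OF module_\<Omega>])
    fix vs v w and j :: nat assume *: "vs \<in> tuples 2 \<Omega>" "j < 2" "v \<in> carrier \<Omega>" "w \<in> carrier \<Omega>"
    obtain a b where "vs = [a, b]" using two[OF *(1)] by blast
    then show "u (vs[j := v \<oplus>\<^bsub>\<Omega>\<^esub> w]) = u (vs[j := v]) + u (vs[j := w])"
      using slot[OF *(2)] act.act_linearD(1)[OF D1 *(3,4)] act.act_linearD(1)[OF D2 *(3,4)]
      by (auto simp: u_def poly_mod_add_left[symmetric] algebra_simps intro: arg_cong[of _ _ "\<lambda>p. p mod q"])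
  next
    fix vs a v and j :: nat assume *: "vs \<in> tuples 2 \<Omega>" "j < 2" "a \<in> carrier R" "v \<in> carrier \<Omega>"
    obtain b c where vs: "vs = [b, c]" using two[OF *(1)] by blast
    have l: "D1 (a \<odot>\<^bsub>\<Omega>\<^esub> v) = (rep (r i) a * D1 v) mod q" "D2 (a \<odot>\<^bsub>\<Omega>\<^esub> v) = (rep (r i) a * D2 v) mod q"
      using act.act_linearD(2)[OF D1 *(4,3)] act.act_linearD(2)[OF D2 *(4,3)] by (simp_all add: act_def)
    have "u [a \<odot>\<^bsub>\<Omega>\<^esub> v, c] = act i q a (u [v, c])"
      unfolding u_def ac by (simp add: l cross)
    moreover have "u [b, a \<odot>\<^bsub>\<Omega>\<^esub> v] = act i q a (u [b, v])"
      using cross[of "rep (r i) a" "D2 v" "D1 b" "D2 b" "D1 v"]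
      unfolding u_def ac by (simp add: l mult.commute)
    ultimately show "u (vs[j := a \<odot>\<^bsub>\<Omega>\<^esub> v]) = act i q a (u (vs[j := v]))"
      using slot[OF *(2)] by (auto simp: vs)
  next
    fix vs :: "('k mpoly set \<Rightarrow> 'k mpoly set) set list" and j k :: nat
    assume "j < k" "k < 2" "vs ! j = vs ! k"
    then have "j = 0" "k = 1" "vs ! 0 = vs ! 1" by (auto simp: less_2_cases_iff)
    then show "u vs = 0" by (simp add: u_def)
  qed (simp add: u_def act_one[OF i q])
  then obtain T where T: "act.act_linear (E 2) T" "\<And>vs. vs \<in> tuples 2 \<Omega> \<Longrightarrow> T (wedge R 2 \<Omega> vs) = u vs"
    unfolding E_eq by blast
  have "T (W 2 f [x, y]) = (r i f * (D1 (dd x) * D2 (dd y) - D1 (dd y) * D2 (dd x))) mod q"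
    if f: "f \<in> carrier P" "x \<in> carrier P" "y \<in> carrier P" for f x y
  proof -
    have tp: "map dd [x, y] \<in> tuples 2 \<Omega>" using f by (intro tuples_dd) (simp add: tup_def)
    have "wedge R 2 \<Omega> (map dd [x, y]) \<in> carrier (E 2)"
      unfolding E_eq by (rule ext_module.wedge_closed[OF ext_\<Omega> tp])
    from act.act_linearD(2)[OF T(1) this cls_closed[OF f(1)]] show ?thesis
      using i f T(2)[OF tp] by (simp add: W_def act_cls u_def mod_mult_right_eq)
  qed
  then show ?thesis using T(1) by blast
qed

lemma coeff_mono_el:
  assumes "i < t" "q dvd g i" "k0 \<le> a" "snd j < degree q" "fst j = i"
  shows "poly.coeff ((r i (mono_el a j)) mod q) k = (if snd j = k then 1 else 0)"
proof -
  have "r i (mono_el a j) mod q = Polynomial.monom 1 (snd j) mod q"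
    using assms by (simp add: r_mono_el mod_mod_cancel)
  also have "\<dots> = Polynomial.monom 1 (snd j)"
    using assms(4) by (intro mod_poly_less) (simp add: degree_monom_eq)
  finally show ?thesis by simp
qed

lemma Y_derivative: "i < t \<Longrightarrow> pderiv (r i Y) mod h i = 1 mod h i"
  by (simp add: Y(2) pderiv_mod_h pderiv_pCons one_pCons)

lemma x0_derivative: "i < t \<Longrightarrow> pderiv (r i x0) mod h i = 0"
  by (simp add: r_x0 pderiv_mod_h)

lemma euler_x0: "euler x0 = (x0 :: 'k mpoly)"
  using euler_homog[of 1 x0] homog_var[of 0] by simp

section \<open>Dimensions in large degrees\<close>

lemma dim_1:
  assumes large: "k0 + 4 * D \<le> d"
  shows "vectorspace.dim class_ring (V 1 d) = card Bg + card Bh"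
proof -
  have a: "k0 \<le> d - 1" "k0 \<le> d - D" "d - 1 + 1 = d" "d - D + D = d" using large D by simp_all
  define v where "v = case_sum (\<lambda>j. W 1 (mono_el (d - 1) j) [x0]) (\<lambda>j. W 1 (mono_el (d - D) j) [Y])"
  note x0P = PH_carrier[OF x0_PH] and YP = PH_carrier[OF Y(1)]
  note mP = PH_carrier[OF mono_el_PH[OF a(1)]] PH_carrier[OF mono_el_PH[OF a(2)]]
  have mem: "v \<in> Bg <+> Bh \<rightarrow> carrier (V 1 d)"
  proof
    fix j assume "j \<in> Bg <+> Bh"
    moreover have "W 1 (mono_el (d - 1) j) [x0] \<in> differential_forms_part n I 1 d" for j
      using W_mem_part[OF _ mono_el_PH[OF a(1)], of 1 "[(x0, 1)]"] a x0_PH by (simp add: graded_tup_def)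
    moreover have "W 1 (mono_el (d - D) j) [Y] \<in> differential_forms_part n I 1 d" for j
      using W_mem_part[OF _ mono_el_PH[OF a(2)], of 1 "[(Y, D)]"] a Y(1) by (simp add: graded_tup_def)
    ultimately show "v j \<in> carrier (V 1 d)" by (auto simp: v_def)
  qed
  have "vectorspace.dim class_ring (V 1 d) = card (Bg <+> Bh)"
  proof (rule dim_functionalsI[OF vectorspace_V fin_dim_V _ mem])
    show "finite (Bg <+> Bh)" using finite_B by simp
    show "l x = 0" if "linear_functional (V 1 d) l" "\<forall>j\<in>Bg <+> Bh. l (v j) = 0" "x \<in> carrier (V 1 d)" for l x
    proof -
      have "\<And>j. j \<in> Bg \<Longrightarrow> l (v (Inl j)) = 0" "\<And>j. j \<in> Bh \<Longrightarrow> l (v (Inr j)) = 0"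
        using that(2) by blast+
      then show ?thesis by (intro span_1[OF that(1) large _ _ that(3)]) (simp_all add: v_def)
    qed
    fix c assume c: "\<And>l. linear_functional (V 1 d) l \<Longrightarrow> (\<Sum>j\<in>Bg <+> Bh. c j * l (v j)) = 0"
    then have c': "(\<Sum>j\<in>Bg. c (Inl j) * l (v (Inl j))) + (\<Sum>j\<in>Bh. c (Inr j) * l (v (Inr j))) = 0"
      if "linear_functional (V 1 d) l" for l
      using c[OF that] by (simp add: sum.Plus finite_B)
    \<comment> \<open>The derivation d/d\<theta> annihilates dx0 and sends dY to 1, so coefficient k
      isolates the unknown at (i, k).\<close>
    have cR: "c (Inr (i, k)) = 0" if ik: "(i, k) \<in> Bh" for i k
    proof -
      have i: "i < t" using ik by (simp add: Bh_def)
      note q = h_dvd_g[OF i]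
      obtain D1 where D1: "ring_action.act_linear R (act i (h i)) \<Omega> D1"
        "\<forall>f\<in>carrier P. D1 (dd f) = pderiv (r i f) mod h i" using affine_derivation[OF i] by blast
      obtain T where T: "ring_action.act_linear R (act i (h i)) (E 1) T"
        "\<forall>f\<in>carrier P. \<forall>x\<in>carrier P. T (W 1 f [x]) = (r i f * D1 (dd x)) mod h i"
        using form_lift_1[OF i q D1(1)] by blast
      have L: "T (v (Inl j)) = 0" for j
        using T(2) D1(2) mP x0P i by (simp add: v_def x0_derivative)
      have R: "T (v (Inr j)) = r i (mono_el (d - D) j) mod h i" for j
      proof -
        have "T (v (Inr j)) = (r i (mono_el (d - D) j) * (pderiv (r i Y) mod h i)) mod h i"
          using T(2) D1(2) mP YP by (simp add: v_def)
        then show ?thesis by (simp only: Y_derivative[OF i] mod_mult_right_eq mult_1_right)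
      qed
      have "poly.coeff (T (v (Inr j))) k = (if j = (i, k) then 1 else 0)" if j: "j \<in> Bh" for j
      proof (cases "fst j = i")
        case True
        then have "snd j < degree (h i)" using j by (auto simp: Bh_def)
        then show ?thesis using coeff_mono_el[OF i q a(2) _ True, of k] True by (auto simp: R prod_eq_iff)
      next
        case False
        then show ?thesis using i by (auto simp: R r_mono_el[OF a(2)])
      qed
      then have "(\<Sum>j\<in>Bh. c (Inr j) * poly.coeff (T (v (Inr j))) k) = (\<Sum>j\<in>Bh. if j = (i, k) then c (Inr j) else 0)"
        by (intro sum.cong) auto
      also have "\<dots> = c (Inr (i, k))" using ik finite_B by simp
      finally show ?thesis using c'[OF coeff_functional[OF i q T(1)], of k] by (simp add: L)
    qed
    \<comment> \<open>The value of the Euler derivation on dY is never computed: the coefficients of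
      those terms are already known to vanish.\<close>
    have cL: "c (Inl (i, k)) = 0" if ik: "(i, k) \<in> Bg" for i k
    proof -
      have i: "i < t" using ik by (simp add: Bg_def)
      note q = dvd_refl[of "g i"]
      obtain D2 where D2: "ring_action.act_linear R (act i (g i)) \<Omega> D2"
        "\<forall>f\<in>carrier P. D2 (dd f) = r i (euler f) mod g i" using euler_derivation[OF i q] by blast
      obtain T where T: "ring_action.act_linear R (act i (g i)) (E 1) T"
        "\<forall>f\<in>carrier P. \<forall>x\<in>carrier P. T (W 1 f [x]) = (r i f * D2 (dd x)) mod g i"
        using form_lift_1[OF i q D2(1)] by blast
      have L: "T (v (Inl j)) = r i (mono_el (d - 1) j) mod g i" for j
        using T(2) D2(2) mP x0P i by (simp add: v_def euler_x0 r_x0 mod_mult_right_eq)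
      have "poly.coeff (T (v (Inl j))) k = (if j = (i, k) then 1 else 0)" if j: "j \<in> Bg" for j
      proof (cases "fst j = i")
        case True
        then have "snd j < degree (g i)" using j by (auto simp: Bg_def)
        then show ?thesis using coeff_mono_el[OF i q a(1) _ True, of k] True by (auto simp: L prod_eq_iff)
      next
        case False
        then show ?thesis using r_mono_el[OF a(1) i, of j] by (auto simp: L)
      qed
      then have "(\<Sum>j\<in>Bg. c (Inl j) * poly.coeff (T (v (Inl j))) k) = (\<Sum>j\<in>Bg. if j = (i, k) then c (Inl j) else 0)"
        by (intro sum.cong) auto
      also have "\<dots> = c (Inl (i, k))" using ik finite_B by simp
      finally show ?thesis using c'[OF coeff_functional[OF i q T(1)], of k] cR by (simp add: split_paired_all)
    qed
    show "\<forall>j\<in>Bg <+> Bh. c j = 0" using cL cR by auto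
  qed
  then show ?thesis using finite_B by (simp add: card_Plus)
qed

lemma dim_2:
  assumes large: "k0 + 5 * D \<le> d"
  shows "vectorspace.dim class_ring (V 2 d) = card Bh"
proof -
  have a: "k0 \<le> d - 1 - D" "d - 1 - D + (1 + D) = d" using large D by simp_all
  define v where "v j = W 2 (mono_el (d - 1 - D) j) [x0, Y]" for j
  note x0P = PH_carrier[OF x0_PH] and YP = PH_carrier[OF Y(1)] and mP = PH_carrier[OF mono_el_PH[OF a(1)]]
  have mem: "v \<in> Bh \<rightarrow> carrier (V 2 d)"
  proof
    fix j
    have "graded_tup 2 [(x0, 1), (Y, D)]" using x0_PH Y(1) by (simp add: graded_tup_def)
    from W_mem_part[OF this mono_el_PH[OF a(1)]] show "v j \<in> carrier (V 2 d)" using a(2) by (simp add: v_def)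
  qed
  show ?thesis
  proof (rule dim_functionalsI[OF vectorspace_V fin_dim_V finite_B(2) mem])
    show "l x = 0" if "linear_functional (V 2 d) l" "\<forall>j\<in>Bh. l (v j) = 0" "x \<in> carrier (V 2 d)" for l x
      using span_2[OF that(1) large _ that(3)] that(2) by (simp add: v_def)
    fix c assume c: "\<And>l. linear_functional (V 2 d) l \<Longrightarrow> (\<Sum>j\<in>Bh. c j * l (v j)) = 0"
    have "c (i, k) = 0" if ik: "(i, k) \<in> Bh" for i k
    proof -
      have i: "i < t" using ik by (simp add: Bh_def)
      note q = h_dvd_g[OF i]
      obtain D1 where D1: "ring_action.act_linear R (act i (h i)) \<Omega> D1"
        "\<forall>f\<in>carrier P. D1 (dd f) = pderiv (r i f) mod h i" using affine_derivation[OF i] by blast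
      obtain D2 where D2: "ring_action.act_linear R (act i (h i)) \<Omega> D2"
        "\<forall>f\<in>carrier P. D2 (dd f) = r i (euler f) mod h i" using euler_derivation[OF i q] by blast
      obtain T where T: "ring_action.act_linear R (act i (h i)) (E 2) T"
        "\<forall>f\<in>carrier P. \<forall>x\<in>carrier P. \<forall>y\<in>carrier P.
          T (W 2 f [x, y]) = (r i f * (D1 (dd x) * D2 (dd y) - D1 (dd y) * D2 (dd x))) mod h i"
        using form_lift_2[OF i q D1(1) D2(1)] by blast
      have D0: "D1 (dd x0) = 0" "D1 (dd Y) = 1 mod h i"
        using D1(2) x0P YP i by (simp_all add: x0_derivative Y_derivative)
      have D0': "D2 (dd x0) = 1 mod h i"
        using D2(2) x0P i q by (simp add: euler_x0 r_x0 mod_mod_cancel)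
      \<comment> \<open>As d/d\<theta> annihilates dx0, the determinant on dx0 \<and> dY reduces to
        one product equal to -1; the Euler value of \<open>Y\<close> drops out.\<close>
      have Tv: "T (v j) = - (r i (mono_el (d - 1 - D) j) mod h i)" for j
      proof -
        have "T (v j) = (r i (mono_el (d - 1 - D) j) * - ((1 mod h i) * (1 mod h i))) mod h i"
          using T(2) mP x0P YP by (simp add: v_def D0 D0')
        also have "\<dots> = (r i (mono_el (d - 1 - D) j) * - (1 * 1)) mod h i"
          by (intro mod_mult_cong mod_minus_cong) simp_all
        finally show ?thesis by (simp add: poly_mod_minus_left)
      qed
      have "poly.coeff (T (v j)) k = (if j = (i, k) then - 1 else 0)" if j: "j \<in> Bh" for j
      proof (cases "fst j = i")
        case True
        then have "snd j < degree (h i)" using j by (auto simp: Bh_def)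
        then show ?thesis using coeff_mono_el[OF i q a(1) _ True, of k] True by (auto simp: Tv prod_eq_iff)
      next
        case False
        then show ?thesis using r_mono_el[OF a(1) i, of j] by (auto simp: Tv)
      qed
      then have "(\<Sum>j\<in>Bh. c j * poly.coeff (T (v j)) k) = (\<Sum>j\<in>Bh. if j = (i, k) then - c j else 0)"
        by (intro sum.cong) auto
      also have "\<dots> = - c (i, k)" using ik finite_B by simp
      finally show ?thesis using c[OF coeff_functional[OF i q T(1)], of k] by simp
    qed
    then show "\<forall>j\<in>Bh. c j = 0" by auto
  qed
qed

lemma dim_ge_3:
  assumes "2 < m" "k0 + 3 * D + m * D \<le> d"
  shows "vectorspace.dim class_ring (V m d) = 0"
proof -
  have "vectorspace.dim class_ring (V m d) = card ({} :: nat set)"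
    by (rule dim_functionalsI[OF vectorspace_V fin_dim_V, of "{}" "\<lambda>_. \<zero>\<^bsub>E m\<^esub>"])
      (use span_ge_3[OF _ assms] in simp_all)
  then show ?thesis by simp
qed

text \<open>In degree \<open>k0\<close> the comparison of \<open>R\<close> with \<open>S\<close> is
  already bijective, so the lifts of the monomial basis dehomogenize to a basis of
  \<open>S\<close>.\<close>

lemma scheme_degree_eq: "scheme_degree n I = card Bg"
proof -
  interpret S: cring S by (rule cring_S)
  have hom: "affine_const n I \<in> Ring.ring_hom class_ring S"
    by (rule ring_hom_memI)
      (simp_all add: affine_const_eq mpoly_const_add mpoly_const_mult dehom_add dehom_mult dehom_one)
  let ?V = "restrict_scalars (affine_const n I) (regular_module S)"
  have vs: "vectorspace class_ring ?V" by (rule vectorspace_restrict_scalars[OF module_regular[OF cring_S] hom])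
  interpret V: vectorspace "class_ring :: 'k ring" ?V by (rule vs)
  define v where "v j = dehom (mono_el k0 j)" for j
  note mP = PH_carrier[OF mono_el_PH[OF order_refl]]
  have mem: "v \<in> A \<rightarrow> carrier ?V" for A by (simp add: v_def mP)
  have comb: "(\<Oplus>\<^bsub>?V\<^esub>j\<in>A. c j \<odot>\<^bsub>?V\<^esub> v j) = dehom (\<Sum>j\<in>A. mpoly_const (c j) * mono_el k0 j)" if "finite A" for A c
    using that
  proof (induction A rule: finite_induct)
    case empty
    show ?case using dehom_ideal_zero[OF I_simps(3)] by simp
  next
    case (insert j A)
    have "(\<lambda>j. c j \<odot>\<^bsub>?V\<^esub> v j) \<in> A \<rightarrow> carrier ?V" "c j \<odot>\<^bsub>?V\<^esub> v j \<in> carrier ?V"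
      by (simp_all add: v_def mP affine_const_eq)
    then have "(\<Oplus>\<^bsub>?V\<^esub>j\<in>insert j A. c j \<odot>\<^bsub>?V\<^esub> v j) = c j \<odot>\<^bsub>?V\<^esub> v j \<oplus>\<^bsub>?V\<^esub> (\<Oplus>\<^bsub>?V\<^esub>j\<in>A. c j \<odot>\<^bsub>?V\<^esub> v j)"
      using insert.hyps by (intro V.finsum_insert)
    moreover have "c j \<odot>\<^bsub>?V\<^esub> v j = dehom (mpoly_const (c j) * mono_el k0 j)"
      by (simp add: v_def mP affine_const_eq dehom_mult)
    moreover have "dehom (\<Sum>j\<in>insert j A. mpoly_const (c j) * mono_el k0 j) =
        dehom (mpoly_const (c j) * mono_el k0 j) \<oplus>\<^bsub>S\<^esub> dehom (\<Sum>j\<in>A. mpoly_const (c j) * mono_el k0 j)"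
      using insert.hyps by (simp add: mP dehom_add)
    ultimately show ?case by (simp only: insert.IH restrict_scalars_simps(1-3) regular_module_simps(1-3))
  qed
  have "vectorspace.fin_dim class_ring ?V \<and> vectorspace.dim class_ring ?V = card Bg"
  proof (rule dim_basisI[OF vs finite_B(1) mem])
    fix x assume "x \<in> carrier ?V"
    then have "x \<in> carrier S" by simp
    then obtain f where f: "f \<in> carrier P" "homog k0 f" "dehom f = x"
      using dehom_homog_surj[of x k0] by blast
    define c where "c j = poly.coeff (r (fst j) f) (snd j)" for j
    let ?s = "\<Sum>j\<in>Bg. mpoly_const (c j) * mono_el k0 j"
    have z: "f - ?s \<in> I" unfolding c_def by (rule expansion) (use f in \<open>simp_all add: PH_def\<close>)
    have sP: "?s \<in> carrier P" by (simp add: mP)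
    have "dehom (f - ?s) \<oplus>\<^bsub>S\<^esub> dehom ?s = dehom (f - ?s + ?s)" by (rule dehom_add[symmetric, OF I_simps(1)[OF z] sP])
    then have "x = dehom ?s" using dehom_ideal_zero[OF z] f(3) dehom_closed[OF sP] by simp
    then show "\<exists>c. x = (\<Oplus>\<^bsub>?V\<^esub>j\<in>Bg. c j \<odot>\<^bsub>?V\<^esub> v j)" unfolding comb[OF finite_B(1)] by blast
  next
    fix c assume "(\<Oplus>\<^bsub>?V\<^esub>j\<in>Bg. c j \<odot>\<^bsub>?V\<^esub> v j) = \<zero>\<^bsub>?V\<^esub>"
    then have d0: "dehom (\<Sum>j\<in>Bg. mpoly_const (c j) * mono_el k0 j) = \<zero>\<^bsub>S\<^esub>" unfolding comb[OF finite_B(1)] by simp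
    have "(\<Sum>j\<in>Bg. mpoly_const (c j) * mono_el k0 j) \<in> PH k0"
      by (intro PH_sum PH_const_mult mono_el_PH order_refl)
    then have I: "(\<Sum>j\<in>Bg. mpoly_const (c j) * mono_el k0 j) \<in> I"
      using dehom_homog_zero_iff d0 by (auto simp: PH_def)
    have "c (i, k) = 0" if ik: "(i, k) \<in> Bg" for i k
    proof -
      have i: "i < t" "k < degree (g i)" using ik by (simp_all add: Bg_def)
      have "0 = (\<Sum>k<degree (g i). Polynomial.monom (c (i, k)) k)"
        using r_ideal[OF i(1) I] r_mono_el_sum[OF order_refl i(1), of c] by simp
      then have "poly.coeff 0 k = poly.coeff (\<Sum>k<degree (g i). Polynomial.monom (c (i, k)) k) k" by (rule arg_cong)
      then show ?thesis using i(2) by (simp add: coeff_sum)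
    qed
    then show "\<forall>j\<in>Bg. c j = 0" by auto
  qed
  then show ?thesis by (simp add: scheme_degree_def algebra_dim_def)
qed

lemma
  shows has_HP_1: "has_HP (V 1) (int (card Bg) + int (card Bh))"
    and has_HP_2: "has_HP (V 2) (int (card Bh))"
    and has_HP_ge_3: "2 < m \<Longrightarrow> has_HP (V m) 0"
  unfolding has_HP_def eventually_sequentially
  using fin_dim_V dim_1 dim_2 dim_ge_3 by (metis of_nat_add, metis, metis of_nat_0)

end

theorem corollary6p8:
  fixes n :: nat
    and I :: "'k::field mpoly set"
    and Os :: "'b ring list"
    and h :: "'k mpoly set set \<Rightarrow> 'b list"
    and \<psi> :: "nat \<Rightarrow> 'k \<Rightarrow> 'b"
    and \<kappa> \<nu> :: "nat \<Rightarrow> nat"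
  assumes "perfect_field TYPE('k)"
    and "n \<ge> 1"
    and "zero_dim_scheme n I"
    and "\<forall>p\<in>proj_points n I. mpoly_var 0 \<notin> p"
    and "local_decomposition (affine_ring n I) Os h"
    and "\<forall>B\<in>set Os. weakly_curvilinear_ring B"
    and "\<And>i c. i < length Os \<Longrightarrow> \<psi> i c = h (affine_const n I c) ! i"
    and "\<And>i. i < length Os \<Longrightarrow> \<kappa> i = residue_dim (\<psi> i) (Os ! i)"
    and "\<And>i. i < length Os \<Longrightarrow> \<nu> i = algebra_dim (\<psi> i) (Os ! i) div \<kappa> i"
  shows "has_HP (forms_graded_part n I 1)
           (2 * int (scheme_degree n I)
             - (\<Sum>i | i < length Os \<and> \<not> CHAR('k) dvd \<nu> i. int (\<kappa> i)))
       \<and> has_HP (forms_graded_part n I 2)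
           (int (scheme_degree n I)
             - (\<Sum>i | i < length Os \<and> \<not> CHAR('k) dvd \<nu> i. int (\<kappa> i)))
       \<and> (\<forall>m>2. has_HP (forms_graded_part n I m) 0)"
proof -
  interpret curvilinear_scheme n I Os h \<psi>
    by (intro curvilinear_scheme.intro proj_scheme.intro curvilinear_scheme_axioms.intro assms)
  obtain g h' u r where "curvilinear_data n I (length Os) g h' u r"
    and deg: "\<And>i. i < length Os \<Longrightarrow> degree (g i) = algebra_dim (\<psi> i) (Os ! i)"
      "\<And>i. i < length Os \<Longrightarrow> int (degree (h' i)) = int (algebra_dim (\<psi> i) (Os ! i)) -
       (if CHAR('k) dvd algebra_dim (\<psi> i) (Os ! i) div residue_dim (\<psi> i) (Os ! i) then 0
        else int (residue_dim (\<psi> i) (Os ! i)))"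
  proof (rule obtain_data, goal_cases)
    case (1 g h u r)
    show ?case by (rule 1(1)) (fact 1)+
  qed
  then interpret X: curvilinear_data n I "length Os" g h' u r by blast
  \<comment> \<open>The index set for \<open>h'\<close> is smaller than that for \<open>g\<close> by
    the residue degree exactly at those factors where the characteristic does not divide \<nu>; this
    is the correction term in both formulas.\<close>
  have "int (degree (h' i)) = int (degree (g i)) - (if CHAR('k) dvd \<nu> i then 0 else int (\<kappa> i))"
    if "i < length Os" for i
    using deg[OF that] assms(8,9)[OF that] by simp
  then have "(\<Sum>i<length Os. int (degree (h' i))) =
      (\<Sum>i<length Os. int (degree (g i))) - (\<Sum>i<length Os. if CHAR('k) dvd \<nu> i then 0 else int (\<kappa> i))"
    by (simp add: sum_subtractf)
  moreover have "(\<Sum>i<length Os. if CHAR('k) dvd \<nu> i then 0 else int (\<kappa> i)) =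
      (\<Sum>i | i < length Os \<and> \<not> CHAR('k) dvd \<nu> i. int (\<kappa> i))"
    by (rule sum.mono_neutral_cong_right) auto
  ultimately have Bh: "int (card X.Bh) = int (card X.Bg) - (\<Sum>i | i < length Os \<and> \<not> CHAR('k) dvd \<nu> i. int (\<kappa> i))"
    by (simp add: X.card_B)
  then have "2 * int (card X.Bg) - (\<Sum>i | i < length Os \<and> \<not> CHAR('k) dvd \<nu> i. int (\<kappa> i)) =
      int (card X.Bg) + int (card X.Bh)"
    by linarith
  then show ?thesis unfolding X.scheme_degree_eq Bh[symmetric]
    using X.has_HP_1 X.has_HP_2 X.has_HP_ge_3 by metis
qed

end
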